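(* Let $(X(t))_{t\in\mathbb{R}^d}$ be a (strictly) stationary and measurable real random field. Assume there are constants $\nu\in\mathbb{N}$, $\delta>4$ and $C,l>0$ with $\nu/d>\max\{l+\delta/(\delta-2),\ \delta/(\delta-4),\ 3\}$ such that $\alpha_\gamma(r)\le Cr^{-\nu}\gamma^l$ for all $\gamma\ge2\kappa_d$, $r>0$, and $\mathbb{E}|X(0)|^\delta<\infty$. Let $(W_n)_{n\in\mathbb{N}}$ be a Van Hove-growing sequence of compact subsets of $\mathbb{R}^d$. Then $(\Phi_n)_{n\in\mathbb{N}}$, viewed as $V^*$-valued random elements, converges in distribution (with $V^*$ carrying the weak-* topology of pointwise convergence) to a centered Gaussian process $\Phi$ on $V$ with linear continuous paths and covariance $$\mathrm{Cov}(\Phi(f),\Phi(g))=\int_{\mathbb{R}^d}\mathrm{Cov}(f(X(0)),g(X(t)))\,dt,\quad f,g\in V.$$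
   Context: $V$ is the space of Lipschitz continuous $f:\mathbb{R}\to\mathbb{R}$ with norm $\|f\|=\mathrm{Lip}f+|f(0)|$, $\mathrm{Lip}f=\sup_{x\ne y}|f(x)-f(y)|/|x-y|$; $V^*$ is its topological dual. $\Phi_n(f)=\big(\int_{W_n}f(X(t))dt-\lambda_d(W_n)\mathbb{E}f(X(0))\big)/\sqrt{\lambda_d(W_n)}$. Convergence in distribution means $\mathbb{E}h(\Phi_n)\to\mathbb{E}h(\Phi)$ for all bounded continuous $h:V^*\to\mathbb{R}$. $\lambda_d$ is Lebesgue measure, $B^d$ the closed unit ball, $\kappa_d=\lambda_d(B^d)$. $(W_n)$ is Van Hove-growing if $\lambda_d(\partial W_n+B^d)/\lambda_d(W_n)\to0$. The mixing coefficient $\alpha_\gamma(r)$ is the supremum of $\sup\{|\mathbb{P}(F\cap G)-\mathbb{P}(F)\mathbb{P}(G)|:F\in\sigma(X_I),G\in\sigma(X_J)\}$ over all $I,J\subseteq\mathbb{R}^d$ with a unit vector $u$ such that $\inf_{t\in I}\langle u,t\rangle-\sup_{t\in J}\langle u,t\rangle>r$ and $\lambda_d((I\cup J)+B^d)\le\gamma$. *)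

theory Defs
  imports "HOL-Probability.Probability"
begin

definition msum :: "'d::euclidean_space set \<Rightarrow> 'd set \<Rightarrow> 'd set" where
  "msum A B = {a + b | a b. a \<in> A \<and> b \<in> B}"

definition kappa :: "'d::euclidean_space itself \<Rightarrow> real" where
  "kappa _ = measure lborel (cball (0::'d) 1)"

definition Lip :: "(real \<Rightarrow> real) \<Rightarrow> real" where
  "Lip f = Sup {\<bar>f x - f y\<bar> / \<bar>x - y\<bar> | x y. x \<noteq> y}"

definition Vspace :: "(real \<Rightarrow> real) set" where
  "Vspace = {f. \<exists>L. lipschitz_on L UNIV f}"

definition Vnorm :: "(real \<Rightarrow> real) \<Rightarrow> real" where
  "Vnorm f = Lip f + \<bar>f 0\<bar>"

(* the topological dual V^*: continuous (= bounded) linear functionals on V,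
   represented as functions on (real => real) that vanish off V.  With the
   product topology of the function type this subspace carries exactly the
   weak-* topology (pointwise convergence on V). *)
definition Vdual :: "((real \<Rightarrow> real) \<Rightarrow> real) set" where
  "Vdual = {\<phi>. (\<forall>f\<in>Vspace. \<forall>g\<in>Vspace. \<forall>a b.
                    \<phi> (\<lambda>x. a * f x + b * g x) = a * \<phi> f + b * \<phi> g)
             \<and> (\<exists>K. \<forall>f\<in>Vspace. \<bar>\<phi> f\<bar> \<le> K * Vnorm f)
             \<and> (\<forall>f. f \<notin> Vspace \<longrightarrow> \<phi> f = 0)}"

definition measurable_field :: "'a measure \<Rightarrow> ('d::euclidean_space \<Rightarrow> 'a \<Rightarrow> real) \<Rightarrow> bool" where
  "measurable_field M X \<longleftrightarrow> (\<lambda>p. X (fst p) (snd p)) \<in> borel_measurable (borel \<Otimes>\<^sub>M M)"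

definition strictly_stationary :: "'a measure \<Rightarrow> ('d::euclidean_space \<Rightarrow> 'a \<Rightarrow> real) \<Rightarrow> bool" where
  "strictly_stationary M X \<longleftrightarrow> (\<forall>s J. finite J \<longrightarrow>
     distr M (PiM J (\<lambda>_. borel)) (\<lambda>\<omega>. \<lambda>j\<in>J. X (j + s) \<omega>)
       = distr M (PiM J (\<lambda>_. borel)) (\<lambda>\<omega>. \<lambda>j\<in>J. X j \<omega>))"

definition sigmaX :: "'a measure \<Rightarrow> ('d \<Rightarrow> 'a \<Rightarrow> real) \<Rightarrow> 'd set \<Rightarrow> 'a set set" where
  "sigmaX M X I = sigma_sets (space M) {X t -` B \<inter> space M | t B. t \<in> I \<and> B \<in> sets borel}"

definition mix_admissible :: "real \<Rightarrow> real \<Rightarrow> 'd::euclidean_space set \<Rightarrow> 'd set \<Rightarrow> bool" where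
  "mix_admissible \<gamma> r I J \<longleftrightarrow>
     (\<exists>u. norm u = 1 \<and>
        Inf ((\<lambda>t. ereal (u \<bullet> t)) ` I) - Sup ((\<lambda>t. ereal (u \<bullet> t)) ` J) > ereal r) \<and>
     emeasure lebesgue (msum (I \<union> J) (cball 0 1)) \<le> ennreal \<gamma>"

definition alpha_mix :: "'a measure \<Rightarrow> ('d::euclidean_space \<Rightarrow> 'a \<Rightarrow> real) \<Rightarrow> real \<Rightarrow> real \<Rightarrow> ereal" where
  "alpha_mix M X \<gamma> r = (SUP p \<in> {(I, J, F, G). mix_admissible \<gamma> r I J \<and>
                                     F \<in> sigmaX M X I \<and> G \<in> sigmaX M X J}.
      (case p of (I, J, F, G) \<Rightarrow>
         ereal \<bar>measure M (F \<inter> G) - measure M F * measure M G\<bar>))"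

(* Van Hove growing sequence (lambda_d(W_n) > 0 is needed for the ratio to make sense) *)
definition van_hove :: "(nat \<Rightarrow> 'd::euclidean_space set) \<Rightarrow> bool" where
  "van_hove W \<longleftrightarrow> (\<forall>n. measure lborel (W n) > 0) \<and>
     (\<lambda>n. measure lborel (msum (frontier (W n)) (cball 0 1)) / measure lborel (W n)) \<longlonglongrightarrow> 0"

(* Phi_n(omega) as an element of V^* (set to the zero functional on the
   null set of omega whose path is not integrable over W_n) *)
definition PhiN :: "'a measure \<Rightarrow> ('d::euclidean_space \<Rightarrow> 'a \<Rightarrow> real) \<Rightarrow> (nat \<Rightarrow> 'd set)
                    \<Rightarrow> nat \<Rightarrow> 'a \<Rightarrow> (real \<Rightarrow> real) \<Rightarrow> real" where
  "PhiN M X W n \<omega> =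
     (if set_integrable lborel (W n) (\<lambda>t. X t \<omega>) then
        (\<lambda>f. if f \<in> Vspace then
               ((LINT t:W n|lborel. f (X t \<omega>))
                 - measure lborel (W n) * (\<integral>\<omega>'. f (X 0 \<omega>') \<partial>M))
               / sqrt (measure lborel (W n))
             else 0)
      else (\<lambda>f. 0))"

definition centered_normal :: "'b measure \<Rightarrow> ('b \<Rightarrow> real) \<Rightarrow> bool" where
  "centered_normal N Y \<longleftrightarrow> Y \<in> borel_measurable N \<and>
     (distr N lborel Y = return lborel 0 \<or>
      (\<exists>\<sigma>>0. distr N lborel Y = density lborel (normal_density 0 \<sigma>)))"

definition centered_gaussian_on_V :: "((real \<Rightarrow> real) \<Rightarrow> real) measure \<Rightarrow> bool" where
  "centered_gaussian_on_V P \<longleftrightarrow> (\<forall>J a. finite J \<and> J \<subseteq> Vspace \<longrightarrow>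
      centered_normal P (\<lambda>\<phi>. \<Sum>j\<in>J. a j * \<phi> j))"

end

theory Submission
  imports Defs
begin

text \<open>
  A Lipschitz function has a dyadic expansion \<open>f x - f 0 = (\<Sum>k. c\<^sub>k f * e\<^sub>k x)\<close> with
  \<open>\<bar>c\<^sub>k f\<bar> \<le> Lip f\<close>, where the \<open>e\<^sub>k\<close> are weighted indicators of half-lines and dyadic intervals. Hence
  \<open>\<Phi>\<^sub>n f = (\<Sum>k. c\<^sub>k f * Y\<^sub>n\<^sub>k)\<close> with \<open>Y\<^sub>n\<^sub>k = \<Phi>\<^sub>n e\<^sub>k\<close>, and \<open>\<Phi>\<^sub>n\<close> is the image of the random summable
  sequence \<open>Y\<^sub>n\<close> under a map that is continuous from the \<open>l\<^sup>1\<close>-norm to the weak-* topology.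

  Interpolating the mixing bound with the trivial one gives
  \<open>\<bar>Cov (1\<^sub>A (X 0)) (1\<^sub>B (X t))\<bar> \<le> h t * P(A)\<^bsup>1/3\<^esup> * P(B)\<^bsup>1/3\<^esup>\<close> with \<open>h\<close> integrable because \<open>\<nu> > 3 d\<close>; so
  \<open>E \<bar>Y\<^sub>n\<^sub>k\<bar>\<close> is bounded uniformly in \<open>n\<close> by a sequence that is summable in \<open>k\<close> because the fourth moment is finite.
  Convergence in distribution in \<open>l\<^sup>1\<close> then reduces to the joint characteristic functions of finitely
  many coordinates, that is, to a central limit theorem for bounded functions of the field. That theorem
  follows by cutting the window into blocks separated by corridors, with fourth moment bounds
  for the blocks and the Van Hove condition for the limit variance. The limit in \<open>l\<^sup>1\<close> is a Gaussian
  sequence built from a Cholesky factor of the limit covariance.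
\<close>

section \<open>Weak convergence in the space of summable sequences\<close>

text \<open>The obstacle is that \<open>Vdual\<close> with the weak-* topology is not metrizable, so
  approximation by Lipschitz functions is not at hand there. A test function is pulled back to
  sequences with a metric, where it is merely continuous and bounded, and is squeezed between
  Lipschitz envelopes. The exponent 1/3 comes from bounding a covariance by P(A), by P(B) and by the
  mixing rate, and taking the geometric mean; the rate then enters with exponent \<nu>/3, integrable
  in dimension d when \<nu> > 3d. The same cube root splits the decay of a four-point moment into
  three integrable factors. The condition \<nu> > (l + 1) d leaves room for a block spacing q: for
  window volume v the decoupling error is of order q^(-\<nu>) v^(l+1), while the block volume, of
  order q^d, must be small against v. The block side is a fixed multiple L of q, so the corridors
  keep a fraction of order 1/L of the volume, which is made small through L before n grows.\<close>

inductive trig_poly :: "nat \<Rightarrow> ((nat \<Rightarrow> real) \<Rightarrow> real) \<Rightarrow> bool" for K where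
  cos: "trig_poly K (\<lambda>y. c * cos ((\<Sum>m<K. a m * y m) + b))"
| add: "trig_poly K F \<Longrightarrow> trig_poly K G \<Longrightarrow> trig_poly K (\<lambda>y. F y + G y)"

text \<open>Cosines with free phases are used because the product-to-sum formula keeps their sums
  closed under multiplication, as Stone-Weierstrass requires, while the expectation of each summand
  is read off one value of a joint characteristic function.\<close>

lemma trig_poly_mult_cos:
  assumes "trig_poly K G"
  shows "trig_poly K (\<lambda>y. c * cos ((\<Sum>m<K. a m * y m) + b) * G y)"
  using assms
proof induction
  case (cos c' a' b')
  have "trig_poly K (\<lambda>y. (c * c' / 2) * cos ((\<Sum>m<K. (a m - a' m) * y m) + (b - b'))
      + (c * c' / 2) * cos ((\<Sum>m<K. (a m + a' m) * y m) + (b + b')))"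
    by (intro trig_poly.intros)
  moreover have "c * cos ((\<Sum>m<K. a m * y m) + b) * (c' * cos ((\<Sum>m<K. a' m * y m) + b'))
     = (c * c' / 2) * cos ((\<Sum>m<K. (a m - a' m) * y m) + (b - b'))
      + (c * c' / 2) * cos ((\<Sum>m<K. (a m + a' m) * y m) + (b + b'))" for y
  proof -
    define A where "A = (\<Sum>m<K. a m * y m) + b"
    define B where "B = (\<Sum>m<K. a' m * y m) + b'"
    have 1: "(\<Sum>m<K. (a m - a' m) * y m) + (b - b') = A - B"
      by (simp add: A_def B_def left_diff_distrib sum_subtractf)
    have 2: "(\<Sum>m<K. (a m + a' m) * y m) + (b + b') = A + B"
      by (simp add: A_def B_def distrib_right sum.distrib)
    show ?thesis unfolding 1 2 A_def[symmetric] B_def[symmetric]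
      by (simp add: cos_diff cos_add algebra_simps)
  qed
  ultimately show ?case by simp
next
  case (add F G)
  then show ?case
    using trig_poly.add[OF add.IH] by (simp add: distrib_left)
qed

lemma trig_poly_mult:
  assumes "trig_poly K F" "trig_poly K G"
  shows "trig_poly K (\<lambda>y. F y * G y)"
  using assms
proof induction
  case (cos c a b)
  then show ?case by (rule trig_poly_mult_cos)
next
  case (add F F')
  then have "trig_poly K (\<lambda>y. F y * G y + F' y * G y)"
    by (intro trig_poly.add) auto
  then show ?case by (simp add: distrib_right)
qed

lemma trig_poly_const: "trig_poly K (\<lambda>y. c)"
  using trig_poly.cos[of K c "\<lambda>_. 0" 0] by simp

lemma trig_poly_sin_coordinate:
  assumes "k < K"
  shows "trig_poly K (\<lambda>y. sin (\<theta> * y k))"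
proof -
  have "(\<Sum>m<K. (if m = k then \<theta> else 0) * y m) = \<theta> * y k" for y :: "nat \<Rightarrow> real"
    using assms by (simp add: if_distrib[of "\<lambda>x. x * _"] cong: if_cong)
  moreover have "cos (x + - (pi/2)) = sin x" for x :: real
    by (simp add: cos_diff)
  ultimately show ?thesis
    using trig_poly.cos[of K 1 "\<lambda>m. if m = k then \<theta> else 0" "- (pi/2)"]
    by (simp only: mult_1)
qed

lemma compact_finite_cube:
  "compact {s :: nat \<Rightarrow> real. \<forall>m. s m \<in> (if m < K then {-1..1} else {0})}"
proof -
  have "compactin (product_topology (\<lambda>_. euclidean) UNIV)
     (PiE UNIV (\<lambda>m. if m < K then {-1..1::real} else {0}))"
    by (subst compactin_PiE) auto
  then show ?thesis
    by (simp add: euclidean_product_topology PiE_def Pi_def)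
qed

text \<open>Passing to the variables \<open>sin (\<theta> * y m)\<close> replaces the non-compact
  range of \<open>y\<close> by a compact cube, so Stone-Weierstrass gives an approximation that is
  uniform in all \<open>y\<close>.\<close>

lemma trig_poly_approximation:
  fixes Q :: "(nat \<Rightarrow> real) \<Rightarrow> real"
  assumes Q: "continuous_on {s. \<forall>m. s m \<in> (if m < K then {-1..1} else {0})} Q"
    and e: "e > 0"
  shows "\<exists>F. trig_poly K F \<and> (\<forall>y. \<bar>Q (\<lambda>m. if m < K then sin (\<theta> * y m) else 0) - F y\<bar> < e)"
proof -
  define S where "S = {s :: nat \<Rightarrow> real. \<forall>m. s m \<in> (if m < K then {-1..1} else {0})}"
  define R where "R = {F. continuous_on S F
      \<and> trig_poly K (\<lambda>y. F (\<lambda>m. if m < K then sin (\<theta> * y m) else 0))}"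
  interpret function_ring_on R S
  proof
    show "compact S" unfolding S_def by (rule compact_finite_cube)
    show "\<And>f. f \<in> R \<Longrightarrow> continuous_on S f" by (simp add: R_def)
    show "\<And>f g. f \<in> R \<Longrightarrow> g \<in> R \<Longrightarrow> (\<lambda>x. f x + g x) \<in> R"
      by (auto simp: R_def intro!: continuous_intros trig_poly.add)
    show "\<And>f g. f \<in> R \<Longrightarrow> g \<in> R \<Longrightarrow> (\<lambda>x. f x * g x) \<in> R"
      by (auto simp: R_def intro!: continuous_intros trig_poly_mult)
    show "\<And>c. (\<lambda>_. c) \<in> R"
      by (auto simp: R_def intro!: trig_poly_const)
    fix x y assume xy: "x \<in> S" "y \<in> S" "x \<noteq> y"
    then obtain k where k: "x k \<noteq> y k" by auto
    have "k < K"
    proof (rule ccontr)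
      assume "\<not> k < K"
      then have "x k = 0" "y k = 0" using xy by (auto simp: S_def split: if_splits)
      with k show False by simp
    qed
    then have "(\<lambda>s. s k) \<in> R"
      by (auto simp: R_def intro: continuous_on_product_coordinates[THEN continuous_on_subset] trig_poly_sin_coordinate)
    then show "\<exists>f\<in>R. f x \<noteq> f y"
      using k by (intro bexI[where x = "\<lambda>s. s k"])
  qed
  have "\<exists>g\<in>R. \<forall>x\<in>S. \<bar>Q x - g x\<bar> < e"
    using Q e unfolding S_def[symmetric] by (rule Stone_Weierstrass_basic)
  then obtain g where g: "g \<in> R" "\<And>x. x \<in> S \<Longrightarrow> \<bar>Q x - g x\<bar> < e"
    by metis
  show ?thesis
  proof (intro exI conjI allI)
    show "trig_poly K (\<lambda>y. g (\<lambda>m. if m < K then sin (\<theta> * y m) else 0))"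
      using g(1) by (simp add: R_def)
    show "\<bar>Q (\<lambda>m. if m < K then sin (\<theta> * y m) else 0) - g (\<lambda>m. if m < K then sin (\<theta> * y m) else 0)\<bar> < e" for y
      by (rule g(2)) (auto simp: S_def)
  qed
qed

section \<open>Summable sequences: distance, truncation and continuity\<close>

definition l1 :: "(nat \<Rightarrow> real) set" where
  "l1 = {y. summable (\<lambda>m. \<bar>y m\<bar>)}"

text \<open>The distance is kept apart from the topology of the type:
  \<open>nat \<Rightarrow> real\<close> carries the product topology, which is coarser on
  \<open>l1\<close>, and the test functions to come are in general continuous for this distance
  only.\<close>

definition l1dist :: "(nat \<Rightarrow> real) \<Rightarrow> (nat \<Rightarrow> real) \<Rightarrow> real" where
  "l1dist y z = (\<Sum>m. \<bar>y m - z m\<bar>)"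

text \<open>Semicontinuity is singled out because it covers indicators of open sets, from which
  measurability is derived, and because one-sided bounds for a function and its negative give back
  the continuous case.\<close>

definition l1_lsc :: "((nat \<Rightarrow> real) \<Rightarrow> real) \<Rightarrow> bool" where
  "l1_lsc H \<longleftrightarrow> (\<forall>y\<in>l1. \<forall>e>0. \<exists>r>0. \<forall>z\<in>l1. l1dist y z < r \<longrightarrow> H y - e < H z)"

definition l1_continuous :: "((nat \<Rightarrow> real) \<Rightarrow> real) \<Rightarrow> bool" where
  "l1_continuous H \<longleftrightarrow> (\<forall>y\<in>l1. \<forall>e>0. \<exists>r>0. \<forall>z\<in>l1. l1dist y z < r \<longrightarrow> \<bar>H y - H z\<bar> < e)"

lemma l1_summable_diff: "y \<in> l1 \<Longrightarrow> z \<in> l1 \<Longrightarrow> summable (\<lambda>m. \<bar>y m - z m\<bar>)"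
  unfolding l1_def mem_Collect_eq
  by (rule summable_comparison_test'[of "\<lambda>m. \<bar>y m\<bar> + \<bar>z m\<bar>" 0]) (rule summable_add, auto)

lemma l1dist_nonneg: "y \<in> l1 \<Longrightarrow> z \<in> l1 \<Longrightarrow> 0 \<le> l1dist y z"
  unfolding l1dist_def by (intro suminf_nonneg l1_summable_diff) auto

lemma l1dist_commute: "l1dist y z = l1dist z y"
  unfolding l1dist_def by (simp add: abs_minus_commute)

lemma l1dist_self: "l1dist y y = 0"
  unfolding l1dist_def by simp

lemma l1dist_triangle:
  assumes "x \<in> l1" "y \<in> l1" "z \<in> l1"
  shows "l1dist x z \<le> l1dist x y + l1dist y z"
proof -
  have "l1dist x z \<le> (\<Sum>m. \<bar>x m - y m\<bar> + \<bar>y m - z m\<bar>)"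
    unfolding l1dist_def using assms
    by (intro suminf_le summable_add l1_summable_diff) auto
  also have "\<dots> = l1dist x y + l1dist y z"
    unfolding l1dist_def using assms by (intro suminf_add[symmetric] l1_summable_diff)
  finally show ?thesis .
qed

definition trunc :: "nat \<Rightarrow> (nat \<Rightarrow> real) \<Rightarrow> nat \<Rightarrow> real" where
  "trunc K y = (\<lambda>m. if m < K then y m else 0)"

lemma trunc_in_l1: "trunc K y \<in> l1"
proof -
  have "summable (\<lambda>m. \<bar>if m < K then y m else 0\<bar>)"
    by (rule summable_finite[of "{..<K}"]) auto
  then show ?thesis by (simp add: l1_def trunc_def)
qed

lemma l1dist_trunc_trunc: "l1dist (trunc K y) (trunc K z) = (\<Sum>m<K. \<bar>y m - z m\<bar>)"
  unfolding l1dist_def trunc_def by (subst suminf_finite[of "{..<K}"]) auto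

lemma l1dist_trunc:
  assumes "y \<in> l1"
  shows "l1dist y (trunc K y) = (\<Sum>m. \<bar>y (m + K)\<bar>)"
proof -
  have s: "summable (\<lambda>m. \<bar>y m - trunc K y m\<bar>)"
    using assms by (intro l1_summable_diff trunc_in_l1)
  show ?thesis
    unfolding l1dist_def by (subst suminf_split_initial_segment[OF s, of K]) (auto simp: trunc_def)
qed

lemma l1dist_trunc_tendsto: "y \<in> l1 \<Longrightarrow> (\<lambda>K. l1dist y (trunc K y)) \<longlonglongrightarrow> 0"
  by (subst l1dist_trunc) (auto simp: l1_def intro: suminf_exist_split2)

lemma l1_continuous_sequentially:
  assumes H: "l1_continuous H" and s: "\<And>k. s k \<in> l1" "y \<in> l1" "(\<lambda>k. l1dist y (s k)) \<longlonglongrightarrow> 0"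
  shows "(\<lambda>k. H (s k)) \<longlonglongrightarrow> H y"
proof (rule tendstoI)
  fix e :: real assume "e > 0"
  then obtain r where r: "r > 0" "\<And>z. z \<in> l1 \<Longrightarrow> l1dist y z < r \<Longrightarrow> \<bar>H y - H z\<bar> < e"
    using H s(2) unfolding l1_continuous_def by meson
  have "\<forall>\<^sub>F k in sequentially. l1dist y (s k) < r"
    using order_tendstoD(2)[OF s(3) r(1)] .
  then show "\<forall>\<^sub>F k in sequentially. dist (H (s k)) (H y) < e"
    by eventually_elim (simp add: r(2) s(1) dist_real_def abs_minus_commute[of _ "H y"])
qed

text \<open>On finitely many coordinates, coordinatewise convergence is convergence in
  \<open>l1dist\<close>; truncation therefore turns continuity for the distance into continuity for
  the product topology.\<close>

lemma continuous_on_l1_continuous_trunc: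
  assumes H: "l1_continuous H"
  shows "continuous_on UNIV (\<lambda>y. H (trunc K y))"
proof -
  have "(\<lambda>k. H (trunc K (x k))) \<longlonglongrightarrow> H (trunc K y)" if "x \<longlonglongrightarrow> y" for x y
  proof (rule l1_continuous_sequentially[OF H trunc_in_l1 trunc_in_l1])
    have "(\<lambda>k. x k m) \<longlonglongrightarrow> y m" for m
      using that by (rule continuous_on_tendsto_compose[OF continuous_on_product_coordinates]) auto
    then have "(\<lambda>k. (\<Sum>m<K. \<bar>y m - x k m\<bar>)) \<longlonglongrightarrow> (\<Sum>m<K. \<bar>y m - y m\<bar>)"
      by (intro tendsto_intros)
    then show "(\<lambda>k. l1dist (trunc K y) (trunc K (x k))) \<longlonglongrightarrow> 0"
      by (simp add: l1dist_trunc_trunc)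
  qed
  then show ?thesis
    unfolding continuous_on_sequentially by (auto simp: comp_def)
qed

text \<open>Continuity for the distance says nothing directly about coordinatewise measurability.
  The truncated functions \<open>H (trunc K y)\<close> are continuous for the product topology, and
  they converge to \<open>H y\<close> at every summable \<open>y\<close>.\<close>

lemma measurable_l1_continuous:
  assumes [measurable]: "\<And>m. (\<lambda>\<omega>. Y \<omega> m) \<in> borel_measurable M"
    and Y: "\<And>\<omega>. \<omega> \<in> space M \<Longrightarrow> Y \<omega> \<in> l1" and H: "l1_continuous H"
  shows "(\<lambda>\<omega>. H (Y \<omega>)) \<in> borel_measurable M"
proof (rule borel_measurable_LIMSEQ_real)
  fix \<omega> assume "\<omega> \<in> space M"
  then show "(\<lambda>K. H (trunc K (Y \<omega>))) \<longlonglongrightarrow> H (Y \<omega>)"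
    by (intro l1_continuous_sequentially[OF H] trunc_in_l1 Y l1dist_trunc_tendsto)
next
  fix K
  have "Y \<in> borel_measurable M"
    by (intro measurable_coordinatewise_then_product) measurable
  then show "(\<lambda>\<omega>. H (trunc K (Y \<omega>))) \<in> borel_measurable M"
    using borel_measurable_continuous_onI[OF continuous_on_l1_continuous_trunc[OF H]]
    by (rule measurable_compose)
qed

definition l1_lipschitz :: "real \<Rightarrow> ((nat \<Rightarrow> real) \<Rightarrow> real) \<Rightarrow> bool" where
  "l1_lipschitz L H \<longleftrightarrow> (\<forall>y\<in>l1. \<forall>z\<in>l1. \<bar>H y - H z\<bar> \<le> L * l1dist y z)"

lemma l1_lipschitz_continuous:
  assumes "l1_lipschitz L H" shows "l1_continuous H"
  unfolding l1_continuous_def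
proof (intro ballI allI impI)
  fix y and e :: real assume y: "y \<in> l1" and e: "e > 0"
  have "\<bar>H y - H z\<bar> < e" if "z \<in> l1" "l1dist y z < e / (\<bar>L\<bar> + 1)" for z
  proof -
    have d: "0 \<le> l1dist y z" using y that by (intro l1dist_nonneg)
    have "\<bar>H y - H z\<bar> \<le> L * l1dist y z"
      using assms y that by (auto simp: l1_lipschitz_def)
    also have "\<dots> \<le> (\<bar>L\<bar> + 1) * l1dist y z"
      using d by (intro mult_right_mono) auto
    also have "\<dots> < e" using that by (simp add: field_simps)
    finally show ?thesis .
  qed
  then show "\<exists>r>0. \<forall>z\<in>l1. l1dist y z < r \<longrightarrow> \<bar>H y - H z\<bar> < e"
    using e by (intro exI[of _ "e / (\<bar>L\<bar> + 1)"]) auto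
qed

section \<open>Lipschitz envelopes from below, by inf-convolution with the distance\<close>

definition l1_infconv :: "((nat \<Rightarrow> real) \<Rightarrow> real) \<Rightarrow> real \<Rightarrow> (nat \<Rightarrow> real) \<Rightarrow> real" where
  "l1_infconv H j y = (INF z\<in>l1. H z + j * l1dist y z)"

context
  fixes H :: "(nat \<Rightarrow> real) \<Rightarrow> real" and B j :: real
  assumes bound: "\<And>y. y \<in> l1 \<Longrightarrow> \<bar>H y\<bar> \<le> B" and j: "j \<ge> 0"
begin

lemma l1_infconv_bdd_below:
  assumes "y \<in> l1"
  shows "bdd_below ((\<lambda>z. H z + j * l1dist y z) ` l1)"
proof (rule bdd_belowI2)
  fix z assume "z \<in> l1"
  then show "- B \<le> H z + j * l1dist y z"
    using bound[of z] mult_nonneg_nonneg[OF j l1dist_nonneg[OF assms, of z]] by linarith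
qed

lemma l1_infconv_le: "y \<in> l1 \<Longrightarrow> l1_infconv H j y \<le> H y"
  unfolding l1_infconv_def
  using cINF_lower[OF l1_infconv_bdd_below, of y y] by (simp add: l1dist_self)

lemma l1_infconv_ge:
  assumes "\<And>z. z \<in> l1 \<Longrightarrow> a \<le> H z + j * l1dist y z"
  shows "a \<le> l1_infconv H j y"
  unfolding l1_infconv_def
proof (rule cINF_greatest)
  show "l1 \<noteq> {}" using trunc_in_l1 by blast
qed (rule assms)

lemma abs_l1_infconv_le: "y \<in> l1 \<Longrightarrow> \<bar>l1_infconv H j y\<bar> \<le> B"
proof -
  assume y: "y \<in> l1"
  have "- B \<le> l1_infconv H j y"
  proof (rule l1_infconv_ge)
    fix z assume "z \<in> l1"
    then show "- B \<le> H z + j * l1dist y z"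
      using bound[of z] mult_nonneg_nonneg[OF j l1dist_nonneg[OF y, of z]] by linarith
  qed
  then show ?thesis using l1_infconv_le[OF y] bound[OF y] by linarith
qed

lemma l1_infconv_lipschitz: "l1_lipschitz j (l1_infconv H j)"
proof -
  have *: "l1_infconv H j y \<le> l1_infconv H j x + j * l1dist x y" if "x \<in> l1" "y \<in> l1" for x y
  proof -
    have "l1_infconv H j y - j * l1dist x y \<le> l1_infconv H j x"
    proof (rule l1_infconv_ge)
      fix z assume z: "z \<in> l1"
      have "l1_infconv H j y \<le> H z + j * l1dist y z"
        unfolding l1_infconv_def using z by (intro cINF_lower l1_infconv_bdd_below that)
      moreover have "j * l1dist y z \<le> j * (l1dist y x + l1dist x z)"
        using z that j by (intro mult_left_mono l1dist_triangle)
      ultimately show "l1_infconv H j y - j * l1dist x y \<le> H z + j * l1dist x z"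
        by (simp add: algebra_simps l1dist_commute)
    qed
    then show ?thesis by simp
  qed
  show ?thesis
    unfolding l1_lipschitz_def
  proof (intro ballI)
    fix y z assume "y \<in> l1" "z \<in> l1"
    then show "\<bar>l1_infconv H j y - l1_infconv H j z\<bar> \<le> j * l1dist y z"
      using *[of y z] *[of z y] by (simp add: abs_le_iff l1dist_commute algebra_simps)
  qed
qed

end

lemma l1_infconv_tendsto:
  assumes bound: "\<And>y. y \<in> l1 \<Longrightarrow> \<bar>H y\<bar> \<le> B" and H: "l1_lsc H" and y: "y \<in> l1"
  shows "(\<lambda>j. l1_infconv H (real j) y) \<longlonglongrightarrow> H y"
proof (rule LIMSEQ_I)
  fix e :: real assume e: "e > 0"
  obtain r where r: "r > 0" "\<And>z. z \<in> l1 \<Longrightarrow> l1dist y z < r \<Longrightarrow> H y - e/2 < H z"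
    using H y e unfolding l1_lsc_def by (meson half_gt_zero)
  \<comment> \<open>Beyond this \<open>N\<close>, a competitor at distance at least \<open>r\<close>
    pays a penalty of at least \<open>2 * B\<close>, the largest possible oscillation of
    \<open>H\<close>. Only nearby competitors remain, and these are handled by
    semicontinuity.\<close>
  obtain N :: nat where N: "real N \<ge> 2 * B / r" using real_arch_simple by blast
  have "norm (l1_infconv H (real j) y - H y) < e" if "j \<ge> N" for j
  proof -
    have j: "real j * r \<ge> 2 * B" using N that r(1)
      by (smt (verit) of_nat_mono pos_divide_le_eq)
    have "H y - e/2 \<le> l1_infconv H (real j) y"
    proof (rule l1_infconv_ge[OF bound])
      fix z assume z: "z \<in> l1"
      have d: "0 \<le> l1dist y z" using y z by (rule l1dist_nonneg)
      show "H y - e / 2 \<le> H z + real j * l1dist y z"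
      proof (cases "l1dist y z < r")
        case True
        then show ?thesis using r(2)[OF z] mult_nonneg_nonneg[of "real j", OF _ d] by linarith
      next
        case False
        then have "real j * r \<le> real j * l1dist y z" by (intro mult_left_mono) auto
        then show ?thesis using j bound[OF z] bound[OF y] e by linarith
      qed
    qed auto
    moreover have "l1_infconv H (real j) y \<le> H y"
      using l1_infconv_le[OF bound _ y, where j = "real j"] by simp
    ultimately show ?thesis using e by simp
  qed
  then show "\<exists>N. \<forall>j\<ge>N. norm (l1_infconv H (real j) y - H y) < e" by blast
qed

text \<open>The Lipschitz envelopes are measurable by the continuous case and converge to
  \<open>H\<close>. Applied to indicators of open sets, this will give measurability of maps into
  \<open>Vdual\<close>.\<close>

lemma measurable_l1_lsc:
  assumes [measurable]: "\<And>m. (\<lambda>\<omega>. Y \<omega> m) \<in> borel_measurable M"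
    and Y: "\<And>\<omega>. \<omega> \<in> space M \<Longrightarrow> Y \<omega> \<in> l1" and H: "l1_lsc H"
    and bound: "\<And>y. y \<in> l1 \<Longrightarrow> \<bar>H y\<bar> \<le> B"
  shows "(\<lambda>\<omega>. H (Y \<omega>)) \<in> borel_measurable M"
proof (rule borel_measurable_LIMSEQ_real)
  show "(\<lambda>j. l1_infconv H (real j) (Y \<omega>)) \<longlonglongrightarrow> H (Y \<omega>)" if "\<omega> \<in> space M" for \<omega>
    using bound H Y[OF that] by (rule l1_infconv_tendsto)
  show "(\<lambda>\<omega>. l1_infconv H (real j) (Y \<omega>)) \<in> borel_measurable M" for j
    by (rule measurable_l1_continuous[OF assms(1) Y l1_lipschitz_continuous[OF l1_infconv_lipschitz[OF bound]]]) auto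
qed

lemma trig_poly_continuous: "trig_poly K F \<Longrightarrow> continuous_on UNIV F"
proof (induction rule: trig_poly.induct)
  case (cos c a b)
  have "continuous_on UNIV (\<lambda>y :: nat \<Rightarrow> real. y m)" for m
    by (rule continuous_on_product_coordinates)
  then show ?case by (intro continuous_intros)
qed (intro continuous_intros)

lemma trig_poly_bounded: "trig_poly K F \<Longrightarrow> \<exists>B. \<forall>y. \<bar>F y\<bar> \<le> B"
proof (induction rule: trig_poly.induct)
  case (cos c a b)
  have "\<bar>c * cos x\<bar> \<le> \<bar>c\<bar>" for x
    using mult_left_mono[OF abs_cos_le_one[of x], of "\<bar>c\<bar>"] by (simp add: abs_mult)
  then show ?case by blast
next
  case (add F G)
  then obtain B B' where "\<forall>y. \<bar>F y\<bar> \<le> B" "\<forall>y. \<bar>G y\<bar> \<le> B'" by blast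
  then have "\<forall>y. \<bar>F y + G y\<bar> \<le> B + B'" by (meson abs_triangle_ineq add_mono order_trans)
  then show ?case by blast
qed

lemma integrable_trig_poly:
  assumes "prob_space M" "trig_poly K F" and [measurable]: "\<And>m. (\<lambda>\<omega>. Y \<omega> m) \<in> borel_measurable M"
  shows "integrable M (\<lambda>\<omega>. F (Y \<omega>))"
proof -
  interpret prob_space M by fact
  obtain B where B: "\<And>y. \<bar>F y\<bar> \<le> B" using trig_poly_bounded[OF assms(2)] by blast
  have "Y \<in> borel_measurable M"
    by (intro measurable_coordinatewise_then_product) measurable
  then have "(\<lambda>\<omega>. F (Y \<omega>)) \<in> borel_measurable M"
    using borel_measurable_continuous_onI[OF trig_poly_continuous[OF assms(2)]]
    by (rule measurable_compose)
  then show ?thesis by (intro integrable_const_bound[of _ B]) (auto simp: B)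
qed

text \<open>By the addition formula, the expectation of a shifted cosine is a combination of the
  real and imaginary parts of one characteristic function value; sums follow by linearity.\<close>

lemma trig_poly_expectation_tendsto:
  assumes M: "prob_space M" and N: "prob_space N" and F: "trig_poly K F"
    and Ym [measurable]: "\<And>n m. (\<lambda>\<omega>. Y n \<omega> m) \<in> borel_measurable M"
    and Zm [measurable]: "\<And>m. (\<lambda>\<omega>. Z \<omega> m) \<in> borel_measurable N"
    and char: "\<And>a. (\<lambda>n. \<integral>\<omega>. iexp (\<Sum>m<K. a m * Y n \<omega> m) \<partial>M) \<longlonglongrightarrow>
      (\<integral>\<omega>. iexp (\<Sum>m<K. a m * Z \<omega> m) \<partial>N)"
  shows "(\<lambda>n. \<integral>\<omega>. F (Y n \<omega>) \<partial>M) \<longlonglongrightarrow> (\<integral>\<omega>. F (Z \<omega>) \<partial>N)"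
  using F
proof induction
  case (cos c a b)
  have *: "(\<integral>\<omega>. c * cos ((\<Sum>m<K. a m * U \<omega> m) + b) \<partial>P) =
      c * (Re (\<integral>\<omega>. iexp (\<Sum>m<K. a m * U \<omega> m) \<partial>P) * cos b - Im (\<integral>\<omega>. iexp (\<Sum>m<K. a m * U \<omega> m) \<partial>P) * sin b)"
    if P: "prob_space P" and U[measurable]: "\<And>m. (\<lambda>\<omega>. U \<omega> m) \<in> borel_measurable P"
    for P :: "'c measure" and U
  proof -
    interpret prob_space P by (rule P)
    have i: "integrable P (\<lambda>\<omega>. iexp (\<Sum>m<K. a m * U \<omega> m))"
      by (rule integrable_const_bound[of _ 1]) (auto simp: norm_exp_i_times)
    have r: "Re (\<integral>\<omega>. iexp (\<Sum>m<K. a m * U \<omega> m) \<partial>P) = (\<integral>\<omega>. cos (\<Sum>m<K. a m * U \<omega> m) \<partial>P)"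
      by (subst integral_Re[OF i, symmetric]) (simp add: Re_exp)
    have s: "Im (\<integral>\<omega>. iexp (\<Sum>m<K. a m * U \<omega> m) \<partial>P) = (\<integral>\<omega>. sin (\<Sum>m<K. a m * U \<omega> m) \<partial>P)"
      by (subst integral_Im[OF i, symmetric]) (simp add: Im_exp)
    have ic: "integrable P (\<lambda>\<omega>. cos (\<Sum>m<K. a m * U \<omega> m))" "integrable P (\<lambda>\<omega>. sin (\<Sum>m<K. a m * U \<omega> m))"
      by (rule integrable_const_bound[of _ 1]; simp)+
    show ?thesis unfolding r s using ic by (simp add: cos_add)
  qed
  show ?case unfolding *[OF M Ym] *[OF N Zm]
    by (intro tendsto_intros char)
next
  case (add F G)
  have "integrable M (\<lambda>\<omega>. F (Y n \<omega>))" "integrable M (\<lambda>\<omega>. G (Y n \<omega>))" for n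
    by (rule integrable_trig_poly[OF M add.hyps(1) Ym] integrable_trig_poly[OF M add.hyps(2) Ym])+
  moreover have "integrable N (\<lambda>\<omega>. F (Z \<omega>))" "integrable N (\<lambda>\<omega>. G (Z \<omega>))"
    by (rule integrable_trig_poly[OF N add.hyps(1) Zm] integrable_trig_poly[OF N add.hyps(2) Zm])+
  ultimately show ?case using tendsto_add[OF add.IH] by simp
qed

text \<open>The reduction of every coordinate modulo reflections at odd multiples of \<open>R/2\<close>: a function of
  the sines of the coordinates that is the identity on the cube of side \<open>R\<close>.\<close>
definition fold_coords :: "nat \<Rightarrow> real \<Rightarrow> (nat \<Rightarrow> real) \<Rightarrow> nat \<Rightarrow> real" where
  "fold_coords K R y = trunc K (\<lambda>m. (R/pi) * arcsin (sin (pi/R * y m)))"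

lemma fold_coords_eq_trunc:
  assumes "R > 0" "\<And>m. m < K \<Longrightarrow> \<bar>y m\<bar> \<le> R/2"
  shows "fold_coords K R y = trunc K y"
proof -
  have "(R/pi) * arcsin (sin (pi/R * y m)) = y m" if "m < K" for m
  proof -
    have "\<bar>pi/R * y m\<bar> \<le> pi/R * (R/2)"
      unfolding abs_mult using assms(1) assms(2)[OF that] by (intro mult_mono) auto
    then have "\<bar>pi/R * y m\<bar> \<le> pi/2" using assms(1) by simp
    then have "- (pi/2) \<le> pi/R * y m" "pi/R * y m \<le> pi/2" by linarith+
    then have "arcsin (sin (pi/R * y m)) = pi/R * y m" by (rule arcsin_sin)
    then show ?thesis using assms(1) by simp
  qed
  then show ?thesis by (auto simp: fold_coords_def trunc_def)
qed

text \<open>Inside the cube the folding only truncates, which costs the tail of \<open>y\<close>.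
  Outside it some coordinate exceeds \<open>R/2\<close>, and then the trivial bound
  \<open>2 * B\<close> is at most \<open>4 * B / R\<close> times the norm of \<open>y\<close>, a
  pointwise form of Markov's inequality.\<close>

lemma fold_coords_error:
  assumes H: "l1_lipschitz L H" "L \<ge> 0" "\<And>y. y \<in> l1 \<Longrightarrow> \<bar>H y\<bar> \<le> B" and R: "R > 0" and y: "y \<in> l1"
  shows "\<bar>H y - H (fold_coords K R y)\<bar> \<le> L * (\<Sum>m. \<bar>y (m + K)\<bar>) + 4 * B / R * (\<Sum>m. \<bar>y m\<bar>)"
proof (cases "\<forall>m<K. \<bar>y m\<bar> \<le> R/2")
  case True
  have B: "B \<ge> 0" using H(3)[OF y] by linarith
  have "\<bar>H y - H (fold_coords K R y)\<bar> \<le> L * l1dist y (trunc K y)"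
    using H(1) y trunc_in_l1 True by (subst fold_coords_eq_trunc[OF R]) (auto simp: l1_lipschitz_def)
  also have "\<dots> = L * (\<Sum>m. \<bar>y (m + K)\<bar>)" by (simp add: l1dist_trunc[OF y])
  finally have *: "\<bar>H y - H (fold_coords K R y)\<bar> \<le> L * (\<Sum>m. \<bar>y (m + K)\<bar>)" .
  have "0 \<le> (\<Sum>m. \<bar>y m\<bar>)" using y by (intro suminf_nonneg) (auto simp: l1_def)
  then have "0 \<le> 4 * B / R * (\<Sum>m. \<bar>y m\<bar>)" using B R by simp
  with * show ?thesis by linarith
next
  case False
  then obtain k where k: "\<bar>y k\<bar> > R/2" by (meson not_le)
  have B: "B \<ge> 0" using H(3)[OF y] by linarith
  have s: "summable (\<lambda>m. \<bar>y m\<bar>)" using y by (simp add: l1_def)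
  have "R/2 \<le> (\<Sum>m. \<bar>y m\<bar>)"
    using k sum_le_suminf[OF s, of "{k}"] by simp
  then have "4 * B / R * (R/2) \<le> 4 * B / R * (\<Sum>m. \<bar>y m\<bar>)"
    using B R by (intro mult_left_mono) auto
  moreover have "summable (\<lambda>m. \<bar>y (m + K)\<bar>)" using s by (rule summable_ignore_initial_segment)
  then have "0 \<le> L * (\<Sum>m. \<bar>y (m + K)\<bar>)"
    using H(2) by (intro mult_nonneg_nonneg suminf_nonneg) auto
  moreover have "\<bar>H (fold_coords K R y)\<bar> \<le> B" unfolding fold_coords_def by (rule H(3)[OF trunc_in_l1])
  moreover have "4 * B / R * (R/2) = 2 * B" using R by simp
  ultimately show ?thesis using H(3)[OF y] by linarith
qed

lemma expectation_suminf_abs_le: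
  fixes Y :: "'a \<Rightarrow> nat \<Rightarrow> real"
  assumes i: "\<And>m. integrable M (\<lambda>\<omega>. Y \<omega> m)" and le: "\<And>m. (\<integral>\<omega>. \<bar>Y \<omega> m\<bar> \<partial>M) \<le> \<tau> m" and s: "summable \<tau>"
    and Y: "\<And>\<omega>. \<omega> \<in> space M \<Longrightarrow> summable (\<lambda>m. \<bar>Y \<omega> m\<bar>)"
  shows "integrable M (\<lambda>\<omega>. \<Sum>m. \<bar>Y \<omega> m\<bar>)" "(\<integral>\<omega>. (\<Sum>m. \<bar>Y \<omega> m\<bar>) \<partial>M) \<le> (\<Sum>m. \<tau> m)"
proof -
  have sI: "summable (\<lambda>m. \<integral>\<omega>. norm \<bar>Y \<omega> m\<bar> \<partial>M)"
    by (rule summable_comparison_test'[OF s, of 0]) (auto simp: le)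
  show "integrable M (\<lambda>\<omega>. \<Sum>m. \<bar>Y \<omega> m\<bar>)"
    using i Y sI by (intro integrable_suminf) auto
  have "(\<integral>\<omega>. (\<Sum>m. \<bar>Y \<omega> m\<bar>) \<partial>M) = (\<Sum>m. \<integral>\<omega>. \<bar>Y \<omega> m\<bar> \<partial>M)"
    using i Y sI by (intro integral_suminf) auto
  also have "\<dots> \<le> (\<Sum>m. \<tau> m)"
    using sI by (intro suminf_le le s) auto
  finally show "(\<integral>\<omega>. (\<Sum>m. \<bar>Y \<omega> m\<bar>) \<partial>M) \<le> (\<Sum>m. \<tau> m)" .
qed

lemma measurable_fold_coords:
  assumes [measurable]: "(\<lambda>\<omega>. Y \<omega> m) \<in> borel_measurable M"
  shows "(\<lambda>\<omega>. fold_coords K R (Y \<omega>) m) \<in> borel_measurable M"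
proof -
  have "continuous_on UNIV (\<lambda>x. arcsin (sin (pi/R * x)))"
    by (intro continuous_intros) auto
  then have [measurable]: "(\<lambda>x. arcsin (sin (pi/R * x))) \<in> borel_measurable borel"
    by (rule borel_measurable_continuous_onI)
  have "(\<lambda>\<omega>. arcsin (sin (pi/R * Y \<omega> m))) \<in> borel_measurable M"
    by measurable
  then show ?thesis by (auto simp: fold_coords_def trunc_def)
qed

lemma fold_coords_expectation_error:
  assumes M: "prob_space M" and H: "l1_lipschitz L H" "L \<ge> 0" "\<And>y. y \<in> l1 \<Longrightarrow> \<bar>H y\<bar> \<le> B" and R: "R > 0"
    and i: "\<And>m. integrable M (\<lambda>\<omega>. Y \<omega> m)" and le: "\<And>m. (\<integral>\<omega>. \<bar>Y \<omega> m\<bar> \<partial>M) \<le> \<tau> m" and s: "summable \<tau>"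
    and Y: "\<And>\<omega>. \<omega> \<in> space M \<Longrightarrow> Y \<omega> \<in> l1"
  shows "integrable M (\<lambda>\<omega>. H (Y \<omega>))" "integrable M (\<lambda>\<omega>. H (fold_coords K R (Y \<omega>)))"
    "\<bar>(\<integral>\<omega>. H (Y \<omega>) \<partial>M) - (\<integral>\<omega>. H (fold_coords K R (Y \<omega>)) \<partial>M)\<bar>
      \<le> L * (\<Sum>m. \<tau> (m + K)) + 4 * B / R * (\<Sum>m. \<tau> m)"
proof -
  interpret prob_space M by fact
  have [measurable]: "(\<lambda>\<omega>. Y \<omega> m) \<in> borel_measurable M" for m using i[of m] by simp
  have [measurable]: "(\<lambda>\<omega>. H (Y \<omega>)) \<in> borel_measurable M"
    by (rule measurable_l1_continuous[OF _ Y l1_lipschitz_continuous[OF H(1)]]) simp_all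
  have fl: "fold_coords K R y \<in> l1" for y by (simp add: fold_coords_def trunc_in_l1)
  have [measurable]: "(\<lambda>\<omega>. H (fold_coords K R (Y \<omega>))) \<in> borel_measurable M"
    by (rule measurable_l1_continuous[OF measurable_fold_coords fl l1_lipschitz_continuous[OF H(1)]]) simp_all
  show 1: "integrable M (\<lambda>\<omega>. H (Y \<omega>))"
    by (rule integrable_const_bound[of _ B]) (simp_all add: H(3) Y)
  show 2: "integrable M (\<lambda>\<omega>. H (fold_coords K R (Y \<omega>)))"
    by (rule integrable_const_bound[of _ B]) (simp_all add: H(3) fl)
  have B: "B \<ge> 0" using H(3)[OF trunc_in_l1[of 0 undefined]] by linarith
  have sY: "summable (\<lambda>m. \<bar>Y \<omega> m\<bar>)" if "\<omega> \<in> space M" for \<omega>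
    using Y[OF that] by (simp add: l1_def)
  note e1 = expectation_suminf_abs_le[OF i le s sY]
  note e2 = expectation_suminf_abs_le[of M "\<lambda>\<omega> m. Y \<omega> (m + K)" "\<lambda>m. \<tau> (m + K)", OF i le]
  have s2: "summable (\<lambda>m. \<tau> (m + K))" using s by (simp add: summable_iff_shift)
  have sY2: "summable (\<lambda>m. \<bar>Y \<omega> (m + K)\<bar>)" if "\<omega> \<in> space M" for \<omega>
    using sY[OF that] by (simp add: summable_iff_shift[of "\<lambda>m. \<bar>Y \<omega> m\<bar>"])
  have "\<bar>(\<integral>\<omega>. H (Y \<omega>) \<partial>M) - (\<integral>\<omega>. H (fold_coords K R (Y \<omega>)) \<partial>M)\<bar>
      = \<bar>\<integral>\<omega>. H (Y \<omega>) - H (fold_coords K R (Y \<omega>)) \<partial>M\<bar>" using 1 2 by simp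
  also have "\<dots> \<le> (\<integral>\<omega>. \<bar>H (Y \<omega>) - H (fold_coords K R (Y \<omega>))\<bar> \<partial>M)" by (rule integral_abs_bound)
  also have "\<dots> \<le> (\<integral>\<omega>. L * (\<Sum>m. \<bar>Y \<omega> (m + K)\<bar>) + 4 * B / R * (\<Sum>m. \<bar>Y \<omega> m\<bar>) \<partial>M)"
  proof (rule integral_mono)
    show "integrable M (\<lambda>\<omega>. \<bar>H (Y \<omega>) - H (fold_coords K R (Y \<omega>))\<bar>)" using 1 2 by simp
    show "integrable M (\<lambda>\<omega>. L * (\<Sum>m. \<bar>Y \<omega> (m + K)\<bar>) + 4 * B / R * (\<Sum>m. \<bar>Y \<omega> m\<bar>))"
      using e1(1) e2(1)[OF s2 sY2] by simp
  qed (rule fold_coords_error[OF H R Y])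
  also have "\<dots> = L * (\<integral>\<omega>. (\<Sum>m. \<bar>Y \<omega> (m + K)\<bar>) \<partial>M) + 4 * B / R * (\<integral>\<omega>. (\<Sum>m. \<bar>Y \<omega> m\<bar>) \<partial>M)"
    using e1(1) e2(1)[OF s2 sY2] by simp
  also have "\<dots> \<le> L * (\<Sum>m. \<tau> (m + K)) + 4 * B / R * (\<Sum>m. \<tau> m)"
    using e1(2) e2(2)[OF s2 sY2] H(2) B R by (intro add_mono mult_left_mono) auto
  finally show "\<bar>(\<integral>\<omega>. H (Y \<omega>) \<partial>M) - (\<integral>\<omega>. H (fold_coords K R (Y \<omega>)) \<partial>M)\<bar>
      \<le> L * (\<Sum>m. \<tau> (m + K)) + 4 * B / R * (\<Sum>m. \<tau> m)" .
qed

section \<open>Convergence of expectations from convergence of characteristic functions\<close>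

context
  fixes M :: "'a measure" and N :: "'b measure" and Y :: "nat \<Rightarrow> 'a \<Rightarrow> nat \<Rightarrow> real"
    and Z :: "'b \<Rightarrow> nat \<Rightarrow> real" and \<tau> :: "nat \<Rightarrow> real"
  assumes M: "prob_space M" and N: "prob_space N"
    and iY: "\<And>n m. integrable M (\<lambda>\<omega>. Y n \<omega> m)" and leY: "\<And>n m. (\<integral>\<omega>. \<bar>Y n \<omega> m\<bar> \<partial>M) \<le> \<tau> m"
    and iZ: "\<And>m. integrable N (\<lambda>\<omega>. Z \<omega> m)" and leZ: "\<And>m. (\<integral>\<omega>. \<bar>Z \<omega> m\<bar> \<partial>N) \<le> \<tau> m"
    and s: "summable \<tau>"
    and Y: "\<And>n \<omega>. \<omega> \<in> space M \<Longrightarrow> Y n \<omega> \<in> l1" and Z: "\<And>\<omega>. \<omega> \<in> space N \<Longrightarrow> Z \<omega> \<in> l1"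
    and char: "\<And>K a. (\<lambda>n. \<integral>\<omega>. iexp (\<Sum>m<K. a m * Y n \<omega> m) \<partial>M) \<longlonglongrightarrow>
      (\<integral>\<omega>. iexp (\<Sum>m<K. a m * Z \<omega> m) \<partial>N)"
begin

text \<open>The common summable bound \<open>\<tau>\<close> controls the errors of truncation and
  folding uniformly in \<open>n\<close> and so plays the part of tightness. What is left is a
  function of finitely many sines, uniformly close to a trigonometric polynomial.\<close>

lemma l1_lipschitz_expectation_tendsto:
  assumes H: "l1_lipschitz L H" "L \<ge> 0" "\<And>y. y \<in> l1 \<Longrightarrow> \<bar>H y\<bar> \<le> B"
  shows "(\<lambda>n. \<integral>\<omega>. H (Y n \<omega>) \<partial>M) \<longlonglongrightarrow> (\<integral>\<omega>. H (Z \<omega>) \<partial>N)"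
proof (rule tendstoI)
  fix e :: real assume e: "e > 0"
  interpret M: prob_space M by (rule M)
  interpret N: prob_space N by (rule N)
  have B: "B \<ge> 0" using H(3)[OF trunc_in_l1[of 0 undefined]] by linarith
  have t0: "\<tau> m \<ge> 0" for m
    by (rule order_trans[OF _ leZ[of m]]) simp
  have "(\<lambda>K. L * (\<Sum>m. \<tau> (m + K))) \<longlonglongrightarrow> L * 0"
    by (intro tendsto_mult_left suminf_exist_split2 s)
  then have "\<forall>\<^sub>F K in sequentially. L * (\<Sum>m. \<tau> (m + K)) < e/10"
    using e by (intro order_tendstoD(2)) auto
  then obtain K where K: "L * (\<Sum>m. \<tau> (m + K)) < e/10"
    by (auto simp: eventually_sequentially)
  \<comment> \<open>Chosen to bring the folding error, \<open>4 * B / R\<close> times the sum of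
    \<open>\<tau>\<close>, down to \<open>e/10\<close>; the summand 1 keeps \<open>R\<close>
    positive when the rest is 0.\<close>
  define R where "R = 40 * B * (\<Sum>m. \<tau> m) / e + 1"
  have R: "R > 0" unfolding R_def using B e t0 s by (intro add_nonneg_pos divide_nonneg_pos mult_nonneg_nonneg suminf_nonneg) auto
  have "40 * B * (\<Sum>m. \<tau> m) / e \<le> R" by (simp add: R_def)
  then have R2: "4 * B / R * (\<Sum>m. \<tau> m) \<le> e/10"
    using R e by (simp add: field_simps)
  define Q where "Q = (\<lambda>t. H (trunc K (\<lambda>m. (R/pi) * arcsin (t m))))"
  have cQ: "continuous_on {t. \<forall>m. t m \<in> (if m < K then {-1..1} else {0})} Q"
    unfolding Q_def
  proof (rule continuous_on_compose2[OF continuous_on_l1_continuous_trunc[OF l1_lipschitz_continuous[OF H(1)]] _ subset_UNIV])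
    show "continuous_on {t. \<forall>m. t m \<in> (if m < K then {-1..1} else {0})} (\<lambda>t m. (R/pi) * arcsin (t m))"
    proof (rule continuous_on_coordinatewise_then_product)
      fix i
      have c: "continuous_on {t. \<forall>m. t m \<in> (if m < K then {-1..1} else {0})} (\<lambda>t :: nat \<Rightarrow> real. t i)"
        by (rule continuous_on_subset[OF continuous_on_product_coordinates]) simp
      have "continuous_on {t. \<forall>m. t m \<in> (if m < K then {-1..1} else {0})} (\<lambda>t :: nat \<Rightarrow> real. arcsin (t i))"
      proof (rule continuous_on_compose2[OF continuous_on_arcsin' c])
        have "t i \<in> {-1..1}" if "\<forall>m. t m \<in> (if m < K then {-1..1} else {0})" for t :: "nat \<Rightarrow> real"
          using that[rule_format, of i] by (cases "i < K") auto
        then show "(\<lambda>t :: nat \<Rightarrow> real. t i) ` {t. \<forall>m. t m \<in> (if m < K then {-1..1} else {0})} \<subseteq> {-1..1}" by auto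
      qed
      then show "continuous_on {t. \<forall>m. t m \<in> (if m < K then {-1..1} else {0})} (\<lambda>t. (R/pi) * arcsin (t i))"
        by (intro continuous_on_mult continuous_on_const)
    qed
  qed
  have "e/10 > 0" using e by simp
  from trig_poly_approximation[OF cQ this, of "pi/R"] obtain F where F: "trig_poly K F"
    and FQ: "\<forall>y. \<bar>Q (\<lambda>m. if m < K then sin (pi/R * y m) else 0) - F y\<bar> < e/10"
    by (elim exE conjE)
  have "Q (\<lambda>m. if m < K then sin (pi/R * y m) else 0) = H (fold_coords K R y)" for y
    unfolding Q_def fold_coords_def trunc_def by (rule arg_cong[of _ _ H]) auto
  with FQ have FH: "\<bar>H (fold_coords K R y) - F y\<bar> \<le> e/10" for y
    by (metis less_imp_le)
  \<comment> \<open>Three errors of \<open>e/10\<close> on either side, for tail, folding and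
    approximation. With another \<open>e/10\<close> for the trigonometric polynomial the total is
    \<open>7 * e / 10\<close>.\<close>
  have err: "\<bar>(\<integral>\<omega>. H (U \<omega>) \<partial>P) - (\<integral>\<omega>. F (U \<omega>) \<partial>P)\<bar> \<le> 3 * e / 10"
    if P: "prob_space P" and i: "\<And>m. integrable P (\<lambda>\<omega>. U \<omega> m)" and le: "\<And>m. (\<integral>\<omega>. \<bar>U \<omega> m\<bar> \<partial>P) \<le> \<tau> m"
      and U: "\<And>\<omega>. \<omega> \<in> space P \<Longrightarrow> U \<omega> \<in> l1" for P :: "'c measure" and U
  proof -
    interpret P: prob_space P by (rule P)
    have [measurable]: "(\<lambda>\<omega>. U \<omega> m) \<in> borel_measurable P" for m using i[of m] by simp
    note E2 = fold_coords_expectation_error(2)[OF P H R i le s U, where K = K]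
    note E3 = fold_coords_expectation_error(3)[OF P H R i le s U, where K = K]
    have iF: "integrable P (\<lambda>\<omega>. F (U \<omega>))" by (rule integrable_trig_poly[OF P F]) measurable
    have "\<bar>(\<integral>\<omega>. H (fold_coords K R (U \<omega>)) \<partial>P) - (\<integral>\<omega>. F (U \<omega>) \<partial>P)\<bar>
       = \<bar>\<integral>\<omega>. H (fold_coords K R (U \<omega>)) - F (U \<omega>) \<partial>P\<bar>" using iF E2 by simp
    also have "\<dots> \<le> (\<integral>\<omega>. \<bar>H (fold_coords K R (U \<omega>)) - F (U \<omega>)\<bar> \<partial>P)" by (rule integral_abs_bound)
    also have "\<dots> \<le> (\<integral>\<omega>. e/10 \<partial>P)"
      using iF E2 by (intro integral_mono[OF _ _ FH]) simp_all
    also have "\<dots> = e/10" by (simp add: P.prob_space)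
    finally show ?thesis using E3 K R2 by linarith
  qed
  have "(\<lambda>n. \<integral>\<omega>. F (Y n \<omega>) \<partial>M) \<longlonglongrightarrow> (\<integral>\<omega>. F (Z \<omega>) \<partial>N)"
  proof (rule trig_poly_expectation_tendsto[OF M N F _ _ char])
    show "(\<lambda>\<omega>. Y n \<omega> m) \<in> borel_measurable M" for n m using iY[of n m] by simp
    show "(\<lambda>\<omega>. Z \<omega> m) \<in> borel_measurable N" for m using iZ[of m] by simp
  qed
  then have "\<forall>\<^sub>F n in sequentially. dist (\<integral>\<omega>. F (Y n \<omega>) \<partial>M) (\<integral>\<omega>. F (Z \<omega>) \<partial>N) < e/10"
    using e by (intro tendstoD) auto
  then show "\<forall>\<^sub>F n in sequentially. dist (\<integral>\<omega>. H (Y n \<omega>) \<partial>M) (\<integral>\<omega>. H (Z \<omega>) \<partial>N) < e"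
  proof eventually_elim
    case (elim n)
    show ?case using elim err[OF M iY leY Y, of n] err[OF N iZ leZ Z] e
      unfolding dist_real_def by linarith
  qed
qed

text \<open>A Lipschitz minorant whose expectation at the limit already exceeds \<open>c\<close>
  transfers the strict inequality to large \<open>n\<close>. It exists because the envelopes
  converge to \<open>H\<close> and stay bounded by \<open>B\<close>.\<close>

lemma l1_lsc_expectation_eventually_gt:
  assumes H: "l1_lsc H" "\<And>y. y \<in> l1 \<Longrightarrow> \<bar>H y\<bar> \<le> B" and c: "c < (\<integral>\<omega>. H (Z \<omega>) \<partial>N)"
  shows "\<forall>\<^sub>F n in sequentially. c < (\<integral>\<omega>. H (Y n \<omega>) \<partial>M)"
proof -
  interpret M: prob_space M by (rule M)
  interpret N: prob_space N by (rule N)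
  have mY [measurable]: "(\<lambda>\<omega>. Y n \<omega> m) \<in> borel_measurable M" for n m using iY[of n m] by simp
  have mZ [measurable]: "(\<lambda>\<omega>. Z \<omega> m) \<in> borel_measurable N" for m using iZ[of m] by simp
  define G where "G = (\<lambda>j. l1_infconv H (real j))"
  have G: "l1_lipschitz (real j) (G j)" "\<And>y. y \<in> l1 \<Longrightarrow> \<bar>G j y\<bar> \<le> B" "\<And>y. y \<in> l1 \<Longrightarrow> G j y \<le> H y" for j
    unfolding G_def using l1_infconv_lipschitz[of H, OF H(2)] abs_l1_infconv_le[of H, OF H(2)]
      l1_infconv_le[of H, OF H(2)] by simp_all
  have mHY: "(\<lambda>\<omega>. H (Y n \<omega>)) \<in> borel_measurable M" for n
    by (rule measurable_l1_lsc[OF mY Y H])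
  have mHZ: "(\<lambda>\<omega>. H (Z \<omega>)) \<in> borel_measurable N"
    by (rule measurable_l1_lsc[OF mZ Z H])
  have mGY: "(\<lambda>\<omega>. G j (Y n \<omega>)) \<in> borel_measurable M" for n j
    by (rule measurable_l1_continuous[OF mY Y l1_lipschitz_continuous[OF G(1)]])
  have mGZ: "(\<lambda>\<omega>. G j (Z \<omega>)) \<in> borel_measurable N" for j
    by (rule measurable_l1_continuous[OF mZ Z l1_lipschitz_continuous[OF G(1)]])
  have "(\<lambda>j. \<integral>\<omega>. G j (Z \<omega>) \<partial>N) \<longlonglongrightarrow> (\<integral>\<omega>. H (Z \<omega>) \<partial>N)"
  proof (rule integral_dominated_convergence[where w = "\<lambda>_. B"])
    show "AE \<omega> in N. (\<lambda>j. G j (Z \<omega>)) \<longlonglongrightarrow> H (Z \<omega>)"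
      unfolding G_def by (intro AE_I2 l1_infconv_tendsto[OF H(2,1)] Z)
    show "AE \<omega> in N. norm (G j (Z \<omega>)) \<le> B" for j
      by (intro AE_I2) (simp add: G(2) Z)
  qed (simp_all add: mHZ mGZ)
  then have "\<forall>\<^sub>F j in sequentially. c < (\<integral>\<omega>. G j (Z \<omega>) \<partial>N)"
    using c by (rule order_tendstoD)
  then obtain j where j: "c < (\<integral>\<omega>. G j (Z \<omega>) \<partial>N)"
    by (auto simp: eventually_sequentially)
  have "(\<lambda>n. \<integral>\<omega>. G j (Y n \<omega>) \<partial>M) \<longlonglongrightarrow> (\<integral>\<omega>. G j (Z \<omega>) \<partial>N)"
    by (rule l1_lipschitz_expectation_tendsto[OF G(1) _ G(2)]) auto
  then have "\<forall>\<^sub>F n in sequentially. c < (\<integral>\<omega>. G j (Y n \<omega>) \<partial>M)"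
    using j by (rule order_tendstoD)
  then show ?thesis
  proof eventually_elim
    case (elim n)
    have "(\<integral>\<omega>. G j (Y n \<omega>) \<partial>M) \<le> (\<integral>\<omega>. H (Y n \<omega>) \<partial>M)"
    proof (rule integral_mono)
      show "integrable M (\<lambda>\<omega>. G j (Y n \<omega>))"
        by (rule M.integrable_const_bound[of _ B]) (simp_all add: mGY G(2) Y)
      show "integrable M (\<lambda>\<omega>. H (Y n \<omega>))"
        by (rule M.integrable_const_bound[of _ B]) (simp_all add: mHY H(2) Y)
    qed (simp add: G(3) Y)
    with elim show ?case by linarith
  qed
qed

text \<open>Both \<open>H\<close> and its negative are lower semicontinuous, so the one-sided bound
  for each of them closes in on the limit.\<close>

theorem l1_continuous_expectation_tendsto:
  assumes H: "l1_continuous H" "\<And>y. y \<in> l1 \<Longrightarrow> \<bar>H y\<bar> \<le> B"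
  shows "(\<lambda>n. \<integral>\<omega>. H (Y n \<omega>) \<partial>M) \<longlonglongrightarrow> (\<integral>\<omega>. H (Z \<omega>) \<partial>N)"
proof (rule order_tendstoI)
  have 1: "l1_lsc H" and 2: "l1_lsc (\<lambda>y. - H y)"
    using H(1) unfolding l1_lsc_def l1_continuous_def by (smt (verit))+
  show "\<forall>\<^sub>F n in sequentially. c < (\<integral>\<omega>. H (Y n \<omega>) \<partial>M)" if "c < (\<integral>\<omega>. H (Z \<omega>) \<partial>N)" for c
    using 1 H(2) that by (rule l1_lsc_expectation_eventually_gt)
  show "\<forall>\<^sub>F n in sequentially. (\<integral>\<omega>. H (Y n \<omega>) \<partial>M) < c" if "(\<integral>\<omega>. H (Z \<omega>) \<partial>N) < c" for c
    using l1_lsc_expectation_eventually_gt[OF 2, of B "- c"] H(2) that by simp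
qed

end

section \<open>Gaussian sequences with a given covariance\<close>

definition psd_kernel :: "(nat \<Rightarrow> nat \<Rightarrow> real) \<Rightarrow> bool" where
  "psd_kernel G \<longleftrightarrow> (\<forall>m k. G m k = G k m) \<and>
     (\<forall>F a. finite F \<longrightarrow> 0 \<le> (\<Sum>m\<in>F. \<Sum>k\<in>F. a m * a k * G m k))"

lemma psd_kernel_diag_nonneg: "psd_kernel G \<Longrightarrow> 0 \<le> G j j"
  unfolding psd_kernel_def by (elim conjE allE[of _ "{j}"] allE[of _ "\<lambda>_. 1"]) simp

text \<open>With \<open>G j j = 0\<close> the form on \<open>m\<close> and \<open>j\<close> is
  affine in the weight \<open>t\<close> of \<open>j\<close>, and an affine function that is never
  negative has slope 0.\<close>

lemma psd_kernel_column_zero: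
  assumes G: "psd_kernel G" and z: "G j j = 0"
  shows "G m j = 0"
proof (cases "m = j")
  case False
  have "0 \<le> G m m + 2 * t * G m j" for t
  proof -
    have "0 \<le> (\<Sum>i\<in>{m,j}. \<Sum>k\<in>{m,j}. (if i = m then 1 else t) * (if k = m then 1 else t) * G i k)"
      using G unfolding psd_kernel_def by (elim conjE allE[of _ "{m,j}"] allE[of _ "\<lambda>i. if i = m then 1 else t"]) simp
    moreover have "G j m = G m j" using G by (simp add: psd_kernel_def)
    ultimately show ?thesis using False z by simp
  qed
  \<comment> \<open>At this \<open>t\<close> the affine function would take the value -1.\<close>
  from this[of "- (G m m + 1) / (2 * G m j)"] show ?thesis
    by (cases "G m j = 0") (auto simp: field_simps)
qed (simp add: z)

text \<open>The form of the complement is the minimum of the form of \<open>G\<close> over the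
  coefficient at \<open>j\<close>. If \<open>G j j = 0\<close>, division by zero gives 0 and the
  kernel is unchanged.\<close>

lemma psd_kernel_schur_complement:
  assumes G: "psd_kernel G"
  shows "psd_kernel (\<lambda>m k. G m k - G m j * G k j / G j j)"
proof (cases "G j j = 0")
  case True
  then show ?thesis using G by simp
next
  case D: False
  have sym: "G m k = G k m" for m k using G by (simp add: psd_kernel_def)
  have "0 \<le> (\<Sum>m\<in>F. \<Sum>k\<in>F. a m * a k * (G m k - G m j * G k j / G j j))" if F: "finite F" for F a
  proof -
    \<comment> \<open>The index \<open>j\<close> may lie outside \<open>F\<close>. Coefficients are
      extended by 0 to \<open>insert j F\<close>, where the minimising correction \<open>t\<close>
      at \<open>j\<close> can be subtracted.\<close>
    define c where "c = (\<lambda>m. if m \<in> F then a m else 0)"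
    define F' where "F' = insert j F"
    have F': "finite F'" "j \<in> F'" "F \<subseteq> F'" using F by (auto simp: F'_def)
    define b where "b = (\<Sum>m\<in>F'. c m * G m j)"
    define t where "t = b / G j j"
    define d where "d = (\<lambda>m. if m = j then t else 0)"
    have 1: "(\<Sum>m\<in>F'. \<Sum>k\<in>F'. c m * d k * G m k) = t * b"
      using F' by (simp add: d_def b_def if_distrib[of "\<lambda>x. x * _"] if_distrib[of "\<lambda>x. _ * x"] sum_distrib_left
          cong: if_cong) (simp add: algebra_simps)
    have 2: "(\<Sum>m\<in>F'. \<Sum>k\<in>F'. d m * c k * G m k) = t * b"
      unfolding 1[symmetric] by (subst sum.swap) (simp add: sym algebra_simps)
    have 3: "(\<Sum>m\<in>F'. \<Sum>k\<in>F'. d m * d k * G m k) = t * t * G j j"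
      using F' by (simp add: d_def if_distrib[of "\<lambda>x. x * _"] if_distrib[of "\<lambda>x. _ * x"] cong: if_cong)
    have "0 \<le> (\<Sum>m\<in>F'. \<Sum>k\<in>F'. (c m - d m) * (c k - d k) * G m k)"
      using G F' unfolding psd_kernel_def by (elim conjE allE[of _ F'] allE[of _ "\<lambda>m. c m - d m"]) simp
    also have "\<dots> = (\<Sum>m\<in>F'. \<Sum>k\<in>F'. c m * c k * G m k) - 2 * (t * b) + t * t * G j j"
      unfolding 3[symmetric] using 1 2 by (simp add: algebra_simps sum.distrib sum_subtractf)
    also have "\<dots> = (\<Sum>m\<in>F'. \<Sum>k\<in>F'. c m * c k * G m k) - b * b / G j j"
      using D by (simp add: t_def field_simps)
    also have "b * b / G j j = (\<Sum>m\<in>F'. \<Sum>k\<in>F'. c m * c k * (G m j * G k j / G j j))"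
      unfolding b_def sum_product by (simp add: sum_divide_distrib algebra_simps)
    also have "(\<Sum>m\<in>F'. \<Sum>k\<in>F'. c m * c k * G m k) - \<dots>
       = (\<Sum>m\<in>F'. \<Sum>k\<in>F'. c m * c k * (G m k - G m j * G k j / G j j))"
      by (simp add: sum_subtractf right_diff_distrib)
    also have "\<dots> = (\<Sum>m\<in>F. \<Sum>k\<in>F. c m * c k * (G m k - G m j * G k j / G j j))"
      using F' by (intro sum.mono_neutral_cong_right sum.mono_neutral_right) (auto simp: c_def)
    also have "\<dots> = (\<Sum>m\<in>F. \<Sum>k\<in>F. a m * a k * (G m k - G m j * G k j / G j j))"
      by (simp add: c_def)
    finally show ?thesis .
  qed
  then show ?thesis by (auto simp: psd_kernel_def sym mult.commute)
qed

fun schur :: "(nat \<Rightarrow> nat \<Rightarrow> real) \<Rightarrow> nat \<Rightarrow> nat \<Rightarrow> nat \<Rightarrow> real" where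
  "schur G 0 = G"
| "schur G (Suc j) = (\<lambda>m k. schur G j m k - schur G j m j * schur G j k j / schur G j j j)"

text \<open>The pivot column of the \<open>j\<close>-th elimination step, divided by the root of its
  pivot. A zero pivot yields a zero column through division by zero, which is right because that
  column of a positive semidefinite kernel vanishes anyway.\<close>

definition cholesky :: "(nat \<Rightarrow> nat \<Rightarrow> real) \<Rightarrow> nat \<Rightarrow> nat \<Rightarrow> real" where
  "cholesky G m j = schur G j m j / sqrt (schur G j j j)"

lemma psd_kernel_schur: "psd_kernel G \<Longrightarrow> psd_kernel (schur G j)"
  by (induction j) (auto intro: psd_kernel_schur_complement)

text \<open>Step \<open>i\<close> clears column \<open>i\<close>: by subtraction if the pivot is
  nonzero, and because the column vanishes already if it is zero. Later steps subtract multiples of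
  an entry of the cleared row, which is 0 by symmetry.\<close>

lemma schur_eliminated:
  assumes G: "psd_kernel G" and "i < j"
  shows "schur G j m i = 0"
  using assms(2)
proof (induction j arbitrary: m)
  case (Suc j)
  have P: "psd_kernel (schur G j)" using G by (rule psd_kernel_schur)
  show ?case
  proof (cases "i = j")
    case True
    then show ?thesis using psd_kernel_column_zero[OF P, of j m]
      by (cases "schur G j j j = 0") auto
  next
    case False
    then have z: "schur G j k i = 0" for k using Suc by simp
    have "schur G j i j = schur G j j i" using P by (simp add: psd_kernel_def)
    then show ?thesis using z by simp
  qed
qed simp

lemma schur_eq:
  "schur G n m k = G m k - (\<Sum>j<n. schur G j m j * schur G j k j / schur G j j j)"
  by (induction n arbitrary: m k) simp_all

lemma cholesky_eq_zero:
  assumes "psd_kernel G" "m < j"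
  shows "cholesky G m j = 0"
proof -
  have "schur G j m j = schur G j j m"
    using psd_kernel_schur[OF assms(1), of j] by (simp add: psd_kernel_def)
  then show ?thesis using schur_eliminated[OF assms] by (simp add: cholesky_def)
qed

text \<open>Adding up the elimination steps gives \<open>G\<close> minus the last complement, and
  that complement vanishes in column \<open>k\<close> as soon as \<open>n\<close> exceeds
  \<open>k\<close>.\<close>

lemma cholesky_factorisation:
  assumes G: "psd_kernel G" and "k < n"
  shows "(\<Sum>j<n. cholesky G m j * cholesky G k j) = G m k"
proof -
  have "cholesky G m j * cholesky G k j = schur G j m j * schur G j k j / schur G j j j" for j
    using psd_kernel_diag_nonneg[OF psd_kernel_schur[OF G, of j], of j]
    by (simp add: cholesky_def)
  then show ?thesis using schur_eq[of G n m k] schur_eliminated[OF assms] by simp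
qed

lemma char_iid_normal_sum:
  defines "N \<equiv> PiM (UNIV :: nat set) (\<lambda>_. std_normal_distribution)"
  shows "(\<integral>\<omega>. iexp (\<Sum>j<K. b j * \<omega> j) \<partial>N) = exp (- (\<Sum>j<K. (b j)\<^sup>2) / 2)"
proof -
  have ps: "prob_space std_normal_distribution"
    using real_dist_normal_dist by (simp add: real_distribution_def)
  interpret product_prob_space "\<lambda>_ :: nat. std_normal_distribution" UNIV
    by (intro product_prob_spaceI ps)
  interpret N: prob_space N unfolding N_def by (rule prob_space_PiM) (rule ps)
  have sN: "sets N = sets (PiM UNIV (\<lambda>_ :: nat. borel))"
    unfolding N_def by (intro sets_PiM_cong) auto
  have comp: "distr N borel (\<lambda>\<omega>. \<omega> j) = std_normal_distribution" for j
  proof -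
    have "distr N borel (\<lambda>\<omega>. \<omega> j) = distr N std_normal_distribution (\<lambda>\<omega>. \<omega> j)"
      by (rule distr_cong) auto
    then show ?thesis using PiM_component[of j] by (simp add: N_def)
  qed
  have m[measurable]: "(\<lambda>\<omega>. \<omega> j) \<in> borel_measurable N" for j :: nat
    unfolding measurable_cong_sets[OF sN refl] by (rule measurable_component_singleton) simp
  have ind: "N.indep_vars (\<lambda>_. borel) (\<lambda>j \<omega>. \<omega> j) UNIV"
  proof (subst N.indep_vars_iff_distr_eq_PiM)
    have "(\<Pi>\<^sub>M j\<in>UNIV. distr N borel (\<lambda>\<omega>. \<omega> j)) = N" unfolding comp unfolding N_def ..
    moreover have "distr N (\<Pi>\<^sub>M j\<in>UNIV. borel) (\<lambda>\<omega>. \<lambda>j\<in>UNIV. \<omega> j) = distr N N (\<lambda>\<omega>. \<omega>)"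
      by (rule distr_cong) (auto simp: sN)
    ultimately show "distr N (\<Pi>\<^sub>M j\<in>UNIV. borel) (\<lambda>\<omega>. \<lambda>j\<in>UNIV. \<omega> j)
       = (\<Pi>\<^sub>M j\<in>UNIV. distr N borel (\<lambda>\<omega>. \<omega> j))" by (simp add: distr_id2)
  qed auto
  have ind': "N.indep_vars (\<lambda>_. borel) (\<lambda>j \<omega>. b j * \<omega> j) {..<K}"
    by (rule N.indep_vars_compose2[OF N.indep_vars_subset[OF ind subset_UNIV], where Y = "\<lambda>j x. b j * x"]) auto
  have "(\<integral>\<omega>. iexp (\<Sum>j<K. b j * \<omega> j) \<partial>N) = char (distr N borel (\<lambda>\<omega>. \<Sum>j<K. b j * \<omega> j)) 1"
    unfolding char_def by (subst integral_distr) auto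
  also have "\<dots> = (\<Prod>j<K. char (distr N borel (\<lambda>\<omega>. b j * \<omega> j)) 1)"
    by (rule N.char_distr_sum[OF ind'])
  also have "\<dots> = (\<Prod>j<K. exp (- complex_of_real ((b j)\<^sup>2) / 2))"
  proof (rule prod.cong[OF refl])
    fix j
    have "char (distr N borel (\<lambda>\<omega>. b j * \<omega> j)) 1 = char (distr N borel (\<lambda>\<omega>. \<omega> j)) (b j)"
      unfolding char_def by (subst (1 2) integral_distr) auto
    also have "\<dots> = exp (- complex_of_real ((b j)\<^sup>2) / 2)"
      unfolding comp char_std_normal_distribution by (simp add: exp_of_real[symmetric])
    finally show "char (distr N borel (\<lambda>\<omega>. b j * \<omega> j)) 1 = exp (- complex_of_real ((b j)\<^sup>2) / 2)" .
  qed
  also have "\<dots> = exp (- (\<Sum>j<K. (b j)\<^sup>2) / 2)"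
    by (simp add: exp_sum[symmetric] sum_negf sum_divide_distrib exp_of_real[symmetric])
  finally show ?thesis .
qed

text \<open>A triangular transform of independent standard normal variables: each coordinate is a
  finite sum, so no question of convergence arises, and the factorisation turns the variance of a
  combination into the quadratic form of \<open>G\<close>.\<close>

theorem gaussian_sequence:
  assumes G: "psd_kernel G"
  obtains N :: "(nat \<Rightarrow> real) measure" and Z :: "(nat \<Rightarrow> real) \<Rightarrow> nat \<Rightarrow> real" where
    "prob_space N" "\<And>m. (\<lambda>\<omega>. Z \<omega> m) \<in> borel_measurable N"
    "\<And>K a. (\<integral>\<omega>. iexp (\<Sum>m<K. a m * Z \<omega> m) \<partial>N) = exp (- (\<Sum>m<K. \<Sum>k<K. a m * a k * G m k) / 2)"
proof
  let ?N = "PiM (UNIV :: nat set) (\<lambda>_. std_normal_distribution)"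
  let ?Z = "\<lambda>\<omega> m. \<Sum>j<Suc m. cholesky G m j * \<omega> j"
  show "prob_space ?N"
    using real_dist_normal_dist by (intro prob_space_PiM) (simp add: real_distribution_def)
  have sN: "sets ?N = sets (PiM UNIV (\<lambda>_ :: nat. borel))"
    by (intro sets_PiM_cong) auto
  have [measurable]: "(\<lambda>\<omega>. \<omega> j) \<in> borel_measurable ?N" for j :: nat
    unfolding measurable_cong_sets[OF sN refl] by (rule measurable_component_singleton) simp
  show "(\<lambda>\<omega>. ?Z \<omega> m) \<in> borel_measurable ?N" for m
    by measurable
  show "(\<integral>\<omega>. iexp (\<Sum>m<K. a m * ?Z \<omega> m) \<partial>?N) = exp (- (\<Sum>m<K. \<Sum>k<K. a m * a k * G m k) / 2)" for K a
  proof -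
    define b where "b = (\<lambda>j. \<Sum>m<K. a m * cholesky G m j)"
    have "(\<Sum>m<K. a m * ?Z \<omega> m) = (\<Sum>j<K. b j * \<omega> j)" for \<omega> :: "nat \<Rightarrow> real"
    proof -
      have "?Z \<omega> m = (\<Sum>j<K. cholesky G m j * \<omega> j)" if "m < K" for m
        using that cholesky_eq_zero[OF G] by (intro sum.mono_neutral_left) auto
      then have "(\<Sum>m<K. a m * ?Z \<omega> m) = (\<Sum>m<K. \<Sum>j<K. a m * cholesky G m j * \<omega> j)"
        by (intro sum.cong refl) (simp add: sum_distrib_left mult.assoc)
      also have "\<dots> = (\<Sum>j<K. b j * \<omega> j)"
        unfolding b_def by (subst sum.swap) (simp add: sum_distrib_right)
      finally show ?thesis .
    qed
    moreover have "(\<Sum>j<K. (b j)\<^sup>2) = (\<Sum>m<K. \<Sum>k<K. a m * a k * G m k)"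
    proof -
      have "(\<Sum>j<K. (b j)\<^sup>2) = (\<Sum>j<K. \<Sum>m<K. \<Sum>k<K. a m * a k * (cholesky G m j * cholesky G k j))"
        unfolding b_def power2_eq_square sum_product by (simp add: algebra_simps)
      also have "\<dots> = (\<Sum>m<K. \<Sum>k<K. \<Sum>j<K. a m * a k * (cholesky G m j * cholesky G k j))"
        by (subst sum.swap, rule sum.cong[OF refl], rule sum.swap)
      also have "\<dots> = (\<Sum>m<K. \<Sum>k<K. a m * a k * G m k)"
        by (intro sum.cong refl) (simp add: sum_distrib_left[symmetric] cholesky_factorisation[OF G])
      finally show ?thesis .
    qed
    ultimately show ?thesis using char_iid_normal_sum[of b K] by simp
  qed
qed

section \<open>A dyadic expansion of Lipschitz functions\<close>

text \<open>Level 0 consists of half-lines pointing away from the origin: the integer step between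
  \<open>u\<close> and \<open>u + 1\<close> is passed on the way from 0 to the floor of
  \<open>x\<close> exactly when \<open>x\<close> lies in the set. Level \<open>Suc i\<close>
  consists of the dyadic cells of length \<open>1 / 2 ^ Suc i\<close>.\<close>

fun lev_set :: "nat \<times> int \<Rightarrow> real set" where
  "lev_set (0, u) = (if u \<ge> 0 then {x. x \<ge> of_int u + 1} else {x. x < of_int u + 1})"
| "lev_set (Suc i, k) = {x. \<lfloor>2 ^ Suc i * x\<rfloor> = k}"

definition lev_height :: "nat \<times> int \<Rightarrow> real" where
  "lev_height m = (1/2) ^ fst m"

definition lev_fun :: "nat \<times> int \<Rightarrow> real \<Rightarrow> real" where
  "lev_fun m x = lev_height m * indicator (lev_set m) x"

text \<open>At level \<open>Suc i\<close> this is the increment from the left end of the parent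
  cell, of index \<open>k div 2\<close>, to that of the cell. The two points differ by at most one
  cell length, so the factor \<open>2 ^ Suc i\<close>, inverse to \<open>lev_height\<close>, makes
  the coefficients bounded by the Lipschitz constant.\<close>

fun lev_coeff :: "(real \<Rightarrow> real) \<Rightarrow> nat \<times> int \<Rightarrow> real" where
  "lev_coeff f (0, u) = (if u \<ge> 0 then f (of_int u + 1) - f (of_int u) else f (of_int u) - f (of_int u + 1))"
| "lev_coeff f (Suc i, k) = 2 ^ Suc i * (f (of_int k / 2 ^ Suc i) - f (of_int (k div 2) / 2 ^ i))"

lemma lev_height_nonneg: "0 \<le> lev_height m" and lev_height_le_1: "lev_height m \<le> 1"
  by (auto simp: lev_height_def power_le_one)

lemma lev_fun_nonneg: "0 \<le> lev_fun m x"
  by (simp add: lev_fun_def lev_height_nonneg)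

lemma lev_fun_le_1: "lev_fun m x \<le> 1"
  using lev_height_le_1 by (auto simp: lev_fun_def indicator_def)

lemma lev_set_borel [measurable]: "lev_set m \<in> sets borel"
proof (cases m rule: lev_set.cases)
  case (1 u)
  then show ?thesis by auto
next
  case (2 i k)
  have "{x. \<lfloor>2 ^ Suc i * x\<rfloor> = k} = (\<lambda>x :: real. \<lfloor>2 ^ Suc i * x\<rfloor>) -` {k} \<inter> space borel" by auto
  also have "\<dots> \<in> sets borel" by (rule measurable_sets[of _ borel "count_space UNIV"]) auto
  finally show ?thesis using 2 by simp
qed

lemma borel_measurable_lev_fun [measurable]: "lev_fun m \<in> borel_measurable borel"
  unfolding lev_fun_def by measurable

lemma abs_lev_coeff_le:
  assumes f: "L-lipschitz_on UNIV f"
  shows "\<bar>lev_coeff f m\<bar> \<le> L"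
proof (cases m rule: lev_set.cases)
  case (1 u)
  have "\<bar>f (of_int u + 1) - f (of_int u)\<bar> \<le> L * \<bar>(of_int u + 1) - of_int u\<bar>"
    using lipschitz_onD[OF f, of "of_int u + 1" "of_int u"] by (simp add: dist_real_def)
  then show ?thesis using 1 by (simp add: abs_minus_commute)
next
  case (2 i k)
  have L: "L \<ge> 0" using f by (rule lipschitz_on_nonneg)
  define a where "a = (of_int k / 2 ^ Suc i :: real)"
  define b where "b = (of_int (k div 2) / 2 ^ i :: real)"
  have "a - b = of_int (k mod 2) / 2 ^ Suc i"
  proof -
    have "of_int k = 2 * of_int (k div 2) + (of_int (k mod 2) :: real)"
      by (metis mult_div_mod_eq of_int_add of_int_mult of_int_numeral)
    then show ?thesis by (simp add: a_def b_def field_simps)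
  qed
  moreover have "0 \<le> k mod 2" "k mod 2 \<le> 1" by presburger+
  ultimately have "\<bar>a - b\<bar> \<le> 1 / 2 ^ Suc i"
    by (simp add: divide_simps)
  then have "L * \<bar>a - b\<bar> \<le> L * (1 / 2 ^ Suc i)" using L by (rule mult_left_mono)
  moreover have "\<bar>f a - f b\<bar> \<le> L * \<bar>a - b\<bar>"
    using lipschitz_onD[OF f, of a b] by (simp add: dist_real_def)
  ultimately have "\<bar>f a - f b\<bar> \<le> L * (1 / 2 ^ Suc i)" by linarith
  then have "2 ^ Suc i * \<bar>f a - f b\<bar> \<le> 2 ^ Suc i * (L * (1 / 2 ^ Suc i))"
    by (rule mult_left_mono) simp
  then show ?thesis using 2 by (simp add: a_def b_def abs_mult)
qed

lemma sum_int_telescope: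
  fixes f :: "int \<Rightarrow> real"
  assumes "a \<le> b"
  shows "(\<Sum>u\<in>{a..<b}. f (u + 1) - f u) = f b - f a"
  using assms
proof (induction b rule: int_ge_induct)
  case (step b)
  have "{a..<b + 1} = insert b {a..<b}" using step by auto
  then show ?case using step by simp
qed simp

lemma lev_zero_sum:
  assumes N: "\<bar>x\<bar> + 2 \<le> of_int N"
  shows "(\<Sum>u\<in>{-N..N}. g u * lev_fun (0, u) x) =
    (if x \<ge> 0 then (\<Sum>u\<in>{0..<\<lfloor>x\<rfloor>}. g u) else (\<Sum>u\<in>{\<lfloor>x\<rfloor>..<0}. g u))"
proof -
  have fl: "of_int \<lfloor>x\<rfloor> \<le> x" "x < of_int \<lfloor>x\<rfloor> + 1" by linarith+
  have n: "- N \<le> \<lfloor>x\<rfloor>" "\<lfloor>x\<rfloor> \<le> N" using N fl by linarith+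
  define A where "A = (if x \<ge> 0 then {0..<\<lfloor>x\<rfloor>} else {\<lfloor>x\<rfloor>..<0})"
  have ind: "lev_fun (0, u) x = (if u \<in> A then 1 else 0)" for u
  proof (cases "u \<ge> 0")
    case True
    have "x \<ge> of_int u + 1 \<longleftrightarrow> u + 1 \<le> \<lfloor>x\<rfloor>" by (simp add: le_floor_iff)
    then show ?thesis using True by (auto simp: lev_fun_def lev_height_def A_def indicator_def)
  next
    case False
    have "x < of_int u + 1 \<longleftrightarrow> \<lfloor>x\<rfloor> < u + 1" by linarith
    then show ?thesis using False by (auto simp: lev_fun_def lev_height_def A_def indicator_def)
  qed
  have A: "A \<subseteq> {-N..N}" using n by (auto simp: A_def)
  have "(\<Sum>u\<in>{-N..N}. g u * lev_fun (0, u) x) = (\<Sum>u\<in>A. g u)"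
    unfolding ind using A by (intro sum.mono_neutral_cong_right) auto
  then show ?thesis by (simp add: A_def)
qed

lemma lev_Suc_sum:
  assumes N: "2 ^ Suc i * (\<bar>x\<bar> + 2) \<le> of_int N"
  shows "(\<Sum>k\<in>{-N..N}. g k * lev_fun (Suc i, k) x) = g \<lfloor>2 ^ Suc i * x\<rfloor> / 2 ^ Suc i"
proof -
  let ?k = "\<lfloor>2 ^ Suc i * x\<rfloor>"
  have p: "(1::real) \<le> 2 ^ Suc i" by (rule one_le_power) simp
  have "\<bar>2 ^ Suc i * x\<bar> = 2 ^ Suc i * \<bar>x\<bar>" by (simp add: abs_mult)
  moreover have "2 ^ Suc i * (\<bar>x\<bar> + 2) = 2 ^ Suc i * \<bar>x\<bar> + 2 ^ Suc i * (2::real)" by (rule distrib_left)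
  ultimately have "\<bar>2 ^ Suc i * x\<bar> + 2 \<le> of_int N" using N p by linarith
  then have k: "?k \<in> {-N..N}" by (simp, linarith)
  have "(\<Sum>k\<in>{-N..N}. g k * lev_fun (Suc i, k) x) = (\<Sum>k\<in>{?k}. g k * lev_fun (Suc i, k) x)"
    using k by (intro sum.mono_neutral_right) (auto simp: lev_fun_def)
  then show ?thesis by (simp add: lev_fun_def lev_height_def power_divide)
qed

text \<open>The levels telescope: level 0 reaches the floor of \<open>x\<close>, and each further
  level moves from one dyadic approximation from below to the next. The bound on \<open>N\<close>
  puts every index of these levels that is active at \<open>x\<close> into the box.\<close>

lemma lev_box_sum:
  assumes N: "2 ^ n * (\<bar>x\<bar> + 2) \<le> of_int N"
  shows "(\<Sum>m\<in>{..n} \<times> {-N..N}. lev_coeff f m * lev_fun m x) = f (of_int \<lfloor>2 ^ n * x\<rfloor> / 2 ^ n) - f 0"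
  using assms
proof (induction n)
  case 0
  have "{..0::nat} \<times> {-N..N} = (\<lambda>u. (0, u)) ` {-N..N}" by auto
  then have "(\<Sum>m\<in>{..0} \<times> {-N..N}. lev_coeff f m * lev_fun m x)
     = (\<Sum>u\<in>{-N..N}. lev_coeff f (0, u) * lev_fun (0, u) x)"
    by (simp add: sum.reindex inj_on_def)
  also have "\<dots> = f (of_int \<lfloor>x\<rfloor>) - f 0"
  proof (cases "x \<ge> 0")
    case True
    then have "(\<Sum>u\<in>{0..<\<lfloor>x\<rfloor>}. lev_coeff f (0, u)) = (\<Sum>u\<in>{0..<\<lfloor>x\<rfloor>}. f (of_int (u + 1)) - f (of_int u))"
      by (intro sum.cong) auto
    also have "\<dots> = f (of_int \<lfloor>x\<rfloor>) - f 0"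
      using True by (subst sum_int_telescope) auto
    finally show ?thesis using lev_zero_sum[of x N] 0 True by simp
  next
    case False
    then have "(\<Sum>u\<in>{\<lfloor>x\<rfloor>..<0}. lev_coeff f (0, u)) = (\<Sum>u\<in>{\<lfloor>x\<rfloor>..<0}. - (f (of_int (u + 1)) - f (of_int u)))"
      by (intro sum.cong) auto
    also have "\<dots> = f (of_int \<lfloor>x\<rfloor>) - f 0"
      unfolding sum_negf using False by (subst sum_int_telescope) auto
    finally show ?thesis using lev_zero_sum[of x N] 0 False by simp
  qed
  finally show ?case by simp
next
  case (Suc n)
  have "2 ^ n * (\<bar>x\<bar> + 2) \<le> 2 ^ Suc n * (\<bar>x\<bar> + 2)" by (intro mult_right_mono) auto
  then have N: "2 ^ n * (\<bar>x\<bar> + 2) \<le> of_int N" using Suc.prems by linarith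
  \<comment> \<open>The parent of the cell of \<open>x\<close> at level \<open>Suc n\<close> is the
    cell of \<open>x\<close> one level up; this is why the increments fit together.\<close>
  have half: "\<lfloor>2 ^ Suc n * x\<rfloor> div 2 = \<lfloor>2 ^ n * x\<rfloor>"
  proof -
    have "\<lfloor>2 ^ Suc n * x\<rfloor> div 2 = \<lfloor>2 ^ Suc n * x / of_int 2\<rfloor>"
      by (rule floor_divide_real_eq_div[symmetric]) simp
    then show ?thesis by simp
  qed
  have "{..Suc n} \<times> {-N..N} = ({..n} \<times> {-N..N}) \<union> (\<lambda>k. (Suc n, k)) ` {-N..N}" by (auto simp: le_Suc_eq)
  then have "(\<Sum>m\<in>{..Suc n} \<times> {-N..N}. lev_coeff f m * lev_fun m x)
    = (\<Sum>m\<in>{..n} \<times> {-N..N}. lev_coeff f m * lev_fun m x)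
      + (\<Sum>k\<in>{-N..N}. lev_coeff f (Suc n, k) * lev_fun (Suc n, k) x)"
    by (simp only:) (subst sum.union_disjoint, auto simp: sum.reindex inj_on_def)
  also have "\<dots> = f (of_int \<lfloor>2 ^ Suc n * x\<rfloor> / 2 ^ Suc n) - f 0"
    unfolding Suc.IH[OF N] lev_Suc_sum[OF Suc.prems] using half by simp
  finally show ?case .
qed

text \<open>Level 0 contributes at most \<open>\<bar>x\<bar> + 1\<close>, and each finer level
  \<open>i\<close> exactly \<open>1 / 2 ^ i\<close>, since one of its cells contains
  \<open>x\<close>. The term \<open>1 / 2 ^ n\<close> is the slack that the induction uses
  up.\<close>

lemma lev_box_sum_le:
  assumes N: "2 ^ n * (\<bar>x\<bar> + 2) \<le> of_int N"
  shows "(\<Sum>m\<in>{..n} \<times> {-N..N}. lev_fun m x) \<le> \<bar>x\<bar> + 2 - 1 / 2 ^ n"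
  using assms
proof (induction n)
  case 0
  have "{..0::nat} \<times> {-N..N} = (\<lambda>u. (0, u)) ` {-N..N}" by auto
  then have "(\<Sum>m\<in>{..0} \<times> {-N..N}. lev_fun m x) = (\<Sum>u\<in>{-N..N}. 1 * lev_fun (0, u) x)"
    by (simp add: sum.reindex inj_on_def)
  also have "\<dots> = \<bar>of_int \<lfloor>x\<rfloor>\<bar>"
    using 0 lev_zero_sum[of x N "\<lambda>_. 1"] by auto
  also have "\<dots> \<le> \<bar>x\<bar> + 1" by linarith
  finally show ?case by simp
next
  case (Suc n)
  have "2 ^ n * (\<bar>x\<bar> + 2) \<le> 2 ^ Suc n * (\<bar>x\<bar> + 2)" by (intro mult_right_mono) auto
  then have N: "2 ^ n * (\<bar>x\<bar> + 2) \<le> of_int N" using Suc.prems by linarith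
  have "{..Suc n} \<times> {-N..N} = ({..n} \<times> {-N..N}) \<union> (\<lambda>k. (Suc n, k)) ` {-N..N}" by (auto simp: le_Suc_eq)
  then have "(\<Sum>m\<in>{..Suc n} \<times> {-N..N}. lev_fun m x)
    = (\<Sum>m\<in>{..n} \<times> {-N..N}. lev_fun m x) + (\<Sum>k\<in>{-N..N}. 1 * lev_fun (Suc n, k) x)"
    by (simp only:) (subst sum.union_disjoint, auto simp: sum.reindex inj_on_def)
  also have "\<dots> \<le> (\<bar>x\<bar> + 2 - 1 / 2 ^ n) + 1 / 2 ^ Suc n"
    unfolding lev_Suc_sum[OF Suc.prems] using Suc.IH[OF N] by simp
  also have "\<dots> = \<bar>x\<bar> + 2 - 1 / 2 ^ Suc n" by (simp add: field_simps)
  finally show ?case .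
qed

lemma finite_subset_box:
  fixes F :: "(nat \<times> int) set"
  assumes "finite F"
  obtains n N where "F \<subseteq> {..n} \<times> {-N..N}" "\<And>n' N'. n \<le> n' \<Longrightarrow> N \<le> N' \<Longrightarrow> F \<subseteq> {..n'} \<times> {-N'..N'}"
proof -
  define n where "n = Max (insert 0 (fst ` F))"
  define N where "N = Max (insert 0 ((\<lambda>m. \<bar>snd m\<bar>) ` F))"
  have *: "F \<subseteq> {..n'} \<times> {-N'..N'}" if "n \<le> n'" "N \<le> N'" for n' N'
  proof
    fix m assume m: "m \<in> F"
    have "fst m \<le> n" unfolding n_def using assms m by (intro Max_ge) auto
    moreover have "\<bar>snd m\<bar> \<le> N" unfolding N_def using assms m by (intro Max_ge) auto
    ultimately show "m \<in> {..n'} \<times> {-N'..N'}" using that by (auto simp: mem_Times_iff)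
  qed
  then show ?thesis by (intro that[of n N]) auto
qed

text \<open>The half-width \<open>N'\<close> may depend on the depth \<open>n\<close>, because a
  fixed stretch of the line needs more cells at finer levels. Such boxes still cover every finite
  set of indices.\<close>

lemma box_summable_on:
  fixes f :: "nat \<times> int \<Rightarrow> real"
  assumes nn: "\<And>m. 0 \<le> f m" and B: "\<And>n N. \<exists>N'\<ge>N. (\<Sum>m\<in>{..n} \<times> {-N'..N'}. f m) \<le> B"
  shows "f summable_on UNIV" "infsum f UNIV \<le> B"
proof -
  have le: "sum f F \<le> B" if fin: "finite F" for F
  proof -
    obtain n N where F: "\<And>n' N'. n \<le> n' \<Longrightarrow> N \<le> N' \<Longrightarrow> F \<subseteq> {..n'} \<times> {-N'..N'}"
      using finite_subset_box[OF fin] by metis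
    obtain N' where N': "N' \<ge> N" "(\<Sum>m\<in>{..n} \<times> {-N'..N'}. f m) \<le> B" using B by metis
    have "sum f F \<le> (\<Sum>m\<in>{..n} \<times> {-N'..N'}. f m)"
      using F[OF order_refl N'(1)] nn by (intro sum_mono2) auto
    then show ?thesis using N'(2) by linarith
  qed
  show "f summable_on UNIV"
    by (rule nonneg_bdd_above_summable_on) (auto simp: nn intro!: bdd_aboveI2[where M = B] le)
  then show "infsum f UNIV \<le> B"
    by (rule infsum_le_finite_sums) (auto intro: le)
qed

lemma lev_fun_summable: "(\<lambda>m. lev_fun m x) summable_on UNIV"
  and lev_fun_infsum_le: "(\<Sum>\<^sub>\<infinity>m. lev_fun m x) \<le> \<bar>x\<bar> + 2"
proof -
  have *: "\<exists>N'\<ge>N. (\<Sum>m\<in>{..n} \<times> {-N'..N'}. lev_fun m x) \<le> \<bar>x\<bar> + 2" for n N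
  proof -
    define N' where "N' = max N \<lceil>2 ^ n * (\<bar>x\<bar> + 2)\<rceil>"
    have "2 ^ n * (\<bar>x\<bar> + 2) \<le> of_int N'" unfolding N'_def by linarith
    from lev_box_sum_le[OF this] have "(\<Sum>m\<in>{..n} \<times> {-N'..N'}. lev_fun m x) \<le> \<bar>x\<bar> + 2"
      by (smt (verit) zero_le_divide_1_iff zero_le_power)
    then show ?thesis by (intro exI[of _ N']) (auto simp: N'_def)
  qed
  show "(\<lambda>m. lev_fun m x) summable_on UNIV" "(\<Sum>\<^sub>\<infinity>m. lev_fun m x) \<le> \<bar>x\<bar> + 2"
    using box_summable_on[of "\<lambda>m. lev_fun m x", OF lev_fun_nonneg *] by auto
qed

lemma lev_expansion_summable:
  assumes f: "L-lipschitz_on UNIV f"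
  shows "(\<lambda>m. norm (lev_coeff f m * lev_fun m x)) summable_on UNIV"
proof (rule summable_on_comparison_test[of "\<lambda>m. L * lev_fun m x"])
  show "(\<lambda>m. L * lev_fun m x) summable_on UNIV"
    by (intro summable_on_cmult_right lev_fun_summable)
  show "norm (lev_coeff f m * lev_fun m x) \<le> L * lev_fun m x" for m
    using abs_lev_coeff_le[OF f, of m] lev_fun_nonneg[of m x] by (simp add: abs_mult mult_right_mono)
qed auto

text \<open>The sum exists absolutely, so its value may be taken along any exhausting sequence of
  finite sets. Along the boxes it is \<open>f\<close> at the dyadic approximations of
  \<open>x\<close>, which converge to \<open>x\<close>.\<close>

lemma lipschitz_lev_expansion:
  assumes f: "L-lipschitz_on UNIV f"
  shows "((\<lambda>m. lev_coeff f m * lev_fun m x) has_sum (f x - f 0)) UNIV"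
proof -
  let ?g = "\<lambda>m. lev_coeff f m * lev_fun m x"
  \<comment> \<open>The summand \<open>int n\<close> makes it immediate that the boxes eventually
    cover any finite index set.\<close>
  define N where "N = (\<lambda>n. \<lceil>2 ^ n * (\<bar>x\<bar> + 2)\<rceil> + int n)"
  define box where "box = (\<lambda>n. {..n} \<times> {- N n..N n})"
  have N: "2 ^ n * (\<bar>x\<bar> + 2) \<le> of_int (N n)" for n unfolding N_def by linarith
  have "(?g has_sum infsum ?g UNIV) UNIV"
    using abs_summable_summable[OF lev_expansion_summable[OF f]] by (rule has_sum_infsum)
  then have lim: "(sum ?g \<longlongrightarrow> infsum ?g UNIV) (finite_subsets_at_top UNIV)"
    by (simp add: has_sum_def)
  have "filterlim box (finite_subsets_at_top UNIV) sequentially"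
    unfolding filterlim_finite_subsets_at_top
  proof (intro allI impI)
    fix F :: "(nat \<times> int) set" assume "finite F \<and> F \<subseteq> UNIV"
    then obtain n M where nM: "\<And>n' N'. n \<le> n' \<Longrightarrow> M \<le> N' \<Longrightarrow> F \<subseteq> {..n'} \<times> {-N'..N'}"
      using finite_subset_box[of F] by metis
    have "F \<subseteq> box k" if "k \<ge> max n (nat M)" for k
    proof -
      have "0 \<le> 2 ^ k * (\<bar>x\<bar> + 2)" by simp
      then have "int k \<le> N k" unfolding N_def by linarith
      then show ?thesis unfolding box_def using that by (intro nM) auto
    qed
    then show "\<forall>\<^sub>F k in sequentially. finite (box k) \<and> F \<subseteq> box k \<and> box k \<subseteq> UNIV"
      unfolding eventually_sequentially box_def by (intro exI[of _ "max n (nat M)"]) auto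
  qed
  from filterlim_compose[OF lim this] have "(\<lambda>n. sum ?g (box n)) \<longlonglongrightarrow> infsum ?g UNIV" .
  moreover have "(\<lambda>n. sum ?g (box n)) \<longlonglongrightarrow> f x - f 0"
  proof -
    have "(\<lambda>n. of_int \<lfloor>2 ^ n * x\<rfloor> / 2 ^ n) \<longlonglongrightarrow> x"
    proof (rule tendsto_sandwich[of "\<lambda>n. x - (1/2) ^ n" _ _ "\<lambda>n. x"])
      have "x - (1/2) ^ n \<le> of_int \<lfloor>2 ^ n * x\<rfloor> / 2 ^ n" "of_int \<lfloor>2 ^ n * x\<rfloor> / 2 ^ n \<le> x" for n
      proof -
        have a: "2 ^ n * x - 1 \<le> of_int \<lfloor>2 ^ n * x\<rfloor>" and b: "of_int \<lfloor>2 ^ n * x\<rfloor> \<le> 2 ^ n * x" by linarith+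
        have "(2 ^ n * x - 1) / 2 ^ n \<le> of_int \<lfloor>2 ^ n * x\<rfloor> / 2 ^ n"
          using a by (rule divide_right_mono) simp
        moreover have "of_int \<lfloor>2 ^ n * x\<rfloor> / 2 ^ n \<le> (2 ^ n * x) / 2 ^ n"
          using b by (rule divide_right_mono) simp
        ultimately show "x - (1/2) ^ n \<le> of_int \<lfloor>2 ^ n * x\<rfloor> / 2 ^ n" "of_int \<lfloor>2 ^ n * x\<rfloor> / 2 ^ n \<le> x"
          by (simp_all add: diff_divide_distrib power_divide)
      qed
      then show "\<forall>\<^sub>F n in sequentially. x - (1/2) ^ n \<le> of_int \<lfloor>2 ^ n * x\<rfloor> / 2 ^ n"
        "\<forall>\<^sub>F n in sequentially. of_int \<lfloor>2 ^ n * x\<rfloor> / 2 ^ n \<le> x" by simp_all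
      have "(\<lambda>n. x - (1/2) ^ n) \<longlonglongrightarrow> x - 0" by (intro tendsto_intros) auto
      then show "(\<lambda>n. x - (1/2) ^ n) \<longlonglongrightarrow> x" by simp
    qed auto
    moreover have "isCont f x" using lipschitz_on_continuous_on[OF f] by (simp add: continuous_on_eq_continuous_at)
    ultimately have "(\<lambda>n. f (of_int \<lfloor>2 ^ n * x\<rfloor> / 2 ^ n)) \<longlonglongrightarrow> f x" by (rule isCont_tendsto_compose[rotated])
    then show ?thesis unfolding box_def lev_box_sum[OF N] by (intro tendsto_intros)
  qed
  ultimately have "infsum ?g UNIV = f x - f 0" by (rule LIMSEQ_unique)
  with \<open>(?g has_sum infsum ?g UNIV) UNIV\<close> show ?thesis by simp
qed

section \<open>Cube roots of cell probabilities and summability of the weights\<close>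

lemma powr_third_le:
  fixes p r :: real
  assumes "p \<ge> 0" "r > 0"
  shows "p powr (1/3) \<le> p * r\<^sup>2 + 1 / r"
proof -
  define q where "q = p powr (1/3)"
  have q: "q \<ge> 0" by (simp add: q_def)
  have p: "p = q ^ 3"
    using assms(1) by (cases "p = 0") (auto simp: q_def powr_powr simp flip: powr_realpow)
  have "q \<le> q ^ 3 * r\<^sup>2 + 1 / r"
  proof (cases "q * r \<le> 1")
    case True
    then have "q \<le> 1 / r" using assms(2) by (simp add: field_simps)
    moreover have "0 \<le> q ^ 3 * r\<^sup>2" using q by simp
    ultimately show ?thesis by linarith
  next
    case False
    then have "q * 1 \<le> q * (q * r)\<^sup>2" using q by (intro mult_left_mono) auto
    also have "\<dots> = q ^ 3 * r\<^sup>2" by (simp add: power_mult_distrib power3_eq_cube power2_eq_square)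
    finally show ?thesis using assms(2) by (simp add: add_increasing2)
  qed
  then show ?thesis by (simp add: q_def[symmetric] p[symmetric])
qed

lemma sum_int_abs_le:
  fixes g :: "nat \<Rightarrow> real"
  assumes "\<And>j. 0 \<le> g j"
  shows "(\<Sum>u\<in>{-N..N}. g (nat \<bar>u\<bar>)) \<le> 2 * (\<Sum>j\<le>nat N. g j)"
proof -
  let ?A = "int ` {..nat N}" and ?B = "(\<lambda>j. - int j) ` {..nat N}"
  have "{-N..N} \<subseteq> ?A \<union> ?B"
  proof
    fix u assume "u \<in> {-N..N}"
    then show "u \<in> ?A \<union> ?B"
      by (cases "u \<ge> 0") (auto intro: image_eqI[of _ _ "nat u"] image_eqI[of _ _ "nat (- u)"])
  qed
  then have "(\<Sum>u\<in>{-N..N}. g (nat \<bar>u\<bar>)) \<le> (\<Sum>u\<in>?A \<union> ?B. g (nat \<bar>u\<bar>))"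
    by (intro sum_mono2) (auto simp: assms)
  also have "\<dots> \<le> (\<Sum>u\<in>?A. g (nat \<bar>u\<bar>)) + (\<Sum>u\<in>?B. g (nat \<bar>u\<bar>))"
  proof -
    have "0 \<le> (\<Sum>u\<in>?A \<inter> ?B. g (nat \<bar>u\<bar>))" by (intro sum_nonneg) (auto simp: assms)
    then show ?thesis using sum.union_inter[of ?A ?B "\<lambda>u. g (nat \<bar>u\<bar>)"] by simp
  qed
  also have "(\<Sum>u\<in>?A. g (nat \<bar>u\<bar>)) = (\<Sum>j\<le>nat N. g j)"
    by (subst sum.reindex) (auto simp: inj_on_def)
  also have "(\<Sum>u\<in>?B. g (nat \<bar>u\<bar>)) = (\<Sum>j\<le>nat N. g j)"
    by (subst sum.reindex) (auto simp: inj_on_def)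
  finally show ?thesis by simp
qed

text \<open>Riemann sum of the integral of \<open>1 / (1 + s)\<^sup>2\<close> with mesh
  \<open>1 / n\<close>; replacing \<open>1 / b\<^sup>2\<close> by \<open>1 / (a * b)\<close> makes
  it telescope.\<close>

lemma sum_inverse_square_le:
  fixes n :: real
  assumes n: "n \<ge> 1"
  shows "(\<Sum>j\<le>J. 1 / (1 + real j / n)\<^sup>2) \<le> 2 * n"
proof -
  have "(\<Sum>j\<le>J. 1 / (1 + real j / n)\<^sup>2) \<le> 1 + n * (1 - 1 / (1 + real J / n))"
  proof (induction J)
    case (Suc J)
    define a where "a = 1 + real J / n"
    define b where "b = 1 + real (Suc J) / n"
    have ab: "0 < a" "a \<le> b" "b - a = 1 / n"
      using n by (auto simp: a_def b_def field_simps intro: add_pos_nonneg)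
    have "1 / b\<^sup>2 \<le> 1 / (a * b)"
      using ab by (intro divide_left_mono) (auto simp: power2_eq_square intro: mult_right_mono)
    also have "\<dots> = n * (1 / a - 1 / b)"
    proof -
      have "b > 0" using ab by linarith
      with ab(1) have "1 / a - 1 / b = (b - a) / (a * b)" by (simp add: field_simps)
      then show ?thesis using ab(3) n by simp
    qed
    finally have "1 / b\<^sup>2 \<le> n * (1 / a) - n * (1 / b)" by (simp only: right_diff_distrib)
    then show ?case using Suc unfolding sum.atMost_Suc a_def[symmetric] b_def[symmetric] right_diff_distrib
      by linarith
  qed simp
  also have "\<dots> \<le> 1 + n * 1" using n by (intro add_left_mono mult_left_mono) auto
  finally show ?thesis using n by linarith
qed

definition lev_prob :: "'a measure \<Rightarrow> ('a \<Rightarrow> real) \<Rightarrow> nat \<times> int \<Rightarrow> real" where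
  "lev_prob M \<xi> m = measure M {\<omega> \<in> space M. \<xi> \<omega> \<in> lev_set m}"

text \<open>On level 0, Markov's inequality with the fourth moment gives probabilities of order
  \<open>\<bar>u\<bar> powr (-4)\<close>, whose cube roots are summable. On finer levels the same
  bound cell by cell would leave a constant per level. There \<open>powr_third_le\<close> trades
  cube roots for a weighted sum of probabilities, controlled jointly by the moment, plus a
  deterministic sum.\<close>

lemma lev_weight_summable:
  assumes M: "prob_space M" and \<xi>[measurable]: "\<xi> \<in> borel_measurable M"
    and i: "integrable M (\<lambda>\<omega>. (2 + \<bar>\<xi> \<omega>\<bar>) ^ 4)"
  shows "(\<lambda>m. lev_height m * lev_prob M \<xi> m powr (1/3)) summable_on UNIV"
proof -
  interpret prob_space M by (rule M)
  define K where "K = (\<integral>\<omega>. (2 + \<bar>\<xi> \<omega>\<bar>) ^ 4 \<partial>M)"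
  have K: "K \<ge> 0" by (simp add: K_def)
  define p where "p = lev_prob M \<xi>"
  have p0: "p m \<ge> 0" for m by (simp add: p_def lev_prob_def)
  have pE: "p m = (\<integral>\<omega>. indicator (lev_set m) (\<xi> \<omega>) \<partial>M)" for m
  proof -
    have "p m = (\<integral>\<omega>. indicator {\<omega> \<in> space M. \<xi> \<omega> \<in> lev_set m} \<omega> \<partial>M)"
      by (simp add: p_def lev_prob_def Int_def conj_commute)
    also have "\<dots> = (\<integral>\<omega>. indicator (lev_set m) (\<xi> \<omega>) \<partial>M)"
      by (rule Bochner_Integration.integral_cong) (auto simp: indicator_def)
    finally show ?thesis .
  qed
  have ii: "integrable M (\<lambda>\<omega>. indicator (lev_set m) (\<xi> \<omega>) :: real)" for m
    by (rule integrable_const_bound[of _ 1]) (auto simp: indicator_def)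
  define S where "S = (\<Sum>j. (1 + real j) powr (-4/3))"
  have sS: "summable (\<lambda>j. (1 + real j) powr (-4/3))"
    using summable_Suc_iff[of "\<lambda>j. real j powr (-4/3)"] by (simp add: summable_real_powr_iff)
  define c where "c = (16 * K) powr (1/3)"
  define lb where "lb = (\<lambda>i. case i of 0 \<Rightarrow> c * (2 * S)
      | Suc i \<Rightarrow> K * (25/32) ^ Suc i + 4 * (4/5) ^ Suc i)"
  have level0: "(\<Sum>u\<in>{-N..N}. lev_height (0, u) * p (0, u) powr (1/3)) \<le> lb 0" for N
  proof -
    have pu: "p (0, u) \<le> 16 * K * (1 + real (nat \<bar>u\<bar>)) powr (-4)" for u
    proof -
      have "indicator (lev_set (0, u)) x \<le> (16 * (1 + real (nat \<bar>u\<bar>)) powr (-4)) * (2 + \<bar>x\<bar>) ^ 4" for x :: real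
      proof (cases "x \<in> lev_set (0, u)")
        case True
        then have "1 + \<bar>of_int u\<bar> \<le> 2 * (2 + \<bar>x\<bar>)"
          by (cases "u \<ge> 0") auto
        then have "(1 + real (nat \<bar>u\<bar>)) ^ 4 \<le> (2 * (2 + \<bar>x\<bar>)) ^ 4"
          by (intro power_mono) auto
        also have "\<dots> = 16 * (2 + \<bar>x\<bar>) ^ 4" by (subst power_mult_distrib) simp
        finally have "1 \<le> 16 * (2 + \<bar>x\<bar>) ^ 4 / (1 + real (nat \<bar>u\<bar>)) ^ 4"
          by (subst le_divide_eq_1_pos) (auto intro: add_pos_nonneg)
        also have "\<dots> = (16 * (1 + real (nat \<bar>u\<bar>)) powr (-4)) * (2 + \<bar>x\<bar>) ^ 4"
        proof -
          have "0 < 1 + real (nat \<bar>u\<bar>)" by (intro add_pos_nonneg) auto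
          then have "(1 + real (nat \<bar>u\<bar>)) powr (-4) = 1 / (1 + real (nat \<bar>u\<bar>)) ^ 4"
            by (simp only: powr_minus_divide powr_numeral)
          then show ?thesis by simp
        qed
        finally show ?thesis using True by simp
      qed simp
      then have "p (0, u) \<le> (\<integral>\<omega>. (16 * (1 + real (nat \<bar>u\<bar>)) powr (-4)) * (2 + \<bar>\<xi> \<omega>\<bar>) ^ 4 \<partial>M)"
        unfolding pE using i ii[of "(0, u)"] by (intro integral_mono) (simp_all del: lev_set.simps)
      also have "\<dots> = 16 * K * (1 + real (nat \<bar>u\<bar>)) powr (-4)" using i by (simp add: K_def)
      finally show ?thesis .
    qed
    have "lev_height (0, u) * p (0, u) powr (1/3) \<le> c * (1 + real (nat \<bar>u\<bar>)) powr (-4/3)" for u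
    proof -
      have "p (0, u) powr (1/3) \<le> (16 * K * (1 + real (nat \<bar>u\<bar>)) powr (-4)) powr (1/3)"
        using pu p0 by (intro powr_mono2) auto
      also have "\<dots> = c * (1 + real (nat \<bar>u\<bar>)) powr (-4/3)"
        using K by (simp add: c_def powr_mult powr_powr)
      finally show ?thesis by (simp add: lev_height_def)
    qed
    then have "(\<Sum>u\<in>{-N..N}. lev_height (0, u) * p (0, u) powr (1/3))
      \<le> c * (\<Sum>u\<in>{-N..N}. (1 + real (nat \<bar>u\<bar>)) powr (-4/3))"
      unfolding sum_distrib_left by (intro sum_mono)
    also have "\<dots> \<le> c * (2 * (\<Sum>j\<le>nat N. (1 + real j) powr (-4/3)))"
      by (intro mult_left_mono sum_int_abs_le[of "\<lambda>j. (1 + real j) powr (-4/3)"]) (auto simp: c_def)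
    also have "\<dots> \<le> c * (2 * S)"
      unfolding S_def by (intro mult_left_mono sum_le_suminf sS) (auto simp: c_def)
    finally show ?thesis by (simp add: lb_def)
  qed
  have levelS: "(\<Sum>k\<in>{-N..N}. lev_height (Suc i, k) * p (Suc i, k) powr (1/3)) \<le> lb (Suc i)" for N i
  proof -
    define n where "n = (2 ^ Suc i :: real)"
    have n: "n \<ge> 1" unfolding n_def by (rule one_le_power) simp
    \<comment> \<open>The square of the position makes \<open>(r k)\<^sup>2\<close> grow like its
      fourth power, matching the moment. The base 5/4 lies strictly between 1 and the root of 2:
      after multiplication by the height \<open>(1/2) ^ Suc i\<close>, the two sums decay like
      \<open>(25/32) ^ Suc i\<close> and \<open>(4/5) ^ Suc i\<close>.\<close>
    define r where "r = (\<lambda>k :: int. (5/4) ^ Suc i * (1 + real (nat \<bar>k\<bar>) / n)\<^sup>2)"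
    have pos: "1 + real (nat \<bar>k\<bar>) / n > 0" for k using n by (intro add_pos_nonneg) auto
    have r: "r k > 0" for k unfolding r_def using pos[of k] by simp
    \<comment> \<open>The cells of one level are disjoint, so at each point at most one term of the
      sum survives.\<close>
    have pw: "(\<Sum>k\<in>{-N..N}. (r k)\<^sup>2 * indicator (lev_set (Suc i, k)) x) \<le> (25/16) ^ Suc i * (2 + \<bar>x\<bar>) ^ 4" for x :: real
    proof -
      define k where "k = \<lfloor>n * x\<rfloor>"
      have "(\<Sum>k\<in>{-N..N}. (r k)\<^sup>2 * indicator (lev_set (Suc i, k)) x)
         = (\<Sum>j\<in>{-N..N}. if j = k then (r j)\<^sup>2 else 0)"
        by (intro sum.cong) (auto simp: indicator_def k_def n_def)
      also have "\<dots> \<le> (r k)\<^sup>2" by simp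
      also have "\<dots> = (25/16) ^ Suc i * (1 + real (nat \<bar>k\<bar>) / n) ^ 4"
      proof -
        have "((5/4 :: real) ^ Suc i)\<^sup>2 = ((5/4)\<^sup>2) ^ Suc i"
          by (simp only: power_mult[symmetric] mult.commute)
        also have "(5/4 :: real)\<^sup>2 = 25/16" by (simp add: power2_eq_square)
        finally show ?thesis unfolding r_def power_mult_distrib by (simp only: power_mult[symmetric]) simp
      qed
      also have "\<dots> \<le> (25/16) ^ Suc i * (2 + \<bar>x\<bar>) ^ 4"
      proof (intro mult_left_mono power_mono)
        have "\<bar>n * x\<bar> = n * \<bar>x\<bar>" using n by (simp add: abs_mult)
        then have "\<bar>of_int k\<bar> \<le> n * \<bar>x\<bar> + 1" unfolding k_def by linarith
        then have "real (nat \<bar>k\<bar>) \<le> n * (\<bar>x\<bar> + 1)" using n by (simp add: distrib_left)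
        then show "1 + real (nat \<bar>k\<bar>) / n \<le> 2 + \<bar>x\<bar>" using n by (simp add: field_simps)
      qed (use n in auto)
      finally show ?thesis .
    qed
    have "(\<Sum>k\<in>{-N..N}. p (Suc i, k) * (r k)\<^sup>2) = (\<integral>\<omega>. (\<Sum>k\<in>{-N..N}. (r k)\<^sup>2 * indicator (lev_set (Suc i, k)) (\<xi> \<omega>)) \<partial>M)"
      unfolding pE using ii by (subst Bochner_Integration.integral_sum) (auto simp: mult.commute simp del: lev_set.simps)
    also have "\<dots> \<le> (\<integral>\<omega>. (25/16) ^ Suc i * (2 + \<bar>\<xi> \<omega>\<bar>) ^ 4 \<partial>M)"
    proof (rule integral_mono[OF _ _ pw])
      show "integrable M (\<lambda>\<omega>. \<Sum>k\<in>{-N..N}. (r k)\<^sup>2 * indicator (lev_set (Suc i, k)) (\<xi> \<omega>))"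
        by (intro Bochner_Integration.integrable_sum integrable_mult_right ii)
      show "integrable M (\<lambda>\<omega>. (25/16) ^ Suc i * (2 + \<bar>\<xi> \<omega>\<bar>) ^ 4)" using i by (intro integrable_mult_right)
    qed
    also have "\<dots> = (25/16) ^ Suc i * K" using i by (simp add: K_def)
    finally have 1: "(\<Sum>k\<in>{-N..N}. p (Suc i, k) * (r k)\<^sup>2) \<le> (25/16) ^ Suc i * K" .
    have "(\<Sum>k\<in>{-N..N}. 1 / r k) = (4/5) ^ Suc i * (\<Sum>k\<in>{-N..N}. 1 / (1 + real (nat \<bar>k\<bar>) / n)\<^sup>2)"
      unfolding sum_distrib_left r_def by (intro sum.cong) (simp_all add: power_divide)
    also have "\<dots> \<le> (4/5) ^ Suc i * (2 * (\<Sum>j\<le>nat N. 1 / (1 + real j / n)\<^sup>2))"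
      by (intro mult_left_mono sum_int_abs_le[of "\<lambda>j. 1 / (1 + real j / n)\<^sup>2"]) auto
    also have "\<dots> \<le> (4/5) ^ Suc i * (2 * (2 * n))"
      by (intro mult_left_mono sum_inverse_square_le n) auto
    finally have 2: "(\<Sum>k\<in>{-N..N}. 1 / r k) \<le> (4/5) ^ Suc i * (4 * n)" by simp
    have "(\<Sum>k\<in>{-N..N}. lev_height (Suc i, k) * p (Suc i, k) powr (1/3))
       = (1/2) ^ Suc i * (\<Sum>k\<in>{-N..N}. p (Suc i, k) powr (1/3))"
      by (simp add: lev_height_def sum_distrib_left)
    also have "\<dots> \<le> (1/2) ^ Suc i * (\<Sum>k\<in>{-N..N}. p (Suc i, k) * (r k)\<^sup>2 + 1 / r k)"
      by (intro mult_left_mono sum_mono powr_third_le p0 r) auto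
    also have "\<dots> \<le> (1/2) ^ Suc i * ((25/16) ^ Suc i * K + (4/5) ^ Suc i * (4 * n))"
      using 1 2 unfolding sum.distrib by (intro mult_left_mono) auto
    also have "\<dots> = (1/2 * (25/16)) ^ Suc i * K + 4 * (4/5) ^ Suc i * (1/2 * 2) ^ Suc i"
      unfolding power_mult_distrib n_def by (simp add: algebra_simps)
    also have "\<dots> = lb (Suc i)" by (simp add: lb_def)
    finally show ?thesis .
  qed
  have lb: "(\<Sum>k\<in>{-N..N}. lev_height (i, k) * p (i, k) powr (1/3)) \<le> lb i" for N i
    using level0 levelS by (cases i) auto
  have lb0: "lb i \<ge> 0" for i
  proof -
    have "0 \<le> (\<Sum>k\<in>{-0..0}. lev_height (i, k) * p (i, k) powr (1/3))"
      by (intro sum_nonneg mult_nonneg_nonneg lev_height_nonneg) simp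
    then show ?thesis using lb[of i 0] by linarith
  qed
  have "summable (\<lambda>i. lb (Suc i))"
    unfolding lb_def by (simp only: nat.case) (intro summable_add summable_mult, auto simp: summable_Suc_iff[of "\<lambda>i. _ ^ i"] intro!: summable_geometric summable_mult)
  then have slb: "summable lb" by (simp add: summable_Suc_iff)
  show ?thesis unfolding p_def[symmetric]
  proof (rule box_summable_on(1)[where B = "\<Sum>i. lb i"])
    show "0 \<le> lev_height m * p m powr (1/3)" for m by (simp add: lev_height_nonneg)
    show "\<exists>N'\<ge>N. (\<Sum>m\<in>{..n} \<times> {-N'..N'}. lev_height m * p m powr (1/3)) \<le> (\<Sum>i. lb i)" for n N
    proof (intro exI[of _ N] conjI order_refl)
      have "(\<Sum>m\<in>{..n} \<times> {-N..N}. lev_height m * p m powr (1/3))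
         = (\<Sum>i\<le>n. \<Sum>k\<in>{-N..N}. lev_height (i, k) * p (i, k) powr (1/3))"
        by (simp add: sum.cartesian_product)
      also have "\<dots> \<le> (\<Sum>i\<le>n. lb i)" by (intro sum_mono lb)
      also have "\<dots> \<le> (\<Sum>i. lb i)" by (intro sum_le_suminf slb) (auto simp: lb0)
      finally show "(\<Sum>m\<in>{..n} \<times> {-N..N}. lev_height m * p m powr (1/3)) \<le> (\<Sum>i. lb i)" .
    qed
  qed
qed

section \<open>Covariance inequalities under mixing\<close>

text \<open>Dyadic shells: where \<open>1 + norm x\<close> lies between \<open>2 ^ k\<close> and
  \<open>2 ^ Suc k\<close>, the integrand is at most \<open>2 powr (- s * real k)\<close> and the
  enclosing ball has volume of order \<open>2 ^ (k * DIM('d))\<close>. The resulting geometric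
  series has ratio \<open>q < 1\<close>.\<close>

lemma nn_integral_norm_powr_finite:
  fixes s :: real
  assumes s: "s > real DIM('d::euclidean_space)"
  shows "(\<integral>\<^sup>+x. ennreal ((1 + norm (x :: 'd)) powr (- s)) \<partial>lborel) < \<infinity>"
proof -
  let ?d = "DIM('d)"
  define c where "c = measure lborel (cball (0::'d) 1)"
  have vol: "emeasure lborel (cball (0::'d) r) = ennreal (unit_ball_vol (real ?d) * r ^ ?d)" if "r \<ge> 0" for r
    using that by (rule emeasure_cball)
  let ?t = "\<lambda>k x. ennreal (2 powr (- s * real k)) * indicator (cball (0::'d) (2 ^ Suc k)) x"
  have pw: "ennreal ((1 + norm x) powr (- s)) \<le> (\<Sum>k. ?t k x)" for x :: 'd
  proof -
    define k where "k = nat \<lfloor>log 2 (1 + norm x)\<rfloor>"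
    have l0: "0 \<le> log 2 (1 + norm x)" by (rule zero_le_log_cancel_iff[THEN iffD2]) (auto intro: add_pos_nonneg)
    have kl: "real k \<le> log 2 (1 + norm x)" "log 2 (1 + norm x) < real k + 1"
      using l0 unfolding k_def by linarith+
    have p: "0 < 1 + norm x" using norm_ge_zero[of x] by linarith
    have lo: "2 powr real k \<le> 1 + norm x" using kl(1) p by (simp add: le_log_iff)
    have "1 + norm x < 2 powr (real k + 1)" using kl(2) p by (simp add: log_less_iff)
    also have "2 powr (real k + 1) = 2 ^ Suc k"
      using powr_realpow[of 2 "Suc k"] by (simp add: add.commute)
    finally have "x \<in> cball 0 (2 ^ Suc k)" by simp
    moreover have "(1 + norm x) powr (- s) \<le> (2 powr real k) powr (- s)"
      using lo s by (intro powr_mono2') auto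
    ultimately have "ennreal ((1 + norm x) powr (- s)) \<le> ?t k x"
      by (auto simp: powr_powr mult.commute intro!: ennreal_leI)
    also have "\<dots> \<le> (\<Sum>k. ?t k x)"
      using sum_le_suminf[of "\<lambda>k. ?t k x" "{k}"] by (simp del: sum_mult_indicator sum_indicator_mult)
    finally show ?thesis .
  qed
  define q where "q = (2::real) powr (real ?d - s)"
  have q: "0 < q" "q < 1" using s powr_less_mono[of "real ?d - s" 0 2] by (auto simp: q_def)
  have "(\<integral>\<^sup>+x. ennreal ((1 + norm (x :: 'd)) powr (- s)) \<partial>lborel) \<le> (\<integral>\<^sup>+x. (\<Sum>k. ?t k x) \<partial>lborel)"
    by (intro nn_integral_mono pw)
  also have "\<dots> = (\<Sum>k. \<integral>\<^sup>+x. ?t k x \<partial>lborel)"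
    by (rule nn_integral_suminf) (intro borel_measurable_times_ennreal borel_measurable_const borel_measurable_indicator, simp)
  also have "\<dots> = (\<Sum>k. ennreal (unit_ball_vol (real ?d) * 2 ^ ?d * q ^ k))"
  proof (rule suminf_cong)
    fix k
    have "(\<integral>\<^sup>+x. ?t k x \<partial>lborel) = ennreal (2 powr (- s * real k)) * emeasure lborel (cball (0::'d) (2 ^ Suc k))"
      by (simp add: nn_integral_cmult_indicator)
    also have "\<dots> = ennreal (2 powr (- s * real k)) * ennreal (unit_ball_vol (real ?d) * (2 ^ Suc k) ^ ?d)"
      by (subst vol) auto
    also have "\<dots> = ennreal (2 powr (- s * real k) * (unit_ball_vol (real ?d) * (2 ^ Suc k) ^ ?d))"
      by (rule ennreal_mult'[symmetric]) simp
    also have "2 powr (- s * real k) * (unit_ball_vol (real ?d) * (2 ^ Suc k) ^ ?d)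
       = unit_ball_vol (real ?d) * 2 ^ ?d * q ^ k"
    proof -
      have "((2::real) ^ Suc k) ^ ?d = 2 ^ ?d * (2 ^ k) ^ ?d" by (simp add: power_mult_distrib)
      moreover have "((2::real) ^ k) ^ ?d = 2 powr (real ?d * real k)"
      proof -
        have "2 powr (real ?d * real k) = 2 powr real (k * ?d)" by (simp add: mult.commute)
        also have "\<dots> = 2 ^ (k * ?d)" by (rule powr_realpow) simp
        finally show ?thesis by (simp add: power_mult)
      qed
      moreover have "q ^ k = 2 powr (real ?d * real k) * 2 powr (- s * real k)"
      proof -
        have "q ^ k = q powr real k" using q by (intro powr_realpow[symmetric])
        also have "\<dots> = 2 powr ((real ?d - s) * real k)" unfolding q_def by (rule powr_powr)
        also have "\<dots> = 2 powr (real ?d * real k + (- s * real k))" by (simp add: algebra_simps)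
        finally show ?thesis by (simp only: powr_add)
      qed
      ultimately show ?thesis by simp
    qed
    finally show "(\<integral>\<^sup>+x. ?t k x \<partial>lborel) = ennreal (unit_ball_vol (real ?d) * 2 ^ ?d * q ^ k)" .
  qed
  also have "\<dots> = ennreal (\<Sum>k. unit_ball_vol (real ?d) * 2 ^ ?d * q ^ k)"
    using q by (intro suminf_ennreal_eq summable_sums summable_mult summable_geometric) auto
  also have "\<dots> < \<infinity>" by simp
  finally show ?thesis .
qed

text \<open>Conditioning on \<open>F\<close> turns the covariance into the integral of
  \<open>U\<close> against \<open>W - expectation V\<close>. Among functions bounded by 1 this is
  largest for the sign of that difference, which is \<open>2 * indicator A - 1\<close>.\<close>

lemma (in prob_space) covariance_sign:
  fixes U V :: "'a \<Rightarrow> real"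
  assumes F: "subalgebra M F" and U: "U \<in> borel_measurable F" "\<And>\<omega>. \<omega> \<in> space M \<Longrightarrow> \<bar>U \<omega>\<bar> \<le> 1"
    and V: "V \<in> borel_measurable M" "\<And>\<omega>. \<omega> \<in> space M \<Longrightarrow> \<bar>V \<omega>\<bar> \<le> 1"
  obtains A where "A \<in> sets F"
    "\<bar>expectation (\<lambda>\<omega>. U \<omega> * V \<omega>) - expectation U * expectation V\<bar>
      \<le> expectation (\<lambda>\<omega>. (2 * indicator A \<omega> - 1) * V \<omega>) - expectation (\<lambda>\<omega>. 2 * indicator A \<omega> - 1) * expectation V"
proof -
  have sp: "space F = space M" using F by (simp add: subalgebra_def)
  interpret finite_measure_subalgebra M F by unfold_locales (rule F)
  interpret sigma_finite_subalgebra M F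
    by (rule finite_measure_subalgebra_is_sigma_finite) unfold_locales
  note [measurable] = V(1) measurable_from_subalg[OF F U(1)]
  define W where "W = real_cond_exp M F V"
  have iV: "integrable M V" by (rule integrable_const_bound[of _ 1]) (auto simp: V)
  have iW: "integrable M W" unfolding W_def using iV by (rule real_cond_exp_int)
  have WF[measurable]: "W \<in> borel_measurable F" by (simp add: W_def)
  define A where "A = {\<omega> \<in> space F. 0 \<le> W \<omega> - expectation V}"
  have A: "A \<in> sets F" unfolding A_def by measurable
  then have AM[measurable]: "A \<in> sets M" using F by (auto simp: subalgebra_def)
  have id: "expectation (\<lambda>\<omega>. H \<omega> * V \<omega>) - expectation H * expectation V = expectation (\<lambda>\<omega>. H \<omega> * (W \<omega> - expectation V))"
    "integrable M (\<lambda>\<omega>. H \<omega> * (W \<omega> - expectation V))"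
    if H: "H \<in> borel_measurable F" "\<And>\<omega>. \<omega> \<in> space M \<Longrightarrow> \<bar>H \<omega>\<bar> \<le> 1" for H
  proof -
    note [measurable] = measurable_from_subalg[OF F H(1)]
    have iH: "integrable M H" by (rule integrable_const_bound[of _ 1]) (auto simp: H)
    have iHV: "integrable M (\<lambda>\<omega>. H \<omega> * V \<omega>)"
      by (rule integrable_const_bound[of _ 1]) (auto simp: H V abs_mult intro!: mult_le_one)
    note * = real_cond_exp_intg[OF iHV H(1) V(1), folded W_def]
    show "expectation (\<lambda>\<omega>. H \<omega> * V \<omega>) - expectation H * expectation V = expectation (\<lambda>\<omega>. H \<omega> * (W \<omega> - expectation V))"
      unfolding *(2)[symmetric] right_diff_distrib using *(1) iH by simp
    show "integrable M (\<lambda>\<omega>. H \<omega> * (W \<omega> - expectation V))"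
      unfolding right_diff_distrib using *(1) iH by simp
  qed
  have sF: "(\<lambda>\<omega>. 2 * indicator A \<omega> - 1 :: real) \<in> borel_measurable F" using A by measurable
  have sb: "\<bar>2 * indicator A \<omega> - 1 :: real\<bar> \<le> 1" for \<omega> by (simp add: indicator_def)
  have "\<bar>expectation (\<lambda>\<omega>. U \<omega> * V \<omega>) - expectation U * expectation V\<bar> = \<bar>expectation (\<lambda>\<omega>. U \<omega> * (W \<omega> - expectation V))\<bar>"
    by (subst id(1)[OF U]) auto
  also have "\<dots> \<le> expectation (\<lambda>\<omega>. \<bar>U \<omega> * (W \<omega> - expectation V)\<bar>)" by (rule integral_abs_bound)
  also have "\<dots> \<le> expectation (\<lambda>\<omega>. (2 * indicator A \<omega> - 1) * (W \<omega> - expectation V))"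
  proof (rule integral_mono)
    show "integrable M (\<lambda>\<omega>. \<bar>U \<omega> * (W \<omega> - expectation V)\<bar>)" using id(2)[OF U] by simp
    show "integrable M (\<lambda>\<omega>. (2 * indicator A \<omega> - 1) * (W \<omega> - expectation V))" using id(2)[OF sF sb] .
    fix \<omega> assume \<omega>: "\<omega> \<in> space M"
    have "\<bar>U \<omega> * (W \<omega> - expectation V)\<bar> \<le> 1 * \<bar>W \<omega> - expectation V\<bar>"
      unfolding abs_mult using U(2)[OF \<omega>] by (intro mult_right_mono) auto
    also have "\<dots> = (2 * indicator A \<omega> - 1) * (W \<omega> - expectation V)"
      using \<omega> by (auto simp: A_def sp indicator_def)
    finally show "\<bar>U \<omega> * (W \<omega> - expectation V)\<bar> \<le> (2 * indicator A \<omega> - 1) * (W \<omega> - expectation V)" .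
  qed
  also have "\<dots> = expectation (\<lambda>\<omega>. (2 * indicator A \<omega> - 1) * V \<omega>) - expectation (\<lambda>\<omega>. 2 * indicator A \<omega> - 1) * expectation V"
    by (rule id(1)[OF sF sb, symmetric])
  finally show thesis using A by (intro that)
qed

text \<open>The reduction to signs is applied twice, first to \<open>U\<close> and then to
  \<open>V\<close>. Two signs have covariance
  \<open>4 * (prob (A \<inter> B) - prob A * prob B)\<close>, hence the factor 4.\<close>

lemma (in prob_space) covariance_le_mixing:
  fixes U V :: "'a \<Rightarrow> real"
  assumes F: "subalgebra M F" and G: "subalgebra M G"
    and U: "U \<in> borel_measurable F" "\<And>\<omega>. \<omega> \<in> space M \<Longrightarrow> \<bar>U \<omega>\<bar> \<le> 1"
    and V: "V \<in> borel_measurable G" "\<And>\<omega>. \<omega> \<in> space M \<Longrightarrow> \<bar>V \<omega>\<bar> \<le> 1"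
    and a: "\<And>A B. A \<in> sets F \<Longrightarrow> B \<in> sets G \<Longrightarrow> \<bar>prob (A \<inter> B) - prob A * prob B\<bar> \<le> a"
  shows "\<bar>expectation (\<lambda>\<omega>. U \<omega> * V \<omega>) - expectation U * expectation V\<bar> \<le> 4 * a"
proof -
  have VM: "V \<in> borel_measurable M" by (rule measurable_from_subalg[OF G V(1)])
  obtain A where A: "A \<in> sets F" and 1: "\<bar>expectation (\<lambda>\<omega>. U \<omega> * V \<omega>) - expectation U * expectation V\<bar>
      \<le> expectation (\<lambda>\<omega>. (2 * indicator A \<omega> - 1) * V \<omega>) - expectation (\<lambda>\<omega>. 2 * indicator A \<omega> - 1) * expectation V"
    by (rule covariance_sign[OF F U VM V(2)])
  have AM[measurable]: "A \<in> sets M" using F A by (auto simp: subalgebra_def)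
  have sM: "(\<lambda>\<omega>. 2 * indicator A \<omega> - 1 :: real) \<in> borel_measurable M" by measurable
  have sb: "\<bar>2 * indicator A \<omega> - 1 :: real\<bar> \<le> 1" for \<omega> by (simp add: indicator_def)
  obtain B where B: "B \<in> sets G" and 2: "\<bar>expectation (\<lambda>\<omega>. V \<omega> * (2 * indicator A \<omega> - 1)) - expectation V * expectation (\<lambda>\<omega>. 2 * indicator A \<omega> - 1)\<bar>
      \<le> expectation (\<lambda>\<omega>. (2 * indicator B \<omega> - 1) * (2 * indicator A \<omega> - 1)) - expectation (\<lambda>\<omega>. 2 * indicator B \<omega> - 1) * expectation (\<lambda>\<omega>. 2 * indicator A \<omega> - 1)"
    by (rule covariance_sign[OF G V sM sb])
  have BM[measurable]: "B \<in> sets M" using G B by (auto simp: subalgebra_def)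
  have e: "expectation (\<lambda>\<omega>. 2 * indicator D \<omega> - 1) = 2 * prob D - 1" if "D \<in> sets M" for D
    using that by (subst Bochner_Integration.integral_diff) (auto simp: prob_space intro!: integrable_const_bound[of _ 1])
  have *: "(2 * indicator B \<omega> - 1) * (2 * indicator A \<omega> - 1) = 4 * indicator (A \<inter> B) \<omega> - 2 * indicator A \<omega> - 2 * indicator B \<omega> + (1::real)" for \<omega>
    by (simp add: indicator_def)
  have "expectation (\<lambda>\<omega>. (2 * indicator B \<omega> - 1) * (2 * indicator A \<omega> - 1))
      = expectation (\<lambda>\<omega>. 4 * indicator (A \<inter> B) \<omega> - 2 * indicator A \<omega> - 2 * indicator B \<omega> + (1::real))"
    by (rule Bochner_Integration.integral_cong[OF refl *])
  also have "\<dots> = 4 * prob (A \<inter> B) - 2 * prob A - 2 * prob B + 1"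
  proof -
    have "integrable M (indicator D :: 'a \<Rightarrow> real)" if "D \<in> sets M" for D
      by (rule integrable_const_bound[of _ 1]) (use that in \<open>auto simp: indicator_def\<close>)
    from this[of A] this[of B] this[of "A \<inter> B"] show ?thesis by (simp add: prob_space)
  qed
  finally have E1: "expectation (\<lambda>\<omega>. (2 * indicator B \<omega> - 1) * (2 * indicator A \<omega> - 1)) = 4 * prob (A \<inter> B) - 2 * prob A - 2 * prob B + 1" .
  have "expectation (\<lambda>\<omega>. (2 * indicator B \<omega> - 1) * (2 * indicator A \<omega> - 1)) - expectation (\<lambda>\<omega>. 2 * indicator B \<omega> - 1) * expectation (\<lambda>\<omega>. 2 * indicator A \<omega> - 1)
     = 4 * (prob (A \<inter> B) - prob A * prob B)"
    unfolding E1 e[OF AM] e[OF BM] by (simp add: algebra_simps)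
  also have "\<dots> \<le> 4 * a" using a[OF A B] by (intro mult_left_mono) (simp_all add: abs_le_iff)
  finally show ?thesis using 1 2 unfolding mult.commute[of "V _"] mult.commute[of "expectation V"] by linarith
qed

section \<open>Mixing fields and random variables determined by part of the field\<close>

locale mixing_field = prob_space M for M :: "'a measure" +
  fixes X :: "'d::euclidean_space \<Rightarrow> 'a \<Rightarrow> real" and \<nu> :: nat and C l :: real
  assumes field: "measurable_field M X" and stationary: "strictly_stationary M X"
    and C_pos: "C > 0" and l_pos: "l > 0"
    and nu_gt_3d: "real \<nu> > 3 * real DIM('d)" and nu_gt: "real \<nu> > (l + 1) * real DIM('d)"
    and mixing: "\<And>\<gamma> r. \<gamma> \<ge> 2 * kappa TYPE('d) \<Longrightarrow> r > 0 \<Longrightarrow>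
           alpha_mix M X \<gamma> r \<le> ereal (C * r powr (- real \<nu>) * \<gamma> powr l)"
begin

lemma field_measurable_pair [measurable]: "(\<lambda>p. X (fst p) (snd p)) \<in> borel_measurable (lborel \<Otimes>\<^sub>M M)"
  using field unfolding measurable_field_def
  by (simp add: measurable_cong_sets[OF sets_pair_measure_cong[OF sets_lborel refl] refl])

lemma field_measurable [measurable]: "X t \<in> borel_measurable M"
  using measurable_compose[OF measurable_Pair1'[of t lborel M] field_measurable_pair] by simp

lemma field_measurable_path [measurable]: "\<omega> \<in> space M \<Longrightarrow> (\<lambda>t. X t \<omega>) \<in> borel_measurable borel"
  using measurable_compose[OF measurable_Pair2'[of \<omega> M lborel] field_measurable_pair] by simp

text \<open>The family \<open>sigmaX\<close> as a measure space, so that measurability and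
  conditional expectation apply to it; no order of time is meant.\<close>

definition past :: "'d set \<Rightarrow> 'a measure" where
  "past I = sigma (space M) {X t -` B \<inter> space M | t B. t \<in> I \<and> B \<in> sets borel}"

lemma space_past: "space (past I) = space M"
  unfolding past_def by (rule space_measure_of) auto

lemma sets_past: "sets (past I) = sigmaX M X I"
  unfolding past_def sigmaX_def by (rule sets_measure_of) auto

lemma subalgebra_past: "subalgebra M (past I)"
proof -
  have "sigma_sets (space M) {X t -` B \<inter> space M | t B. t \<in> I \<and> B \<in> sets borel} \<subseteq> sets M"
    by (rule sets.sigma_sets_subset) (auto intro: measurable_sets[OF field_measurable])
  then show ?thesis by (simp add: subalgebra_def space_past sets_past sigmaX_def)
qed

lemma measurable_past: "t \<in> I \<Longrightarrow> X t \<in> borel_measurable (past I)"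
  by (rule measurableI) (auto simp: space_past sets_past sigmaX_def intro!: sigma_sets.Basic)

lemma mixing_events:
  assumes "mix_admissible \<gamma> r I J" "\<gamma> \<ge> 2 * kappa TYPE('d)" "r > 0"
    and "A \<in> sets (past I)" "B \<in> sets (past J)"
  shows "\<bar>prob (A \<inter> B) - prob A * prob B\<bar> \<le> C * r powr (- real \<nu>) * \<gamma> powr l"
proof -
  have "ereal \<bar>prob (A \<inter> B) - prob A * prob B\<bar> \<le> alpha_mix M X \<gamma> r"
    unfolding alpha_mix_def using assms(1,4,5)
    by (intro SUP_upper2[of "(I, J, A, B)"]) (auto simp: sets_past)
  also have "\<dots> \<le> ereal (C * r powr (- real \<nu>) * \<gamma> powr l)" by (rule mixing[OF assms(2,3)])
  finally show ?thesis by simp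
qed

text \<open>Equality is asked only up to a null set because an integral of the field over an
  uncountable set is in general not literally measurable for \<open>past I\<close>. Measurability
  for \<open>M\<close> is demanded separately since \<open>M\<close> need not be complete.\<close>

definition ae_determined :: "'d set \<Rightarrow> ('a \<Rightarrow> real) \<Rightarrow> bool" where
  "ae_determined I U \<longleftrightarrow> U \<in> borel_measurable M \<and> (\<exists>U'\<in>borel_measurable (past I). AE \<omega> in M. U \<omega> = U' \<omega>)"

lemma ae_determined_comp:
  assumes "ae_determined I U" and [measurable]: "\<phi> \<in> borel_measurable borel"
  shows "ae_determined I (\<lambda>\<omega>. \<phi> (U \<omega>))"
proof -
  obtain U' where [measurable]: "U' \<in> borel_measurable (past I)" and ae: "AE \<omega> in M. U \<omega> = U' \<omega>"
    using assms(1) by (auto simp: ae_determined_def)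
  have [measurable]: "U \<in> borel_measurable M" using assms(1) by (auto simp: ae_determined_def)
  show ?thesis unfolding ae_determined_def
  proof (intro conjI bexI[of _ "\<lambda>\<omega>. \<phi> (U' \<omega>)"])
    show "AE \<omega> in M. \<phi> (U \<omega>) = \<phi> (U' \<omega>)" using ae by eventually_elim simp
  qed measurable
qed

lemma ae_determined_add:
  assumes "ae_determined I U" "ae_determined I V"
  shows "ae_determined I (\<lambda>\<omega>. U \<omega> + V \<omega>)"
proof -
  obtain U' V' where [measurable]: "U' \<in> borel_measurable (past I)" "V' \<in> borel_measurable (past I)"
    and ae: "AE \<omega> in M. U \<omega> = U' \<omega>" "AE \<omega> in M. V \<omega> = V' \<omega>"
    using assms by (auto simp: ae_determined_def)
  have [measurable]: "U \<in> borel_measurable M" "V \<in> borel_measurable M" using assms by (auto simp: ae_determined_def)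
  show ?thesis unfolding ae_determined_def
  proof (intro conjI bexI[of _ "\<lambda>\<omega>. U' \<omega> + V' \<omega>"])
    show "AE \<omega> in M. U \<omega> + V \<omega> = U' \<omega> + V' \<omega>" using ae by eventually_elim simp
  qed measurable
qed

lemma ae_determined_const: "ae_determined I (\<lambda>_. c)"
  unfolding ae_determined_def by (auto intro!: bexI[of _ "\<lambda>_. c"])

lemma past_mono: "I \<subseteq> J \<Longrightarrow> sets (past I) \<subseteq> sets (past J)"
  unfolding sets_past sigmaX_def by (rule sigma_sets_mono') auto

lemma ae_determined_mono:
  assumes "ae_determined I U" "I \<subseteq> J"
  shows "ae_determined J U"
proof -
  have "borel_measurable (past I) \<subseteq> borel_measurable (past J)"
    using past_mono[OF assms(2)] by (intro measurable_mono) (auto simp: space_past)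
  then show ?thesis using assms(1) unfolding ae_determined_def by blast
qed

lemma covariance_ae_determined:
  assumes adm: "mix_admissible \<gamma> r I J" "\<gamma> \<ge> 2 * kappa TYPE('d)" "r > 0"
    and U: "ae_determined I U" "\<And>\<omega>. \<omega> \<in> space M \<Longrightarrow> \<bar>U \<omega>\<bar> \<le> 1"
    and V: "ae_determined J V" "\<And>\<omega>. \<omega> \<in> space M \<Longrightarrow> \<bar>V \<omega>\<bar> \<le> 1"
  shows "\<bar>expectation (\<lambda>\<omega>. U \<omega> * V \<omega>) - expectation U * expectation V\<bar> \<le> 4 * (C * r powr (- real \<nu>) * \<gamma> powr l)"
proof -
  obtain U' V' where mU[measurable]: "U' \<in> borel_measurable (past I)" and mV[measurable]: "V' \<in> borel_measurable (past J)"
    and ae: "AE \<omega> in M. U \<omega> = U' \<omega>" "AE \<omega> in M. V \<omega> = V' \<omega>"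
    using U(1) V(1) by (auto simp: ae_determined_def)
  have [measurable]: "U \<in> borel_measurable M" "V \<in> borel_measurable M" using U(1) V(1) by (auto simp: ae_determined_def)
  note [measurable] = measurable_from_subalg[OF subalgebra_past mU] measurable_from_subalg[OF subalgebra_past mV]
  \<comment> \<open>The version \<open>U'\<close> agrees with \<open>U\<close> only almost
    everywhere and may be unbounded on the exceptional set. Clipping restores the bound everywhere
    and preserves measurability for \<open>past I\<close>.\<close>
  define U2 where "U2 = (\<lambda>\<omega>. max (-1) (min 1 (U' \<omega>)))"
  define V2 where "V2 = (\<lambda>\<omega>. max (-1) (min 1 (V' \<omega>)))"
  have m2: "U2 \<in> borel_measurable (past I)" "V2 \<in> borel_measurable (past J)"
    unfolding U2_def V2_def by measurable
  have M2[measurable]: "U2 \<in> borel_measurable M" "V2 \<in> borel_measurable M"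
    unfolding U2_def V2_def by measurable
  have aeU: "AE \<omega> in M. U \<omega> = U2 \<omega>"
    using ae(1) AE_space by eventually_elim (use U(2) in \<open>force simp: U2_def abs_le_iff\<close>)
  have aeV: "AE \<omega> in M. V \<omega> = V2 \<omega>"
    using ae(2) AE_space by eventually_elim (use V(2) in \<open>force simp: V2_def abs_le_iff\<close>)
  have aeUV: "AE \<omega> in M. U \<omega> * V \<omega> = U2 \<omega> * V2 \<omega>" using aeU aeV by eventually_elim simp
  have eq: "expectation U = expectation U2" "expectation V = expectation V2"
    "expectation (\<lambda>\<omega>. U \<omega> * V \<omega>) = expectation (\<lambda>\<omega>. U2 \<omega> * V2 \<omega>)"
    using aeU aeV aeUV by (auto intro!: integral_cong_AE)
  have b: "\<bar>U2 \<omega>\<bar> \<le> 1" "\<bar>V2 \<omega>\<bar> \<le> 1" for \<omega> by (auto simp: U2_def V2_def)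
  show ?thesis unfolding eq
    by (rule covariance_le_mixing[OF subalgebra_past subalgebra_past m2(1) b(1) m2(2) b(2) mixing_events[OF adm]])
qed

text \<open>The real and imaginary parts together consist of four covariances of sines and cosines,
  each at most 4 times the mixing bound; hence 16.\<close>

lemma covariance_ae_determined_unit:
  assumes adm: "mix_admissible \<gamma> r I J" "\<gamma> \<ge> 2 * kappa TYPE('d)" "r > 0"
    and U: "ae_determined I U" and V: "ae_determined J V"
  shows "cmod ((\<integral>\<omega>. iexp (U \<omega>) * iexp (V \<omega>) \<partial>M) - (\<integral>\<omega>. iexp (U \<omega>) \<partial>M) * (\<integral>\<omega>. iexp (V \<omega>) \<partial>M))
     \<le> 16 * (C * r powr (- real \<nu>) * \<gamma> powr l)"
proof -
  have [measurable]: "U \<in> borel_measurable M" "V \<in> borel_measurable M" using U V by (auto simp: ae_determined_def)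
  let ?a = "4 * (C * r powr (- real \<nu>) * \<gamma> powr l)"
  have iexp_eq: "iexp x = complex_of_real (cos x) + \<i> * complex_of_real (sin x)" for x
    by (simp add: complex_eq_iff Re_exp Im_exp)
  have i: "integrable M (\<lambda>\<omega>. \<phi> (U \<omega>))" "integrable M (\<lambda>\<omega>. \<phi> (V \<omega>))" "integrable M (\<lambda>\<omega>. \<phi> (U \<omega>) * \<psi> (V \<omega>))"
    if "\<phi> \<in> {sin, cos}" "\<psi> \<in> {sin, cos}" for \<phi> \<psi> :: "real \<Rightarrow> real"
  proof -
    have [measurable]: "\<phi> \<in> borel_measurable borel" "\<psi> \<in> borel_measurable borel" using that by auto
    have b: "\<bar>\<phi> x\<bar> \<le> 1" "\<bar>\<psi> x\<bar> \<le> 1" for x using that by auto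
    show "integrable M (\<lambda>\<omega>. \<phi> (U \<omega>))" "integrable M (\<lambda>\<omega>. \<phi> (V \<omega>))" "integrable M (\<lambda>\<omega>. \<phi> (U \<omega>) * \<psi> (V \<omega>))"
      by (rule integrable_const_bound[of _ 1]; auto simp: b abs_mult intro!: mult_le_one)+
  qed
  have le: "\<bar>expectation (\<lambda>\<omega>. \<phi> (U \<omega>) * \<psi> (V \<omega>)) - expectation (\<lambda>\<omega>. \<phi> (U \<omega>)) * expectation (\<lambda>\<omega>. \<psi> (V \<omega>))\<bar> \<le> ?a"
    if "\<phi> \<in> {sin, cos}" "\<psi> \<in> {sin, cos}" for \<phi> \<psi> :: "real \<Rightarrow> real"
  proof -
    have m: "\<phi> \<in> borel_measurable borel" "\<psi> \<in> borel_measurable borel" using that by auto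
    have b: "\<bar>\<phi> x\<bar> \<le> 1" "\<bar>\<psi> x\<bar> \<le> 1" for x using that by auto
    show ?thesis
      by (rule covariance_ae_determined[OF adm ae_determined_comp[OF U m(1)] b(1) ae_determined_comp[OF V m(2)] b(2)])
  qed
  define c :: "(real \<Rightarrow> real) \<Rightarrow> (real \<Rightarrow> real) \<Rightarrow> real" where "c = (\<lambda>\<phi> \<psi>. expectation (\<lambda>\<omega>. \<phi> (U \<omega>) * \<psi> (V \<omega>)) - expectation (\<lambda>\<omega>. \<phi> (U \<omega>)) * expectation (\<lambda>\<omega>. \<psi> (V \<omega>)))"
  have 1: "(\<integral>\<omega>. iexp (U \<omega>) \<partial>M) = complex_of_real (expectation (\<lambda>\<omega>. cos (U \<omega>))) + \<i> * complex_of_real (expectation (\<lambda>\<omega>. sin (U \<omega>)))"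
    "(\<integral>\<omega>. iexp (V \<omega>) \<partial>M) = complex_of_real (expectation (\<lambda>\<omega>. cos (V \<omega>))) + \<i> * complex_of_real (expectation (\<lambda>\<omega>. sin (V \<omega>)))"
    unfolding iexp_eq using i(1)[of sin sin] i(1)[of cos sin] i(2)[of sin sin] i(2)[of cos sin] by simp_all
  have "(\<integral>\<omega>. iexp (U \<omega>) * iexp (V \<omega>) \<partial>M) =
     (\<integral>\<omega>. complex_of_real (cos (U \<omega>) * cos (V \<omega>) - sin (U \<omega>) * sin (V \<omega>)) + \<i> * complex_of_real (sin (U \<omega>) * cos (V \<omega>) + cos (U \<omega>) * sin (V \<omega>)) \<partial>M)"
    unfolding iexp_eq by (rule Bochner_Integration.integral_cong) (auto simp: complex_eq_iff algebra_simps)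
  also have "\<dots> = complex_of_real (expectation (\<lambda>\<omega>. cos (U \<omega>) * cos (V \<omega>)) - expectation (\<lambda>\<omega>. sin (U \<omega>) * sin (V \<omega>)))
     + \<i> * complex_of_real (expectation (\<lambda>\<omega>. sin (U \<omega>) * cos (V \<omega>)) + expectation (\<lambda>\<omega>. cos (U \<omega>) * sin (V \<omega>)))"
  proof -
    have 2: "expectation (\<lambda>\<omega>. cos (U \<omega>) * cos (V \<omega>) - sin (U \<omega>) * sin (V \<omega>)) = expectation (\<lambda>\<omega>. cos (U \<omega>) * cos (V \<omega>)) - expectation (\<lambda>\<omega>. sin (U \<omega>) * sin (V \<omega>))"
      "expectation (\<lambda>\<omega>. sin (U \<omega>) * cos (V \<omega>) + cos (U \<omega>) * sin (V \<omega>)) = expectation (\<lambda>\<omega>. sin (U \<omega>) * cos (V \<omega>)) + expectation (\<lambda>\<omega>. cos (U \<omega>) * sin (V \<omega>))"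
      using i(3)[of sin sin] i(3)[of cos cos] i(3)[of sin cos] i(3)[of cos sin] by simp_all
    have "integrable M (\<lambda>\<omega>. complex_of_real (cos (U \<omega>) * cos (V \<omega>) - sin (U \<omega>) * sin (V \<omega>)))"
      "integrable M (\<lambda>\<omega>. \<i> * complex_of_real (sin (U \<omega>) * cos (V \<omega>) + cos (U \<omega>) * sin (V \<omega>)))"
      using i(3)[of sin sin] i(3)[of cos cos] i(3)[of sin cos] i(3)[of cos sin]
      by (intro integrable_of_real integrable_mult_right Bochner_Integration.integrable_diff Bochner_Integration.integrable_add; simp)+
    then show ?thesis unfolding 2[symmetric]
      by (subst Bochner_Integration.integral_add) (simp_all only: integral_mult_right_zero integral_complex_of_real)
  qed
  finally have "(\<integral>\<omega>. iexp (U \<omega>) * iexp (V \<omega>) \<partial>M) - (\<integral>\<omega>. iexp (U \<omega>) \<partial>M) * (\<integral>\<omega>. iexp (V \<omega>) \<partial>M)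
    = complex_of_real (c cos cos - c sin sin) + \<i> * complex_of_real (c sin cos + c cos sin)"
    unfolding 1 by (simp add: c_def complex_eq_iff algebra_simps)
  moreover have "cmod (complex_of_real x + \<i> * complex_of_real y) \<le> \<bar>x\<bar> + \<bar>y\<bar>" for x y
    by (rule order_trans[OF norm_triangle_ineq]) (simp add: norm_mult)
  ultimately have "cmod ((\<integral>\<omega>. iexp (U \<omega>) * iexp (V \<omega>) \<partial>M) - (\<integral>\<omega>. iexp (U \<omega>) \<partial>M) * (\<integral>\<omega>. iexp (V \<omega>) \<partial>M))
    \<le> \<bar>c cos cos - c sin sin\<bar> + \<bar>c sin cos + c cos sin\<bar>" by metis
  also have "\<dots> \<le> 16 * (C * r powr (- real \<nu>) * \<gamma> powr l)"
    using le[of cos cos] le[of sin sin] le[of sin cos] le[of cos sin] unfolding c_def by simp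
  finally show ?thesis .
qed

end

lemma mix_admissibleI:
  assumes "norm u = 1" "\<And>i. i \<in> I \<Longrightarrow> b \<le> u \<bullet> i" "\<And>j. j \<in> J \<Longrightarrow> u \<bullet> j \<le> a" "r < b - a"
    and "emeasure lebesgue (msum (I \<union> J) (cball 0 1)) \<le> ennreal \<gamma>"
  shows "mix_admissible \<gamma> r I J"
proof -
  have "ereal b \<le> Inf ((\<lambda>t. ereal (u \<bullet> t)) ` I)" using assms(2) by (intro INF_greatest) auto
  moreover have "Sup ((\<lambda>t. ereal (u \<bullet> t)) ` J) \<le> ereal a" using assms(3) by (intro SUP_least) auto
  ultimately have "ereal b - ereal a \<le> Inf ((\<lambda>t. ereal (u \<bullet> t)) ` I) - Sup ((\<lambda>t. ereal (u \<bullet> t)) ` J)"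
    by (rule ereal_minus_mono)
  moreover have "ereal r < ereal b - ereal a" using assms(4) by simp
  ultimately have "ereal r < Inf ((\<lambda>t. ereal (u \<bullet> t)) ` I) - Sup ((\<lambda>t. ereal (u \<bullet> t)) ` J)"
    by (rule less_le_trans[rotated])
  then show ?thesis unfolding mix_admissible_def using assms(1,5) by blast
qed

lemma kappa_pos: "kappa TYPE('d::euclidean_space) > 0"
  unfolding kappa_def by (rule content_cball_pos) simp

lemma emeasure_cball_kappa: "emeasure lborel (cball (x::'d::euclidean_space) 1) = ennreal (kappa TYPE('d))"
  by (simp add: kappa_def emeasure_cball content_cball)

text \<open>The bound depends on the number of points and not on their distances, so a single value
  of \<open>\<gamma>\<close> serves for all moments at up to four points.\<close>

lemma emeasure_msum_finite:
  fixes F :: "'d::euclidean_space set"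
  assumes F: "finite F" "card F \<le> k"
  shows "emeasure lebesgue (msum F (cball 0 1)) \<le> ennreal (real k * kappa TYPE('d))"
proof -
  have sub: "msum F (cball 0 1) \<subseteq> (\<Union>x\<in>F. cball x 1)"
    unfolding msum_def by (auto simp: dist_norm)
  have "emeasure lebesgue (msum F (cball 0 1)) \<le> emeasure lebesgue (\<Union>x\<in>F. cball x 1)"
    using F by (intro emeasure_mono sub) auto
  also have "\<dots> \<le> (\<Sum>x\<in>F. emeasure lebesgue (cball x 1))"
    using F by (intro emeasure_subadditive_finite) auto
  also have "\<dots> = (\<Sum>x\<in>F. ennreal (kappa TYPE('d)))"
    by (intro sum.cong refl) (simp add: emeasure_cball_kappa)
  also have "\<dots> = ennreal (real (card F) * kappa TYPE('d))"
    using kappa_pos[where 'd = 'd] by (subst sum_ennreal) auto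
  also have "\<dots> \<le> ennreal (real k * kappa TYPE('d))"
    using F kappa_pos[where 'd = 'd] by (intro ennreal_leI mult_right_mono) auto
  finally show ?thesis .
qed

context mixing_field
begin

lemma stationary_pair:
  fixes \<Psi> :: "real \<times> real \<Rightarrow> real"
  assumes [measurable]: "\<Psi> \<in> borel_measurable (borel \<Otimes>\<^sub>M borel)"
  shows "expectation (\<lambda>\<omega>. \<Psi> (X s \<omega>, X t \<omega>)) = expectation (\<lambda>\<omega>. \<Psi> (X 0 \<omega>, X (t - s) \<omega>))"
proof -
  define J where "J = {0, t - s}"
  let ?P = "PiM J (\<lambda>_. borel :: real measure)"
  define \<Phi> where "\<Phi> = (\<lambda>y :: 'd \<Rightarrow> real. \<Psi> (y 0, y (t - s)))"
  have [measurable]: "(\<lambda>y. y 0) \<in> borel_measurable ?P" "(\<lambda>y. y (t - s)) \<in> borel_measurable ?P"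
    by (auto intro!: measurable_component_singleton simp: J_def)
  have m\<Phi>: "\<Phi> \<in> borel_measurable ?P" unfolding \<Phi>_def by measurable
  have mX: "(\<lambda>\<omega>. \<lambda>j\<in>J. X (j + v) \<omega>) \<in> measurable M ?P" for v
    by (intro measurable_restrict) measurable
  have mX0: "(\<lambda>\<omega>. \<lambda>j\<in>J. X j \<omega>) \<in> measurable M ?P"
    by (intro measurable_restrict) measurable
  have "distr M ?P (\<lambda>\<omega>. \<lambda>j\<in>J. X (j + s) \<omega>) = distr M ?P (\<lambda>\<omega>. \<lambda>j\<in>J. X j \<omega>)"
    using stationary unfolding strictly_stationary_def J_def by simp
  then have "(\<integral>y. \<Phi> y \<partial>distr M ?P (\<lambda>\<omega>. \<lambda>j\<in>J. X (j + s) \<omega>)) = (\<integral>y. \<Phi> y \<partial>distr M ?P (\<lambda>\<omega>. \<lambda>j\<in>J. X j \<omega>))"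
    by simp
  then show ?thesis
    unfolding integral_distr[OF mX m\<Phi>] integral_distr[OF mX0 m\<Phi>] by (simp add: \<Phi>_def J_def)
qed

lemma stationary_single:
  fixes \<phi> :: "real \<Rightarrow> real"
  assumes [measurable]: "\<phi> \<in> borel_measurable borel"
  shows "expectation (\<lambda>\<omega>. \<phi> (X t \<omega>)) = expectation (\<lambda>\<omega>. \<phi> (X 0 \<omega>))"
  using stationary_pair[of "\<lambda>p. \<phi> (fst p)" t t] by simp

section \<open>Integrals of bounded functions of the field over a set\<close>

definition S :: "(real \<Rightarrow> real) \<Rightarrow> 'd set \<Rightarrow> 'a \<Rightarrow> real" where
  "S g A \<omega> = (LINT t:A|lborel. g (X t \<omega>))"

context
  fixes g :: "real \<Rightarrow> real" and B :: real and A :: "'d set"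
  assumes g[measurable]: "g \<in> borel_measurable borel" and gB: "\<And>x. \<bar>g x\<bar> \<le> B"
    and A[measurable]: "A \<in> sets borel" and Afin: "emeasure lborel A < \<infinity>"
begin

lemma S_integrable_pair:
  assumes V: "integrable M V"
  shows "integrable (lborel \<Otimes>\<^sub>M M) (\<lambda>(t, \<omega>). indicator A t * g (X t \<omega>) * V \<omega>)"
proof (rule integrableI_bounded)
  have [measurable]: "V \<in> borel_measurable M" using V by simp
  have B: "B \<ge> 0" using gB[of 0] by linarith
  have [measurable]: "(\<lambda>(t, \<omega>). X t \<omega>) \<in> borel_measurable (lborel \<Otimes>\<^sub>M M)"
    using field_measurable_pair by (simp add: case_prod_beta)
  show "(\<lambda>(t, \<omega>). indicator A t * g (X t \<omega>) * V \<omega>) \<in> borel_measurable (lborel \<Otimes>\<^sub>M M)"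
    by measurable
  have "(\<integral>\<^sup>+p. ennreal (norm (case p of (t, \<omega>) \<Rightarrow> indicator A t * g (X t \<omega>) * V \<omega>)) \<partial>(lborel \<Otimes>\<^sub>M M))
     \<le> (\<integral>\<^sup>+p. (case p of (t, \<omega>) \<Rightarrow> indicator A t * ennreal (B * norm (V \<omega>))) \<partial>(lborel \<Otimes>\<^sub>M M))"
  proof (intro nn_integral_mono, clarify)
    fix t \<omega>
    have "norm (g (X t \<omega>) * V \<omega>) \<le> B * norm (V \<omega>)"
      using gB[of "X t \<omega>"] by (simp add: abs_mult mult_right_mono)
    then show "ennreal (norm (indicator A t * g (X t \<omega>) * V \<omega>)) \<le> indicator A t * ennreal (B * norm (V \<omega>))"
      by (auto simp: indicator_def intro: ennreal_leI)
  qed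
  also have "\<dots> = (\<integral>\<^sup>+t. (\<integral>\<^sup>+\<omega>. indicator A t * ennreal (B * norm (V \<omega>)) \<partial>M) \<partial>lborel)"
    by (subst nn_integral_fst[symmetric]) (auto simp: case_prod_beta)
  also have "\<dots> = (\<integral>\<^sup>+t. indicator A t * (\<integral>\<^sup>+\<omega>. ennreal (B * norm (V \<omega>)) \<partial>M) \<partial>lborel)"
    by (subst nn_integral_cmult) auto
  also have "\<dots> = emeasure lborel A * (\<integral>\<^sup>+\<omega>. ennreal (B * norm (V \<omega>)) \<partial>M)"
    by (subst nn_integral_multc) auto
  also have "(\<integral>\<^sup>+\<omega>. ennreal (B * norm (V \<omega>)) \<partial>M) = ennreal B * (\<integral>\<^sup>+\<omega>. ennreal (norm (V \<omega>)) \<partial>M)"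
    using B by (subst nn_integral_cmult[symmetric]) (auto simp: ennreal_mult)
  also have "emeasure lborel A * \<dots> < \<infinity>"
    using V Afin by (simp add: integrable_iff_bounded ennreal_mult_less_top)
  finally show "(\<integral>\<^sup>+p. ennreal (norm (case p of (t, \<omega>) \<Rightarrow> indicator A t * g (X t \<omega>) * V \<omega>)) \<partial>(lborel \<Otimes>\<^sub>M M)) < \<infinity>" .
qed

lemma S_mult_eq: "S g A \<omega> * V \<omega> = (\<integral>t. indicator A t * g (X t \<omega>) * V \<omega> \<partial>lborel)"
  unfolding S_def set_lebesgue_integral_def by simp

lemma S_Fubini:
  assumes V: "integrable M V"
  shows "integrable M (\<lambda>\<omega>. S g A \<omega> * V \<omega>)"
    "expectation (\<lambda>\<omega>. S g A \<omega> * V \<omega>) = (\<integral>t. indicator A t * expectation (\<lambda>\<omega>. g (X t \<omega>) * V \<omega>) \<partial>lborel)"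
    "integrable lborel (\<lambda>t. indicator A t * expectation (\<lambda>\<omega>. g (X t \<omega>) * V \<omega>))"
proof -
  interpret P: pair_sigma_finite lborel M ..
  note i = S_integrable_pair[OF V]
  show "integrable M (\<lambda>\<omega>. S g A \<omega> * V \<omega>)"
    unfolding S_mult_eq using P.integrable_snd[OF i] .
  show "integrable lborel (\<lambda>t. indicator A t * expectation (\<lambda>\<omega>. g (X t \<omega>) * V \<omega>))"
    using P.integrable_fst[OF i] by (simp add: mult.assoc)
  show "expectation (\<lambda>\<omega>. S g A \<omega> * V \<omega>) = (\<integral>t. indicator A t * expectation (\<lambda>\<omega>. g (X t \<omega>) * V \<omega>) \<partial>lborel)"
    unfolding S_mult_eq P.Fubini_integral[OF i] by (simp add: mult.assoc)
qed

lemma S_measurable: "S g A \<in> borel_measurable M"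
  using S_Fubini(1)[of "\<lambda>_. 1"] by simp

lemma path_integrable: "\<omega> \<in> space M \<Longrightarrow> integrable lborel (\<lambda>t. indicator A t * g (X t \<omega>))"
proof (rule Bochner_Integration.integrable_bound)
  show "integrable lborel (\<lambda>t. indicator A t * B)" using Afin A by simp
  assume "\<omega> \<in> space M"
  note [measurable] = field_measurable_path[OF this]
  show "(\<lambda>t. indicator A t * g (X t \<omega>)) \<in> borel_measurable lborel" by measurable
  show "AE t in lborel. norm (indicator A t * g (X t \<omega>)) \<le> norm (indicator A t * B)"
    using gB by (intro AE_I2) (auto simp: indicator_def intro: order_trans[OF _ abs_ge_self])
qed

lemma abs_S_le:
  assumes \<omega>: "\<omega> \<in> space M"
  shows "\<bar>S g A \<omega>\<bar> \<le> B * measure lborel A"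
proof -
  have "\<bar>S g A \<omega>\<bar> \<le> (\<integral>t. \<bar>indicator A t * g (X t \<omega>)\<bar> \<partial>lborel)"
    unfolding S_def set_lebesgue_integral_def using integral_abs_bound[of lborel "\<lambda>t. indicator A t * g (X t \<omega>)"] by simp
  also have "\<dots> \<le> (\<integral>t. indicator A t * B \<partial>lborel)"
  proof (rule integral_mono)
    show "integrable lborel (\<lambda>t. indicator A t * B)" using Afin A by simp
    show "integrable lborel (\<lambda>t. \<bar>indicator A t * g (X t \<omega>)\<bar>)" using path_integrable[OF \<omega>] by simp
    show "\<bar>indicator A t * g (X t \<omega>)\<bar> \<le> indicator A t * B" for t
      using gB[of "X t \<omega>"] by (simp add: indicator_def)
  qed
  also have "\<dots> = B * measure lborel A" by (simp add: mult.commute)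
  finally show ?thesis .
qed

lemma S_integrable: "integrable M (S g A)"
  by (rule integrable_const_bound[of _ "B * measure lborel A"]) (auto simp: abs_S_le S_measurable)

text \<open>The integral over \<open>A\<close> need not be measurable for the \<open>\<sigma>\<close>-algebra generated by the field
  on \<open>A\<close>, but it agrees almost surely with its conditional expectation.\<close>
lemma ae_determined_S:
  assumes I: "A \<subseteq> I"
  shows "ae_determined I (S g A)"
proof -
  let ?F = "past I"
  interpret finite_measure_subalgebra M ?F by unfold_locales (rule subalgebra_past)
  interpret sigma_finite_subalgebra M ?F
    by (rule finite_measure_subalgebra_is_sigma_finite) unfold_locales
  note [measurable] = S_measurable
  define W where "W = real_cond_exp M ?F (S g A)"
  have iW: "integrable M W" unfolding W_def using S_integrable by (rule real_cond_exp_int)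
  have [measurable]: "W \<in> borel_measurable M" using iW by simp
  \<comment> \<open>\<open>V\<close> is the sign of \<open>S g A - W\<close>, so the mean distance
    of the two is a difference of expectations against \<open>V\<close>. These agree: under the
    integral over \<open>A\<close> each \<open>g (X t)\<close> is measurable for
    \<open>past I\<close>, so \<open>V\<close> may be exchanged for its conditional expectation
    \<open>V'\<close>, then \<open>S g A\<close> for \<open>W\<close>, and finally \<open>V'\<close>
    for \<open>V\<close> again.\<close>
  define V where "V = (\<lambda>\<omega>. if S g A \<omega> - W \<omega> \<ge> 0 then 1 else - 1 :: real)"
  have [measurable]: "V \<in> borel_measurable M" unfolding V_def by measurable
  have Vb: "\<bar>V \<omega>\<bar> \<le> 1" for \<omega> by (simp add: V_def)
  have iV: "integrable M V" by (rule integrable_const_bound[of _ 1]) (auto simp: Vb)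
  define V' where "V' = real_cond_exp M ?F V"
  have iV': "integrable M V'" unfolding V'_def using iV by (rule real_cond_exp_int)
  have V'F: "V' \<in> borel_measurable ?F" by (simp add: V'_def)
  have bi: "integrable M (\<lambda>\<omega>. f \<omega> * v \<omega>)" if "integrable M v" "f \<in> borel_measurable M" "\<And>\<omega>. \<omega> \<in> space M \<Longrightarrow> \<bar>f \<omega>\<bar> \<le> K" for f v :: "'a \<Rightarrow> real" and K
  proof (rule Bochner_Integration.integrable_bound[of _ "\<lambda>\<omega>. K * v \<omega>"])
    show "integrable M (\<lambda>\<omega>. K * v \<omega>)" using that(1) by simp
    show "(\<lambda>\<omega>. f \<omega> * v \<omega>) \<in> borel_measurable M" using that by simp
    show "AE \<omega> in M. norm (f \<omega> * v \<omega>) \<le> norm (K * v \<omega>)"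
    proof (intro AE_I2)
      fix \<omega> assume "\<omega> \<in> space M"
      then have "\<bar>f \<omega>\<bar> \<le> \<bar>K\<bar>" using that(3)[of \<omega>] by linarith
      then show "norm (f \<omega> * v \<omega>) \<le> norm (K * v \<omega>)" by (simp add: abs_mult mult_right_mono)
    qed
  qed
  have "expectation (\<lambda>\<omega>. S g A \<omega> * V \<omega>) = (\<integral>t. indicator A t * expectation (\<lambda>\<omega>. g (X t \<omega>) * V \<omega>) \<partial>lborel)"
    by (rule S_Fubini(2)[OF iV])
  also have "\<dots> = (\<integral>t. indicator A t * expectation (\<lambda>\<omega>. g (X t \<omega>) * V' \<omega>) \<partial>lborel)"
  proof (rule Bochner_Integration.integral_cong[OF refl])
    fix t
    show "indicator A t * expectation (\<lambda>\<omega>. g (X t \<omega>) * V \<omega>) = indicator A t * expectation (\<lambda>\<omega>. g (X t \<omega>) * V' \<omega>)"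
    proof (cases "t \<in> A")
      case True
      have "(\<lambda>\<omega>. g (X t \<omega>)) \<in> borel_measurable ?F"
        using measurable_compose[OF measurable_past g] True I by auto
      moreover have "integrable M (\<lambda>\<omega>. g (X t \<omega>) * V \<omega>)"
        by (rule bi[OF iV _ gB]) measurable
      ultimately show ?thesis
        unfolding V'_def by (subst real_cond_exp_intg(2)) (auto simp: iV)
    qed simp
  qed
  also have "\<dots> = expectation (\<lambda>\<omega>. S g A \<omega> * V' \<omega>)"
    by (rule S_Fubini(2)[OF iV', symmetric])
  also have "\<dots> = expectation (\<lambda>\<omega>. V' \<omega> * S g A \<omega>)" by (simp add: mult.commute)
  also have "\<dots> = expectation (\<lambda>\<omega>. V' \<omega> * W \<omega>)"
    unfolding W_def using bi[OF iV' S_measurable abs_S_le]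
    by (intro real_cond_exp_intg(2)[symmetric] V'F S_measurable) (simp add: mult.commute)
  also have "\<dots> = expectation (\<lambda>\<omega>. W \<omega> * V' \<omega>)" by (simp add: mult.commute)
  also have "\<dots> = expectation (\<lambda>\<omega>. W \<omega> * V \<omega>)"
    unfolding V'_def using bi[OF iW, of V 1] Vb
    by (intro real_cond_exp_intg(2)) (auto simp: W_def mult.commute)
  finally have eq: "expectation (\<lambda>\<omega>. S g A \<omega> * V \<omega>) = expectation (\<lambda>\<omega>. W \<omega> * V \<omega>)" .
  have i1: "integrable M (\<lambda>\<omega>. S g A \<omega> * V \<omega>)" by (rule S_Fubini(1)[OF iV])
  have i2: "integrable M (\<lambda>\<omega>. W \<omega> * V \<omega>)" using bi[OF iW, of V 1] Vb by (simp add: mult.commute)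
  have "expectation (\<lambda>\<omega>. \<bar>S g A \<omega> - W \<omega>\<bar>) = expectation (\<lambda>\<omega>. S g A \<omega> * V \<omega> - W \<omega> * V \<omega>)"
    by (rule Bochner_Integration.integral_cong) (auto simp: V_def algebra_simps)
  also have "\<dots> = 0" using i1 i2 eq by simp
  finally have "AE \<omega> in M. \<bar>S g A \<omega> - W \<omega>\<bar> = 0"
    using S_integrable iW by (subst integral_nonneg_eq_0_iff_AE[symmetric]) auto
  then have "AE \<omega> in M. S g A \<omega> = W \<omega>" by eventually_elim simp
  moreover have "W \<in> borel_measurable ?F" by (simp add: W_def)
  ultimately show ?thesis unfolding ae_determined_def by (auto simp: S_measurable)
qed

end

text \<open>The summand \<open>2 ^ \<nu>\<close> makes \<open>decay\<close> at least 4 at distances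
  up to 1, where trivial bounds are used. The other one absorbs the mixing bound for up to four
  points, whose unit balls fill at most \<open>4 * kappa TYPE('d)\<close>, at separation
  \<open>\<rho> / (4 * real DIM('d))\<close>; the 8 comes from
  \<open>1 + \<rho> \<le> 2 * \<rho>\<close> for \<open>\<rho> \<ge> 1\<close>.\<close>

definition decay_const :: real where
  "decay_const = 4 * (2 ^ \<nu> + C * (4 * kappa TYPE('d)) powr l * (8 * real DIM('d)) ^ \<nu>)"

definition decay :: "real \<Rightarrow> real" where
  "decay \<rho> = decay_const * (1 + \<rho>) powr (- real \<nu>)"

text \<open>The exponent is a third of that of \<open>decay\<close>: this much is left after a
  geometric mean with two probabilities, and three such factors recover one
  \<open>decay\<close>.\<close>

definition h :: "'d \<Rightarrow> real" where
  "h x = decay_const * (1 + norm x) powr (- (real \<nu> / 3))"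

lemma decay_const_ge: "decay_const \<ge> 4 * 2 ^ \<nu>"
  unfolding decay_const_def using C_pos by simp

lemma decay_const_ge_1: "decay_const \<ge> 1"
  using decay_const_ge one_le_power[of "2::real" \<nu>] by linarith

lemma decay_ge_4:
  assumes "0 \<le> \<rho>" "\<rho> \<le> 1"
  shows "decay \<rho> \<ge> 4"
proof -
  have "2 powr (- real \<nu>) \<le> (1 + \<rho>) powr (- real \<nu>)" using assms by (intro powr_mono2') auto
  then have "4 * 2 ^ \<nu> * 2 powr (- real \<nu>) \<le> decay_const * (1 + \<rho>) powr (- real \<nu>)"
    using decay_const_ge decay_const_ge_1 by (intro mult_mono) auto
  moreover have "2 ^ \<nu> * 2 powr (- real \<nu>) = (1::real)"
    by (simp add: powr_minus powr_realpow)
  ultimately show ?thesis unfolding decay_def by simp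
qed

lemma decay_mixing:
  assumes \<rho>: "\<rho> \<ge> 1" and r: "\<rho> / (4 * real DIM('d)) \<le> r"
  shows "4 * (C * r powr (- real \<nu>) * (4 * kappa TYPE('d)) powr l) \<le> decay \<rho>"
proof -
  let ?d = "real DIM('d)"
  have d: "?d > 0" by simp
  have "(1 + \<rho>) / (8 * ?d) \<le> \<rho> / (4 * ?d)" using \<rho> d by (simp add: field_simps)
  then have "r powr (- real \<nu>) \<le> ((1 + \<rho>) / (8 * ?d)) powr (- real \<nu>)"
    using r \<rho> by (intro powr_mono2') auto
  also have "\<dots> = (1 + \<rho>) powr (- real \<nu>) * (8 * ?d) ^ \<nu>"
  proof -
    have "(8 * ?d) powr (- real \<nu>) = 1 / (8 * ?d) ^ \<nu>"
      using d powr_realpow[of "8 * ?d" \<nu>] by (simp only: powr_minus_divide)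
    moreover have "((1 + \<rho>) / (8 * ?d)) powr (- real \<nu>) = (1 + \<rho>) powr (- real \<nu>) / (8 * ?d) powr (- real \<nu>)"
      by (rule powr_divide)
    ultimately show ?thesis by (simp only: divide_divide_eq_right div_by_1)
  qed
  finally have "C * (4 * kappa TYPE('d)) powr l * r powr (- real \<nu>)
     \<le> C * (4 * kappa TYPE('d)) powr l * ((1 + \<rho>) powr (- real \<nu>) * (8 * ?d) ^ \<nu>)"
    using C_pos by (intro mult_left_mono) auto
  moreover have "4 * (C * (4 * kappa TYPE('d)) powr l * (8 * ?d) ^ \<nu>) \<le> decay_const"
    unfolding decay_const_def by simp
  then have "4 * (C * (4 * kappa TYPE('d)) powr l * (8 * ?d) ^ \<nu>) * (1 + \<rho>) powr (- real \<nu>) \<le> decay \<rho>"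
    unfolding decay_def by (rule mult_right_mono) simp
  ultimately show ?thesis by (simp add: mult_ac)
qed

lemma h_pos: "h x > 0"
proof -
  have "1 + norm x > 0" using norm_ge_zero[of x] by linarith
  then show ?thesis unfolding h_def using decay_const_ge_1 by simp
qed

lemma h_uminus: "h (- x) = h x" and h_commute: "h (x - y) = h (y - x)"
  by (simp_all add: h_def norm_minus_commute)

lemma borel_measurable_h [measurable]: "h \<in> borel_measurable borel"
  unfolding h_def by measurable

lemma decay_le_h: "\<rho> \<ge> norm x \<Longrightarrow> decay \<rho> \<le> h x"
proof -
  assume \<rho>: "\<rho> \<ge> norm x"
  have p: "1 + norm x \<ge> 1" by simp
  have "(1 + \<rho>) powr (- real \<nu>) \<le> (1 + norm x) powr (- real \<nu>)"
    using \<rho> p by (intro powr_mono2') (simp_all add: add_pos_nonneg)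
  also have "\<dots> \<le> (1 + norm x) powr (- (real \<nu> / 3))"
    using p by (intro powr_mono) auto
  finally show ?thesis unfolding decay_def h_def using decay_const_ge_1 by (intro mult_left_mono) auto
qed

definition HH :: real where "HH = (\<integral>x. h x \<partial>lborel)"

lemma h_nn_integral_finite: "(\<integral>\<^sup>+x. ennreal (h x) \<partial>lborel) < \<infinity>"
proof -
  have "(\<integral>\<^sup>+x. ennreal (h x) \<partial>lborel) = ennreal decay_const * (\<integral>\<^sup>+x. ennreal ((1 + norm (x::'d)) powr (- (real \<nu> / 3))) \<partial>lborel)"
    unfolding h_def using decay_const_ge_1 by (subst nn_integral_cmult[symmetric]) (auto simp: ennreal_mult)
  also have "\<dots> < \<infinity>"
    using nn_integral_norm_powr_finite[where 'd = 'd, of "real \<nu> / 3"] nu_gt_3d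
    by (simp add: ennreal_mult_less_top)
  finally show ?thesis .
qed

lemma h_integrable: "integrable lborel h"
  using h_nn_integral_finite h_pos by (intro integrableI_nonneg) (auto intro: less_imp_le)

lemma h_nn_integral: "(\<integral>\<^sup>+x. ennreal (h x) \<partial>lborel) = ennreal HH"
  unfolding HH_def using h_integrable h_pos by (intro nn_integral_eq_integral) (auto intro: less_imp_le)

lemma HH_nonneg: "HH \<ge> 0"
  unfolding HH_def using h_pos by (intro Bochner_Integration.integral_nonneg) (auto intro: less_imp_le)

lemma h_nn_integral_shift: "(\<integral>\<^sup>+x. ennreal (h (x - y)) \<partial>lborel) = ennreal HH"
  "(\<integral>\<^sup>+x. ennreal (h (y - x)) \<partial>lborel) = ennreal HH"
proof -
  have "(\<integral>\<^sup>+x. ennreal (h x) \<partial>lborel) = (\<integral>\<^sup>+x. ennreal (h x) \<partial>distr lborel borel ((+) (- y)))"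
    by (simp add: lborel_distr_plus)
  also have "\<dots> = (\<integral>\<^sup>+x. ennreal (h (x - y)) \<partial>lborel)"
    by (subst nn_integral_distr) auto
  finally show "(\<integral>\<^sup>+x. ennreal (h (x - y)) \<partial>lborel) = ennreal HH" by (simp add: h_nn_integral)
  then show "(\<integral>\<^sup>+x. ennreal (h (y - x)) \<partial>lborel) = ennreal HH" by (simp add: h_commute[of y])
qed

lemma mix_admissible_two:
  fixes s t :: 'd
  assumes "s \<noteq> t" "r < norm (s - t)"
  shows "mix_admissible (4 * kappa TYPE('d)) r {s} {t}"
proof (rule mix_admissibleI)
  let ?u = "(s - t) /\<^sub>R norm (s - t)"
  show "norm ?u = 1" using assms by simp
  have "?u \<bullet> s - ?u \<bullet> t = norm (s - t)"
  proof -
    have "?u \<bullet> s - ?u \<bullet> t = ?u \<bullet> (s - t)" by (simp only: inner_diff_right)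
    also have "\<dots> = norm (s - t)" using assms by (simp add: dot_square_norm power2_eq_square)
    finally show ?thesis .
  qed
  then show "r < ?u \<bullet> s - ?u \<bullet> t" using assms by simp
  show "emeasure lebesgue (msum ({s} \<union> {t}) (cball 0 1)) \<le> ennreal (4 * kappa TYPE('d))"
    using emeasure_msum_finite[of "{s} \<union> {t}" 4] assms by simp
qed auto

lemma kappa_4: "2 * kappa TYPE('d) \<le> 4 * kappa TYPE('d)" using kappa_pos[where 'd = 'd] by simp

lemma ae_determined_field:
  assumes [measurable]: "\<phi> \<in> borel_measurable borel" and "t \<in> I"
  shows "ae_determined I (\<lambda>\<omega>. \<phi> (X t \<omega>))"
  unfolding ae_determined_def using measurable_compose[OF measurable_past[OF assms(2)] assms(1)]
  by (auto intro!: bexI[of _ "\<lambda>\<omega>. \<phi> (X t \<omega>)"])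

lemma covariance_two_points:
  fixes \<phi> \<psi> :: "real \<Rightarrow> real"
  assumes m[measurable]: "\<phi> \<in> borel_measurable borel" "\<psi> \<in> borel_measurable borel"
    and b: "\<And>x. \<bar>\<phi> x\<bar> \<le> 1" "\<And>x. \<bar>\<psi> x\<bar> \<le> 1"
  shows "\<bar>expectation (\<lambda>\<omega>. \<phi> (X s \<omega>) * \<psi> (X t \<omega>)) - expectation (\<lambda>\<omega>. \<phi> (X s \<omega>)) * expectation (\<lambda>\<omega>. \<psi> (X t \<omega>))\<bar>
    \<le> decay (norm (s - t))"
proof (cases "norm (s - t) \<ge> 1")
  case True
  \<comment> \<open>This separation is smaller than the available distance; it is taken so that the
    constant tuned to four points serves for two as well.\<close>
  let ?r = "norm (s - t) / (4 * real DIM('d))"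
  have ne: "s \<noteq> t" using True by auto
  have "(1::real) < 4 * real DIM('d)" using DIM_positive[where 'a = 'd] by linarith
  then have "?r < norm (s - t) / 1" using True by (intro divide_strict_left_mono) auto
  then have adm: "mix_admissible (4 * kappa TYPE('d)) ?r {s} {t}" by (intro mix_admissible_two ne) simp
  have "?r > 0" using True by (auto intro!: divide_pos_pos)
  from covariance_ae_determined[OF adm kappa_4 this ae_determined_field[OF m(1) singletonI] b(1) ae_determined_field[OF m(2) singletonI] b(2)]
    decay_mixing[OF True order_refl]
  show ?thesis by (rule order_trans)
next
  case False
  have le: "\<bar>expectation f\<bar> \<le> 1" if "\<And>\<omega>. \<bar>f \<omega>\<bar> \<le> 1" "f \<in> borel_measurable M" for f :: "'a \<Rightarrow> real"
  proof -
    have "\<bar>expectation f\<bar> \<le> expectation (\<lambda>\<omega>. \<bar>f \<omega>\<bar>)" by (rule integral_abs_bound)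
    also have "\<dots> \<le> expectation (\<lambda>\<omega>. 1)"
      using that by (intro integral_mono integrable_const_bound[of _ 1]) auto
    finally show ?thesis by (simp add: prob_space)
  qed
  have "\<bar>expectation (\<lambda>\<omega>. \<phi> (X s \<omega>)) * expectation (\<lambda>\<omega>. \<psi> (X t \<omega>))\<bar> \<le> 1"
    unfolding abs_mult by (intro mult_le_one le) (auto simp: b)
  moreover have "\<bar>expectation (\<lambda>\<omega>. \<phi> (X s \<omega>) * \<psi> (X t \<omega>))\<bar> \<le> 1"
    by (intro le) (auto simp: b abs_mult intro!: mult_le_one)
  moreover have "decay (norm (s - t)) \<ge> 4" using False by (intro decay_ge_4) auto
  ultimately show ?thesis by linarith
qed

text \<open>The covariance is bounded by each of the two probabilities and by the mixing rate at
  distance \<open>norm t\<close>. A nonnegative number below three bounds is below the product of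
  their cube roots.\<close>

lemma covariance_indicators:
  assumes [measurable]: "A \<in> sets borel" "B \<in> sets borel"
  defines "p \<equiv> \<lambda>D. measure M {\<omega> \<in> space M. X 0 \<omega> \<in> D}"
  shows "\<bar>expectation (\<lambda>\<omega>. indicator A (X 0 \<omega>) * indicator B (X t \<omega>))
      - expectation (\<lambda>\<omega>. indicator A (X 0 \<omega>)) * expectation (\<lambda>\<omega>. indicator B (X 0 \<omega>))\<bar>
    \<le> h t * p A powr (1/3) * p B powr (1/3)"
proof -
  define c where "c = \<bar>expectation (\<lambda>\<omega>. indicator A (X 0 \<omega>) * indicator B (X t \<omega>))
      - expectation (\<lambda>\<omega>. indicator A (X 0 \<omega>)) * expectation (\<lambda>\<omega>. indicator B (X 0 \<omega>) :: real)\<bar>"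
  have pE: "expectation (\<lambda>\<omega>. indicator D (X 0 \<omega>)) = p D" if [measurable]: "D \<in> sets borel" for D
  proof -
    have "p D = (\<integral>\<omega>. indicator {\<omega> \<in> space M. X 0 \<omega> \<in> D} \<omega> \<partial>M)"
      by (simp add: p_def Int_def conj_commute)
    also have "\<dots> = (\<integral>\<omega>. indicator D (X 0 \<omega>) \<partial>M)"
      by (rule Bochner_Integration.integral_cong) (auto simp: indicator_def)
    finally show ?thesis by simp
  qed
  have pE': "expectation (\<lambda>\<omega>. indicator B (X t \<omega>)) = p B"
    using stationary_single[of "indicator B" t] pE[of B] by simp
  have p01: "0 \<le> p D" "p D \<le> 1" for D by (auto simp: p_def)
  have i: "integrable M (\<lambda>\<omega>. indicator A (X 0 \<omega>) :: real)" "integrable M (\<lambda>\<omega>. indicator B (X t \<omega>) :: real)"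
     "integrable M (\<lambda>\<omega>. indicator A (X 0 \<omega>) * indicator B (X t \<omega>) :: real)"
    by (rule integrable_const_bound[of _ 1]; auto simp: indicator_def)+
  have "0 \<le> expectation (\<lambda>\<omega>. indicator A (X 0 \<omega>) * indicator B (X t \<omega>) :: real)"
    by (rule Bochner_Integration.integral_nonneg) (auto simp: indicator_def)
  moreover have "expectation (\<lambda>\<omega>. indicator A (X 0 \<omega>) * indicator B (X t \<omega>)) \<le> expectation (\<lambda>\<omega>. indicator A (X 0 \<omega>) :: real)"
    using i by (intro integral_mono) (auto simp: indicator_def)
  moreover have "expectation (\<lambda>\<omega>. indicator A (X 0 \<omega>) * indicator B (X t \<omega>)) \<le> expectation (\<lambda>\<omega>. indicator B (X t \<omega>) :: real)"
    using i by (intro integral_mono) (auto simp: indicator_def)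
  moreover have "0 \<le> p A * p B" "p A * p B \<le> p A" "p A * p B \<le> p B"
    using p01 by (auto intro: mult_left_le mult_left_le_one_le)
  ultimately have c: "c \<le> p A" "c \<le> p B" unfolding c_def pE' pE[OF assms(1)] pE[OF assms(2)] by linarith+
  have "c \<le> decay (norm (0 - t))"
    using covariance_two_points[of "indicator A" "indicator B" 0 t] unfolding c_def
    by (auto simp: pE' pE)
  then have c3: "c \<le> decay_const * (1 + norm t) powr (- real \<nu>)" by (simp add: decay_def)
  have c0: "c \<ge> 0" by (simp add: c_def)
  have "c powr (1/3) \<le> (decay_const * (1 + norm t) powr (- real \<nu>)) powr (1/3)"
    using c0 c3 by (intro powr_mono2) auto
  also have "\<dots> = decay_const powr (1/3) * (1 + norm t) powr (- (real \<nu> / 3))"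
    using decay_const_ge_1 by (simp add: powr_mult powr_powr)
  also have "\<dots> \<le> h t"
    unfolding h_def using decay_const_ge_1 powr_mono[of "1/3" 1 decay_const]
    by (intro mult_right_mono) auto
  finally have 1: "c powr (1/3) \<le> h t" .
  have 2: "c powr (1/3) \<le> p A powr (1/3)" "c powr (1/3) \<le> p B powr (1/3)"
    using c c0 by (auto intro!: powr_mono2)
  have "c = c powr (1/3) * c powr (1/3) * c powr (1/3)"
    using c0 by (simp add: powr_add[symmetric])
  also have "\<dots> \<le> h t * p A powr (1/3) * p B powr (1/3)"
    using 1 2 h_pos[of t] by (intro mult_mono) auto
  finally show ?thesis unfolding c_def .
qed

end

section \<open>Moment bounds for integrals of the field\<close>

text \<open>If each third of the range had a point in its interior, these three points and the two
  extremes would be five distinct indices below 4. A free third is the gap.\<close>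

lemma four_reals_gap:
  fixes y :: "nat \<Rightarrow> real"
  assumes i: "i0 < 4" "i1 < 4" and D: "y i1 - y i0 = D" "D > 0"
    and mm: "\<And>j. j < 4 \<Longrightarrow> y i0 \<le> y j \<and> y j \<le> y i1"
  shows "\<exists>c. (\<forall>j<4. y j \<le> c \<or> c + D/3 \<le> y j) \<and> y i0 \<le> c \<and> c + D/3 \<le> y i1"
proof (rule ccontr)
  assume neg: "\<not> ?thesis"
  have "\<exists>j<4. y i0 + real k * (D/3) < y j \<and> y j < y i0 + real k * (D/3) + D/3" if k: "k < 3" for k :: nat
  proof (rule ccontr)
    assume "\<not> ?thesis"
    then have "\<forall>j<4. y j \<le> y i0 + real k * (D/3) \<or> y i0 + real k * (D/3) + D/3 \<le> y j"
      by (meson not_le)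
    moreover have "real k * (D/3) \<le> 2 * (D/3)" using k D by (intro mult_right_mono) auto
    then have "y i0 + real k * (D/3) + D/3 \<le> y i1" using D by linarith
    moreover have "y i0 \<le> y i0 + real k * (D/3)" using D by simp
    ultimately show False using neg by blast
  qed
  from this[of 0] this[of 1] this[of 2] obtain j0 j1 j2 where j: "j0 < 4" "j1 < 4" "j2 < 4"
    and y0: "y i0 < y j0" "y j0 < y i0 + D/3" and y1: "y i0 + D/3 < y j1" "y j1 < y i0 + 2 * (D/3)"
    and y2: "y i0 + 2 * (D/3) < y j2" "y j2 < y i0 + D"
    using D by auto
  have "distinct [i0, j0, j1, j2, i1]" using y0 y1 y2 D by auto
  then have "card (set [i0, j0, j1, j2, i1]) = 5" by (subst distinct_card) auto
  moreover have "card (set [i0, j0, j1, j2, i1]) \<le> card {..<4::nat}"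
    using i j by (intro card_mono) auto
  ultimately show False by simp
qed

locale centered_field = mixing_field M X \<nu> C l
  for M :: "'a measure" and X :: "'d::euclidean_space \<Rightarrow> 'a \<Rightarrow> real" and \<nu> C l +
  fixes g :: "real \<Rightarrow> real"
  assumes g_measurable [measurable]: "g \<in> borel_measurable borel" and g_le_1: "\<And>x. \<bar>g x\<bar> \<le> 1"
    and g_centered: "expectation (\<lambda>\<omega>. g (X 0 \<omega>)) = 0"
begin

lemma field_centered: "expectation (\<lambda>\<omega>. g (X t \<omega>)) = 0"
  using stationary_single[OF g_measurable, of t] g_centered by simp

lemma two_points: "\<bar>expectation (\<lambda>\<omega>. g (X s \<omega>) * g (X t \<omega>))\<bar> \<le> h (s - t)"
  using covariance_two_points[OF g_measurable g_measurable g_le_1 g_le_1, of s t] decay_le_h[of "s - t" "norm (s - t)"]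
  by (simp add: field_centered)

lemma abs_expectation_le_1:
  fixes f :: "'a \<Rightarrow> real"
  assumes "f \<in> borel_measurable M" "\<And>\<omega>. \<omega> \<in> space M \<Longrightarrow> \<bar>f \<omega>\<bar> \<le> 1"
  shows "\<bar>expectation f\<bar> \<le> 1"
proof -
  have "\<bar>expectation f\<bar> \<le> expectation (\<lambda>\<omega>. \<bar>f \<omega>\<bar>)" by (rule integral_abs_bound)
  also have "\<dots> \<le> expectation (\<lambda>\<omega>. 1)"
    using assms by (intro integral_mono integrable_const_bound[of _ 1]) auto
  finally show ?thesis by (simp add: prob_space)
qed

lemma abs_prod_field_le_1: "\<bar>\<Prod>i\<in>T. g (X (x i) \<omega>)\<bar> \<le> 1"
  unfolding abs_prod by (rule prod_le_1) (auto simp: g_le_1)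

text \<open>\<open>\<rho>\<close> is the dimension times the largest coordinate spread
  \<open>D\<close> and so dominates all mutual distances. Along the axis that realises
  \<open>D\<close> the four points leave a gap \<open>D/3\<close>, larger than \<open>D/4\<close>,
  which is the separation \<open>\<rho> / (4 * real DIM('d))\<close> that \<open>decay\<close> is
  tuned to. For \<open>\<rho> \<le> 1\<close> the trivial bound suffices.\<close>

lemma four_points_split:
  fixes x :: "nat \<Rightarrow> 'd"
  obtains (small) \<rho> where "0 \<le> \<rho>" "\<And>i j. i < 4 \<Longrightarrow> j < 4 \<Longrightarrow> norm (x i - x j) \<le> \<rho>"
    "\<bar>expectation (\<lambda>\<omega>. \<Prod>i<4. g (X (x i) \<omega>))\<bar> \<le> decay \<rho>"
  | (split) \<rho> L H where "0 \<le> \<rho>" "\<And>i j. i < 4 \<Longrightarrow> j < 4 \<Longrightarrow> norm (x i - x j) \<le> \<rho>"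
    "L \<union> H = {..<4}" "L \<inter> H = {}" "L \<noteq> {}" "H \<noteq> {}"
    "\<bar>expectation (\<lambda>\<omega>. \<Prod>i<4. g (X (x i) \<omega>))
       - expectation (\<lambda>\<omega>. \<Prod>i\<in>L. g (X (x i) \<omega>)) * expectation (\<lambda>\<omega>. \<Prod>i\<in>H. g (X (x i) \<omega>))\<bar> \<le> decay \<rho>"
proof -
  let ?d = "real DIM('d)"
  define V where "V = (\<lambda>(b, i, j). (x i - x j) \<bullet> b) ` (Basis \<times> {..<4::nat} \<times> {..<4::nat})"
  define D where "D = Max V"
  obtain b where b: "b \<in> (Basis :: 'd set)" using nonempty_Basis by blast
  have "(b, 0, 0) \<in> Basis \<times> {..<4::nat} \<times> {..<4::nat}" using b by simp
  then have V: "finite V" "V \<noteq> {}" unfolding V_def by (simp, blast)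
  have le: "(x i - x j) \<bullet> b \<le> D" if "i < 4" "j < 4" "b \<in> Basis" for i j b
    unfolding D_def using V(1) that by (intro Max_ge) (force simp: V_def)+
  have D0: "D \<ge> 0" using le[of 0 0 b] b by simp
  have abs: "\<bar>(x i - x j) \<bullet> b\<bar> \<le> D" if "i < 4" "j < 4" "b \<in> Basis" for i j b
    using le[OF that] le[of j i b] that by (simp add: inner_diff_left abs_le_iff)
  define \<rho> where "\<rho> = ?d * D"
  have \<rho>: "norm (x i - x j) \<le> \<rho>" if "i < 4" "j < 4" for i j
  proof -
    have "norm (x i - x j) \<le> (\<Sum>b\<in>Basis. \<bar>(x i - x j) \<bullet> b\<bar>)" by (rule norm_le_l1)
    also have "\<dots> \<le> (\<Sum>b\<in>(Basis::'d set). D)" using abs that by (intro sum_mono) auto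
    finally show ?thesis by (simp add: \<rho>_def)
  qed
  have \<rho>0: "0 \<le> \<rho>" using D0 by (simp add: \<rho>_def)
  have meas: "(\<lambda>\<omega>. \<Prod>i\<in>T. g (X (x i) \<omega>)) \<in> borel_measurable M" for T by measurable
  show thesis
  proof (cases "\<rho> \<le> 1")
    case True
    have "\<bar>expectation (\<lambda>\<omega>. \<Prod>i<4. g (X (x i) \<omega>))\<bar> \<le> 1"
      by (intro abs_expectation_le_1 meas abs_prod_field_le_1)
    with decay_ge_4[OF \<rho>0 True] show thesis using \<rho> \<rho>0 by (intro small[of \<rho>]) auto
  next
    case False
    then have Dpos: "D > 0" using D0 by (cases "D = 0") (auto simp: \<rho>_def)
    have "D \<in> V" unfolding D_def using V by (rule Max_in)
    then obtain b i1 i0 where bi: "b \<in> Basis" "i0 < 4" "i1 < 4" "(x i1 - x i0) \<bullet> b = D"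
      by (auto simp: V_def)
    define y where "y = (\<lambda>i. x i \<bullet> b)"
    have yD: "y i1 - y i0 = D" using bi by (simp add: y_def inner_diff_left)
    have mm: "y i0 \<le> y j \<and> y j \<le> y i1" if "j < 4" for j
      using le[of j i0 b] le[of i1 j b] that bi yD by (simp add: y_def inner_diff_left)
    obtain c where c: "\<And>j. j < 4 \<Longrightarrow> y j \<le> c \<or> c + D/3 \<le> y j" "y i0 \<le> c" "c + D/3 \<le> y i1"
      using four_reals_gap[OF bi(2,3) yD Dpos mm] by auto
    define L where "L = {j. j < 4 \<and> y j \<le> c}"
    define H where "H = {j. j < 4 \<and> c + D/3 \<le> y j}"
    have LH: "L \<union> H = {..<4}" "L \<inter> H = {}" "i0 \<in> L" "i1 \<in> H"
      using c bi Dpos by (auto simp: L_def H_def)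
    have fin: "finite L" "finite H" by (auto simp: L_def H_def)
    have adm: "mix_admissible (4 * kappa TYPE('d)) (D/4) (x ` H) (x ` L)"
    proof (rule mix_admissibleI[where u = b and b = "c + D/3" and a = c])
      show "norm b = 1" using bi by simp
      show "D/4 < c + D/3 - c" using Dpos by simp
      have "card (x ` H \<union> x ` L) \<le> card {..<4::nat}"
        unfolding image_Un[symmetric] Un_commute[of H] LH(1) by (rule card_image_le) simp
      then show "emeasure lebesgue (msum (x ` H \<union> x ` L) (cball 0 1)) \<le> ennreal (4 * kappa TYPE('d))"
        using emeasure_msum_finite[of "x ` H \<union> x ` L" 4] fin by simp
    qed (auto simp: L_def H_def y_def inner_commute)
    have det: "ae_determined (x ` T) (\<lambda>\<omega>. \<Prod>i\<in>T. g (X (x i) \<omega>))" for T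
    proof -
      have "(\<lambda>\<omega>. \<Prod>i\<in>T. g (X (x i) \<omega>)) \<in> borel_measurable (past (x ` T))"
        by (intro borel_measurable_prod measurable_compose[OF measurable_past g_measurable]) auto
      then show ?thesis unfolding ae_determined_def using meas[of T] by auto
    qed
    have D4: "D/4 > 0" using Dpos by simp
    have "\<bar>expectation (\<lambda>\<omega>. (\<Prod>i\<in>H. g (X (x i) \<omega>)) * (\<Prod>i\<in>L. g (X (x i) \<omega>)))
       - expectation (\<lambda>\<omega>. \<Prod>i\<in>H. g (X (x i) \<omega>)) * expectation (\<lambda>\<omega>. \<Prod>i\<in>L. g (X (x i) \<omega>))\<bar>
       \<le> 4 * (C * (D/4) powr (- real \<nu>) * (4 * kappa TYPE('d)) powr l)"
      by (rule covariance_ae_determined[OF adm kappa_4 D4 det abs_prod_field_le_1 det abs_prod_field_le_1])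
    also have "\<dots> \<le> decay \<rho>"
      using False by (intro decay_mixing) (auto simp: \<rho>_def)
    also have "(\<lambda>\<omega>. (\<Prod>i\<in>H. g (X (x i) \<omega>)) * (\<Prod>i\<in>L. g (X (x i) \<omega>))) = (\<lambda>\<omega>. \<Prod>i<4. g (X (x i) \<omega>))"
    proof
      fix \<omega>
      show "(\<Prod>i\<in>H. g (X (x i) \<omega>)) * (\<Prod>i\<in>L. g (X (x i) \<omega>)) = (\<Prod>i<4. g (X (x i) \<omega>))"
        unfolding LH(1)[symmetric] using fin LH(2) by (subst prod.union_disjoint) (auto simp: mult.commute)
    qed
    finally show thesis
      using \<rho> \<rho>0 LH by (intro split[of \<rho> L H]) (auto simp: mult.commute)
  qed
qed

text \<open>The power at \<open>\<rho>\<close> splits into three equal factors, and each grows when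
  \<open>\<rho>\<close> is replaced by a smaller norm; \<open>decay_const \<ge> 1\<close> lets the
  constant be cubed.\<close>

lemma decay_le_hhh:
  assumes "norm a \<le> \<rho>" "norm b \<le> \<rho>" "norm c \<le> \<rho>"
  shows "decay \<rho> \<le> h a * h b * h c"
proof -
  define f where "f = (\<lambda>x::real. (1 + x) powr (- (real \<nu> / 3)))"
  have \<rho>: "0 \<le> \<rho>" using norm_ge_zero[of a] assms by linarith
  have f: "f \<rho> \<le> f (norm x)" if "norm x \<le> \<rho>" for x :: 'd
    unfolding f_def using that by (intro powr_mono2') (auto intro: add_pos_nonneg)
  have f0: "0 \<le> f x" for x by (simp add: f_def)
  have "(1 + \<rho>) powr (- real \<nu>) = f \<rho> * f \<rho> * f \<rho>"
    unfolding f_def using \<rho> by (simp add: powr_add[symmetric])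
  also have "\<dots> \<le> f (norm a) * f (norm b) * f (norm c)"
    using f[OF assms(1)] f[OF assms(2)] f[OF assms(3)] f0 by (intro mult_mono) auto
  finally have "decay \<rho> \<le> decay_const * (f (norm a) * f (norm b) * f (norm c))"
    unfolding decay_def using decay_const_ge_1 by (intro mult_left_mono) auto
  also have "\<dots> \<le> (decay_const * decay_const * decay_const) * (f (norm a) * f (norm b) * f (norm c))"
  proof (rule mult_right_mono)
    have "1 * decay_const \<le> decay_const * decay_const" using decay_const_ge_1 by (intro mult_right_mono) auto
    moreover have "1 * (decay_const * decay_const) \<le> decay_const * (decay_const * decay_const)"
      using decay_const_ge_1 by (intro mult_right_mono) auto
    ultimately show "decay_const \<le> decay_const * decay_const * decay_const" by (simp add: mult.assoc)
  qed (simp add: f0)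
  also have "\<dots> = h a * h b * h c" by (simp add: h_def f_def)
  finally show ?thesis .
qed

lemma pair_of_four:
  assumes "A \<subseteq> {..<4::nat}" "card A = 2" "0 \<in> A" and B: "B = {..<4} - A"
  shows "(A = {0, 1} \<and> B = {2, 3}) \<or> (A = {0, 2} \<and> B = {1, 3}) \<or> (A = {0, 3} \<and> B = {1, 2})"
proof -
  obtain p where p: "A = {0, p}" "p \<noteq> 0"
    using assms(2,3) by (auto simp: card_2_iff)
  have four: "{..<4::nat} = {0, 1, 2, 3}" by auto
  have "p = 1 \<or> p = 2 \<or> p = 3" using assms(1) p by auto
  then show ?thesis
  proof (elim disjE)
    assume "p = 1" then have "B = {2, 3}" unfolding B p(1) four by auto
    with \<open>p = 1\<close> p(1) show ?thesis by simp
  next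
    assume "p = 2" then have "B = {1, 3}" unfolding B p(1) four by auto
    with \<open>p = 2\<close> p(1) show ?thesis by simp
  next
    assume "p = 3" then have "B = {1, 2}" unfolding B p(1) four by auto
    with \<open>p = 3\<close> p(1) show ?thesis by simp
  qed
qed

lemma h_nonneg: "0 \<le> h x"
  by (rule less_imp_le[OF h_pos])

text \<open>A split into one and three points leaves no product of expectations because
  \<open>g\<close> is centered; a split into two pairs is one of three pairings, each with two-point
  decay. The last term bounds what mixing leaves over. After integration the pairings will give the
  square of the volume, the last term only the volume.\<close>

lemma four_points:
  "\<bar>expectation (\<lambda>\<omega>. g (X a \<omega>) * (g (X b \<omega>) * (g (X c \<omega>) * g (X e \<omega>))))\<bar>
    \<le> h (b - a) * h (e - c) + h (c - a) * h (e - b) + h (e - a) * h (c - b) + h (b - a) * h (c - a) * h (e - a)"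
proof -
  define x where "x = (\<lambda>i::nat. if i = 0 then a else if i = 1 then b else if i = 2 then c else e)"
  have x: "x 0 = a" "x 1 = b" "x 2 = c" "x 3 = e" by (auto simp: x_def)
  have four: "{..<4::nat} = {0, 1, 2, 3}" by auto
  have P: "(\<Prod>i<4. g (X (x i) \<omega>)) = g (X a \<omega>) * (g (X b \<omega>) * (g (X c \<omega>) * g (X e \<omega>)))" for \<omega>
    by (simp add: four x x(2)[unfolded One_nat_def])
  define T where "T = h (b - a) * h (e - c) + h (c - a) * h (e - b) + h (e - a) * h (c - b)"
  have T0: "T \<ge> 0" unfolding T_def by (intro add_nonneg_nonneg mult_nonneg_nonneg h_nonneg)
  have hhh: "decay \<rho> \<le> h (b - a) * h (c - a) * h (e - a)"
    if "\<And>i j. i < 4 \<Longrightarrow> j < 4 \<Longrightarrow> norm (x i - x j) \<le> \<rho>" for \<rho>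
    using that[of 1 0] that[of 2 0] that[of 3 0] unfolding x by (intro decay_le_hhh) simp_all
  have two: "\<bar>expectation (\<lambda>\<omega>. \<Prod>i\<in>{i, j}. g (X (x i) \<omega>))\<bar> \<le> h (x j - x i)" if "i \<noteq> j" for i j
    using two_points[of "x j" "x i"] that by (simp add: mult.commute)
  have "\<bar>expectation (\<lambda>\<omega>. g (X a \<omega>) * (g (X b \<omega>) * (g (X c \<omega>) * g (X e \<omega>))))\<bar> \<le> T + h (b - a) * h (c - a) * h (e - a)"
  proof (cases rule: four_points_split[of x])
    case (small \<rho>)
    have "decay \<rho> \<le> h (b - a) * h (c - a) * h (e - a)" by (rule hhh) (rule small(2))
    then show ?thesis using small(3) T0 unfolding P by linarith
  next
    case (split \<rho> L H)
    define m where "m = (\<lambda>T. expectation (\<lambda>\<omega>. \<Prod>i\<in>T. g (X (x i) \<omega>)))"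
    have fin: "finite L" "finite H" using split(3) by (metis finite_Un finite_lessThan)+
    have "card L + card H = 4" using card_Un_disjoint[OF fin split(4)] split(3) by simp
    moreover have "card L \<noteq> 0" "card H \<noteq> 0" using fin split by auto
    ultimately consider "card L = 1" | "card H = 1" | "card L = 2" "card H = 2" by linarith
    then have "\<bar>m L * m H\<bar> \<le> T"
    proof cases
      case 1
      then obtain i where "L = {i}" by (auto simp: card_1_singleton_iff)
      then show ?thesis using T0 by (simp add: m_def field_centered)
    next
      case 2
      then obtain i where "H = {i}" by (auto simp: card_1_singleton_iff)
      then show ?thesis using T0 by (simp add: m_def field_centered)
    next
      case 3
      have pair: "\<bar>m A * m B\<bar> \<le> T" if A: "A \<subseteq> {..<4}" "card A = 2" "0 \<in> A" "B = {..<4} - A" for A B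
      proof -
        have *: "\<bar>m {i, j} * m {k, n}\<bar> \<le> h (x j - x i) * h (x n - x k)" if "i \<noteq> j" "k \<noteq> n" for i j k n
          unfolding abs_mult m_def using two[OF that(1)] two[OF that(2)] h_pos[of "x j - x i"] by (intro mult_mono) auto
        have nn: "0 \<le> h u * h v" for u v by (intro mult_nonneg_nonneg h_nonneg)
        from pair_of_four[OF A] show ?thesis
        proof (elim disjE conjE)
          assume "A = {0, 1}" "B = {2, 3}"
          then show ?thesis using *[of 0 1 2 3] nn[of "c - a" "e - b"] nn[of "e - a" "c - b"] unfolding T_def x by simp
        next
          assume "A = {0, 2}" "B = {1, 3}"
          then show ?thesis using *[of 0 2 1 3] nn[of "b - a" "e - c"] nn[of "e - a" "c - b"] unfolding T_def x by simp
        next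
          assume "A = {0, 3}" "B = {1, 2}"
          then show ?thesis using *[of 0 3 1 2] nn[of "b - a" "e - c"] nn[of "c - a" "e - b"] unfolding T_def x by simp
        qed
      qed
      show ?thesis
      proof (cases "0 \<in> L")
        case True
        then show ?thesis using 3 split(3,4) by (intro pair) auto
      next
        case False
        then have "0 \<in> H" using split(3) by (metis UnE lessThan_iff zero_less_numeral)
        then have "\<bar>m H * m L\<bar> \<le> T" using 3 split(3,4) by (intro pair) auto
        then show ?thesis by (simp add: mult.commute)
      qed
    qed
    moreover have "decay \<rho> \<le> h (b - a) * h (c - a) * h (e - a)" by (rule hhh) (rule split(2))
    ultimately show ?thesis using split(7) unfolding P m_def by linarith
  qed
  then show ?thesis by (simp add: T_def)
qed

end

text \<open>The third moment in the Taylor remainder is replaced by second and fourth moments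
  through \<open>\<bar>y\<bar> ^ 3 \<le> (e * y\<^sup>2 + y ^ 4 / e) / 2\<close> with free
  \<open>e\<close>. For the second moment \<open>s\<close>, the gap between \<open>1 - s/2\<close>
  and \<open>exp (- s/2)\<close> is of order \<open>s\<^sup>2\<close>, which is at most the fourth
  moment.\<close>

lemma (in prob_space) char_normal_approx:
  fixes Y :: "'a \<Rightarrow> real"
  assumes m[measurable]: "Y \<in> borel_measurable M" and b: "\<And>\<omega>. \<omega> \<in> space M \<Longrightarrow> \<bar>Y \<omega>\<bar> \<le> K"
    and z: "expectation Y = 0" and e: "e > 0"
  shows "cmod ((\<integral>\<omega>. iexp (Y \<omega>) \<partial>M) - exp (- expectation (\<lambda>\<omega>. (Y \<omega>)\<^sup>2) / 2))
    \<le> e * expectation (\<lambda>\<omega>. (Y \<omega>)\<^sup>2) + expectation (\<lambda>\<omega>. (Y \<omega>) ^ 4) / e + expectation (\<lambda>\<omega>. (Y \<omega>) ^ 4)"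
proof -
  have iY: "integrable M (\<lambda>\<omega>. Y \<omega> ^ k)" for k
  proof (rule integrable_const_bound[of _ "K ^ k"])
    show "AE \<omega> in M. norm (Y \<omega> ^ k) \<le> K ^ k"
      using b by (intro AE_I2) (auto simp: power_abs intro!: power_mono)
  qed measurable
  have iY1: "integrable M Y" using iY[of 1] by simp
  define s where "s = expectation (\<lambda>\<omega>. (Y \<omega>)\<^sup>2)"
  define q where "q = expectation (\<lambda>\<omega>. (Y \<omega>) ^ 4)"
  have s0: "s \<ge> 0" unfolding s_def by (rule Bochner_Integration.integral_nonneg) simp
  have q0: "q \<ge> 0" unfolding q_def by (rule Bochner_Integration.integral_nonneg) simp
  have sq: "s\<^sup>2 \<le> q"
  proof -
    have "0 \<le> expectation (\<lambda>\<omega>. ((Y \<omega>)\<^sup>2 - s)\<^sup>2)" by (rule Bochner_Integration.integral_nonneg) simp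
    also have "\<dots> = expectation (\<lambda>\<omega>. Y \<omega> ^ 4 - 2 * s * (Y \<omega>)\<^sup>2 + s\<^sup>2)"
      by (rule Bochner_Integration.integral_cong) (auto simp: power2_eq_square power4_eq_xxxx algebra_simps)
    also have "\<dots> = q - s\<^sup>2"
      using iY[of 4] iY[of 2] by (simp add: q_def[symmetric] s_def[symmetric] prob_space) (simp add: power2_eq_square)
    finally show ?thesis by simp
  qed
  have ie: "integrable M (\<lambda>\<omega>. iexp (Y \<omega>))"
    by (rule integrable_const_bound[of _ 1]) (auto simp: norm_exp_i_times)
  have ip: "integrable M (\<lambda>\<omega>. 1 + \<i> * complex_of_real (Y \<omega>) - complex_of_real ((Y \<omega>)\<^sup>2) / 2)"
    using iY1 iY[of 2] by (intro Bochner_Integration.integrable_add Bochner_Integration.integrable_diff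
        integrable_mult_right integrable_divide integrable_of_real) auto
  have p: "(\<integral>\<omega>. 1 + \<i> * complex_of_real (Y \<omega>) - complex_of_real ((Y \<omega>)\<^sup>2) / 2 \<partial>M) = complex_of_real (1 - s / 2)"
  proof -
    have 1: "integrable M (\<lambda>\<omega>. \<i> * complex_of_real (Y \<omega>))" using iY1 by (intro integrable_mult_right integrable_of_real)
    have 2: "integrable M (\<lambda>\<omega>. complex_of_real ((Y \<omega>)\<^sup>2) / 2)" using iY[of 2] by (intro integrable_divide integrable_of_real)
    have 3: "integrable M (\<lambda>\<omega>. 1 :: complex)" by simp
    have "(\<integral>\<omega>. 1 + \<i> * complex_of_real (Y \<omega>) - complex_of_real ((Y \<omega>)\<^sup>2) / 2 \<partial>M)
       = (\<integral>\<omega>. 1 \<partial>M) + (\<integral>\<omega>. \<i> * complex_of_real (Y \<omega>) \<partial>M) - (\<integral>\<omega>. complex_of_real ((Y \<omega>)\<^sup>2) / 2 \<partial>M)"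
      using 1 2 3 by (simp del: of_real_power)
    also have "(\<integral>\<omega>. \<i> * complex_of_real (Y \<omega>) \<partial>M) = 0"
      by (simp only: integral_mult_right_zero integral_complex_of_real z of_real_0 mult_zero_right)
    also have "(\<integral>\<omega>. complex_of_real ((Y \<omega>)\<^sup>2) / 2 \<partial>M) = complex_of_real (s / 2)"
      by (simp only: integral_divide_zero integral_complex_of_real s_def of_real_divide of_real_numeral)
    finally show ?thesis by (simp add: prob_space)
  qed
  have "cmod (iexp y - (1 + \<i> * complex_of_real y - complex_of_real (y\<^sup>2) / 2)) \<le> (e * y\<^sup>2 + y ^ 4 / e) / 2" for y
  proof -
    have sum: "(\<Sum>k\<le>2. (\<i> * complex_of_real y) ^ k / fact k) = 1 + \<i> * complex_of_real y - complex_of_real (y\<^sup>2) / 2"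
      by (simp add: numeral_2_eq_2 power_mult_distrib)
    have "cmod (iexp y - (1 + \<i> * complex_of_real y - complex_of_real (y\<^sup>2) / 2)) \<le> \<bar>y\<bar> ^ 3 / 6"
      using iexp_approx1[of y 2] unfolding sum by (simp add: numeral_3_eq_3 fact_numeral)
    also have "\<dots> \<le> \<bar>y\<bar> ^ 3" by simp
    also have "\<bar>y\<bar> ^ 3 = y\<^sup>2 * \<bar>y\<bar>" by (simp add: power3_eq_cube power2_eq_square)
    also have "\<dots> \<le> y\<^sup>2 * ((e + y\<^sup>2 / e) / 2)"
    proof (rule mult_left_mono)
      have "0 \<le> (e - \<bar>y\<bar>)\<^sup>2" by simp
      then have "2 * (e * \<bar>y\<bar>) \<le> e * e + y\<^sup>2" by (simp add: power2_eq_square algebra_simps)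
      then show "\<bar>y\<bar> \<le> (e + y\<^sup>2 / e) / 2" using e by (simp add: field_simps)
    qed simp
    also have "\<dots> = (e * y\<^sup>2 + y ^ 4 / e) / 2"
      by (simp add: power2_eq_square power4_eq_xxxx algebra_simps)
    finally show ?thesis .
  qed
  note pw = this
  have "cmod ((\<integral>\<omega>. iexp (Y \<omega>) \<partial>M) - complex_of_real (1 - s / 2))
     = cmod (\<integral>\<omega>. iexp (Y \<omega>) - (1 + \<i> * complex_of_real (Y \<omega>) - complex_of_real ((Y \<omega>)\<^sup>2) / 2) \<partial>M)"
    unfolding p[symmetric] Bochner_Integration.integral_diff[OF ie ip] ..
  also have "\<dots> \<le> (\<integral>\<omega>. cmod (iexp (Y \<omega>) - (1 + \<i> * complex_of_real (Y \<omega>) - complex_of_real ((Y \<omega>)\<^sup>2) / 2)) \<partial>M)"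
    by (rule integral_norm_bound)
  also have "\<dots> \<le> (\<integral>\<omega>. (e * (Y \<omega>)\<^sup>2 + Y \<omega> ^ 4 / e) / 2 \<partial>M)"
  proof (rule integral_mono[OF _ _ pw])
    show "integrable M (\<lambda>\<omega>. cmod (iexp (Y \<omega>) - (1 + \<i> * complex_of_real (Y \<omega>) - complex_of_real ((Y \<omega>)\<^sup>2) / 2)))"
      by (rule integrable_norm[OF Bochner_Integration.integrable_diff[OF ie ip]])
    show "integrable M (\<lambda>\<omega>. (e * (Y \<omega>)\<^sup>2 + Y \<omega> ^ 4 / e) / 2)" using iY[of 2] iY[of 4] by simp
  qed
  also have "\<dots> = (e * s + q / e) / 2" using iY[of 2] iY[of 4] by (simp add: s_def q_def)
  finally have 1: "cmod ((\<integral>\<omega>. iexp (Y \<omega>) \<partial>M) - complex_of_real (1 - s / 2)) \<le> (e * s + q / e) / 2" .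
  have 2: "cmod (complex_of_real (1 - s / 2) - exp (- complex_of_real s / 2)) \<le> q"
  proof -
    have "exp (- complex_of_real s / 2) = complex_of_real (exp (- s / 2))"
      by (simp add: exp_of_real[symmetric])
    then have "cmod (complex_of_real (1 - s / 2) - exp (- complex_of_real s / 2)) = \<bar>1 - s / 2 - exp (- s / 2)\<bar>"
      by (metis norm_of_real of_real_diff)
    also have "\<dots> = exp (- s / 2) - (1 - s / 2)"
      using exp_ge_add_one_self[of "- s / 2"] by simp
    also have "\<dots> \<le> (s / 2)\<^sup>2"
    proof -
      have "0 < 1 + s / 2" using s0 by simp
      moreover have "1 + s / 2 \<le> exp (s / 2)" by (rule exp_ge_add_one_self)
      ultimately have "1 / exp (s / 2) \<le> 1 / (1 + s / 2)" by (intro divide_left_mono) auto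
      moreover have "exp (- s / 2) = 1 / exp (s / 2)"
        by (simp add: exp_minus inverse_eq_divide)
      ultimately have "exp (- s / 2) \<le> 1 / (1 + s / 2)" by simp
      also have "\<dots> \<le> 1 - s / 2 + (s / 2)\<^sup>2"
      proof -
        have "(1 - s / 2 + (s / 2)\<^sup>2) * (1 + s / 2) = 1 + (s / 2) ^ 3"
          by (simp add: power2_eq_square power3_eq_cube algebra_simps)
        moreover have "0 \<le> (s / 2) ^ 3" using s0 by simp
        ultimately have "1 \<le> (1 - s / 2 + (s / 2)\<^sup>2) * (1 + s / 2)" by linarith
        then show ?thesis using s0 by (subst pos_divide_le_eq) auto
      qed
      finally show ?thesis by simp
    qed
    also have "\<dots> \<le> q" using sq s0 q0 by (simp add: power_divide)
    finally show ?thesis .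
  qed
  have "cmod ((\<integral>\<omega>. iexp (Y \<omega>) \<partial>M) - exp (- complex_of_real s / 2)) \<le> (e * s + q / e) / 2 + q"
  proof -
    have "cmod ((\<integral>\<omega>. iexp (Y \<omega>) \<partial>M) - exp (- complex_of_real s / 2))
      \<le> cmod ((\<integral>\<omega>. iexp (Y \<omega>) \<partial>M) - complex_of_real (1 - s / 2)) + cmod (complex_of_real (1 - s / 2) - exp (- complex_of_real s / 2))"
      by (rule order_trans[OF _ norm_triangle_ineq]) simp
    then show ?thesis using 1 2 by linarith
  qed
  also have "\<dots> \<le> e * s + q / e + q"
  proof -
    have "(x + y) / 2 + q \<le> x + y + q" if "0 \<le> x" "0 \<le> y" for x y :: real using that by simp
    from this[of "e * s" "q / e"] show ?thesis using e s0 q0 by simp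
  qed
  finally show ?thesis by (simp add: s_def q_def exp_of_real[symmetric])
qed

section \<open>Second and fourth moments of integrals of the field\<close>

context centered_field
begin

definition fin_set :: "'d set \<Rightarrow> bool" where
  "fin_set A \<longleftrightarrow> A \<in> sets borel \<and> emeasure lborel A < \<infinity>"

definition vol :: "'d set \<Rightarrow> real" where "vol A = measure lborel A"

lemma vol_nonneg: "0 \<le> vol A" by (simp add: vol_def)

lemma emeasure_vol: "fin_set A \<Longrightarrow> emeasure lborel A = ennreal (vol A)"
  unfolding fin_set_def vol_def by (intro emeasure_eq_ennreal_measure) auto

definition bounded_rv :: "('a \<Rightarrow> real) \<Rightarrow> bool" where
  "bounded_rv f \<longleftrightarrow> f \<in> borel_measurable M \<and> (\<exists>K. \<forall>\<omega>\<in>space M. \<bar>f \<omega>\<bar> \<le> K)"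

lemma bounded_rv_integrable: "bounded_rv f \<Longrightarrow> integrable M f"
  unfolding bounded_rv_def by (elim conjE exE, rule integrable_const_bound) auto

lemma bounded_rv_mult:
  assumes "bounded_rv f" "bounded_rv k" shows "bounded_rv (\<lambda>\<omega>. f \<omega> * k \<omega>)"
proof -
  obtain K K' where K: "\<And>\<omega>. \<omega> \<in> space M \<Longrightarrow> \<bar>f \<omega>\<bar> \<le> K" "\<And>\<omega>. \<omega> \<in> space M \<Longrightarrow> \<bar>k \<omega>\<bar> \<le> K'"
    using assms by (auto simp: bounded_rv_def)
  have "\<bar>f \<omega> * k \<omega>\<bar> \<le> K * K'" if "\<omega> \<in> space M" for \<omega>
    unfolding abs_mult using K[OF that] by (intro mult_mono) (auto intro: order_trans[OF abs_ge_zero])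
  then show ?thesis using assms by (auto simp: bounded_rv_def)
qed

lemma bounded_rv_field: "bounded_rv (\<lambda>\<omega>. g (X t \<omega>))"
  unfolding bounded_rv_def using g_le_1 by auto

lemma fin_setD: assumes "fin_set A" shows "A \<in> sets borel" "emeasure lborel A < \<infinity>"
  using assms by (auto simp: fin_set_def)

lemma bounded_rv_S: "fin_set A \<Longrightarrow> bounded_rv (S g A)"
  unfolding bounded_rv_def
  using S_measurable[OF g_measurable g_le_1 fin_setD] abs_S_le[OF g_measurable g_le_1 fin_setD] by blast

lemma S_mult_nn:
  assumes A: "fin_set A" and V: "bounded_rv V"
  shows "ennreal \<bar>expectation (\<lambda>\<omega>. S g A \<omega> * V \<omega>)\<bar>
    \<le> (\<integral>\<^sup>+t. indicator A t * ennreal \<bar>expectation (\<lambda>\<omega>. g (X t \<omega>) * V \<omega>)\<bar> \<partial>lborel)"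
proof -
  note F = S_Fubini[OF g_measurable g_le_1 fin_setD[OF A] bounded_rv_integrable[OF V]]
  have "ennreal \<bar>expectation (\<lambda>\<omega>. S g A \<omega> * V \<omega>)\<bar>
     \<le> (\<integral>\<^sup>+t. ennreal (norm (indicator A t * expectation (\<lambda>\<omega>. g (X t \<omega>) * V \<omega>))) \<partial>lborel)"
    unfolding F(2) using integral_norm_bound_ennreal[OF F(3)] by simp
  also have "\<dots> = (\<integral>\<^sup>+t. indicator A t * ennreal \<bar>expectation (\<lambda>\<omega>. g (X t \<omega>) * V \<omega>)\<bar> \<partial>lborel)"
    by (intro nn_integral_cong) (auto simp: indicator_def)
  finally show ?thesis .
qed

text \<open>Moments are computed by peeling off one factor \<open>S g A\<close> at a time: Fubini
  exchanges it for a point value \<open>g (X t)\<close>, and the bound for the reduced expression is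
  integrated over \<open>A\<close>. Boundedness of \<open>V\<close> keeps the intermediate products
  integrable.\<close>

lemma S_mult_le:
  assumes A: "fin_set A" and V: "bounded_rv V"
    and le: "\<And>t. t \<in> A \<Longrightarrow> ennreal \<bar>expectation (\<lambda>\<omega>. g (X t \<omega>) * V \<omega>)\<bar> \<le> b t"
  shows "ennreal \<bar>expectation (\<lambda>\<omega>. S g A \<omega> * V \<omega>)\<bar> \<le> (\<integral>\<^sup>+t. indicator A t * b t \<partial>lborel)"
  by (rule order_trans[OF S_mult_nn[OF A V]], intro nn_integral_mono) (auto simp: indicator_def le)

lemma S_centered:
  assumes A: "fin_set A" shows "expectation (S g A) = 0"
proof -
  have "bounded_rv (\<lambda>_. 1)" by (auto simp: bounded_rv_def)
  from S_mult_le[OF A this, of "\<lambda>_. 0"] show ?thesis by (simp add: field_centered)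
qed

lemma nn_integral_indicator_h:
  assumes "k \<ge> 0" and [measurable]: "A \<in> sets borel"
  shows "(\<integral>\<^sup>+x. indicator A x * ennreal (k * h (x - y)) \<partial>lborel) \<le> ennreal (k * HH)"
proof -
  have "(\<integral>\<^sup>+x. indicator A x * ennreal (k * h (x - y)) \<partial>lborel) \<le> (\<integral>\<^sup>+x. ennreal k * ennreal (h (x - y)) \<partial>lborel)"
    using assms by (intro nn_integral_mono) (auto simp: indicator_def ennreal_mult h_nonneg)
  also have "\<dots> = ennreal k * ennreal HH" by (subst nn_integral_cmult) (auto simp: h_nn_integral_shift)
  also have "\<dots> = ennreal (k * HH)" using assms HH_nonneg by (simp add: ennreal_mult)
  finally show ?thesis .
qed

lemma nn_integral_indicator_const:
  assumes "k \<ge> 0" "fin_set A"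
  shows "(\<integral>\<^sup>+x. indicator A x * ennreal k \<partial>lborel) \<le> ennreal (k * vol A)"
  using assms fin_setD[OF assms(2)] by (subst nn_integral_multc) (auto simp: emeasure_vol ennreal_mult vol_nonneg mult.commute)

lemma nn_integral_indicator_add:
  assumes "(\<integral>\<^sup>+x. indicator A x * ennreal (f x) \<partial>lborel) \<le> ennreal F" "(\<integral>\<^sup>+x. indicator A x * ennreal (k x) \<partial>lborel) \<le> ennreal K"
    and [measurable]: "f \<in> borel_measurable borel" "k \<in> borel_measurable borel" "A \<in> sets borel"
    and nn: "\<And>x. 0 \<le> f x" "\<And>x. 0 \<le> k x" "0 \<le> F" "0 \<le> K"
  shows "(\<integral>\<^sup>+x. indicator A x * ennreal (f x + k x) \<partial>lborel) \<le> ennreal (F + K)"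
proof -
  have "(\<integral>\<^sup>+x. indicator A x * ennreal (f x + k x) \<partial>lborel)
    = (\<integral>\<^sup>+x. indicator A x * ennreal (f x) \<partial>lborel) + (\<integral>\<^sup>+x. indicator A x * ennreal (k x) \<partial>lborel)"
    by (subst nn_integral_add[symmetric]) (auto simp: nn distrib_left)
  also have "\<dots> \<le> ennreal F + ennreal K" by (intro add_mono assms)
  also have "\<dots> = ennreal (F + K)" using nn by simp
  finally show ?thesis .
qed

definition tail :: "real \<Rightarrow> real" where
  "tail q = (\<integral>x. indicator {x. q \<le> norm x} x * h x \<partial>lborel)"

lemma tail_integrable: "integrable lborel (\<lambda>x. indicator {x. q \<le> norm x} x * h x)"
  by (rule Bochner_Integration.integrable_bound[OF h_integrable]) (auto simp: indicator_def h_nonneg)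

lemma tail_nonneg: "0 \<le> tail q"
  unfolding tail_def by (rule Bochner_Integration.integral_nonneg) (simp add: h_nonneg)

lemma tail_tendsto: "(tail \<longlongrightarrow> 0) at_top"
proof -
  have "(tail \<longlongrightarrow> (\<integral>x. (0::real) \<partial>(lborel :: 'd measure))) at_top"
    unfolding tail_def
  proof (rule integral_dominated_convergence_at_top[where w = h])
    show "AE x in lborel. ((\<lambda>q. indicator {x. q \<le> norm x} x * h x) \<longlongrightarrow> 0) at_top"
    proof (intro AE_I2 tendsto_eventually)
      fix x :: 'd
      show "\<forall>\<^sub>F q in at_top. indicator {x. q \<le> norm x} x * h x = 0"
        using eventually_gt_at_top[of "norm x"] by eventually_elim simp
    qed
    show "\<forall>\<^sub>F q in at_top. AE x in lborel. norm (indicator {x. q \<le> norm x} x * h x) \<le> h x"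
      by (intro always_eventually allI AE_I2) (auto simp: indicator_def h_nonneg)
  qed (auto intro: h_integrable)
  then show ?thesis by simp
qed

text \<open>The inner integral over \<open>B\<close> is at most the mass of \<open>h\<close> outside
  radius \<open>q\<close>, however large \<open>B\<close> is. Only the volume of \<open>A\<close>
  enters, and \<open>q = 0\<close> gives the full mass \<open>HH\<close>.\<close>

lemma cross_moment:
  assumes A: "fin_set A" and B: "fin_set B" and q: "\<And>s t. s \<in> A \<Longrightarrow> t \<in> B \<Longrightarrow> q \<le> norm (t - s)"
  shows "\<bar>expectation (\<lambda>\<omega>. S g A \<omega> * S g B \<omega>)\<bar> \<le> vol A * tail q"
proof -
  note [measurable] = fin_setD(1)[OF A] fin_setD(1)[OF B]
  have in1: "ennreal \<bar>expectation (\<lambda>\<omega>. g (X s \<omega>) * S g B \<omega>)\<bar> \<le> ennreal (tail q)" if s: "s \<in> A" for s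
  proof -
    have "ennreal \<bar>expectation (\<lambda>\<omega>. S g B \<omega> * g (X s \<omega>))\<bar> \<le> (\<integral>\<^sup>+t. indicator B t * ennreal (h (t - s)) \<partial>lborel)"
      by (rule S_mult_le[OF B bounded_rv_field]) (intro ennreal_leI two_points)
    also have "\<dots> \<le> (\<integral>\<^sup>+t. ennreal (indicator {x. q \<le> norm x} (t - s) * h (t - s)) \<partial>lborel)"
      using q s by (intro nn_integral_mono) (auto simp: indicator_def)
    also have "\<dots> = (\<integral>\<^sup>+t. ennreal (indicator {x. q \<le> norm x} t * h t) \<partial>lborel)"
    proof -
      have "(\<integral>\<^sup>+x. ennreal (indicator {x. q \<le> norm x} x * h x) \<partial>lborel)
         = (\<integral>\<^sup>+x. ennreal (indicator {x. q \<le> norm x} x * h x) \<partial>distr lborel borel ((+) (- s)))"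
        by (simp add: lborel_distr_plus)
      also have "\<dots> = (\<integral>\<^sup>+x. ennreal (indicator {x. q \<le> norm x} (x - s) * h (x - s)) \<partial>lborel)"
        by (subst nn_integral_distr) auto
      finally show ?thesis by simp
    qed
    also have "\<dots> = ennreal (tail q)"
      unfolding tail_def using tail_integrable by (intro nn_integral_eq_integral) (auto simp: h_nonneg)
    finally show ?thesis by (simp add: mult.commute)
  qed
  have "ennreal \<bar>expectation (\<lambda>\<omega>. S g A \<omega> * S g B \<omega>)\<bar> \<le> (\<integral>\<^sup>+s. indicator A s * ennreal (tail q) \<partial>lborel)"
    by (rule S_mult_le[OF A bounded_rv_S[OF B] in1])
  also have "\<dots> \<le> ennreal (tail q * vol A)" by (rule nn_integral_indicator_const[OF tail_nonneg A])
  finally show ?thesis using tail_nonneg vol_nonneg by (simp add: mult.commute)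
qed

lemma second_moment:
  assumes A: "fin_set A"
  shows "expectation (\<lambda>\<omega>. (S g A \<omega>)\<^sup>2) \<le> HH * vol A"
proof -
  have "tail 0 = HH" by (simp add: tail_def HH_def)
  then show ?thesis using cross_moment[OF A A, of 0] by (simp add: power2_eq_square mult.commute)
qed

text \<open>Four successive peelings. Each of the three pairings leaves two free points and gives
  \<open>HH\<^sup>2\<close> times the squared volume; the remaining term leaves one free point and
  gives \<open>HH ^ 3\<close> times the volume.\<close>

lemma fourth_moment:
  assumes A: "fin_set A"
  shows "expectation (\<lambda>\<omega>. (S g A \<omega>) ^ 4) \<le> 3 * HH\<^sup>2 * (vol A)\<^sup>2 + HH ^ 3 * vol A"
proof -
  note [measurable] = fin_setD(1)[OF A]
  note bS = bounded_rv_S[OF A]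
  note nn = h_nonneg HH_nonneg vol_nonneg
  let ?S = "S g A"
  \<comment> \<open>The four-point bound, to be integrated over \<open>e\<close>, then
    \<open>c\<close>, then \<open>b\<close>, then \<open>a\<close>; \<open>?T3\<close> and
    \<open>?T2\<close> bound the first two integrals. A factor \<open>h\<close> containing the
    variable of integration gives \<open>HH\<close>; a term free of it gives
    \<open>vol A\<close>.\<close>
  let ?T = "\<lambda>a b c e. h (b - a) * h (e - c) + h (c - a) * h (e - b) + h (c - b) * h (e - a) + h (b - a) * h (c - a) * h (e - a)"
  let ?T3 = "\<lambda>a b c. h (b - a) * HH + HH * h (c - a) + HH * h (c - b) + h (b - a) * HH * h (c - a)"
  let ?T2 = "\<lambda>a b. HH * vol A * h (b - a) + HH * HH + HH * HH + HH * HH * h (b - a)"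
  have 4: "ennreal \<bar>expectation (\<lambda>\<omega>. g (X e \<omega>) * (g (X c \<omega>) * (g (X b \<omega>) * g (X a \<omega>))))\<bar> \<le> ennreal (?T a b c e)" for a b c e
    using four_points[of a b c e] by (intro ennreal_leI) (simp add: mult_ac)
  have 3: "ennreal \<bar>expectation (\<lambda>\<omega>. g (X c \<omega>) * (g (X b \<omega>) * (g (X a \<omega>) * ?S \<omega>)))\<bar> \<le> ennreal (?T3 a b c)" for a b c
  proof -
    have "ennreal \<bar>expectation (\<lambda>\<omega>. ?S \<omega> * (g (X c \<omega>) * (g (X b \<omega>) * g (X a \<omega>))))\<bar> \<le> (\<integral>\<^sup>+e. indicator A e * ennreal (?T a b c e) \<partial>lborel)"
      by (rule S_mult_le[OF A _ 4]) (intro bounded_rv_mult bounded_rv_field)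
    also have "\<dots> \<le> ennreal (h (b - a) * HH + h (c - a) * HH + h (c - b) * HH + h (b - a) * h (c - a) * HH)"
      by (intro nn_integral_indicator_add nn_integral_indicator_h) (auto intro!: mult_nonneg_nonneg add_nonneg_nonneg simp: nn)
    finally show ?thesis by (simp add: mult_ac)
  qed
  have 2: "ennreal \<bar>expectation (\<lambda>\<omega>. g (X b \<omega>) * (g (X a \<omega>) * (?S \<omega> * ?S \<omega>)))\<bar> \<le> ennreal (?T2 a b)" for a b
  proof -
    have "ennreal \<bar>expectation (\<lambda>\<omega>. ?S \<omega> * (g (X b \<omega>) * (g (X a \<omega>) * ?S \<omega>)))\<bar> \<le> (\<integral>\<^sup>+c. indicator A c * ennreal (?T3 a b c) \<partial>lborel)"
      by (rule S_mult_le[OF A _ 3]) (intro bounded_rv_mult bounded_rv_field bS)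
    also have "\<dots> \<le> ennreal (h (b - a) * HH * vol A + HH * HH + HH * HH + h (b - a) * HH * HH)"
      by (intro nn_integral_indicator_add nn_integral_indicator_h nn_integral_indicator_const A)
        (auto intro!: mult_nonneg_nonneg add_nonneg_nonneg simp: nn)
    finally show ?thesis by (simp add: mult_ac)
  qed
  have 1: "ennreal \<bar>expectation (\<lambda>\<omega>. g (X a \<omega>) * (?S \<omega> * (?S \<omega> * ?S \<omega>)))\<bar>
     \<le> ennreal (3 * HH\<^sup>2 * vol A + HH ^ 3)" for a
  proof -
    have "ennreal \<bar>expectation (\<lambda>\<omega>. ?S \<omega> * (g (X a \<omega>) * (?S \<omega> * ?S \<omega>)))\<bar> \<le> (\<integral>\<^sup>+b. indicator A b * ennreal (?T2 a b) \<partial>lborel)"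
      by (rule S_mult_le[OF A _ 2]) (intro bounded_rv_mult bounded_rv_field bS)
    also have "\<dots> \<le> ennreal (HH * vol A * HH + HH * HH * vol A + HH * HH * vol A + HH * HH * HH)"
      by (intro nn_integral_indicator_add nn_integral_indicator_h nn_integral_indicator_const A)
        (auto intro!: mult_nonneg_nonneg add_nonneg_nonneg simp: nn)
    also have "HH * vol A * HH + HH * HH * vol A + HH * HH * vol A + HH * HH * HH = 3 * HH\<^sup>2 * vol A + HH ^ 3"
      by (simp add: power2_eq_square power3_eq_cube algebra_simps)
    finally show ?thesis by (simp add: mult_ac)
  qed
  have "ennreal \<bar>expectation (\<lambda>\<omega>. ?S \<omega> * (?S \<omega> * (?S \<omega> * ?S \<omega>)))\<bar> \<le> (\<integral>\<^sup>+a. indicator A a * ennreal (3 * HH\<^sup>2 * vol A + HH ^ 3) \<partial>lborel)"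
    by (rule S_mult_le[OF A _ 1]) (intro bounded_rv_mult bS)
  also have "\<dots> \<le> ennreal ((3 * HH\<^sup>2 * vol A + HH ^ 3) * vol A)"
    by (rule nn_integral_indicator_const[OF _ A]) (auto intro!: mult_nonneg_nonneg add_nonneg_nonneg simp: nn)
  finally have "\<bar>expectation (\<lambda>\<omega>. ?S \<omega> * (?S \<omega> * (?S \<omega> * ?S \<omega>)))\<bar> \<le> (3 * HH\<^sup>2 * vol A + HH ^ 3) * vol A"
    by (subst (asm) ennreal_le_iff) (auto intro!: mult_nonneg_nonneg add_nonneg_nonneg simp: nn)
  then show ?thesis by (simp add: power4_eq_xxxx power2_eq_square algebra_simps)
qed

end

section \<open>Blocks separated by corridors\<close>

context mixing_field
begin

lemma ae_determined_sum:
  assumes "finite T" "\<And>i. i \<in> T \<Longrightarrow> ae_determined I (Y i)"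
  shows "ae_determined I (\<lambda>\<omega>. \<Sum>i\<in>T. Y i \<omega>)"
  using assms by (induction T rule: finite_induct) (auto intro: ae_determined_const ae_determined_add)

lemma cmod_iexp_expectation_le_1:
  assumes [measurable]: "U \<in> borel_measurable M"
  shows "cmod (\<integral>\<omega>. iexp (U \<omega>) \<partial>M) \<le> 1"
proof -
  have "cmod (\<integral>\<omega>. iexp (U \<omega>) \<partial>M) \<le> (\<integral>\<omega>. cmod (iexp (U \<omega>)) \<partial>M)" by (rule integral_norm_bound)
  then show ?thesis by (simp add: prob_space)
qed

text \<open>Repeated splitting by hyperplanes: any family of at least two blocks falls into two
  groups separated by \<open>r\<close>, and decoupling them costs one mixing error. The same
  \<open>\<gamma>\<close> serves at every stage.\<close>

lemma block_factorisation:
  fixes Bl :: "'i \<Rightarrow> 'd set" and Y :: "'i \<Rightarrow> 'a \<Rightarrow> real"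
  assumes \<gamma>: "\<gamma> \<ge> 2 * kappa TYPE('d)" and r: "r > 0"
    and sep: "\<And>T'. T' \<subseteq> T \<Longrightarrow> 2 \<le> card T' \<Longrightarrow> \<exists>T1 T2. T1 \<noteq> {} \<and> T2 \<noteq> {} \<and> T1 \<inter> T2 = {} \<and> T1 \<union> T2 = T'
        \<and> mix_admissible \<gamma> r (\<Union>(Bl ` T2)) (\<Union>(Bl ` T1))"
    and det: "\<And>i. i \<in> T \<Longrightarrow> ae_determined (Bl i) (Y i)"
  shows "finite T \<Longrightarrow> cmod ((\<integral>\<omega>. iexp (\<Sum>i\<in>T. Y i \<omega>) \<partial>M) - (\<Prod>i\<in>T. \<integral>\<omega>. iexp (Y i \<omega>) \<partial>M))
    \<le> 16 * (C * r powr (- real \<nu>) * \<gamma> powr l) * real (card T)"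
proof -
  define \<alpha> where "\<alpha> = 16 * (C * r powr (- real \<nu>) * \<gamma> powr l)"
  have \<alpha>: "\<alpha> \<ge> 0" using C_pos by (simp add: \<alpha>_def)
  define e where "e = (\<lambda>T. \<integral>\<omega>. iexp (\<Sum>i\<in>T. Y i \<omega>) \<partial>M)"
  define p where "p = (\<lambda>T. \<Prod>i\<in>T. \<integral>\<omega>. iexp (Y i \<omega>) \<partial>M)"
  \<comment> \<open>\<open>card T' - 1\<close> is the number of splits, and it adds up exactly: the
    counts of the two groups plus one. The weaker bound with \<open>card T\<close> would not
    reproduce itself.\<close>
  have main: "cmod (e T' - p T') \<le> \<alpha> * (real (card T') - 1)" if "finite T'" "T' \<subseteq> T" "T' \<noteq> {}" for T'
    using that
  proof (induction "card T'" arbitrary: T' rule: less_induct)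
    case less
    show ?case
    proof (cases "card T' = 1")
      case True
      then obtain i where "T' = {i}" by (auto simp: card_1_singleton_iff)
      then show ?thesis by (simp add: e_def p_def)
    next
      case False
      then have "2 \<le> card T'" using less.prems by (cases "card T'") (auto simp: card_eq_0_iff)
      then obtain T1 T2 where T12: "T1 \<noteq> {}" "T2 \<noteq> {}" "T1 \<inter> T2 = {}" "T1 \<union> T2 = T'"
        and adm: "mix_admissible \<gamma> r (\<Union>(Bl ` T2)) (\<Union>(Bl ` T1))"
        using sep[OF less.prems(2)] by blast
      have fin: "finite T1" "finite T2" using T12 less.prems by auto
      have cc: "card T' = card T1 + card T2" using card_Un_disjoint[OF fin T12(3)] T12(4) by simp
      have pos: "card T1 > 0" "card T2 > 0" using fin T12 by (auto simp: card_gt_0_iff)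
      have IH: "cmod (e T1 - p T1) \<le> \<alpha> * (real (card T1) - 1)" "cmod (e T2 - p T2) \<le> \<alpha> * (real (card T2) - 1)"
        using less.hyps[of T1] less.hyps[of T2] fin T12 cc pos less.prems by auto
      have d: "ae_determined (\<Union>(Bl ` S)) (\<lambda>\<omega>. \<Sum>i\<in>S. Y i \<omega>)" if "S \<subseteq> T'" "finite S" for S
      proof (rule ae_determined_sum[OF that(2)])
        fix i assume i: "i \<in> S"
        then have "ae_determined (Bl i) (Y i)" using det that less.prems by blast
        then show "ae_determined (\<Union>(Bl ` S)) (Y i)" by (rule ae_determined_mono) (use i in auto)
      qed
      note d1 = d[of T1] and d2 = d[of T2]
      have Ym: "Y i \<in> borel_measurable M" if "i \<in> T" for i using det[OF that] by (simp add: ae_determined_def)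
      have m: "(\<lambda>\<omega>. \<Sum>i\<in>T1. Y i \<omega>) \<in> borel_measurable M"
        using Ym T12 less.prems by (intro borel_measurable_sum) auto
      have split: "e T' = (\<integral>\<omega>. iexp (\<Sum>i\<in>T2. Y i \<omega>) * iexp (\<Sum>i\<in>T1. Y i \<omega>) \<partial>M)"
        unfolding e_def
      proof (rule Bochner_Integration.integral_cong[OF refl])
        fix \<omega>
        have "(\<Sum>i\<in>T'. Y i \<omega>) = (\<Sum>i\<in>T2. Y i \<omega>) + (\<Sum>i\<in>T1. Y i \<omega>)"
          using sum.union_disjoint[OF fin T12(3), of "\<lambda>i. Y i \<omega>"] T12(4) by simp
        then show "iexp (\<Sum>i\<in>T'. Y i \<omega>) = iexp (\<Sum>i\<in>T2. Y i \<omega>) * iexp (\<Sum>i\<in>T1. Y i \<omega>)"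
          by (simp only: of_real_add distrib_left exp_add)
      qed
      have 1: "cmod (e T' - e T2 * e T1) \<le> \<alpha>"
        unfolding split unfolding e_def \<alpha>_def
        using T12 fin by (intro covariance_ae_determined_unit[OF adm \<gamma> r] d) auto
      have pp: "p T' = p T2 * p T1"
        unfolding p_def using prod.union_disjoint[OF fin T12(3), of "\<lambda>i. \<integral>\<omega>. iexp (Y i \<omega>) \<partial>M"] T12(4) by (simp add: mult.commute)
      have e1: "cmod (e T1) \<le> 1" unfolding e_def by (rule cmod_iexp_expectation_le_1[OF m])
      have p2: "cmod (p T2) \<le> 1"
        unfolding p_def prod_norm[symmetric] using Ym T12 less.prems
        by (intro prod_le_1) (auto intro!: cmod_iexp_expectation_le_1)
      have "e T2 * e T1 - p T' = (e T2 - p T2) * e T1 + p T2 * (e T1 - p T1)"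
        unfolding pp by (simp add: algebra_simps)
      then have "cmod (e T2 * e T1 - p T') \<le> cmod (e T2 - p T2) * cmod (e T1) + cmod (p T2) * cmod (e T1 - p T1)"
        by (metis norm_triangle_ineq norm_mult)
      also have "\<dots> \<le> cmod (e T2 - p T2) * 1 + 1 * cmod (e T1 - p T1)"
        using e1 p2 by (intro add_mono mult_left_mono mult_right_mono) auto
      finally have 2: "cmod (e T2 * e T1 - p T') \<le> cmod (e T2 - p T2) + cmod (e T1 - p T1)" by simp
      have "cmod (e T' - p T') \<le> cmod (e T' - e T2 * e T1) + cmod (e T2 * e T1 - p T')"
        by (rule order_trans[OF _ norm_triangle_ineq]) simp
      also have "\<dots> \<le> \<alpha> + (\<alpha> * (real (card T2) - 1) + \<alpha> * (real (card T1) - 1))"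
        using 1 2 IH by linarith
      also have "\<dots> = \<alpha> * (real (card T') - 1)" by (simp add: cc algebra_simps)
      finally show ?thesis .
    qed
  qed
  assume "finite T"
  show ?thesis
  proof (cases "T = {}")
    case True
    then show ?thesis by (simp add: prob_space)
  next
    case False
    have "cmod (e T - p T) \<le> \<alpha> * (real (card T) - 1)" using main \<open>finite T\<close> False by blast
    also have "\<dots> \<le> \<alpha> * real (card T)" using \<alpha> by (intro mult_left_mono) auto
    finally show ?thesis by (simp add: e_def p_def \<alpha>_def)
  qed
qed

end

lemma pigeonhole_residue:
  fixes k :: "'d::euclidean_space \<Rightarrow> int"
  assumes W: "W \<in> sets borel" "emeasure lborel W < \<infinity>" and L: "L \<ge> 1"
    and k: "k \<in> borel \<rightarrow>\<^sub>M count_space UNIV"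
  shows "\<exists>j<int L. 0 \<le> j \<and> measure lborel {x \<in> W. k x mod int L = j} \<le> measure lborel W / real L"
proof (rule ccontr)
  assume neg: "\<not> ?thesis"
  define A where "A = (\<lambda>j. {x \<in> W. k x mod int L = j})"
  have A: "A j \<in> sets borel" for j
  proof -
    have "A j = W \<inter> (k -` {i. i mod int L = j} \<inter> space borel)" by (auto simp: A_def)
    also have "\<dots> \<in> sets borel" using W k by (intro sets.Int measurable_sets[OF k]) auto
    finally show ?thesis .
  qed
  have gt: "measure lborel W / real L < measure lborel (A j)" if "j \<in> {0..<int L}" for j
    using neg that by (auto simp: A_def not_le)
  have fin: "emeasure lborel (A j) \<noteq> \<infinity>" for j
    using W emeasure_mono[of "A j" W lborel] by (auto simp: A_def top_unique)
  have WA: "W = (\<Union>j\<in>{0..<int L}. A j)"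
    using L by (auto simp: A_def)
  have "measure lborel W = (\<Sum>j\<in>{0..<int L}. measure lborel (A j))"
    unfolding WA using A fin by (intro measure_finite_Union) (auto simp: disjoint_family_on_def A_def)
  also have "\<dots> > (\<Sum>j\<in>{0..<int L}. measure lborel W / real L)"
    using gt L by (intro sum_strict_mono) auto
  also have "(\<Sum>j\<in>{0..<int L}. measure lborel W / real L) = measure lborel W" using L by simp
  finally show False by simp
qed

text \<open>The cube index of a point along every axis is reduced modulo \<open>L\<close>; one residue class per axis is
  sacrificed as a corridor, chosen so that it carries at most a fraction \<open>1/L\<close> of the volume.\<close>
lemma grid_blocks:
  fixes W :: "'d::euclidean_space set"
  assumes W: "compact W" and q: "q > 2" and L: "L \<ge> (2::nat)"
  obtains T :: "('d \<Rightarrow> int) set" and Bl :: "('d \<Rightarrow> int) \<Rightarrow> 'd set" where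
    "finite T" "\<And>i. Bl i \<in> sets borel" "\<And>i. Bl i \<subseteq> W" "disjoint_family Bl"
    "measure lborel (W - (\<Union>i\<in>T. Bl i)) \<le> real DIM('d) * measure lborel W / real L"
    "\<And>i. measure lborel (Bl i) \<le> (real L * q) ^ DIM('d)"
    "\<And>i j s t. i \<noteq> j \<Longrightarrow> s \<in> Bl i \<Longrightarrow> t \<in> Bl j \<Longrightarrow> q \<le> norm (t - s)"
    "\<And>T'. T' \<subseteq> T \<Longrightarrow> 2 \<le> card T' \<Longrightarrow> \<exists>T1 T2. T1 \<noteq> {} \<and> T2 \<noteq> {} \<and> T1 \<inter> T2 = {} \<and> T1 \<union> T2 = T'
        \<and> mix_admissible (measure lborel (msum W (cball 0 1))) (q/2) (\<Union>(Bl ` T2)) (\<Union>(Bl ` T1))"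
    "real (card T) * kappa TYPE('d) \<le> measure lborel (msum W (cball 0 1))"
proof -
  have Wb: "W \<in> sets borel" using W by (rule borel_compact)
  have Wf: "emeasure lborel W < \<infinity>" using W by (rule emeasure_compact_finite)
  \<comment> \<open>Layer index along axis \<open>b\<close> for cubes of side \<open>q\<close>; a
    corridor is one such layer and has width \<open>q\<close>.\<close>
  define k where "k = (\<lambda>b (x::'d). \<lfloor>(x \<bullet> b) / q\<rfloor>)"
  have km: "k b \<in> borel \<rightarrow>\<^sub>M count_space UNIV" for b unfolding k_def by measurable
  have L1: "L \<ge> 1" using L by simp
  have "\<forall>b. \<exists>j<int L. 0 \<le> j \<and> measure lborel {x \<in> W. k b x mod int L = j} \<le> measure lborel W / real L"
    using pigeonhole_residue[OF Wb Wf L1 km] by blast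
  then obtain j where j: "\<And>b. j b < int L" "\<And>b. 0 \<le> j b"
    "\<And>b. measure lborel {x \<in> W. k b x mod int L = j b} \<le> measure lborel W / real L" by metis
  \<comment> \<open>The run of \<open>L\<close> layers, counted from the corridor residue
    \<open>j b\<close>, that contains \<open>x\<close>. The value 0 off \<open>Basis\<close> leaves
    only finitely many index functions for a bounded window.\<close>
  define id where "id = (\<lambda>x b. if b \<in> Basis then (k b x - j b) div int L else 0)"
  define good where "good = (\<lambda>x. \<forall>b\<in>Basis. \<not> int L dvd k b x - j b)"
  define Bl where "Bl = (\<lambda>i. {x \<in> W. good x \<and> id x = i})"
  define T where "T = id ` {x \<in> W. good x}"
  have corr: "k b x mod int L = j b" if "int L dvd k b x - j b" for b x
    using that j[of b] by (metis mod_eq_dvd_iff mod_pos_pos_trivial)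
  have setm: "{x. P (k b x)} \<in> sets borel" for P b
  proof -
    have "{x. P (k b x)} = k b -` {i. P i} \<inter> space borel" by auto
    then show ?thesis using measurable_sets[OF km, of "{i. P i}" b] by simp
  qed
  have Blb: "Bl i \<in> sets borel" for i
  proof (cases "\<forall>b. b \<notin> Basis \<longrightarrow> i b = 0")
    case True
    have "Bl i = W \<inter> (\<Inter>b\<in>Basis. {x. \<not> int L dvd k b x - j b \<and> (k b x - j b) div int L = i b})"
      using True by (auto simp: Bl_def good_def id_def fun_eq_iff)
    also have "\<dots> \<in> sets borel"
      using Wb nonempty_Basis by (intro sets.Int sets.finite_INT setm) auto
    finally show ?thesis .
  next
    case False
    then have "Bl i = {}" by (auto simp: Bl_def id_def)
    then show ?thesis by simp
  qed
  \<comment> \<open>Between index \<open>m\<close> and the next one along axis \<open>b\<close> lies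
    the corridor layer number \<open>j b + int L * m + int L\<close>. The fact \<open>lo\<close>
    places good points of index at most \<open>m\<close> below it, and \<open>hi\<close> places
    those of larger index above it.\<close>
  have lo: "x \<bullet> b < q * of_int (j b + int L * m + int L)"
    if "good x" "b \<in> Basis" "id x b \<le> m" for x b m
  proof -
    have L0: "int L > 0" using L by simp
    have "(k b x - j b) div int L \<le> m" using that by (simp add: id_def)
    then have "int L * ((k b x - j b) div int L) \<le> int L * m" using L0 by (intro mult_left_mono) auto
    moreover have "k b x - j b = int L * ((k b x - j b) div int L) + (k b x - j b) mod int L" by simp
    moreover have "(k b x - j b) mod int L < int L" using L0 by simp
    ultimately have "k b x - j b < int L * m + int L" by linarith
    then have "k b x + 1 \<le> j b + int L * m + int L" by (simp add: algebra_simps)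
    then have "of_int (k b x) + 1 \<le> (of_int (j b + int L * m + int L) :: real)" by linarith
    moreover have "(x \<bullet> b) / q < of_int (k b x) + 1" unfolding k_def by linarith
    ultimately have "(x \<bullet> b) / q < of_int (j b + int L * m + int L)" by linarith
    then show ?thesis using q by (simp add: divide_less_eq mult.commute)
  qed
  have hi: "q * of_int (j b + int L * m + int L) + q \<le> x \<bullet> b"
    if "good x" "b \<in> Basis" "m < id x b" for x b m
  proof -
    have L0: "int L > 0" using L by simp
    have "m + 1 \<le> (k b x - j b) div int L" using that by (simp add: id_def)
    then have "int L * (m + 1) \<le> int L * ((k b x - j b) div int L)" using L0 by (intro mult_left_mono) auto
    moreover have "k b x - j b = int L * ((k b x - j b) div int L) + (k b x - j b) mod int L" by simp
    moreover have "(k b x - j b) mod int L \<ge> 1"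
    proof -
      have "(k b x - j b) mod int L \<noteq> 0" using that by (auto simp: good_def dvd_eq_mod_eq_0)
      moreover have "(k b x - j b) mod int L \<ge> 0" using L0 by simp
      ultimately show ?thesis by linarith
    qed
    ultimately have "int L * (m + 1) + 1 \<le> k b x - j b" by linarith
    then have "j b + int L * m + int L + 1 \<le> k b x" by (simp add: algebra_simps)
    then have "of_int (j b + int L * m + int L) + 1 \<le> (of_int (k b x) :: real)" by linarith
    moreover have "of_int (k b x) \<le> (x \<bullet> b) / q" unfolding k_def by linarith
    ultimately have "of_int (j b + int L * m + int L) + 1 \<le> (x \<bullet> b) / q" by linarith
    then have "(of_int (j b + int L * m + int L) + 1) * q \<le> x \<bullet> b" using q by (simp add: le_divide_eq)
    then show ?thesis by (simp add: algebra_simps)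
  qed
  have fc: "compact (msum W (cball 0 1))" unfolding msum_def using W by (intro compact_sums) auto
  have fT: "finite T"
  proof -
    obtain R where R: "\<And>x. x \<in> W \<Longrightarrow> norm x \<le> R" using compact_imp_bounded[OF W] by (auto simp: bounded_iff)
    define N where "N = \<lceil>\<bar>R\<bar> / q\<rceil> + 1"
    define V where "V = (\<Union>b\<in>Basis. (\<lambda>z. (z - j b) div int L) ` {- N..N})"
    have "id x b \<in> V" if "x \<in> W" "b \<in> Basis" for x b
    proof -
      have "\<bar>x \<bullet> b\<bar> \<le> \<bar>R\<bar>" using Basis_le_norm[OF that(2), of x] R[OF that(1)] by linarith
      then have "\<bar>(x \<bullet> b) / q\<bar> \<le> \<bar>R\<bar> / q" using q by (simp add: divide_right_mono)
      then have "k b x \<in> {- N..N}" unfolding k_def N_def by (simp, linarith)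
      then have "(k b x - j b) div int L \<in> (\<lambda>z. (z - j b) div int L) ` {- N..N}" by (rule imageI)
      then show ?thesis using that(2) unfolding V_def id_def by auto
    qed
    then have "T \<subseteq> {f. \<forall>b. (b \<in> Basis \<longrightarrow> f b \<in> V) \<and> (b \<notin> Basis \<longrightarrow> f b = 0)}"
      by (auto simp: T_def id_def)
    then show ?thesis by (rule finite_subset) (intro finite_set_of_finite_funs, auto simp: V_def)
  qed
  have far: "q < norm (t - s)" if ne: "i \<noteq> i'" and sB: "s \<in> Bl i" and tB: "t \<in> Bl i'" for i i' s t
  proof -
    have *: "q < norm (t - s)" if "s \<in> W" "good s" "t \<in> W" "good t" "id s b < id t b" for s t b
    proof -
      have b: "b \<in> Basis" using that(5) by (auto simp: id_def split: if_splits)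
      have "q < (t - s) \<bullet> b"
        using lo[OF that(2) b order_refl] hi[OF that(4) b that(5)] by (simp add: inner_diff_left)
      also have "\<dots> \<le> norm (t - s)" using Basis_le_norm[OF b, of "t - s"] by linarith
      finally show ?thesis .
    qed
    have st: "s \<in> W" "good s" "id s = i" "t \<in> W" "good t" "id t = i'" using sB tB by (auto simp: Bl_def)
    then obtain b where "id s b \<noteq> id t b" using ne by (auto simp: fun_eq_iff)
    then show ?thesis using *[of s t b] *[of t s b] st by (auto simp: neq_iff norm_minus_commute)
  qed
  show thesis
  proof (rule that[of T Bl])
    show "finite T" by (rule fT)
    show "\<And>i. Bl i \<in> sets borel" by (rule Blb)
    show "\<And>i. Bl i \<subseteq> W" by (auto simp: Bl_def)
    show "disjoint_family Bl" by (auto simp: disjoint_family_on_def Bl_def)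
    show "\<And>i j s t. i \<noteq> j \<Longrightarrow> s \<in> Bl i \<Longrightarrow> t \<in> Bl j \<Longrightarrow> q \<le> norm (t - s)" using far less_imp_le by blast
    show "measure lborel (W - (\<Union>i\<in>T. Bl i)) \<le> real DIM('d) * measure lborel W / real L"
    proof -
      have K: "{x \<in> W. k b x mod int L = j b} \<in> sets borel" for b
        using sets.Int[OF Wb setm[of "\<lambda>i. i mod int L = j b" b]] by (simp add: Int_def)
      have Kf: "emeasure lborel {x \<in> W. k b x mod int L = j b} < \<infinity>" for b
        by (rule le_less_trans[OF emeasure_mono Wf]) (auto simp: Wb)
      have "W - (\<Union>i\<in>T. Bl i) \<subseteq> (\<Union>b\<in>Basis. {x \<in> W. k b x mod int L = j b})"
      proof
        fix x assume x: "x \<in> W - (\<Union>i\<in>T. Bl i)"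
        have "\<not> good x"
        proof
          assume "good x"
          then have "id x \<in> T" "x \<in> Bl (id x)" using x by (auto simp: T_def Bl_def)
          then show False using x by blast
        qed
        then obtain b where "b \<in> Basis" "int L dvd k b x - j b" by (auto simp: good_def)
        then show "x \<in> (\<Union>b\<in>Basis. {x \<in> W. k b x mod int L = j b})" using corr x by blast
      qed
      then have "measure lborel (W - (\<Union>i\<in>T. Bl i)) \<le> measure lborel (\<Union>b\<in>Basis. {x \<in> W. k b x mod int L = j b})"
      proof (rule measure_mono_fmeasurable)
        have "W - (\<Union>i\<in>T. Bl i) \<in> sets borel" using Wb fT Blb by (intro sets.Diff sets.finite_UN) auto
        then show "W - (\<Union>i\<in>T. Bl i) \<in> sets lborel" by simp
        have Wfm: "W \<in> fmeasurable lborel" using Wb Wf by (intro fmeasurableI) auto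
        have "(\<Union>b\<in>Basis. {x \<in> W. k b x mod int L = j b}) \<in> sets borel" using K by (intro sets.finite_UN) auto
        then show "(\<Union>b\<in>Basis. {x \<in> W. k b x mod int L = j b}) \<in> fmeasurable lborel"
          by (intro fmeasurableI2[OF Wfm]) auto
      qed
      also have "\<dots> \<le> (\<Sum>b\<in>(Basis::'d set). measure lborel {x \<in> W. k b x mod int L = j b})"
        using K Kf by (intro measure_UNION_le) (auto intro!: fmeasurableI)
      also have "\<dots> \<le> (\<Sum>b\<in>(Basis::'d set). measure lborel W / real L)" by (intro sum_mono j)
      finally show ?thesis by simp
    qed
    show "measure lborel (Bl i) \<le> (real L * q) ^ DIM('d)" for i
    proof -
      define a where "a = (\<Sum>b\<in>Basis. (q * of_int (j b + int L * i b)) *\<^sub>R b :: 'd)"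
      define c where "c = (\<Sum>b\<in>Basis. (q * of_int (j b + int L * i b + int L)) *\<^sub>R b :: 'd)"
      have ac: "a \<bullet> b = q * of_int (j b + int L * i b)" "c \<bullet> b = q * of_int (j b + int L * i b + int L)" if "b \<in> Basis" for b
        using that by (simp_all add: a_def c_def)
      have "Bl i \<subseteq> cbox a c"
      proof
        fix x assume "x \<in> Bl i"
        then have x: "good x" "id x = i" by (auto simp: Bl_def)
        show "x \<in> cbox a c"
        proof (unfold mem_box, intro ballI conjI)
          fix b :: 'd assume b: "b \<in> Basis"
          have "q * of_int (j b + int L * (i b - 1) + int L) + q \<le> x \<bullet> b"
            using hi[OF x(1) b, of "i b - 1"] x(2) by simp
          then have "q * of_int (j b + int L * i b) + q \<le> x \<bullet> b" by (simp add: right_diff_distrib)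
          then show "a \<bullet> b \<le> x \<bullet> b" using q ac[OF b] by linarith
          show "x \<bullet> b \<le> c \<bullet> b" using lo[OF x(1) b, of "i b"] x(2) ac[OF b] by simp
        qed
      qed
      then have "measure lborel (Bl i) \<le> measure lborel (cbox a c)"
        using Blb by (intro measure_mono_fmeasurable) (auto intro: fmeasurable_cbox)
      also have "\<dots> = (\<Prod>b\<in>(Basis::'d set). c \<bullet> b - a \<bullet> b)"
        using q by (intro content_cbox) (auto simp: ac)
      also have "\<dots> = (\<Prod>b\<in>(Basis::'d set). real L * q)"
        by (intro prod.cong refl) (simp add: ac algebra_simps)
      finally show ?thesis by simp
    qed
    show "\<exists>T1 T2. T1 \<noteq> {} \<and> T2 \<noteq> {} \<and> T1 \<inter> T2 = {} \<and> T1 \<union> T2 = T'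
        \<and> mix_admissible (measure lborel (msum W (cball 0 1))) (q/2) (\<Union>(Bl ` T2)) (\<Union>(Bl ` T1))"
      if T': "T' \<subseteq> T" "2 \<le> card T'" for T'
    proof -
      obtain i i' where ii: "i \<in> T'" "i' \<in> T'" "i \<noteq> i'"
        using T'(2) by (metis One_nat_def Suc_1 card_le_Suc0_iff_eq finite_subset[OF T'(1) fT] not_less_eq_eq)
      obtain b where b0: "i b \<noteq> i' b" using ii(3) by (auto simp: fun_eq_iff)
      have "v b = 0" if "v \<in> T" "b \<notin> Basis" for v using that by (auto simp: T_def id_def)
      then have b: "b \<in> Basis" using b0 ii T'(1) by (metis subsetD)
      \<comment> \<open>The smaller of two differing coordinates of block indices; cutting right
        above it leaves one of the two blocks on either side.\<close>
      define m where "m = min (i b) (i' b)"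
      define T1 where "T1 = {v \<in> T'. v b \<le> m}"
      define T2 where "T2 = {v \<in> T'. m < v b}"
      have "T1 \<noteq> {}" "T2 \<noteq> {}" using ii b0 unfolding T1_def T2_def m_def
        by (auto simp: min_def split: if_splits)
      moreover have "T1 \<inter> T2 = {}" "T1 \<union> T2 = T'" by (auto simp: T1_def T2_def)
      moreover have "mix_admissible (measure lborel (msum W (cball 0 1))) (q/2) (\<Union>(Bl ` T2)) (\<Union>(Bl ` T1))"
      \<comment> \<open>The two bounding hyperplanes are \<open>q\<close> apart; admissibility asks
        for a strict inequality, and \<open>q/2\<close> leaves room for it.\<close>
      proof (rule mix_admissibleI[where u = b and a = "q * of_int (j b + int L * m + int L)" and b = "q * of_int (j b + int L * m + int L) + q"])
        show "norm b = 1" using b by simp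
        show "q * of_int (j b + int L * m + int L) + q \<le> b \<bullet> x" if "x \<in> \<Union>(Bl ` T2)" for x
        proof -
          from that have "good x" "m < id x b" by (auto simp: Bl_def T2_def)
          from hi[OF this(1) b this(2)] show ?thesis by (simp only: inner_commute[of b x])
        qed
        show "b \<bullet> x \<le> q * of_int (j b + int L * m + int L)" if "x \<in> \<Union>(Bl ` T1)" for x
        proof -
          from that have "good x" "id x b \<le> m" by (auto simp: Bl_def T1_def)
          from lo[OF this(1) b this(2)] show ?thesis by (simp only: inner_commute[of b x] less_imp_le)
        qed
        have "msum (\<Union>(Bl ` T2) \<union> \<Union>(Bl ` T1)) (cball 0 1) \<subseteq> msum W (cball 0 1)"
          by (auto simp: msum_def Bl_def)
        then have "emeasure lebesgue (msum (\<Union>(Bl ` T2) \<union> \<Union>(Bl ` T1)) (cball 0 1)) \<le> emeasure lebesgue (msum W (cball 0 1))"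
          using borel_compact[OF fc] by (intro emeasure_mono) auto
        also have "\<dots> = emeasure lborel (msum W (cball 0 1))" using borel_compact[OF fc] by simp
        also have "\<dots> = ennreal (measure lborel (msum W (cball 0 1)))"
          using emeasure_compact_finite[OF fc] by (intro emeasure_eq_ennreal_measure) auto
        finally show "emeasure lebesgue (msum (\<Union>(Bl ` T2) \<union> \<Union>(Bl ` T1)) (cball 0 1)) \<le> ennreal (measure lborel (msum W (cball 0 1)))" .
      qed (use q in auto)
      ultimately show ?thesis by blast
    qed
    show "real (card T) * kappa TYPE('d) \<le> measure lborel (msum W (cball 0 1))"
    proof -
      \<comment> \<open>One point is picked from each block. The unit balls around them are
        disjoint, since blocks are more than 2 apart, and lie in the dilated window, so its volume
        bounds the number of blocks.\<close>
      have "\<forall>i\<in>T. \<exists>x. x \<in> Bl i" by (auto simp: T_def Bl_def)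
      then obtain x where x: "\<And>i. i \<in> T \<Longrightarrow> x i \<in> Bl i" by metis
      have "real (card T) * kappa TYPE('d) = (\<Sum>i\<in>T. measure lborel (cball (x i) 1))"
      proof -
        have "measure lborel (cball (y::'d) 1) = kappa TYPE('d)" for y
          using emeasure_cball_kappa[of y] kappa_pos[where 'd = 'd] by (simp add: measure_def)
        then show ?thesis by simp
      qed
      also have "\<dots> = measure lborel (\<Union>i\<in>T. cball (x i) 1)"
      proof (rule measure_finite_Union[symmetric])
        show "disjoint_family_on (\<lambda>i. cball (x i) 1) T"
          unfolding disjoint_family_on_def
        proof (intro ballI impI)
          fix i i' assume "i \<in> T" "i' \<in> T" "i \<noteq> i'"
          then have "2 < norm (x i' - x i)" using far[of i i' "x i" "x i'"] x q by force
          then show "cball (x i) 1 \<inter> cball (x i') 1 = {}"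
            by (intro disjoint_cballI) (simp add: dist_norm norm_minus_commute)
        qed
        show "emeasure lborel (cball (x i) 1) \<noteq> \<infinity>" if "i \<in> T" for i by (simp add: emeasure_cball_kappa)
      qed (auto simp: fT)
      also have "\<dots> \<le> measure lborel (msum W (cball 0 1))"
      proof (rule measure_mono_fmeasurable)
        show "(\<Union>i\<in>T. cball (x i) 1) \<subseteq> msum W (cball 0 1)"
        proof
          fix y assume "y \<in> (\<Union>i\<in>T. cball (x i) 1)"
          then obtain i where i: "i \<in> T" "dist (x i) y \<le> 1" by auto
          have "x i \<in> W" using x[OF i(1)] by (auto simp: Bl_def)
          moreover have "y - x i \<in> cball 0 1" using i(2) by (simp add: dist_norm norm_minus_commute)
          moreover have "y = x i + (y - x i)" by simp
          ultimately show "y \<in> msum W (cball 0 1)" unfolding msum_def by blast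
        qed
        show "msum W (cball 0 1) \<in> fmeasurable lborel"
          using borel_compact[OF fc] emeasure_compact_finite[OF fc] by (intro fmeasurableI) auto
      qed (auto simp: fT)
      finally show ?thesis .
    qed
  qed
qed

section \<open>The central limit theorem for bounded functions of the field\<close>

lemma cmod_iexp_diff_le: "cmod (iexp x - iexp y) \<le> \<bar>x - y\<bar>"
proof -
  have "iexp x = iexp y * iexp (x - y)"
    by (simp add: exp_add[symmetric] algebra_simps)
  then have "cmod (iexp x - iexp y) = cmod (iexp y * (iexp (x - y) - 1))" by (simp add: algebra_simps)
  also have "\<dots> = cmod (iexp (x - y) - 1)" by (simp add: norm_mult norm_exp_i_times)
  also have "\<dots> \<le> \<bar>x - y\<bar>" using iexp_approx1[of "x - y" 0] by simp
  finally show ?thesis .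
qed

lemma abs_exp_minus_diff_le:
  fixes x y :: real
  assumes "x \<ge> 0" "y \<ge> 0"
  shows "\<bar>exp (- x) - exp (- y)\<bar> \<le> \<bar>x - y\<bar>"
proof -
  have *: "exp (- a) - exp (- b) \<le> b - a" if "0 \<le> a" "a \<le> b" for a b :: real
  proof -
    have "exp (- a) - exp (- b) = exp (- a) * (1 - exp (- (b - a)))"
      by (simp add: right_diff_distrib exp_add[symmetric])
    also have "1 - exp (- (b - a)) \<le> b - a" using exp_ge_add_one_self[of "- (b - a)"] by linarith
    then have "exp (- a) * (1 - exp (- (b - a))) \<le> 1 * (b - a)"
      using that by (intro mult_mono) auto
    finally show ?thesis by simp
  qed
  show ?thesis
  proof (cases "x \<le> y")
    case True
    then have "exp (- y) \<le> exp (- x)" by simp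
    then show ?thesis using *[OF assms(1) True] True by simp
  next
    case False
    then have "exp (- x) \<le> exp (- y)" by simp
    then show ?thesis using *[OF assms(2), of x] False by simp
  qed
qed

context centered_field
begin

lemma S_Un:
  assumes A: "fin_set A" and B: "fin_set B" and AB: "A \<inter> B = {}" and \<omega>: "\<omega> \<in> space M"
  shows "S g (A \<union> B) \<omega> = S g A \<omega> + S g B \<omega>"
proof -
  have i: "set_integrable lborel D (\<lambda>t. g (X t \<omega>))" if "fin_set D" for D
    unfolding set_integrable_def using path_integrable[OF g_measurable g_le_1 fin_setD[OF that] \<omega>] by simp
  show ?thesis unfolding S_def by (rule set_integral_Un[OF AB i[OF A] i[OF B]])
qed

lemma fin_set_Un: "fin_set A \<Longrightarrow> fin_set B \<Longrightarrow> fin_set (A \<union> B)"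
  unfolding fin_set_def using emeasure_subadditive[of A lborel B]
  by (auto intro: le_less_trans)

lemma fin_set_empty: "fin_set {}" by (simp add: fin_set_def)

lemma fin_set_UN: "finite T \<Longrightarrow> (\<And>i. i \<in> T \<Longrightarrow> fin_set (B i)) \<Longrightarrow> fin_set (\<Union>i\<in>T. B i)"
  by (induction T rule: finite_induct) (auto intro: fin_set_Un fin_set_empty)

lemma fin_set_subset: "fin_set W \<Longrightarrow> A \<in> sets borel \<Longrightarrow> A \<subseteq> W \<Longrightarrow> fin_set A"
  unfolding fin_set_def using emeasure_mono[of A W lborel] by (auto intro: le_less_trans)

lemma S_UN:
  assumes "finite T" "\<And>i. i \<in> T \<Longrightarrow> fin_set (B i)" "disjoint_family_on B T" and \<omega>: "\<omega> \<in> space M"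
  shows "S g (\<Union>i\<in>T. B i) \<omega> = (\<Sum>i\<in>T. S g (B i) \<omega>)"
  using assms(1,2,3)
proof (induction T rule: finite_induct)
  case empty
  then show ?case by (simp add: S_def set_lebesgue_integral_def)
next
  case (insert i T)
  have "B i \<inter> (\<Union>i\<in>T. B i) = {}" using insert.prems(2) insert.hyps by (auto simp: disjoint_family_on_def)
  moreover have "fin_set (\<Union>i\<in>T. B i)" using insert by (intro fin_set_UN) auto
  moreover have "disjoint_family_on B T" using insert.prems(2) by (auto simp: disjoint_family_on_def)
  ultimately show ?case using insert S_Un[of "B i" "\<Union>i\<in>T. B i"] \<omega> by simp
qed

lemma vol_UN:
  assumes "finite T" "\<And>i. i \<in> T \<Longrightarrow> fin_set (B i)" "disjoint_family_on B T"
  shows "vol (\<Union>i\<in>T. B i) = (\<Sum>i\<in>T. vol (B i))"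
  unfolding vol_def using assms fin_setD by (intro measure_finite_Union) (auto simp: less_top)

lemma vol_mono: "fin_set W \<Longrightarrow> A \<in> sets borel \<Longrightarrow> A \<subseteq> W \<Longrightarrow> vol A \<le> vol W"
  unfolding vol_def using fin_setD by (intro measure_mono_fmeasurable) (auto intro!: fmeasurableI)

text \<open>Dropping the corridors \<open>K\<close> costs two cross terms and one square, each at
  most \<open>HH * vol K\<close>. Every block is paired with the union of the others at once, which
  costs \<open>vol (B i) * tail q\<close> and no factor for the number of blocks.\<close>

lemma block_variance:
  assumes T: "finite T" and B: "\<And>i. i \<in> T \<Longrightarrow> fin_set (B i)" and dis: "disjoint_family_on B T"
    and W: "fin_set W" and BW: "(\<Union>i\<in>T. B i) \<subseteq> W"
    and q: "\<And>i j s t. i \<in> T \<Longrightarrow> j \<in> T \<Longrightarrow> i \<noteq> j \<Longrightarrow> s \<in> B i \<Longrightarrow> t \<in> B j \<Longrightarrow> q \<le> norm (t - s)"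
  shows "\<bar>expectation (\<lambda>\<omega>. (S g W \<omega>)\<^sup>2) - (\<Sum>i\<in>T. expectation (\<lambda>\<omega>. (S g (B i) \<omega>)\<^sup>2))\<bar>
    \<le> vol W * tail q + 3 * HH * vol (W - (\<Union>i\<in>T. B i))"
proof -
  define U where "U = (\<Union>i\<in>T. B i)"
  define K where "K = W - U"
  have U: "fin_set U" unfolding U_def by (rule fin_set_UN[OF T B])
  have K: "fin_set K" unfolding K_def using W U fin_setD by (intro fin_set_subset[OF W]) auto
  have WUK: "W = U \<union> K" "U \<inter> K = {}" using BW by (auto simp: K_def U_def)
  have tail0: "tail 0 = HH" by (simp add: tail_def HH_def)
  note bi = bounded_rv_integrable[OF bounded_rv_mult[OF bounded_rv_S bounded_rv_S]]
  have "expectation (\<lambda>\<omega>. (S g W \<omega>)\<^sup>2) = expectation (\<lambda>\<omega>. S g U \<omega> * S g U \<omega> + 2 * (S g K \<omega> * S g U \<omega>) + S g K \<omega> * S g K \<omega>)"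
  proof (rule Bochner_Integration.integral_cong[OF refl])
    fix \<omega> assume "\<omega> \<in> space M"
    then have "S g W \<omega> = S g U \<omega> + S g K \<omega>" unfolding WUK(1) by (intro S_Un[OF U K WUK(2)])
    then show "(S g W \<omega>)\<^sup>2 = S g U \<omega> * S g U \<omega> + 2 * (S g K \<omega> * S g U \<omega>) + S g K \<omega> * S g K \<omega>"
      by (simp add: power2_eq_square algebra_simps)
  qed
  also have "\<dots> = expectation (\<lambda>\<omega>. S g U \<omega> * S g U \<omega>) + 2 * expectation (\<lambda>\<omega>. S g K \<omega> * S g U \<omega>) + expectation (\<lambda>\<omega>. S g K \<omega> * S g K \<omega>)"
    using bi[OF U U] bi[OF K U] bi[OF K K] by simp
  finally have "expectation (\<lambda>\<omega>. (S g W \<omega>)\<^sup>2) - expectation (\<lambda>\<omega>. S g U \<omega> * S g U \<omega>)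
     = 2 * expectation (\<lambda>\<omega>. S g K \<omega> * S g U \<omega>) + expectation (\<lambda>\<omega>. S g K \<omega> * S g K \<omega>)" by simp
  moreover have "\<bar>expectation (\<lambda>\<omega>. S g K \<omega> * S g U \<omega>)\<bar> \<le> vol K * HH"
    using cross_moment[OF K U, of 0] by (simp add: tail0)
  moreover have "\<bar>expectation (\<lambda>\<omega>. S g K \<omega> * S g K \<omega>)\<bar> \<le> vol K * HH"
    using cross_moment[OF K K, of 0] unfolding tail0 by simp
  ultimately have "\<bar>expectation (\<lambda>\<omega>. (S g W \<omega>)\<^sup>2) - expectation (\<lambda>\<omega>. S g U \<omega> * S g U \<omega>)\<bar> \<le> 3 * (vol K * HH)"
    by linarith
  then have 1: "\<bar>expectation (\<lambda>\<omega>. (S g W \<omega>)\<^sup>2) - expectation (\<lambda>\<omega>. S g U \<omega> * S g U \<omega>)\<bar> \<le> 3 * HH * vol K"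
    by (simp only: mult_ac)
  have "expectation (\<lambda>\<omega>. S g U \<omega> * S g U \<omega>) = expectation (\<lambda>\<omega>. \<Sum>i\<in>T. S g (B i) \<omega> * S g (B i) \<omega> + S g (B i) \<omega> * S g (U - B i) \<omega>)"
  proof (rule Bochner_Integration.integral_cong[OF refl])
    fix \<omega> assume \<omega>: "\<omega> \<in> space M"
    have sp: "S g U \<omega> = S g (B i) \<omega> + S g (U - B i) \<omega>" if "i \<in> T" for i
    proof -
      have "U = B i \<union> (U - B i)" using that by (auto simp: U_def)
      moreover have "fin_set (U - B i)" using U B[OF that] fin_setD by (intro fin_set_subset[OF U]) auto
      ultimately show ?thesis using S_Un[OF B[OF that], of "U - B i" \<omega>] \<omega> by auto
    qed
    have "S g U \<omega> * S g U \<omega> = (\<Sum>i\<in>T. S g (B i) \<omega>) * S g U \<omega>"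
      using S_UN[OF T B dis \<omega>] by (simp add: U_def)
    also have "\<dots> = (\<Sum>i\<in>T. S g (B i) \<omega> * S g U \<omega>)" by (rule sum_distrib_right)
    also have "\<dots> = (\<Sum>i\<in>T. S g (B i) \<omega> * S g (B i) \<omega> + S g (B i) \<omega> * S g (U - B i) \<omega>)"
      by (rule sum.cong[OF refl]) (subst sp, assumption, rule distrib_left)
    finally show "S g U \<omega> * S g U \<omega> = (\<Sum>i\<in>T. S g (B i) \<omega> * S g (B i) \<omega> + S g (B i) \<omega> * S g (U - B i) \<omega>)" .
  qed
  also have "\<dots> = (\<Sum>i\<in>T. expectation (\<lambda>\<omega>. S g (B i) \<omega> * S g (B i) \<omega>) + expectation (\<lambda>\<omega>. S g (B i) \<omega> * S g (U - B i) \<omega>))"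
  proof -
    have UB: "fin_set (U - B i)" if "i \<in> T" for i using U B[OF that] fin_setD by (intro fin_set_subset[OF U]) auto
    have "expectation (\<lambda>\<omega>. \<Sum>i\<in>T. S g (B i) \<omega> * S g (B i) \<omega> + S g (B i) \<omega> * S g (U - B i) \<omega>)
      = (\<Sum>i\<in>T. expectation (\<lambda>\<omega>. S g (B i) \<omega> * S g (B i) \<omega> + S g (B i) \<omega> * S g (U - B i) \<omega>))"
      by (rule Bochner_Integration.integral_sum) (intro Bochner_Integration.integrable_add bi B UB)
    also have "\<dots> = (\<Sum>i\<in>T. expectation (\<lambda>\<omega>. S g (B i) \<omega> * S g (B i) \<omega>) + expectation (\<lambda>\<omega>. S g (B i) \<omega> * S g (U - B i) \<omega>))"
      by (rule sum.cong[OF refl], rule Bochner_Integration.integral_add) (intro bi B UB; assumption)+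
    finally show ?thesis .
  qed
  finally have "expectation (\<lambda>\<omega>. S g U \<omega> * S g U \<omega>) - (\<Sum>i\<in>T. expectation (\<lambda>\<omega>. (S g (B i) \<omega>)\<^sup>2))
     = (\<Sum>i\<in>T. expectation (\<lambda>\<omega>. S g (B i) \<omega> * S g (U - B i) \<omega>))"
    by (simp add: sum.distrib power2_eq_square)
  also have "\<bar>\<dots>\<bar> \<le> (\<Sum>i\<in>T. vol (B i) * tail q)"
  proof (rule order_trans[OF sum_abs sum_mono])
    fix i assume i: "i \<in> T"
    have "fin_set (U - B i)" using U B[OF i] fin_setD by (intro fin_set_subset[OF U]) auto
    then show "\<bar>expectation (\<lambda>\<omega>. S g (B i) \<omega> * S g (U - B i) \<omega>)\<bar> \<le> vol (B i) * tail q"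
    proof (rule cross_moment[OF B[OF i]])
      fix s t assume s: "s \<in> B i" and "t \<in> U - B i"
      then obtain j where "j \<in> T" "t \<in> B j" "i \<noteq> j" by (auto simp: U_def)
      then show "q \<le> norm (t - s)" using q i s by blast
    qed
  qed
  also have "\<dots> = vol U * tail q" unfolding U_def by (simp add: vol_UN[OF T B dis] sum_distrib_right)
  also have "\<dots> \<le> vol W * tail q"
    using vol_mono[OF W, of U] U fin_setD BW tail_nonneg by (intro mult_right_mono) (auto simp: U_def)
  finally have 2: "\<bar>expectation (\<lambda>\<omega>. S g U \<omega> * S g U \<omega>) - (\<Sum>i\<in>T. expectation (\<lambda>\<omega>. (S g (B i) \<omega>)\<^sup>2))\<bar> \<le> vol W * tail q" .
  show ?thesis using 1 2 unfolding K_def U_def by linarith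
qed

text \<open>The exponentials differ by at most the size \<open>x\<close> of the scaled corridor
  part, and \<open>x \<le> e + x\<^sup>2 / e\<close> reduces this to a second moment.\<close>

lemma remainder_char:
  fixes t :: real
  assumes W: "fin_set W" "vol W > 0" and U: "U \<in> sets borel" "U \<subseteq> W" and e: "e > 0"
  defines "c \<equiv> t / sqrt (vol W)"
  shows "cmod ((\<integral>\<omega>. iexp (c * S g W \<omega>) \<partial>M) - (\<integral>\<omega>. iexp (c * S g U \<omega>) \<partial>M)) \<le> e + t\<^sup>2 * HH * (vol (W - U) / vol W) / e"
proof -
  have fU: "fin_set U" by (rule fin_set_subset[OF W(1) U])
  have fK: "fin_set (W - U)" using fin_setD[OF W(1)] U by (intro fin_set_subset[OF W(1)]) auto
  have WUK: "W = U \<union> (W - U)" using U by auto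
  have c2: "c\<^sup>2 = t\<^sup>2 / vol W" using W(2) by (simp add: c_def power_divide)
  have m[measurable]: "S g D \<in> borel_measurable M" if "fin_set D" for D
    using bounded_rv_S[OF that] by (simp add: bounded_rv_def)
  note [measurable] = m[OF W(1)] m[OF fU] m[OF fK]
  have ii: "integrable M (\<lambda>\<omega>. iexp (c * S g D \<omega>))" if "fin_set D" for D
  proof -
    note [measurable] = m[OF that]
    show ?thesis by (rule integrable_const_bound[of _ 1]) (auto simp: norm_exp_i_times)
  qed
  have pw: "cmod (iexp (c * S g W \<omega>) - iexp (c * S g U \<omega>)) \<le> e + c\<^sup>2 * (S g (W - U) \<omega>)\<^sup>2 / e" if "\<omega> \<in> space M" for \<omega>
  proof -
    have "S g W \<omega> = S g U \<omega> + S g (W - U) \<omega>" using S_Un[OF fU fK _ that] WUK by auto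
    then have "cmod (iexp (c * S g W \<omega>) - iexp (c * S g U \<omega>)) \<le> \<bar>c * S g (W - U) \<omega>\<bar>"
      using cmod_iexp_diff_le[of "c * S g W \<omega>" "c * S g U \<omega>"] by (simp add: distrib_left)
    also have "\<dots> \<le> e + (c * S g (W - U) \<omega>)\<^sup>2 / e"
    proof -
      define y where "y = \<bar>c * S g (W - U) \<omega>\<bar>"
      have "0 \<le> (e - y)\<^sup>2" by simp
      then have "2 * (e * y) \<le> e * e + y\<^sup>2" by (simp add: power2_eq_square algebra_simps)
      moreover have "0 \<le> e * y" using e by (simp add: y_def)
      ultimately have "e * y \<le> e * e + y\<^sup>2" by linarith
      then have "y \<le> (e * e + y\<^sup>2) / e" using e by (simp add: pos_le_divide_eq mult.commute)
      also have "\<dots> = e + y\<^sup>2 / e" using e by (simp add: add_divide_distrib)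
      finally show ?thesis by (simp add: y_def)
    qed
    finally show ?thesis by (simp add: power_mult_distrib)
  qed
  have i2: "integrable M (\<lambda>\<omega>. (S g (W - U) \<omega>)\<^sup>2)"
    using bounded_rv_integrable[OF bounded_rv_mult[OF bounded_rv_S[OF fK] bounded_rv_S[OF fK]]] by (simp add: power2_eq_square)
  have "cmod ((\<integral>\<omega>. iexp (c * S g W \<omega>) \<partial>M) - (\<integral>\<omega>. iexp (c * S g U \<omega>) \<partial>M))
     = cmod (\<integral>\<omega>. iexp (c * S g W \<omega>) - iexp (c * S g U \<omega>) \<partial>M)"
    using Bochner_Integration.integral_diff[OF ii[OF W(1)] ii[OF fU]] by simp
  also have "\<dots> \<le> (\<integral>\<omega>. cmod (iexp (c * S g W \<omega>) - iexp (c * S g U \<omega>)) \<partial>M)" by (rule integral_norm_bound)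
  also have "\<dots> \<le> (\<integral>\<omega>. e + c\<^sup>2 * (S g (W - U) \<omega>)\<^sup>2 / e \<partial>M)"
  proof (rule integral_mono)
    show "integrable M (\<lambda>\<omega>. cmod (iexp (c * S g W \<omega>) - iexp (c * S g U \<omega>)))"
      by (rule integrable_norm[OF Bochner_Integration.integrable_diff[OF ii[OF W(1)] ii[OF fU]]])
    show "integrable M (\<lambda>\<omega>. e + c\<^sup>2 * (S g (W - U) \<omega>)\<^sup>2 / e)" using i2 by simp
  qed (rule pw)
  also have "\<dots> = e + c\<^sup>2 * expectation (\<lambda>\<omega>. (S g (W - U) \<omega>)\<^sup>2) / e" using i2 by (simp add: prob_space)
  also have "\<dots> \<le> e + c\<^sup>2 * (HH * vol (W - U)) / e"
    using second_moment[OF fK] e by (intro add_left_mono divide_right_mono mult_left_mono) auto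
  also have "\<dots> = e + t\<^sup>2 * HH * (vol (W - U) / vol W) / e" by (simp add: c2 mult_ac)
  finally show ?thesis .
qed

text \<open>The four groups of the bound belong to four steps: leaving out the corridors, decoupling
  the blocks, replacing each block by a normal variable, and comparing the sum of the block
  variances with the variance of the window. \<open>e\<close>, \<open>q\<close> and \<open>L\<close>
  stay free.\<close>

lemma clt_estimate:
  fixes t :: real
  assumes W: "compact W" "vol W > 0" and q: "q > 2" and L: "L \<ge> (2::nat)" and e: "e > 0"
    and \<gamma>: "\<gamma> = measure lborel (msum W (cball 0 1))" "\<gamma> \<ge> 2 * kappa TYPE('d)"
  defines "d \<equiv> real DIM('d)"
  shows "cmod ((\<integral>\<omega>. iexp (t * S g W \<omega> / sqrt (vol W)) \<partial>M) - exp (- (t\<^sup>2 * expectation (\<lambda>\<omega>. (S g W \<omega>)\<^sup>2) / vol W) / 2))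
    \<le> (e + t\<^sup>2 * HH * d / real L / e) + 16 * (C * (q/2) powr (- real \<nu>) * \<gamma> powr l) * (\<gamma> / kappa TYPE('d))
      + (e * (t\<^sup>2 * HH) + (1 / e + 1) * (t ^ 4 * (3 * HH\<^sup>2 * (real L * q) ^ DIM('d) + HH ^ 3) / vol W))
      + t\<^sup>2 * (tail q + 3 * HH * d / real L)"
proof -
  obtain T :: "('d \<Rightarrow> int) set" and Bl where T: "finite T" and Blb: "\<And>i. Bl i \<in> sets borel" and BW: "\<And>i. Bl i \<subseteq> W"
    and dis: "disjoint_family Bl"
    and corr: "measure lborel (W - (\<Union>i\<in>T. Bl i)) \<le> real DIM('d) * measure lborel W / real L"
    and vB: "\<And>i. measure lborel (Bl i) \<le> (real L * q) ^ DIM('d)"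
    and far: "\<And>i j s t. i \<noteq> j \<Longrightarrow> s \<in> Bl i \<Longrightarrow> t \<in> Bl j \<Longrightarrow> q \<le> norm (t - s)"
    and sep: "\<And>T'. T' \<subseteq> T \<Longrightarrow> 2 \<le> card T' \<Longrightarrow> \<exists>T1 T2. T1 \<noteq> {} \<and> T2 \<noteq> {} \<and> T1 \<inter> T2 = {} \<and> T1 \<union> T2 = T'
        \<and> mix_admissible (measure lborel (msum W (cball 0 1))) (q/2) (\<Union>(Bl ` T2)) (\<Union>(Bl ` T1))"
    and cT: "real (card T) * kappa TYPE('d) \<le> measure lborel (msum W (cball 0 1))"
    using grid_blocks[OF W(1) q L] by metis
  have Wf: "fin_set W" unfolding fin_set_def
    using borel_compact[OF W(1)] emeasure_compact_finite[OF W(1)] by simp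
  have Bf: "fin_set (Bl i)" for i by (rule fin_set_subset[OF Wf Blb BW])
  have disT: "disjoint_family_on Bl T" using dis by (rule disjoint_family_on_mono[rotated]) simp
  define U where "U = (\<Union>i\<in>T. Bl i)"
  have Ub: "U \<in> sets borel" "U \<subseteq> W" using Blb BW T by (auto simp: U_def)
  define v where "v = vol W"
  have v: "v > 0" using W(2) by (simp add: v_def)
  define c where "c = t / sqrt v"
  have c2: "c\<^sup>2 = t\<^sup>2 / v" using v by (simp add: c_def power_divide)
  have c4: "c ^ 4 = t ^ 4 / v\<^sup>2"
  proof -
    have "c ^ 4 = (c\<^sup>2)\<^sup>2" by (simp flip: power_mult)
    then show ?thesis unfolding c2 by (simp add: power_divide flip: power_mult)
  qed
  have rem: "vol (W - U) / v \<le> d / real L"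
  proof -
    have "vol (W - U) \<le> d / real L * v" using corr by (simp add: vol_def U_def v_def d_def)
    then show ?thesis using v by (simp add: pos_divide_le_eq)
  qed
  have rem0: "0 \<le> vol (W - U) / v" using v vol_nonneg by simp
  have 1: "cmod ((\<integral>\<omega>. iexp (c * S g W \<omega>) \<partial>M) - (\<integral>\<omega>. iexp (c * S g U \<omega>) \<partial>M)) \<le> e + t\<^sup>2 * HH * d / real L / e"
  proof -
    have "t\<^sup>2 * HH * (vol (W - U) / v) / e \<le> t\<^sup>2 * HH * (d / real L) / e"
      using rem e HH_nonneg by (intro divide_right_mono mult_left_mono) auto
    then show ?thesis using remainder_char[OF Wf W(2) Ub e, of t] by (simp add: c_def v_def)
  qed
  define Y where "Y = (\<lambda>i \<omega>. c * S g (Bl i) \<omega>)"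
  have detY: "ae_determined (Bl i) (Y i)" for i
    unfolding Y_def by (rule ae_determined_comp[OF ae_determined_S[OF g_measurable g_le_1 fin_setD[OF Bf] order_refl]]) simp
  have Ym: "Y i \<in> borel_measurable M" for i using detY[of i] by (simp add: ae_determined_def)
  have q2: "q / 2 > 0" using q by simp
  have \<alpha>0: "0 \<le> 16 * (C * (q/2) powr (- real \<nu>) * \<gamma> powr l)" using C_pos by simp
  have "cmod ((\<integral>\<omega>. iexp (\<Sum>i\<in>T. Y i \<omega>) \<partial>M) - (\<Prod>i\<in>T. \<integral>\<omega>. iexp (Y i \<omega>) \<partial>M))
    \<le> 16 * (C * (q/2) powr (- real \<nu>) * \<gamma> powr l) * real (card T)"
    by (rule block_factorisation[OF \<gamma>(2) q2 sep[folded \<gamma>(1)] detY T])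
  also have "\<dots> \<le> 16 * (C * (q/2) powr (- real \<nu>) * \<gamma> powr l) * (\<gamma> / kappa TYPE('d))"
    using cT kappa_pos[where 'd = 'd] unfolding \<gamma>(1)[symmetric] by (intro mult_left_mono \<alpha>0) (simp add: pos_le_divide_eq)
  also have "(\<integral>\<omega>. iexp (\<Sum>i\<in>T. Y i \<omega>) \<partial>M) = (\<integral>\<omega>. iexp (c * S g U \<omega>) \<partial>M)"
    by (rule Bochner_Integration.integral_cong[OF refl])
      (simp only: Y_def sum_distrib_left[symmetric] U_def S_UN[OF T Bf disT])
  finally have 2: "cmod ((\<integral>\<omega>. iexp (c * S g U \<omega>) \<partial>M) - (\<Prod>i\<in>T. \<integral>\<omega>. iexp (Y i \<omega>) \<partial>M))
     \<le> 16 * (C * (q/2) powr (- real \<nu>) * \<gamma> powr l) * (\<gamma> / kappa TYPE('d))" .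
  define s where "s = (\<lambda>i. expectation (\<lambda>\<omega>. (Y i \<omega>)\<^sup>2))"
  have s0: "0 \<le> s i" for i unfolding s_def by (rule Bochner_Integration.integral_nonneg) simp
  have s_eq: "s i = t\<^sup>2 * expectation (\<lambda>\<omega>. (S g (Bl i) \<omega>)\<^sup>2) / v" for i
    by (simp add: s_def Y_def power_mult_distrib c2)
  define V where "V = (real L * q) ^ DIM('d)"
  have V0: "0 \<le> V" using q by (simp add: V_def)
  have "cmod ((\<integral>\<omega>. iexp (Y i \<omega>) \<partial>M) - complex_of_real (exp (- s i / 2)))
     \<le> (vol (Bl i) / v) * (e * (t\<^sup>2 * HH) + (1 / e + 1) * (t ^ 4 * (3 * HH\<^sup>2 * V + HH ^ 3) / v))" for i
  proof -
    define p where "p = expectation (\<lambda>\<omega>. (Y i \<omega>) ^ 4)"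
    obtain K where K: "\<And>\<omega>. \<omega> \<in> space M \<Longrightarrow> \<bar>S g (Bl i) \<omega>\<bar> \<le> K"
      using bounded_rv_S[OF Bf[of i]] by (auto simp: bounded_rv_def)
    have a1: "cmod ((\<integral>\<omega>. iexp (Y i \<omega>) \<partial>M) - complex_of_real (exp (- s i / 2))) \<le> e * s i + p / e + p"
      unfolding s_def p_def
    proof (rule char_normal_approx[OF Ym _ _ e])
      show "\<bar>Y i \<omega>\<bar> \<le> \<bar>c\<bar> * K" if "\<omega> \<in> space M" for \<omega>
        unfolding Y_def abs_mult using K[OF that] by (intro mult_left_mono) auto
      show "expectation (Y i) = 0" unfolding Y_def using S_centered[OF Bf[of i]] by simp
    qed
    have a2: "e * s i \<le> (vol (Bl i) / v) * (e * (t\<^sup>2 * HH))"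
    proof -
      have "s i \<le> t\<^sup>2 * (HH * vol (Bl i)) / v" unfolding s_eq using second_moment[OF Bf[of i]] v by (intro divide_right_mono mult_left_mono) auto
      then have "e * s i \<le> e * (t\<^sup>2 * (HH * vol (Bl i)) / v)" using e by (intro mult_left_mono) auto
      then show ?thesis by (simp add: mult_ac)
    qed
    have "(1 / e + 1) * p = p / e + p" by (simp add: algebra_simps)
    then have a: "cmod ((\<integral>\<omega>. iexp (Y i \<omega>) \<partial>M) - complex_of_real (exp (- s i / 2))) \<le> (vol (Bl i) / v) * (e * (t\<^sup>2 * HH)) + (1 / e + 1) * p"
      using a1 a2 by linarith
    have "p = t ^ 4 * expectation (\<lambda>\<omega>. (S g (Bl i) \<omega>) ^ 4) / v\<^sup>2"
      by (simp add: p_def Y_def power_mult_distrib c4)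
    also have "\<dots> \<le> t ^ 4 * (3 * HH\<^sup>2 * (vol (Bl i))\<^sup>2 + HH ^ 3 * vol (Bl i)) / v\<^sup>2"
      using fourth_moment[OF Bf[of i]] by (intro divide_right_mono mult_left_mono) auto
    also have "\<dots> = (vol (Bl i) / v) * (t ^ 4 * (3 * HH\<^sup>2 * vol (Bl i) + HH ^ 3) / v)"
      by (simp add: power2_eq_square add_divide_distrib algebra_simps)
    also have "\<dots> \<le> (vol (Bl i) / v) * (t ^ 4 * (3 * HH\<^sup>2 * V + HH ^ 3) / v)"
      using vB[of i] v vol_nonneg[of "Bl i"] by (intro mult_left_mono divide_right_mono add_right_mono) (auto simp: vol_def V_def)
    finally have "(1 / e + 1) * p \<le> (1 / e + 1) * ((vol (Bl i) / v) * (t ^ 4 * (3 * HH\<^sup>2 * V + HH ^ 3) / v))"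
      using e by (intro mult_left_mono) auto
    with a have "cmod ((\<integral>\<omega>. iexp (Y i \<omega>) \<partial>M) - complex_of_real (exp (- s i / 2)))
      \<le> (vol (Bl i) / v) * (e * (t\<^sup>2 * HH)) + (vol (Bl i) / v) * ((1 / e + 1) * (t ^ 4 * (3 * HH\<^sup>2 * V + HH ^ 3) / v))"
      unfolding mult.left_commute[of "1 / e + 1"] by linarith
    then show ?thesis by (simp only: distrib_left)
  qed
  note blk = this
  \<comment> \<open>The error of a block is proportional to its share of the volume. The shares add
    up to at most 1, so the total does not depend on the number of blocks.\<close>
  have sumv: "(\<Sum>i\<in>T. vol (Bl i) / v) \<le> 1"
  proof -
    have "(\<Sum>i\<in>T. vol (Bl i)) = vol U" unfolding U_def by (rule vol_UN[OF T Bf disT, symmetric])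
    also have "\<dots> \<le> v" unfolding v_def by (rule vol_mono[OF Wf Ub])
    finally show ?thesis using v by (simp add: sum_divide_distrib[symmetric])
  qed
  have R0: "0 \<le> e * (t\<^sup>2 * HH) + (1 / e + 1) * (t ^ 4 * (3 * HH\<^sup>2 * V + HH ^ 3) / v)"
    using e HH_nonneg V0 v by (intro add_nonneg_nonneg mult_nonneg_nonneg divide_nonneg_nonneg) auto
  \<comment> \<open>All factors have modulus at most 1, so the difference of the products is at most
    the sum of the differences.\<close>
  have "cmod ((\<Prod>i\<in>T. \<integral>\<omega>. iexp (Y i \<omega>) \<partial>M) - (\<Prod>i\<in>T. complex_of_real (exp (- s i / 2))))
    \<le> (\<Sum>i\<in>T. cmod ((\<integral>\<omega>. iexp (Y i \<omega>) \<partial>M) - complex_of_real (exp (- s i / 2))))"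
  proof (rule norm_prod_diff)
    show "cmod (\<integral>\<omega>. iexp (Y i \<omega>) \<partial>M) \<le> 1" for i by (rule cmod_iexp_expectation_le_1[OF Ym])
    show "cmod (complex_of_real (exp (- s i / 2))) \<le> 1" for i using s0[of i] by simp
  qed
  also have "\<dots> \<le> (\<Sum>i\<in>T. (vol (Bl i) / v) * (e * (t\<^sup>2 * HH) + (1 / e + 1) * (t ^ 4 * (3 * HH\<^sup>2 * V + HH ^ 3) / v)))"
    by (intro sum_mono blk)
  also have "\<dots> = (\<Sum>i\<in>T. vol (Bl i) / v) * (e * (t\<^sup>2 * HH) + (1 / e + 1) * (t ^ 4 * (3 * HH\<^sup>2 * V + HH ^ 3) / v))"
    by (simp only: sum_distrib_right)
  also have "\<dots> \<le> 1 * (e * (t\<^sup>2 * HH) + (1 / e + 1) * (t ^ 4 * (3 * HH\<^sup>2 * V + HH ^ 3) / v))"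
    by (rule mult_right_mono[OF sumv R0])
  also have "(\<Prod>i\<in>T. complex_of_real (exp (- s i / 2))) = complex_of_real (exp (- ((\<Sum>i\<in>T. s i) / 2)))"
    by (simp add: exp_sum[OF T, symmetric] sum_negf sum_divide_distrib flip: of_real_prod)
  finally have 3: "cmod ((\<Prod>i\<in>T. \<integral>\<omega>. iexp (Y i \<omega>) \<partial>M) - complex_of_real (exp (- ((\<Sum>i\<in>T. s i) / 2))))
    \<le> e * (t\<^sup>2 * HH) + (1 / e + 1) * (t ^ 4 * (3 * HH\<^sup>2 * V + HH ^ 3) / v)" by simp
  define \<sigma> where "\<sigma> = t\<^sup>2 * expectation (\<lambda>\<omega>. (S g W \<omega>)\<^sup>2) / v"
  have \<sigma>0: "0 \<le> \<sigma>" unfolding \<sigma>_def using v by (intro divide_nonneg_nonneg mult_nonneg_nonneg Bochner_Integration.integral_nonneg) auto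
  have 4: "cmod (complex_of_real (exp (- ((\<Sum>i\<in>T. s i) / 2))) - complex_of_real (exp (- (\<sigma> / 2)))) \<le> t\<^sup>2 * (tail q + 3 * HH * d / real L)"
  proof -
    have "\<bar>expectation (\<lambda>\<omega>. (S g W \<omega>)\<^sup>2) - (\<Sum>i\<in>T. expectation (\<lambda>\<omega>. (S g (Bl i) \<omega>)\<^sup>2))\<bar> \<le> v * tail q + 3 * HH * vol (W - U)"
      unfolding U_def v_def
    proof (rule block_variance[OF T Bf disT Wf])
      show "(\<Union>i\<in>T. Bl i) \<subseteq> W" using Ub(2) by (simp add: U_def)
      show "q \<le> norm (t - s)" if "i \<in> T" "j \<in> T" "i \<noteq> j" "s \<in> Bl i" "t \<in> Bl j" for i j s t
        using that(3-5) by (rule far)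
    qed
    then have "\<bar>expectation (\<lambda>\<omega>. (S g W \<omega>)\<^sup>2) - (\<Sum>i\<in>T. expectation (\<lambda>\<omega>. (S g (Bl i) \<omega>)\<^sup>2))\<bar> * (t\<^sup>2 / v) \<le> (v * tail q + 3 * HH * vol (W - U)) * (t\<^sup>2 / v)"
      using v by (intro mult_right_mono) auto
    moreover have "\<bar>expectation (\<lambda>\<omega>. (S g W \<omega>)\<^sup>2) - (\<Sum>i\<in>T. expectation (\<lambda>\<omega>. (S g (Bl i) \<omega>)\<^sup>2))\<bar> * (t\<^sup>2 / v) = \<bar>\<sigma> - (\<Sum>i\<in>T. s i)\<bar>"
    proof -
      have "\<sigma> - (\<Sum>i\<in>T. s i) = (expectation (\<lambda>\<omega>. (S g W \<omega>)\<^sup>2) - (\<Sum>i\<in>T. expectation (\<lambda>\<omega>. (S g (Bl i) \<omega>)\<^sup>2))) * (t\<^sup>2 / v)"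
        by (simp add: \<sigma>_def s_eq sum_divide_distrib[symmetric] sum_distrib_left[symmetric] diff_divide_distrib algebra_simps)
      then show ?thesis using v by (simp add: abs_mult)
    qed
    moreover have "(v * tail q + 3 * HH * vol (W - U)) * (t\<^sup>2 / v) = t\<^sup>2 * (tail q + 3 * HH * (vol (W - U) / v))"
      using v by (simp add: field_simps)
    moreover have "t\<^sup>2 * (tail q + 3 * HH * (vol (W - U) / v)) \<le> t\<^sup>2 * (tail q + 3 * HH * (d / real L))"
      using rem HH_nonneg by (intro mult_left_mono add_left_mono) auto
    ultimately have "\<bar>\<sigma> - (\<Sum>i\<in>T. s i)\<bar> \<le> t\<^sup>2 * (tail q + 3 * HH * d / real L)" by simp
    moreover have "\<bar>exp (- ((\<Sum>i\<in>T. s i) / 2)) - exp (- (\<sigma> / 2))\<bar> \<le> \<bar>(\<Sum>i\<in>T. s i) / 2 - \<sigma> / 2\<bar>"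
      using \<sigma>0 s0 by (intro abs_exp_minus_diff_le divide_nonneg_nonneg sum_nonneg) auto
    ultimately have "\<bar>exp (- ((\<Sum>i\<in>T. s i) / 2)) - exp (- (\<sigma> / 2))\<bar> \<le> t\<^sup>2 * (tail q + 3 * HH * d / real L)"
      by linarith
    moreover have "cmod (complex_of_real a - complex_of_real b) = \<bar>a - b\<bar>" for a b
      by (metis norm_of_real of_real_diff)
    ultimately show ?thesis by metis
  qed
  have tri: "cmod (x1 - x5) \<le> cmod (x1 - x2) + cmod (x2 - x3) + cmod (x3 - x4) + cmod (x4 - x5)" for x1 x2 x3 x4 x5 :: complex
  proof -
    have "x1 - x5 = ((x1 - x2) + (x2 - x3)) + ((x3 - x4) + (x4 - x5))" by simp
    then show ?thesis by (smt (verit) norm_triangle_ineq)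
  qed
  have "cmod ((\<integral>\<omega>. iexp (c * S g W \<omega>) \<partial>M) - complex_of_real (exp (- (\<sigma> / 2))))
    \<le> (e + t\<^sup>2 * HH * d / real L / e) + 16 * (C * (q/2) powr (- real \<nu>) * \<gamma> powr l) * (\<gamma> / kappa TYPE('d))
      + (e * (t\<^sup>2 * HH) + (1 / e + 1) * (t ^ 4 * (3 * HH\<^sup>2 * V + HH ^ 3) / v)) + t\<^sup>2 * (tail q + 3 * HH * d / real L)"
    by (rule order_trans[OF tri add_mono[OF add_mono[OF add_mono[OF 1 2] 3] 4]])
  moreover have "complex_of_real (exp (- (\<sigma> / 2))) = complex_of_real (exp (- (t\<^sup>2 * expectation (\<lambda>\<omega>. (S g W \<omega>)\<^sup>2) / vol W) / 2))"
    by (simp add: \<sigma>_def v_def)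
  ultimately show ?thesis by (simp add: c_def V_def v_def)
qed

end

section \<open>Van Hove windows: shifts, volume growth and dilation\<close>

lemma emeasure_lborel_shift:
  fixes A :: "'d::euclidean_space set"
  assumes [measurable]: "A \<in> sets borel"
  shows "emeasure lborel {s. s + a \<in> A} = emeasure lborel A"
proof -
  have "emeasure lborel A = emeasure (distr lborel borel ((+) a)) A" by (simp add: lborel_distr_plus)
  also have "\<dots> = emeasure lborel {s. s + a \<in> A}"
    by (subst emeasure_distr) (auto simp: vimage_def add.commute)
  finally show ?thesis by simp
qed

definition exit_set :: "'d::euclidean_space set \<Rightarrow> 'd \<Rightarrow> 'd set" where
  "exit_set W u = {s \<in> W. s + u \<notin> W}"

lemma exit_set_borel:
  assumes [measurable]: "W \<in> sets borel" shows "exit_set W u \<in> sets borel"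
proof -
  have "{s \<in> space borel. s \<in> W \<and> s + u \<notin> W} \<in> sets borel" by measurable
  then show ?thesis by (simp add: exit_set_def)
qed

lemma segment_meets_frontier:
  fixes W :: "'d::euclidean_space set"
  assumes "s \<in> W" "t \<notin> W"
  obtains y where "y \<in> frontier W" "norm (s - y) \<le> norm (s - t)" "norm (t - y) \<le> norm (s - t)"
proof -
  have "closed_segment s t \<inter> frontier W \<noteq> {}"
    using assms by (intro connected_Int_frontier) auto
  then obtain y where y: "y \<in> frontier W" "y \<in> closed_segment s t" by blast
  have "dist y s \<le> dist s t" "dist y t \<le> dist s t" using dist_in_closed_segment[OF y(2)] by auto
  then show thesis using y(1) by (intro that[of y]) (auto simp: dist_norm norm_minus_commute)
qed

lemma msum_frontier_compact: "compact W \<Longrightarrow> compact (msum (frontier W) (cball 0 1))"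
  unfolding msum_def by (intro compact_sums compact_frontier) auto

text \<open>The Van Hove condition speaks of radius 1, so a long shift is walked in \<open>k\<close>
  steps of length at most 1. A point lost in the end is outside before the last step or leaves in
  that step, and points that leave in one step lie within 1 of the frontier.\<close>

lemma exit_set_le:
  fixes W :: "'d::euclidean_space set"
  assumes W: "compact W" and u: "norm v \<le> 1"
  shows "emeasure lborel (exit_set W (real k *\<^sub>R v)) \<le> of_nat k * emeasure lborel (msum (frontier W) (cball 0 1))"
proof (induction k)
  case 0
  then show ?case by (simp add: exit_set_def)
next
  case (Suc k)
  have Wb[measurable]: "W \<in> sets borel" using W by (rule borel_compact)
  note eb = exit_set_borel[OF Wb]
  have sub: "exit_set W v \<subseteq> msum (frontier W) (cball 0 1)"
  proof
    fix s assume "s \<in> exit_set W v"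
    then have "s \<in> W" "s + v \<notin> W" by (auto simp: exit_set_def)
    then obtain y where y: "y \<in> frontier W" "norm (s - y) \<le> norm (s - (s + v))" by (rule segment_meets_frontier)
    then have "s - y \<in> cball 0 1" using u by simp
    moreover have "s = y + (s - y)" by simp
    ultimately show "s \<in> msum (frontier W) (cball 0 1)" using y(1) unfolding msum_def by blast
  qed
  have mb: "msum (frontier W) (cball 0 1) \<in> sets borel" by (rule borel_compact[OF msum_frontier_compact[OF W]])
  have "exit_set W (real (Suc k) *\<^sub>R v) \<subseteq> exit_set W (real k *\<^sub>R v) \<union> {s. s + real k *\<^sub>R v \<in> exit_set W v}"
    by (auto simp: exit_set_def algebra_simps)
  then have "emeasure lborel (exit_set W (real (Suc k) *\<^sub>R v))
     \<le> emeasure lborel (exit_set W (real k *\<^sub>R v) \<union> {s. s + real k *\<^sub>R v \<in> exit_set W v})"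
    using eb by (intro emeasure_mono) (auto intro!: sets.Un borel_measurable_pred_less simp: pred_def)
  also have "\<dots> \<le> emeasure lborel (exit_set W (real k *\<^sub>R v)) + emeasure lborel {s. s + real k *\<^sub>R v \<in> exit_set W v}"
    using eb by (intro emeasure_subadditive) auto
  also have "emeasure lborel {s. s + real k *\<^sub>R v \<in> exit_set W v} = emeasure lborel (exit_set W v)"
    by (rule emeasure_lborel_shift[OF eb])
  also have "\<dots> \<le> emeasure lborel (msum (frontier W) (cball 0 1))"
    using mb by (intro emeasure_mono sub) auto
  also have "emeasure lborel (exit_set W (real k *\<^sub>R v)) \<le> of_nat k * emeasure lborel (msum (frontier W) (cball 0 1))"
    by (rule Suc)
  finally show ?case by (simp add: algebra_simps)
qed

lemma van_hove_exit:
  fixes W :: "nat \<Rightarrow> 'd::euclidean_space set"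
  assumes W: "\<And>n. compact (W n)" and vh: "van_hove W"
  shows "(\<lambda>n. measure lborel (exit_set (W n) u) / measure lborel (W n)) \<longlonglongrightarrow> 0"
proof -
  define k where "k = nat \<lceil>norm u\<rceil> + 1"
  have k: "norm u \<le> real k" "k > 0" unfolding k_def by linarith+
  define v where "v = u /\<^sub>R real k"
  have v: "norm v \<le> 1" using k by (simp add: v_def field_simps)
  have uv: "u = real k *\<^sub>R v" using k by (simp add: v_def)
  define f where "f = (\<lambda>n. measure lborel (msum (frontier (W n)) (cball 0 1)))"
  have le: "measure lborel (exit_set (W n) u) \<le> real k * f n" for n
  proof -
    have "emeasure lborel (msum (frontier (W n)) (cball 0 1)) = ennreal (f n)"
      unfolding f_def using emeasure_compact_finite[OF msum_frontier_compact[OF W[of n]]]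
      by (intro emeasure_eq_ennreal_measure) auto
    then have "emeasure lborel (exit_set (W n) u) \<le> ennreal (real k * f n)"
      using exit_set_le[OF W v, of n k] uv by (simp add: ennreal_mult' ennreal_of_nat_eq_real_of_nat)
    then show ?thesis unfolding measure_def by (intro enn2real_leI) (simp_all add: f_def)
  qed
  have pos: "measure lborel (W n) > 0" for n using vh by (simp add: van_hove_def)
  have "(\<lambda>n. real k * (f n / measure lborel (W n))) \<longlonglongrightarrow> real k * 0"
    using vh unfolding van_hove_def f_def by (intro tendsto_mult_left) blast
  then have lim: "(\<lambda>n. real k * (f n / measure lborel (W n))) \<longlonglongrightarrow> 0" by simp
  show ?thesis
  proof (rule tendsto_sandwich[OF _ _ tendsto_const lim])
    show "\<forall>\<^sub>F n in sequentially. 0 \<le> measure lborel (exit_set (W n) u) / measure lborel (W n)" by simp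
    show "\<forall>\<^sub>F n in sequentially. measure lborel (exit_set (W n) u) / measure lborel (W n) \<le> real k * (f n / measure lborel (W n))"
      using le pos by (intro always_eventually allI) (simp add: divide_right_mono less_imp_le)
  qed
qed

text \<open>A compact set of positive volume is neither empty nor the whole space, so it has a
  frontier point, and the dilated frontier contains a unit ball. Hence the Van Hove ratio is at
  least \<open>kappa\<close> over the volume, and the volume must grow.\<close>

lemma van_hove_volume:
  fixes W :: "nat \<Rightarrow> 'd::euclidean_space set"
  assumes W: "\<And>n. compact (W n)" and vh: "van_hove W"
  shows "filterlim (\<lambda>n. measure lborel (W n)) at_top sequentially"
proof -
  have pos: "measure lborel (W n) > 0" for n using vh by (simp add: van_hove_def)
  let ?k = "kappa TYPE('d)"
  have le: "?k \<le> measure lborel (msum (frontier (W n)) (cball 0 1))" for n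
  proof -
    have "W n \<noteq> {}" using pos[of n] by auto
    moreover have "W n \<noteq> UNIV" using W[of n] not_bounded_UNIV compact_imp_bounded by metis
    ultimately obtain y where y: "y \<in> frontier (W n)" using frontier_not_empty by blast
    have "cball y 1 \<subseteq> msum (frontier (W n)) (cball 0 1)"
    proof
      fix x assume "x \<in> cball y 1"
      then have "x - y \<in> cball 0 1" by (simp add: dist_norm norm_minus_commute)
      moreover have "x = y + (x - y)" by simp
      ultimately show "x \<in> msum (frontier (W n)) (cball 0 1)" using y unfolding msum_def by blast
    qed
    moreover have "msum (frontier (W n)) (cball 0 1) \<in> fmeasurable lborel"
      using borel_compact[OF msum_frontier_compact[OF W[of n]]] emeasure_compact_finite[OF msum_frontier_compact[OF W[of n]]]
      by (intro fmeasurableI) auto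
    ultimately have "measure lborel (cball y 1) \<le> measure lborel (msum (frontier (W n)) (cball 0 1))"
      by (intro measure_mono_fmeasurable) auto
    moreover have "measure lborel (cball y 1) = ?k"
      using emeasure_cball_kappa[of y] kappa_pos[where 'd = 'd] by (simp add: measure_def)
    ultimately show ?thesis by simp
  qed
  have "(\<lambda>n. ?k / measure lborel (W n)) \<longlonglongrightarrow> 0"
  proof (rule tendsto_sandwich[OF _ _ tendsto_const])
    show "\<forall>\<^sub>F n in sequentially. 0 \<le> ?k / measure lborel (W n)" using kappa_pos[where 'd = 'd] by simp
    show "\<forall>\<^sub>F n in sequentially. ?k / measure lborel (W n) \<le> measure lborel (msum (frontier (W n)) (cball 0 1)) / measure lborel (W n)"
      using le pos by (intro always_eventually allI divide_right_mono) auto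
    show "(\<lambda>n. measure lborel (msum (frontier (W n)) (cball 0 1)) / measure lborel (W n)) \<longlonglongrightarrow> 0"
      using vh by (simp add: van_hove_def)
  qed
  moreover have "\<forall>\<^sub>F n in sequentially. 0 < ?k / measure lborel (W n)"
    using kappa_pos[where 'd = 'd] pos by (intro always_eventually allI divide_pos_pos) auto
  ultimately have "filterlim (\<lambda>n. inverse (?k / measure lborel (W n))) at_top sequentially"
    by (rule filterlim_inverse_at_top)
  then have "filterlim (\<lambda>n. ?k * inverse (?k / measure lborel (W n))) at_top sequentially"
    by (rule filterlim_tendsto_pos_mult_at_top[OF tendsto_const kappa_pos])
  then show ?thesis using kappa_pos[where 'd = 'd] by (simp add: field_simps)
qed

text \<open>A point of the dilated window outside the window is joined to it by a segment of length
  at most 1 that meets the frontier. So the volume of the dilation, which serves as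
  \<open>\<gamma>\<close> in the mixing bound, is comparable to that of the window.\<close>

lemma van_hove_dilation:
  fixes W :: "nat \<Rightarrow> 'd::euclidean_space set"
  assumes W: "\<And>n. compact (W n)" and vh: "van_hove W"
  shows "\<forall>\<^sub>F n in sequentially. measure lborel (msum (W n) (cball 0 1)) \<le> 2 * measure lborel (W n)"
    and "measure lborel (W n) \<le> measure lborel (msum (W n) (cball 0 1))"
proof -
  have fm: "K \<in> fmeasurable lborel" if "compact K" for K :: "'d set"
    using borel_compact[OF that] emeasure_compact_finite[OF that] by (intro fmeasurableI) auto
  have mc: "compact (msum (W n) (cball 0 1))" for n unfolding msum_def using W by (intro compact_sums) auto
  show "measure lborel (W n) \<le> measure lborel (msum (W n) (cball 0 1))"
  proof (rule measure_mono_fmeasurable)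
    show "W n \<subseteq> msum (W n) (cball 0 1)" unfolding msum_def by force
  qed (use fm[OF mc] borel_compact[OF W] in auto)
  have pos: "measure lborel (W n) > 0" for n using vh by (simp add: van_hove_def)
  have le: "measure lborel (msum (W n) (cball 0 1)) \<le> measure lborel (W n) + measure lborel (msum (frontier (W n)) (cball 0 1))" for n
  proof -
    have "msum (W n) (cball 0 1) \<subseteq> W n \<union> msum (frontier (W n)) (cball 0 1)"
    proof
      fix x assume "x \<in> msum (W n) (cball 0 1)"
      then obtain w b where wb: "x = w + b" "w \<in> W n" "norm b \<le> 1" by (auto simp: msum_def)
      show "x \<in> W n \<union> msum (frontier (W n)) (cball 0 1)"
      proof (cases "x \<in> W n")
        case False
        with wb(2) obtain y where y: "y \<in> frontier (W n)" "norm (x - y) \<le> norm (w - x)" by (rule segment_meets_frontier)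
        then have "x - y \<in> cball 0 1" using wb by simp
        moreover have "x = y + (x - y)" by simp
        ultimately show ?thesis using y(1) unfolding msum_def by blast
      qed simp
    qed
    then have "measure lborel (msum (W n) (cball 0 1)) \<le> measure lborel (W n \<union> msum (frontier (W n)) (cball 0 1))"
      using borel_compact[OF mc] fm[OF W] fm[OF msum_frontier_compact[OF W]] by (intro measure_mono_fmeasurable) auto
    also have "\<dots> \<le> measure lborel (W n) + measure lborel (msum (frontier (W n)) (cball 0 1))"
      using borel_compact[OF W] borel_compact[OF msum_frontier_compact[OF W]] by (intro measure_Un_le) auto
    finally show ?thesis .
  qed
  have "\<forall>\<^sub>F n in sequentially. measure lborel (msum (frontier (W n)) (cball 0 1)) / measure lborel (W n) < 1"
    using vh unfolding van_hove_def by (intro order_tendstoD(2)[of _ 0]) auto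
  then show "\<forall>\<^sub>F n in sequentially. measure lborel (msum (W n) (cball 0 1)) \<le> 2 * measure lborel (W n)"
  proof eventually_elim
    case (elim n)
    then have "measure lborel (msum (frontier (W n)) (cball 0 1)) < measure lborel (W n)" using pos[of n] by simp
    then show ?case using le[of n] by linarith
  qed
qed

section \<open>Limit variance and the central limit theorem\<close>

context centered_field
begin

definition acov :: "'d \<Rightarrow> real" where
  "acov u = expectation (\<lambda>\<omega>. g (X 0 \<omega>) * g (X u \<omega>))"

definition sigma2 :: real where
  "sigma2 = (\<integral>u. acov u \<partial>lborel)"

lemma acov_eq: "expectation (\<lambda>\<omega>. g (X s \<omega>) * g (X t \<omega>)) = acov (t - s)"
  using stationary_pair[of "\<lambda>p. g (fst p) * g (snd p)" s t] by (simp add: acov_def)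

lemma abs_acov_le: "\<bar>acov u\<bar> \<le> h u"
  using two_points[of 0 u] h_uminus[of u] by (simp add: acov_def)

lemma acov_measurable [measurable]: "acov \<in> borel_measurable borel"
proof -
  have "(\<lambda>(u, \<omega>). X u \<omega>) \<in> borel_measurable (lborel \<Otimes>\<^sub>M M)"
    using field_measurable_pair by (simp add: case_prod_beta)
  note [measurable] = this
  have "(\<lambda>u. expectation (\<lambda>\<omega>. g (X 0 \<omega>) * g (X u \<omega>))) \<in> borel_measurable lborel"
    by (rule borel_measurable_lebesgue_integral) measurable
  then show ?thesis by (simp add: acov_def[abs_def])
qed

lemma acov_integrable: "integrable lborel acov"
  by (rule Bochner_Integration.integrable_bound[OF h_integrable]) (auto simp: abs_acov_le h_nonneg)

lemma acov_integrable_shift: "integrable lborel (\<lambda>t. acov (t - s))" and acov_integral_shift: "(\<integral>t. acov (t - s) \<partial>lborel) = sigma2"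
proof -
  have d: "distr lborel borel ((+) (- s)) = (lborel :: 'd measure)" by (rule lborel_distr_plus)
  have "integrable (distr lborel borel ((+) (- s))) acov" unfolding d by (rule acov_integrable)
  then show "integrable lborel (\<lambda>t. acov (t - s))" by (subst (asm) integrable_distr_eq) auto
  have "(\<integral>t. acov t \<partial>distr lborel borel ((+) (- s))) = (\<integral>t. acov (t - s) \<partial>lborel)"
    by (subst integral_distr) auto
  then show "(\<integral>t. acov (t - s) \<partial>lborel) = sigma2" unfolding d sigma2_def by simp
qed

text \<open>The variance is the double integral of \<open>acov (t - s)\<close> over the window.
  Letting \<open>t\<close> range over the whole space gives \<open>vol W * sigma2\<close>; the
  excess collects pairs with \<open>s\<close> inside and \<open>t = s + u\<close> outside, that is,
  \<open>s\<close> in \<open>exit_set W u\<close>.\<close>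

lemma variance_error:
  assumes W: "fin_set W"
  shows "ennreal \<bar>expectation (\<lambda>\<omega>. (S g W \<omega>)\<^sup>2) - vol W * sigma2\<bar> \<le> (\<integral>\<^sup>+u. ennreal (h u) * emeasure lborel (exit_set W u) \<partial>lborel)"
proof -
  note Wb [measurable] = fin_setD(1)[OF W]
  have bi: "integrable M (\<lambda>\<omega>. g (X s \<omega>))" for s by (rule bounded_rv_integrable[OF bounded_rv_field])
  note F = S_Fubini[OF g_measurable g_le_1 fin_setD[OF W]]
  have E1: "expectation (\<lambda>\<omega>. g (X s \<omega>) * S g W \<omega>) = (\<integral>t. indicator W t * acov (t - s) \<partial>lborel)" for s
  proof -
    have sw: "expectation (\<lambda>\<omega>. g (X t \<omega>) * g (X s \<omega>)) = acov (t - s)" for t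
      using acov_eq[of s t] by (simp add: mult.commute)
    have "expectation (\<lambda>\<omega>. g (X s \<omega>) * S g W \<omega>) = expectation (\<lambda>\<omega>. S g W \<omega> * g (X s \<omega>))"
      by (simp only: mult.commute)
    also have "\<dots> = (\<integral>t. indicator W t * expectation (\<lambda>\<omega>. g (X t \<omega>) * g (X s \<omega>)) \<partial>lborel)"
      by (rule F(2)[OF bi])
    finally show ?thesis by (simp only: sw)
  qed
  have iS: "integrable M (S g W)" by (rule bounded_rv_integrable[OF bounded_rv_S[OF W]])
  have in1: "integrable lborel (\<lambda>t. indicator D t * acov (t - s))" if "D \<in> sets borel" for D s
    using integrable_mult_indicator[OF _ acov_integrable_shift[of s], of D] that by simp
  have diff: "expectation (\<lambda>\<omega>. g (X s \<omega>) * S g W \<omega>) - sigma2 = - (\<integral>t. indicator (- W) t * acov (t - s) \<partial>lborel)" for s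
  proof -
    have "sigma2 = (\<integral>t. indicator W t * acov (t - s) + indicator (- W) t * acov (t - s) \<partial>lborel)"
      unfolding acov_integral_shift[of s, symmetric]
      by (rule Bochner_Integration.integral_cong) (auto simp: indicator_def)
    also have "\<dots> = (\<integral>t. indicator W t * acov (t - s) \<partial>lborel) + (\<integral>t. indicator (- W) t * acov (t - s) \<partial>lborel)"
      by (rule Bochner_Integration.integral_add) (auto intro!: in1)
    finally show ?thesis unfolding E1 by simp
  qed
  have "expectation (\<lambda>\<omega>. (S g W \<omega>)\<^sup>2) - vol W * sigma2
     = (\<integral>s. indicator W s * expectation (\<lambda>\<omega>. g (X s \<omega>) * S g W \<omega>) \<partial>lborel) - (\<integral>s. indicator W s * sigma2 \<partial>lborel)"
    using F(2)[OF iS] by (simp add: power2_eq_square vol_def)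
  also have "\<dots> = (\<integral>s. indicator W s * expectation (\<lambda>\<omega>. g (X s \<omega>) * S g W \<omega>) - indicator W s * sigma2 \<partial>lborel)"
    using F(3)[OF iS] fin_setD[OF W] by (intro Bochner_Integration.integral_diff[symmetric]) auto
  also have "\<dots> = (\<integral>s. indicator W s * - (\<integral>t. indicator (- W) t * acov (t - s) \<partial>lborel) \<partial>lborel)"
    unfolding diff[symmetric] right_diff_distrib ..
  finally have eq: "expectation (\<lambda>\<omega>. (S g W \<omega>)\<^sup>2) - vol W * sigma2 = (\<integral>s. indicator W s * - (\<integral>t. indicator (- W) t * acov (t - s) \<partial>lborel) \<partial>lborel)" .
  have int: "integrable lborel (\<lambda>s. indicator W s * - (\<integral>t. indicator (- W) t * acov (t - s) \<partial>lborel))"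
    unfolding diff[symmetric] right_diff_distrib using F(3)[OF iS] fin_setD[OF W] by (intro Bochner_Integration.integrable_diff) auto
  have "ennreal \<bar>expectation (\<lambda>\<omega>. (S g W \<omega>)\<^sup>2) - vol W * sigma2\<bar>
     \<le> (\<integral>\<^sup>+s. ennreal (norm (indicator W s * - (\<integral>t. indicator (- W) t * acov (t - s) \<partial>lborel))) \<partial>lborel)"
    unfolding eq using integral_norm_bound_ennreal[OF int] by simp
  also have "\<dots> \<le> (\<integral>\<^sup>+s. (\<integral>\<^sup>+u. ennreal (h u) * indicator (exit_set W u) s \<partial>lborel) \<partial>lborel)"
  proof (rule nn_integral_mono)
    fix s :: 'd
    show "ennreal (norm (indicator W s * - (\<integral>t. indicator (- W) t * acov (t - s) \<partial>lborel))) \<le> (\<integral>\<^sup>+u. ennreal (h u) * indicator (exit_set W u) s \<partial>lborel)"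
    proof (cases "s \<in> W")
      case True
      have "ennreal (norm (\<integral>t. indicator (- W) t * acov (t - s) \<partial>lborel)) \<le> (\<integral>\<^sup>+t. ennreal (norm (indicator (- W) t * acov (t - s))) \<partial>lborel)"
        by (rule integral_norm_bound_ennreal[OF in1]) measurable
      also have "\<dots> \<le> (\<integral>\<^sup>+t. ennreal (h (t - s)) * indicator (- W) t \<partial>lborel)"
        using abs_acov_le by (intro nn_integral_mono) (auto simp: indicator_def intro: ennreal_leI)
      also have "\<dots> = (\<integral>\<^sup>+t. ennreal (h (t - s)) * indicator (- W) t \<partial>distr lborel borel ((+) s))"
        by (simp add: lborel_distr_plus)
      also have "\<dots> = (\<integral>\<^sup>+u. ennreal (h u) * indicator (- W) (s + u) \<partial>lborel)"
        by (subst nn_integral_distr) auto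
      also have "\<dots> = (\<integral>\<^sup>+u. ennreal (h u) * indicator (exit_set W u) s \<partial>lborel)"
        using True by (intro nn_integral_cong) (auto simp: exit_set_def indicator_def)
      finally show ?thesis using True by simp
    qed simp
  qed
  also have "\<dots> = (\<integral>\<^sup>+u. (\<integral>\<^sup>+s. ennreal (h u) * indicator (exit_set W u) s \<partial>lborel) \<partial>lborel)"
  proof (rule lborel_pair.Fubini')
    have "(\<lambda>(u, s). ennreal (h u) * (indicator W s * indicator (- W) (s + u))) \<in> borel_measurable (lborel \<Otimes>\<^sub>M lborel)"
      by measurable
    also have "(\<lambda>(u, s). ennreal (h u) * (indicator W s * indicator (- W) (s + u))) = (\<lambda>(u, s). ennreal (h u) * indicator (exit_set W u) s)"
      by (auto simp: fun_eq_iff exit_set_def indicator_def)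
    finally show "(\<lambda>(u, s). ennreal (h u) * indicator (exit_set W u) s) \<in> borel_measurable (lborel \<Otimes>\<^sub>M lborel)" .
  qed
  also have "\<dots> = (\<integral>\<^sup>+u. ennreal (h u) * emeasure lborel (exit_set W u) \<partial>lborel)"
    by (intro nn_integral_cong nn_integral_cmult_indicator) (simp add: exit_set_borel)
  finally show ?thesis .
qed

end

context centered_field
begin

lemma measurable_exit_set:
  assumes [measurable]: "W \<in> sets borel"
  shows "(\<lambda>u. emeasure lborel (exit_set W u)) \<in> borel_measurable (borel :: 'd measure)"
proof -
  have "(\<lambda>u. \<integral>\<^sup>+s. indicator W s * indicator (- W) (s + u) \<partial>lborel) \<in> borel_measurable (lborel :: 'd measure)"
    by measurable
  moreover have "(\<integral>\<^sup>+s. indicator W s * indicator (- W) (s + u) \<partial>lborel) = emeasure lborel (exit_set W u)" for u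
  proof -
    have "(\<integral>\<^sup>+s. indicator W s * indicator (- W) (s + u) \<partial>lborel) = (\<integral>\<^sup>+s. indicator (exit_set W u) s \<partial>lborel)"
      by (intro nn_integral_cong) (auto simp: exit_set_def indicator_def)
    then show ?thesis using exit_set_borel[of W u] by simp
  qed
  ultimately show ?thesis by simp
qed

text \<open>Dominated convergence in \<open>u\<close>: the relative volume of the exit set is at
  most 1 and tends to 0 for each fixed \<open>u\<close>, while \<open>h\<close> is
  integrable.\<close>

lemma variance_tendsto:
  assumes W: "\<And>n. compact (W n)" and vh: "van_hove W"
  shows "(\<lambda>n. expectation (\<lambda>\<omega>. (S g (W n) \<omega>)\<^sup>2) / vol (W n)) \<longlonglongrightarrow> sigma2"
proof -
  have pos: "vol (W n) > 0" for n using vh by (simp add: van_hove_def vol_def)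
  have Wb: "W n \<in> sets borel" for n using W by (rule borel_compact)
  have Wf: "fin_set (W n)" for n unfolding fin_set_def
    using borel_compact[OF W[of n]] emeasure_compact_finite[OF W[of n]] by simp
  define \<delta> where "\<delta> = (\<lambda>n u. measure lborel (exit_set (W n) u) / vol (W n))"
  have m\<delta>: "\<delta> n \<in> borel_measurable borel" for n
    unfolding \<delta>_def measure_def using measurable_exit_set[OF Wb[of n]] by measurable
  have em: "emeasure lborel (exit_set (W n) u) = ennreal (measure lborel (exit_set (W n) u))" for n u
  proof -
    have "exit_set (W n) u \<subseteq> W n" by (auto simp: exit_set_def)
    from fin_setD(2)[OF fin_set_subset[OF Wf[of n] exit_set_borel[OF Wb[of n]] this]] show ?thesis
      by (intro emeasure_eq_ennreal_measure) auto
  qed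
  have \<delta>1: "\<delta> n u \<le> 1" "0 \<le> \<delta> n u" for n u
  proof -
    have "measure lborel (exit_set (W n) u) \<le> vol (W n)"
      using vol_mono[OF Wf[of n] exit_set_borel[OF Wb[of n], of u]] by (auto simp: vol_def exit_set_def)
    then show "\<delta> n u \<le> 1" using pos[of n] by (simp add: \<delta>_def)
    show "0 \<le> \<delta> n u" using pos[of n] by (simp add: \<delta>_def)
  qed
  define I where "I = (\<lambda>n. \<integral>\<^sup>+u. ennreal (h u * \<delta> n u) \<partial>lborel)"
  have "I \<longlonglongrightarrow> (\<integral>\<^sup>+u. 0 \<partial>(lborel :: 'd measure))"
    unfolding I_def
  proof (rule nn_integral_dominated_convergence[where w = "\<lambda>u. ennreal (h u)"])
    show "AE u in lborel. ennreal (h u * \<delta> n u) \<le> ennreal (h u)" for n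
      using \<delta>1 h_nonneg by (intro AE_I2 ennreal_leI mult_left_le) auto
    show "AE u in lborel. (\<lambda>n. ennreal (h u * \<delta> n u)) \<longlonglongrightarrow> 0"
    proof (intro AE_I2)
      fix u :: 'd
      have "(\<lambda>n. h u * \<delta> n u) \<longlonglongrightarrow> h u * 0"
        unfolding \<delta>_def vol_def using van_hove_exit[OF W vh] by (intro tendsto_mult_left)
      then have "(\<lambda>n. ennreal (h u * \<delta> n u)) \<longlonglongrightarrow> ennreal (h u * 0)" by (rule tendsto_ennrealI)
      then show "(\<lambda>n. ennreal (h u * \<delta> n u)) \<longlonglongrightarrow> 0" by simp
    qed
  qed (use m\<delta> h_nn_integral_finite in measurable)
  then have I0: "I \<longlonglongrightarrow> 0" by simp
  define a where "a = (\<lambda>n. \<bar>expectation (\<lambda>\<omega>. (S g (W n) \<omega>)\<^sup>2) / vol (W n) - sigma2\<bar>)"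
  have aI: "ennreal (a n) \<le> I n" for n
  proof -
    have "(\<integral>\<^sup>+u. ennreal (h u) * emeasure lborel (exit_set (W n) u) \<partial>lborel) = (\<integral>\<^sup>+u. ennreal (vol (W n)) * ennreal (h u * \<delta> n u) \<partial>lborel)"
    proof (rule nn_integral_cong)
      fix u :: 'd
      have "h u * measure lborel (exit_set (W n) u) = vol (W n) * (h u * \<delta> n u)" using pos[of n] by (simp add: \<delta>_def)
      then show "ennreal (h u) * emeasure lborel (exit_set (W n) u) = ennreal (vol (W n)) * ennreal (h u * \<delta> n u)"
        unfolding em using h_nonneg vol_nonneg \<delta>1 by (simp add: ennreal_mult[symmetric])
    qed
    also have "\<dots> = ennreal (vol (W n)) * I n"
      unfolding I_def using m\<delta>[of n] by (intro nn_integral_cmult) measurable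
    finally have le: "ennreal \<bar>expectation (\<lambda>\<omega>. (S g (W n) \<omega>)\<^sup>2) - vol (W n) * sigma2\<bar> \<le> ennreal (vol (W n)) * I n"
      using variance_error[OF Wf[of n]] by simp
    have "a n = (1 / vol (W n)) * \<bar>expectation (\<lambda>\<omega>. (S g (W n) \<omega>)\<^sup>2) - vol (W n) * sigma2\<bar>"
    proof -
      have "expectation (\<lambda>\<omega>. (S g (W n) \<omega>)\<^sup>2) / vol (W n) - sigma2 = (expectation (\<lambda>\<omega>. (S g (W n) \<omega>)\<^sup>2) - vol (W n) * sigma2) / vol (W n)"
        using pos[of n] by (simp add: diff_divide_distrib)
      then show ?thesis unfolding a_def using pos[of n] by (simp add: abs_divide)
    qed
    then have "ennreal (a n) = ennreal (1 / vol (W n)) * ennreal \<bar>expectation (\<lambda>\<omega>. (S g (W n) \<omega>)\<^sup>2) - vol (W n) * sigma2\<bar>"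
      using pos[of n] by (simp add: ennreal_mult[symmetric])
    also have "\<dots> \<le> ennreal (1 / vol (W n)) * (ennreal (vol (W n)) * I n)" using le by (rule mult_left_mono) simp
    also have "\<dots> = (ennreal (1 / vol (W n)) * ennreal (vol (W n))) * I n" by (simp only: mult.assoc)
    also have "ennreal (1 / vol (W n)) * ennreal (vol (W n)) = 1" using pos[of n] by (simp add: ennreal_mult[symmetric])
    also have "1 * I n = I n" by simp
    finally show ?thesis .
  qed
  have "(\<lambda>n. ennreal (a n)) \<longlonglongrightarrow> 0"
    by (rule tendsto_sandwich[OF _ _ tendsto_const I0]) (auto simp: aI)
  then have "(\<lambda>n. ennreal (a n)) \<longlonglongrightarrow> ennreal 0" by simp
  then have "a \<longlonglongrightarrow> 0" by (subst (asm) tendsto_ennreal_iff) (auto simp: a_def)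
  then show ?thesis unfolding a_def by (simp add: tendsto_rabs_zero_iff LIM_zero_iff)
qed

text \<open>Keeps the factor \<open>c\<close> of a sharper covariance bound. With \<open>c\<close>
  the squared weight of a level function, the square roots of these moments become summable over the
  expansion.\<close>

lemma second_moment_scaled:
  assumes A: "fin_set A" and c: "c \<ge> 0" "\<And>u. \<bar>acov u\<bar> \<le> c * h u"
  shows "expectation (\<lambda>\<omega>. (S g A \<omega>)\<^sup>2) \<le> c * HH * vol A"
proof -
  have in1: "ennreal \<bar>expectation (\<lambda>\<omega>. g (X s \<omega>) * S g A \<omega>)\<bar> \<le> ennreal (c * HH)" for s
  proof -
    have "ennreal \<bar>expectation (\<lambda>\<omega>. S g A \<omega> * g (X s \<omega>))\<bar> \<le> (\<integral>\<^sup>+t. indicator A t * ennreal (c * h (t - s)) \<partial>lborel)"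
    proof (rule S_mult_le[OF A bounded_rv_field])
      fix t
      have "\<bar>acov (s - t)\<bar> \<le> c * h (t - s)" using c(2)[of "s - t"] h_commute[of s t] by simp
      then show "ennreal \<bar>expectation (\<lambda>\<omega>. g (X t \<omega>) * g (X s \<omega>))\<bar> \<le> ennreal (c * h (t - s))"
        unfolding acov_eq by (rule ennreal_leI)
    qed
    also have "\<dots> \<le> ennreal (c * HH)" using fin_setD(1)[OF A] c(1) by (intro nn_integral_indicator_h)
    finally show ?thesis by (simp add: mult.commute)
  qed
  have "ennreal \<bar>expectation (\<lambda>\<omega>. S g A \<omega> * S g A \<omega>)\<bar> \<le> (\<integral>\<^sup>+s. indicator A s * ennreal (c * HH) \<partial>lborel)"
    by (rule S_mult_le[OF A bounded_rv_S[OF A] in1])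
  also have "\<dots> \<le> ennreal (c * HH * vol A)"
    using c(1) HH_nonneg by (intro nn_integral_indicator_const A) simp
  finally have "\<bar>expectation (\<lambda>\<omega>. S g A \<omega> * S g A \<omega>)\<bar> \<le> c * HH * vol A"
    using c(1) HH_nonneg vol_nonneg[of A] by (subst (asm) ennreal_le_iff) auto
  then show ?thesis by (simp add: power2_eq_square)
qed

lemma sigma2_nonneg:
  fixes W :: "nat \<Rightarrow> 'd set"
  assumes "\<And>n. compact (W n)" "van_hove W"
  shows "0 \<le> sigma2"
proof (rule LIMSEQ_le_const[OF variance_tendsto[OF assms]])
  show "\<exists>N. \<forall>n\<ge>N. 0 \<le> expectation (\<lambda>\<omega>. (S g (W n) \<omega>)\<^sup>2) / vol (W n)"
    using vol_nonneg by (intro exI allI impI divide_nonneg_nonneg Bochner_Integration.integral_nonneg) auto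
qed

theorem clt:
  fixes t :: real
  assumes W: "\<And>n. compact (W n)" and vh: "van_hove W"
  shows "(\<lambda>n. \<integral>\<omega>. iexp (t * S g (W n) \<omega> / sqrt (vol (W n))) \<partial>M) \<longlonglongrightarrow> complex_of_real (exp (- (t\<^sup>2 * sigma2) / 2))"
proof -
  let ?d = "real DIM('d)"
  let ?k = "kappa TYPE('d)"
  define v where "v = (\<lambda>n. vol (W n))"
  have pos: "v n > 0" for n using vh by (simp add: van_hove_def vol_def v_def)
  have vlim: "filterlim v at_top sequentially" unfolding v_def vol_def by (rule van_hove_volume[OF W vh])
  \<comment> \<open>The exponent \<open>\<beta>\<close> is the midpoint between \<open>b\<close> and
    1. \<open>\<beta> > b\<close> makes the decoupling error, of order
    \<open>v n powr (l + 1 - \<beta> * real \<nu> / ?d)\<close>, vanish, and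
    \<open>\<beta> < 1\<close> makes the block volume, of order \<open>v n powr \<beta>\<close>,
    small against the window.\<close>
  define b where "b = (l + 1) * ?d / real \<nu>"
  define \<beta> where "\<beta> = (b + 1) / 2"
  have d: "?d > 0" by simp
  have \<nu>: "real \<nu> > 0" using nu_gt_3d d by linarith
  have lt1: "b < 1" using nu_gt \<nu> by (simp add: b_def)
  have l0: "0 \<le> b" using l_pos by (simp add: b_def)
  have \<beta>: "0 < \<beta>" "\<beta> < 1" "b < \<beta>" using lt1 l0 unfolding \<beta>_def by simp_all
  have ex: "l + 1 - \<beta> * real \<nu> / ?d < 0"
  proof -
    have "b * (real \<nu> / ?d) < \<beta> * (real \<nu> / ?d)" using \<beta>(3) \<nu> d by (intro mult_strict_right_mono) auto
    moreover have "b * (real \<nu> / ?d) = l + 1" using \<nu> d by (simp add: b_def)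
    ultimately show ?thesis by simp
  qed
  define q where "q = (\<lambda>n. v n powr (\<beta> / ?d))"
  have qlim: "filterlim q at_top sequentially"
  proof -
    have "(\<lambda>n. v n powr (- (\<beta> / ?d))) \<longlonglongrightarrow> 0" using \<beta>(1) d by (intro tendsto_neg_powr[OF _ vlim]) simp
    moreover have "\<forall>\<^sub>F n in sequentially. 0 < v n powr (- (\<beta> / ?d))" using pos by (simp add: less_imp_neq[symmetric])
    ultimately have "filterlim (\<lambda>n. inverse (v n powr (- (\<beta> / ?d)))) at_top sequentially"
      by (rule filterlim_inverse_at_top)
    then show ?thesis by (simp add: q_def powr_minus)
  qed
  define \<gamma> where "\<gamma> = (\<lambda>n. measure lborel (msum (W n) (cball 0 1)))"
  have \<gamma>v: "\<forall>\<^sub>F n in sequentially. \<gamma> n \<le> 2 * v n" unfolding \<gamma>_def v_def vol_def by (rule van_hove_dilation(1)[OF W vh])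
  have v\<gamma>: "v n \<le> \<gamma> n" for n unfolding \<gamma>_def v_def vol_def by (rule van_hove_dilation(2)[OF W vh])
  define a1 where "a1 = (\<lambda>n. 16 * (C * (q n/2) powr (- real \<nu>) * \<gamma> n powr l) * (\<gamma> n / ?k))"
  have a1: "a1 \<longlonglongrightarrow> 0"
  proof (rule tendsto_sandwich[OF _ _ tendsto_const])
    define K where "K = 16 * C * 2 powr real \<nu> * 2 powr (l + 1) / ?k"
    show "\<forall>\<^sub>F n in sequentially. 0 \<le> a1 n"
      unfolding a1_def using C_pos kappa_pos[where 'd = 'd]
      by (intro always_eventually allI mult_nonneg_nonneg divide_nonneg_pos) (auto simp: \<gamma>_def)
    show "\<forall>\<^sub>F n in sequentially. a1 n \<le> K * v n powr (l + 1 - \<beta> * real \<nu> / ?d)"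
      using \<gamma>v
    proof eventually_elim
      case (elim n)
      have \<gamma>p: "\<gamma> n > 0" using v\<gamma>[of n] pos[of n] by linarith
      have "(q n / 2) powr (- real \<nu>) = q n powr (- real \<nu>) / 2 powr (- real \<nu>)" by (rule powr_divide)
      also have "\<dots> = q n powr (- real \<nu>) * 2 powr real \<nu>" by (simp add: powr_minus divide_inverse)
      also have "q n powr (- real \<nu>) = v n powr (- (\<beta> * real \<nu> / ?d))" unfolding q_def powr_powr by simp
      finally have e1: "(q n / 2) powr (- real \<nu>) = v n powr (- (\<beta> * real \<nu> / ?d)) * 2 powr real \<nu>" .
      have "\<gamma> n powr l * \<gamma> n = \<gamma> n powr (l + 1)" using \<gamma>p by (simp add: powr_add)
      also have "\<dots> \<le> (2 * v n) powr (l + 1)" using elim \<gamma>p l_pos by (intro powr_mono2) auto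
      also have "\<dots> = 2 powr (l + 1) * v n powr (l + 1)" by (rule powr_mult)
      finally have e2: "\<gamma> n powr l * \<gamma> n \<le> 2 powr (l + 1) * v n powr (l + 1)" .
      have "a1 n = (16 * C * 2 powr real \<nu> / ?k) * v n powr (- (\<beta> * real \<nu> / ?d)) * (\<gamma> n powr l * \<gamma> n)"
        unfolding a1_def e1 by (simp add: mult_ac)
      also have "\<dots> \<le> (16 * C * 2 powr real \<nu> / ?k) * v n powr (- (\<beta> * real \<nu> / ?d)) * (2 powr (l + 1) * v n powr (l + 1))"
        using C_pos kappa_pos[where 'd = 'd] by (intro mult_left_mono[OF e2]) auto
      also have "\<dots> = K * (v n powr (l + 1) * v n powr (- (\<beta> * real \<nu> / ?d)))" by (simp add: K_def mult_ac)
      also have "\<dots> = K * v n powr (l + 1 - \<beta> * real \<nu> / ?d)" by (simp only: powr_add[symmetric] diff_conv_add_uminus)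
      finally show ?case .
    qed
    have "(\<lambda>n. K * v n powr (l + 1 - \<beta> * real \<nu> / ?d)) \<longlonglongrightarrow> K * 0"
      by (intro tendsto_mult_left tendsto_neg_powr[OF ex vlim])
    then show "(\<lambda>n. K * v n powr (l + 1 - \<beta> * real \<nu> / ?d)) \<longlonglongrightarrow> 0" by simp
  qed
  have a2: "(\<lambda>n. (3 * HH\<^sup>2 * (real L * q n) ^ DIM('d) + HH ^ 3) / v n) \<longlonglongrightarrow> 0" for L :: nat
  proof -
    have eq: "(3 * HH\<^sup>2 * (real L * q n) ^ DIM('d) + HH ^ 3) / v n
       = 3 * HH\<^sup>2 * real L ^ DIM('d) * v n powr (\<beta> - 1) + HH ^ 3 * v n powr (- 1)" for n
    proof -
      have "q n ^ DIM('d) = v n powr \<beta>"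
      proof -
        have "q n > 0" using pos[of n] by (simp add: q_def)
        then have "q n ^ DIM('d) = q n powr ?d" by (rule powr_realpow[symmetric])
        also have "\<dots> = v n powr \<beta>" unfolding q_def powr_powr by simp
        finally show ?thesis .
      qed
      moreover have "v n powr \<beta> / v n = v n powr (\<beta> - 1)" using pos[of n] by (simp add: powr_diff)
      moreover have "1 / v n = v n powr (- 1)" using pos[of n] by (simp add: powr_minus_divide)
      ultimately show ?thesis by (simp add: power_mult_distrib add_divide_distrib flip: times_divide_eq_right) (simp add: divide_inverse)
    qed
    have "(\<lambda>n. 3 * HH\<^sup>2 * real L ^ DIM('d) * v n powr (\<beta> - 1) + HH ^ 3 * v n powr (- 1))
       \<longlonglongrightarrow> 3 * HH\<^sup>2 * real L ^ DIM('d) * 0 + HH ^ 3 * 0"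
      using \<beta>(2) by (intro tendsto_add tendsto_mult_left tendsto_neg_powr[OF _ vlim]) auto
    then show ?thesis unfolding eq by simp
  qed
  have a3: "(\<lambda>n. tail (q n)) \<longlonglongrightarrow> 0" using tail_tendsto qlim by (rule filterlim_compose)
  define E where "E = (\<lambda>n. t\<^sup>2 * expectation (\<lambda>\<omega>. (S g (W n) \<omega>)\<^sup>2) / v n)"
  define D where "D = (\<lambda>n. cmod ((\<integral>\<omega>. iexp (t * S g (W n) \<omega> / sqrt (vol (W n))) \<partial>M) - complex_of_real (exp (- E n / 2))))"
  have D0: "D \<longlonglongrightarrow> 0"
  proof (rule tendstoI)
    fix \<eta> :: real assume \<eta>: "\<eta> > 0"
    define K where "K = t\<^sup>2 * HH"
    have K0: "K \<ge> 0" using HH_nonneg by (simp add: K_def)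
    \<comment> \<open>\<open>e\<close> and then \<open>L\<close> are fixed before \<open>n\<close>:
      the terms \<open>e + e * K\<close> and the corridor terms, which do not vanish as
      \<open>n\<close> grows, get \<open>\<eta> / 8\<close> each. What remains, including the
      factors \<open>1 / e\<close> and the powers of \<open>L\<close>, is below
      \<open>\<eta> / 2\<close> for large \<open>n\<close>.\<close>
    define e where "e = \<eta> / (8 * (1 + K))"
    have e: "e > 0" using \<eta> K0 by (simp add: e_def)
    have e1: "e + e * K = \<eta> / 8"
    proof -
      define k where "k = 1 + K"
      have k: "k \<noteq> 0" using K0 by (simp add: k_def)
      have "e + e * K = e * k" by (simp add: k_def distrib_left)
      also have "\<dots> = \<eta> / 8" unfolding e_def k_def[symmetric] using k by simp
      finally show ?thesis .
    qed
    obtain L0 :: nat where L0: "real L0 \<ge> 8 * (K * ?d / e + 3 * K * ?d) / \<eta>" using real_arch_simple by blast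
    define L where "L = max 2 L0"
    have L: "L \<ge> 2" "real L \<ge> 8 * (K * ?d / e + 3 * K * ?d) / \<eta>" using L0 by (auto simp: L_def)
    have L1: "(K * ?d / e + 3 * K * ?d) / real L \<le> \<eta> / 8"
    proof -
      have "8 * (K * ?d / e + 3 * K * ?d) \<le> real L * \<eta>" using L(2) \<eta> by (simp add: pos_divide_le_eq)
      then show ?thesis using L(1) by (simp add: pos_divide_le_eq mult.commute)
    qed
    have "(\<lambda>n. a1 n + ((1 / e + 1) * t ^ 4) * ((3 * HH\<^sup>2 * (real L * q n) ^ DIM('d) + HH ^ 3) / v n) + t\<^sup>2 * tail (q n)) \<longlonglongrightarrow> 0 + ((1 / e + 1) * t ^ 4) * 0 + t\<^sup>2 * 0"
      by (intro tendsto_add tendsto_mult_left a1 a2 a3)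
    then have "\<forall>\<^sub>F n in sequentially. a1 n + ((1 / e + 1) * t ^ 4) * ((3 * HH\<^sup>2 * (real L * q n) ^ DIM('d) + HH ^ 3) / v n) + t\<^sup>2 * tail (q n) < \<eta> / 2"
      using \<eta> by (intro order_tendstoD(2)) auto
    moreover have "\<forall>\<^sub>F n in sequentially. q n > 2" using qlim by (simp add: filterlim_at_top_dense)
    moreover have "\<forall>\<^sub>F n in sequentially. 2 * ?k \<le> v n" using vlim by (simp add: filterlim_at_top)
    ultimately show "\<forall>\<^sub>F n in sequentially. dist (D n) 0 < \<eta>"
    proof eventually_elim
      case (elim n)
      have g2: "\<gamma> n \<ge> 2 * ?k" using elim(3) v\<gamma>[of n] by linarith
      have "D n \<le> (e + t\<^sup>2 * HH * ?d / real L / e) + a1 n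
        + (e * (t\<^sup>2 * HH) + (1 / e + 1) * (t ^ 4 * (3 * HH\<^sup>2 * (real L * q n) ^ DIM('d) + HH ^ 3) / v n)) + t\<^sup>2 * (tail (q n) + 3 * HH * ?d / real L)"
        unfolding D_def E_def a1_def v_def \<gamma>_def
        by (rule clt_estimate[OF W pos[unfolded v_def] elim(2) L(1) e refl g2[unfolded \<gamma>_def]])
      moreover have "(K * ?d / e + 3 * K * ?d) / real L = t\<^sup>2 * HH * ?d / real L / e + t\<^sup>2 * (3 * HH * ?d / real L)"
        by (simp add: add_divide_distrib K_def mult_ac)
      moreover have "(1 / e + 1) * (t ^ 4 * (3 * HH\<^sup>2 * (real L * q n) ^ DIM('d) + HH ^ 3) / v n)
        = ((1 / e + 1) * t ^ 4) * ((3 * HH\<^sup>2 * (real L * q n) ^ DIM('d) + HH ^ 3) / v n)" by (simp only: mult.assoc times_divide_eq_right)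
      moreover have "t\<^sup>2 * (tail (q n) + 3 * HH * ?d / real L) = t\<^sup>2 * tail (q n) + t\<^sup>2 * (3 * HH * ?d / real L)" by (rule distrib_left)
      ultimately have "D n \<le> \<eta> / 8 + \<eta> / 8 + \<eta> / 2" using elim(1) e1 L1 unfolding K_def by linarith
      then show ?case using \<eta> by (simp add: D_def)
    qed
  qed
  have "(\<lambda>n. complex_of_real (exp (- E n / 2))) \<longlonglongrightarrow> complex_of_real (exp (- (t\<^sup>2 * sigma2) / 2))"
    unfolding E_def v_def times_divide_eq_right[symmetric]
    by (intro tendsto_of_real tendsto_exp tendsto_mult tendsto_minus variance_tendsto[OF W vh] tendsto_const tendsto_divide) simp
  moreover have "(\<lambda>n. (\<integral>\<omega>. iexp (t * S g (W n) \<omega> / sqrt (vol (W n))) \<partial>M) - complex_of_real (exp (- E n / 2))) \<longlonglongrightarrow> 0"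
    using D0 unfolding D_def by (rule tendsto_norm_zero_cancel)
  ultimately show ?thesis using tendsto_add by force
qed

end

section \<open>The weights of the expansion and the limit covariance\<close>

text \<open>Uniqueness of characteristic functions identifies the law with that of
  \<open>sqrt s\<close> times a standard normal variable, where mean and second moment are read off.
  \<open>s = 0\<close> is the degenerate branch of \<open>centered_normal\<close>.\<close>

lemma gaussian_from_char:
  fixes Z :: "'b \<Rightarrow> real"
  assumes N: "prob_space N" and Z[measurable]: "Z \<in> borel_measurable N" and s: "s \<ge> 0"
    and char: "\<And>t. (\<integral>\<omega>. iexp (t * Z \<omega>) \<partial>N) = complex_of_real (exp (- (t\<^sup>2 * s) / 2))"
  shows "centered_normal N Z" "integrable N (\<lambda>\<omega>. (Z \<omega>)\<^sup>2)" "(\<integral>\<omega>. (Z \<omega>)\<^sup>2 \<partial>N) = s"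
    "integrable N Z" "(\<integral>\<omega>. Z \<omega> \<partial>N) = 0"
proof -
  interpret N: prob_space N by (rule N)
  interpret G: real_distribution std_normal_distribution by (rule real_dist_normal_dist)
  define R where "R = distr std_normal_distribution borel (\<lambda>x. sqrt s * x)"
  have eq: "distr N borel Z = R"
  proof (rule Levy_uniqueness)
    show "real_distribution (distr N borel Z)" by (rule N.real_distribution_distr) simp
    show "real_distribution R" unfolding R_def by (rule G.real_distribution_distr) simp
    show "char (distr N borel Z) = char R"
    proof
      fix t
      have "char (distr N borel Z) t = (\<integral>\<omega>. iexp (t * Z \<omega>) \<partial>N)"
        unfolding char_def by (subst integral_distr) auto
      also have "\<dots> = complex_of_real (exp (- (t\<^sup>2 * s) / 2))" by (rule char)
      also have "\<dots> = char std_normal_distribution (t * sqrt s)"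
        using s by (simp add: char_std_normal_distribution power_mult_distrib)
      also have "\<dots> = char R t"
        unfolding char_def R_def by (subst integral_distr) (auto simp: mult_ac)
      finally show "char (distr N borel Z) t = char R t" .
    qed
  qed
  have i2: "integrable std_normal_distribution (\<lambda>x. x ^ 2)" and e2: "(\<integral>x. x ^ 2 \<partial>std_normal_distribution) = 1"
    using integrable_std_normal_distribution_moment[of 2] std_normal_distribution_even_moments[of 1] by (simp_all add: fact_2)
  have i1: "integrable std_normal_distribution (\<lambda>x. x)" and e1: "(\<integral>x. x \<partial>std_normal_distribution) = 0"
    using integrable_std_normal_distribution_moment[of 1] integral_std_normal_distribution_moment_odd[of 1] by simp_all
  have "integrable R (\<lambda>x. x\<^sup>2)" unfolding R_def
    using i2 by (subst integrable_distr_eq) (auto simp: power_mult_distrib)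
  then show "integrable N (\<lambda>\<omega>. (Z \<omega>)\<^sup>2)" unfolding eq[symmetric] by (subst (asm) integrable_distr_eq) auto
  have "(\<integral>\<omega>. (Z \<omega>)\<^sup>2 \<partial>N) = (\<integral>x. x\<^sup>2 \<partial>R)" unfolding eq[symmetric] by (subst integral_distr) auto
  also have "\<dots> = s" unfolding R_def using s e2 by (subst integral_distr) (auto simp: power_mult_distrib)
  finally show "(\<integral>\<omega>. (Z \<omega>)\<^sup>2 \<partial>N) = s" .
  show "integrable N Z"
  proof (rule Bochner_Integration.integrable_bound)
    show "integrable N (\<lambda>\<omega>. 1 + (Z \<omega>)\<^sup>2)" using \<open>integrable N (\<lambda>\<omega>. (Z \<omega>)\<^sup>2)\<close> by simp
    show "AE \<omega> in N. norm (Z \<omega>) \<le> norm (1 + (Z \<omega>)\<^sup>2)"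
    proof (intro AE_I2)
      fix \<omega>
      have "0 \<le> (\<bar>Z \<omega>\<bar> - 1)\<^sup>2" by simp
      then have "2 * \<bar>Z \<omega>\<bar> \<le> 1 + (Z \<omega>)\<^sup>2" by (simp add: power2_eq_square algebra_simps)
      then show "norm (Z \<omega>) \<le> norm (1 + (Z \<omega>)\<^sup>2)" by simp
    qed
  qed simp
  have m1: "(\<lambda>x. sqrt s * x) \<in> measurable std_normal_distribution borel" by simp
  have m2: "(\<lambda>x::real. x) \<in> borel_measurable borel" by simp
  have "(\<integral>\<omega>. Z \<omega> \<partial>N) = (\<integral>x. x \<partial>distr N borel Z)"
    by (rule integral_distr[OF Z m2, symmetric])
  also have "\<dots> = (\<integral>x. x \<partial>R)" by (simp only: eq)
  also have "\<dots> = (\<integral>x. sqrt s * x \<partial>std_normal_distribution)"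
    unfolding R_def by (rule integral_distr[OF m1 m2])
  also have "\<dots> = 0" by (simp only: integral_mult_right_zero e1 mult_zero_right)
  finally show "(\<integral>\<omega>. Z \<omega> \<partial>N) = 0" .
  have dl: "distr N lborel Z = distr N borel Z" by (rule distr_cong) auto
  show "centered_normal N Z"
  proof (cases "s = 0")
    case True
    have "R = return borel 0"
    proof -
      have "(\<lambda>x. sqrt s * x) = (\<lambda>_. 0)" using True by (simp add: fun_eq_iff)
      then show ?thesis unfolding R_def by (simp only:) (rule G.distr_const, simp)
    qed
    also have "\<dots> = return lborel 0" by (rule return_cong) simp
    finally show ?thesis unfolding centered_normal_def dl eq by simp
  next
    case False
    then have sp: "sqrt s > 0" using s by simp
    have "distributed std_normal_distribution lborel (\<lambda>x. x) (normal_density 0 1)"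
      unfolding distributed_def by (auto simp: distr_id2)
    then have "distributed std_normal_distribution lborel (\<lambda>x. 0 + sqrt s * x) (normal_density (0 + sqrt s * 0) (\<bar>sqrt s\<bar> * 1))"
      using sp by (intro G.normal_density_affine) auto
    then have "distr std_normal_distribution lborel (\<lambda>x. sqrt s * x) = density lborel (normal_density 0 (sqrt s))"
      using sp by (simp add: distributed_def)
    moreover have "distr std_normal_distribution lborel (\<lambda>x. sqrt s * x) = R" unfolding R_def by (rule distr_cong) auto
    ultimately have "R = density lborel (normal_density 0 (sqrt s))" by simp
    then show ?thesis unfolding centered_normal_def dl eq using sp Z by blast
  qed
qed

section \<open>The dyadic system arranged as a sequence, and its covariances\<close>

definition lev_idx :: "nat \<Rightarrow> nat \<times> int" where
  "lev_idx = from_nat_into UNIV"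

lemma lev_idx_bij: "bij_betw lev_idx UNIV UNIV"
proof -
  have "infinite (UNIV :: (nat \<times> int) set)" by (simp add: finite_prod)
  then show ?thesis unfolding lev_idx_def by (intro bij_betw_from_nat_into) auto
qed

definition lev_seq :: "nat \<Rightarrow> real \<Rightarrow> real" where
  "lev_seq k = lev_fun (lev_idx k)"

definition coeff_seq :: "(real \<Rightarrow> real) \<Rightarrow> nat \<Rightarrow> real" where
  "coeff_seq f k = lev_coeff f (lev_idx k)"

lemma lev_seq_nonneg: "0 \<le> lev_seq k x" and lev_seq_le_1: "lev_seq k x \<le> 1"
  by (simp_all add: lev_seq_def lev_fun_nonneg lev_fun_le_1)

lemma lev_seq_measurable [measurable]: "lev_seq k \<in> borel_measurable borel"
  by (simp add: lev_seq_def)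

lemma lev_seq_sum_le: "(\<Sum>k<K. lev_seq k x) \<le> \<bar>x\<bar> + 2"
proof -
  have "((\<lambda>m. lev_fun m x) has_sum (\<Sum>\<^sub>\<infinity>m. lev_fun m x)) UNIV"
    by (rule has_sum_infsum[OF lev_fun_summable])
  then have "((\<lambda>k. lev_fun (lev_idx k) x) has_sum (\<Sum>\<^sub>\<infinity>m. lev_fun m x)) UNIV"
    by (subst has_sum_reindex_bij_betw[OF lev_idx_bij])
  then have s: "(\<lambda>k. lev_seq k x) sums (\<Sum>\<^sub>\<infinity>m. lev_fun m x)"
    unfolding lev_seq_def by (rule has_sum_imp_sums)
  then have "summable (\<lambda>k. lev_seq k x)" by (rule sums_summable)
  then have "(\<Sum>k<K. lev_seq k x) \<le> (\<Sum>k. lev_seq k x)"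
    by (rule sum_le_suminf) (auto simp: lev_seq_nonneg)
  also have "\<dots> \<le> \<bar>x\<bar> + 2" using lev_fun_infsum_le s by (simp add: sums_unique[symmetric])
  finally show "(\<Sum>k<K. lev_seq k x) \<le> \<bar>x\<bar> + 2" .
qed

lemma abs_coeff_seq_le: "L-lipschitz_on UNIV f \<Longrightarrow> \<bar>coeff_seq f k\<bar> \<le> L"
  unfolding coeff_seq_def by (rule abs_lev_coeff_le)

lemma coeff_seq_linear: "coeff_seq (\<lambda>x. a * f x + b * g x) k = a * coeff_seq f k + b * coeff_seq g k"
  unfolding coeff_seq_def by (cases "lev_idx k" rule: lev_set.cases) (auto simp: algebra_simps)

lemma lipschitz_expansion_sums:
  assumes "L-lipschitz_on UNIV f"
  shows "(\<lambda>k. coeff_seq f k * lev_seq k x) sums (f x - f 0)"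
proof -
  have "((\<lambda>k. lev_coeff f (lev_idx k) * lev_fun (lev_idx k) x) has_sum (f x - f 0)) UNIV"
    using lipschitz_lev_expansion[OF assms, of x] by (subst has_sum_reindex_bij_betw[OF lev_idx_bij])
  then show ?thesis unfolding coeff_seq_def lev_seq_def by (rule has_sum_imp_sums)
qed

lemma lborel_integral_uminus:
  fixes f :: "'d::euclidean_space \<Rightarrow> real"
  assumes [measurable]: "f \<in> borel_measurable borel"
  shows "(\<integral>u. f (- u) \<partial>lborel) = (\<integral>u. f u \<partial>lborel)"
proof -
  have "(lborel :: 'd measure) = density (distr lborel borel (\<lambda>x. 0 + (-1) *\<^sub>R x)) (\<lambda>_. ennreal (\<bar>-1\<bar> ^ DIM('d)))"
    using lborel_affine[of "-1" "0::'d"] by simp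
  then have *: "(lborel :: 'd measure) = distr lborel borel uminus" by (simp add: density_1)
  have "(\<integral>u. f u \<partial>distr lborel borel uminus) = (\<integral>u. f (- u) \<partial>lborel)"
    by (subst integral_distr) auto
  then show ?thesis using * by simp
qed

locale lev_field = mixing_field M X \<nu> C l
  for M :: "'a measure" and X :: "'d::euclidean_space \<Rightarrow> 'a \<Rightarrow> real" and \<nu> C l +
  assumes moment: "integrable M (\<lambda>\<omega>. (2 + \<bar>X 0 \<omega>\<bar>) ^ 4)"
begin

text \<open>Exactly what the covariance inequality for indicators charges for one of the two
  factors, so that covariances are bounded by \<open>h u * (wt j * wt k)\<close>.\<close>

definition wt :: "nat \<Rightarrow> real" where
  "wt k = lev_height (lev_idx k) * lev_prob M (X 0) (lev_idx k) powr (1/3)"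

lemma wt_nonneg: "0 \<le> wt k" by (simp add: wt_def lev_height_nonneg)

lemma wt_summable: "summable wt"
proof -
  have "(\<lambda>m. lev_height m * lev_prob M (X 0) m powr (1/3)) summable_on UNIV"
    by (rule lev_weight_summable[OF prob_space_axioms field_measurable moment])
  then have "(\<lambda>k. lev_height (lev_idx k) * lev_prob M (X 0) (lev_idx k) powr (1/3)) summable_on UNIV"
    by (subst summable_on_reindex_bij_betw[OF lev_idx_bij])
  then show ?thesis unfolding wt_def[abs_def] by (rule summable_on_imp_summable)
qed

definition mean :: "nat \<Rightarrow> real" where
  "mean k = expectation (\<lambda>\<omega>. lev_seq k (X 0 \<omega>))"

lemma integrable_lev_seq: "integrable M (\<lambda>\<omega>. lev_seq k (X t \<omega>))"
  by (rule integrable_const_bound[of _ 1]) (auto simp: lev_seq_nonneg lev_seq_le_1)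

lemma mean_stationary: "expectation (\<lambda>\<omega>. lev_seq k (X t \<omega>)) = mean k"
  using stationary_single[OF lev_seq_measurable] by (simp add: mean_def)

lemma mean_nonneg: "0 \<le> mean k" and mean_le_1: "mean k \<le> 1"
proof -
  show "0 \<le> mean k" unfolding mean_def by (rule Bochner_Integration.integral_nonneg) (simp add: lev_seq_nonneg)
  have "mean k \<le> expectation (\<lambda>_. 1)" unfolding mean_def
    by (rule integral_mono[OF integrable_lev_seq]) (auto simp: lev_seq_le_1)
  then show "mean k \<le> 1" by (simp add: prob_space)
qed

definition cov :: "nat \<Rightarrow> nat \<Rightarrow> 'd \<Rightarrow> real" where
  "cov j k u = expectation (\<lambda>\<omega>. lev_seq j (X 0 \<omega>) * lev_seq k (X u \<omega>)) - mean j * mean k"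

lemma abs_cov_le: "\<bar>cov j k u\<bar> \<le> h u * (wt j * wt k)"
proof -
  let ?A = "lev_set (lev_idx j)" and ?B = "lev_set (lev_idx k)"
  define a where "a = lev_height (lev_idx j)"
  define b where "b = lev_height (lev_idx k)"
  have ab: "0 \<le> a" "0 \<le> b" by (simp_all add: a_def b_def lev_height_nonneg)
  define e where "e = expectation (\<lambda>\<omega>. indicator ?A (X 0 \<omega>) * indicator ?B (X u \<omega>)) - expectation (\<lambda>\<omega>. indicator ?A (X 0 \<omega>)) * expectation (\<lambda>\<omega>. indicator ?B (X 0 \<omega>) :: real)"
  have "cov j k u = expectation (\<lambda>\<omega>. (a * b) * (indicator ?A (X 0 \<omega>) * indicator ?B (X u \<omega>))) - expectation (\<lambda>\<omega>. a * indicator ?A (X 0 \<omega>)) * expectation (\<lambda>\<omega>. b * indicator ?B (X 0 \<omega>))"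
    unfolding cov_def mean_def lev_seq_def lev_fun_def a_def b_def by (simp only: mult_ac)
  also have "\<dots> = a * b * e" unfolding e_def by (simp only: integral_mult_right_zero right_diff_distrib mult_ac)
  finally have "\<bar>cov j k u\<bar> = a * b * \<bar>e\<bar>" using ab by (simp add: abs_mult)
  also have "\<dots> \<le> a * b * (h u * lev_prob M (X 0) (lev_idx j) powr (1/3) * lev_prob M (X 0) (lev_idx k) powr (1/3))"
    using ab covariance_indicators[OF lev_set_borel lev_set_borel, of "lev_idx j" "lev_idx k" u]
    unfolding e_def lev_prob_def by (intro mult_left_mono) auto
  also have "\<dots> = h u * (wt j * wt k)" unfolding wt_def a_def b_def by (simp only: mult_ac)
  finally show ?thesis .
qed

lemma field_measurable_prod [measurable]: "(\<lambda>(u, \<omega>). X u \<omega>) \<in> borel_measurable (lborel \<Otimes>\<^sub>M M)"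
  using field_measurable_pair by (simp add: case_prod_beta)

lemma cov_measurable [measurable]: "cov j k \<in> borel_measurable borel"
proof -
  have "(\<lambda>u. expectation (\<lambda>\<omega>. lev_seq j (X 0 \<omega>) * lev_seq k (X u \<omega>))) \<in> borel_measurable lborel"
    by (rule borel_measurable_lebesgue_integral) measurable
  then have "(\<lambda>u. expectation (\<lambda>\<omega>. lev_seq j (X 0 \<omega>) * lev_seq k (X u \<omega>))) \<in> borel_measurable borel" by simp
  then show ?thesis unfolding cov_def[abs_def] by (intro borel_measurable_diff borel_measurable_const)
qed

lemma cov_integrable: "integrable lborel (cov j k)"
proof (rule Bochner_Integration.integrable_bound)
  show "integrable lborel (\<lambda>u. h u * (wt j * wt k))" using h_integrable by simp
  show "AE u in lborel. norm (cov j k u) \<le> norm (h u * (wt j * wt k))"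
    using abs_cov_le by (intro AE_I2) (auto intro: order_trans[OF _ abs_ge_self])
qed simp

definition Gam :: "nat \<Rightarrow> nat \<Rightarrow> real" where
  "Gam j k = (\<integral>u. cov j k u \<partial>lborel)"

lemma cov_uminus: "cov j k (- u) = cov k j u"
proof -
  have "expectation (\<lambda>\<omega>. lev_seq j (X u \<omega>) * lev_seq k (X 0 \<omega>)) = expectation (\<lambda>\<omega>. lev_seq j (X 0 \<omega>) * lev_seq k (X (0 - u) \<omega>))"
    using stationary_pair[of "\<lambda>p. lev_seq j (fst p) * lev_seq k (snd p)" u 0] by simp
  then show ?thesis by (simp add: cov_def mult.commute)
qed

lemma Gam_commute: "Gam j k = Gam k j"
  using lborel_integral_uminus[of "cov j k"] by (simp add: Gam_def cov_uminus)

lemma Gam_diag_le: "Gam k k \<le> HH * (wt k)\<^sup>2"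
proof -
  have "Gam k k \<le> (\<integral>u. h u * (wt k * wt k) \<partial>lborel)"
    unfolding Gam_def using h_integrable abs_cov_le[of k k] by (intro integral_mono cov_integrable) (auto intro: order_trans[OF abs_ge_self])
  then show ?thesis by (simp add: HH_def power2_eq_square)
qed

end

section \<open>The random coefficient sequence of a window\<close>

locale lev_window = lev_field M X \<nu> C l
  for M :: "'a measure" and X :: "'d::euclidean_space \<Rightarrow> 'a \<Rightarrow> real" and \<nu> C l +
  fixes W :: "nat \<Rightarrow> 'd set"
  assumes Wc: "\<And>n. compact (W n)" and vh: "van_hove W"
begin

definition vW :: "nat \<Rightarrow> real" where "vW n = measure lborel (W n)"

lemma vW_pos: "vW n > 0" using vh by (simp add: van_hove_def vW_def)

lemma W_borel [measurable]: "W n \<in> sets borel" using Wc by (rule borel_compact)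

lemma W_finite: "emeasure lborel (W n) < \<infinity>" using Wc by (rule emeasure_compact_finite)

definition good :: "nat \<Rightarrow> 'a \<Rightarrow> bool" where
  "good n \<omega> \<longleftrightarrow> set_integrable lborel (W n) (\<lambda>t. X t \<omega>)"

text \<open>The value 0 on paths that are not integrable follows the convention of
  \<open>PhiN\<close>, so that the two correspond at every point of the probability space and not
  only almost surely.\<close>

definition Yn :: "nat \<Rightarrow> 'a \<Rightarrow> nat \<Rightarrow> real" where
  "Yn n \<omega> k = (if good n \<omega> then (S (lev_seq k) (W n) \<omega> - vW n * mean k) / sqrt (vW n) else 0)"

lemma distr_field: "distr M borel (X t) = distr M borel (X 0)"
proof (rule measure_eqI)
  fix A :: "real set" assume "A \<in> sets (distr M borel (X t))"
  then have [measurable]: "A \<in> sets borel" by simp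
  have *: "prob (X s -` A \<inter> space M) = expectation (\<lambda>\<omega>. indicator A (X s \<omega>))" for s
  proof -
    have "expectation (\<lambda>\<omega>. indicator A (X s \<omega>) :: real) = expectation (\<lambda>\<omega>. indicator (X s -` A \<inter> space M) \<omega>)"
      by (rule Bochner_Integration.integral_cong) (auto simp: indicator_def)
    then show ?thesis by simp
  qed
  have "prob (X t -` A \<inter> space M) = prob (X 0 -` A \<inter> space M)"
    unfolding * by (rule stationary_single) measurable
  then show "emeasure (distr M borel (X t)) A = emeasure (distr M borel (X 0)) A"
    by (simp add: emeasure_distr emeasure_eq_measure)
qed simp

lemma integrable_abs_field: "integrable M (\<lambda>\<omega>. \<bar>X t \<omega>\<bar>)"
proof -
  have "integrable M (\<lambda>\<omega>. \<bar>X 0 \<omega>\<bar>)"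
  proof (rule Bochner_Integration.integrable_bound[OF moment])
    show "AE \<omega> in M. norm \<bar>X 0 \<omega>\<bar> \<le> norm ((2 + \<bar>X 0 \<omega>\<bar>) ^ 4)"
    proof (intro AE_I2)
      fix \<omega>
      have "2 + \<bar>X 0 \<omega>\<bar> \<le> (2 + \<bar>X 0 \<omega>\<bar>) ^ 4" by (rule self_le_power) auto
      then show "norm \<bar>X 0 \<omega>\<bar> \<le> norm ((2 + \<bar>X 0 \<omega>\<bar>) ^ 4)" by simp
    qed
  qed simp
  then have "integrable (distr M borel (X 0)) (\<lambda>x. \<bar>x\<bar>)" by (subst integrable_distr_eq) auto
  then have "integrable (distr M borel (X t)) (\<lambda>x. \<bar>x\<bar>)" by (subst distr_field)
  then show ?thesis by (subst (asm) integrable_distr_eq) auto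
qed

lemma field_measurable_swap [measurable]: "(\<lambda>(\<omega>, t). X t \<omega>) \<in> borel_measurable (M \<Otimes>\<^sub>M lborel)"
  using measurable_pair_swap[OF field_measurable_prod] by (simp add: case_prod_beta)

definition path_norm :: "nat \<Rightarrow> 'a \<Rightarrow> ennreal" where
  "path_norm n \<omega> = (\<integral>\<^sup>+t. indicator (W n) t * ennreal \<bar>X t \<omega>\<bar> \<partial>lborel)"

lemma path_norm_measurable [measurable]: "path_norm n \<in> borel_measurable M"
  unfolding path_norm_def[abs_def] by measurable

lemma good_iff:
  assumes "\<omega> \<in> space M" shows "good n \<omega> \<longleftrightarrow> path_norm n \<omega> < \<infinity>"
proof -
  note [measurable] = field_measurable_path[OF assms]
  have "good n \<omega> \<longleftrightarrow> (\<integral>\<^sup>+t. ennreal (norm (indicator (W n) t *\<^sub>R X t \<omega>)) \<partial>lborel) < \<infinity>"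
    unfolding good_def set_integrable_def integrable_iff_bounded by simp
  also have "(\<integral>\<^sup>+t. ennreal (norm (indicator (W n) t *\<^sub>R X t \<omega>)) \<partial>lborel) = path_norm n \<omega>"
    unfolding path_norm_def by (intro nn_integral_cong) (auto simp: indicator_def)
  finally show ?thesis .
qed

lemma good_measurable [measurable]: "Measurable.pred M (good n)"
proof -
  have "Measurable.pred M (\<lambda>\<omega>. path_norm n \<omega> < \<infinity>)" by measurable
  then show ?thesis by (subst measurable_cong[where g = "\<lambda>\<omega>. path_norm n \<omega> < \<infinity>"]) (auto simp: good_iff)
qed

text \<open>By Tonelli, the expected integral of \<open>\<bar>X t \<omega>\<bar>\<close> over the
  window is its volume times the finite first absolute moment.\<close>

lemma AE_good: "AE \<omega> in M. good n \<omega>"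
proof -
  interpret P: pair_sigma_finite M lborel ..
  have "(\<integral>\<^sup>+\<omega>. path_norm n \<omega> \<partial>M) = (\<integral>\<^sup>+t. (\<integral>\<^sup>+\<omega>. indicator (W n) t * ennreal \<bar>X t \<omega>\<bar> \<partial>M) \<partial>lborel)"
    unfolding path_norm_def by (rule P.Fubini'[symmetric]) measurable
  also have "\<dots> = (\<integral>\<^sup>+t. indicator (W n) t * ennreal (expectation (\<lambda>\<omega>. \<bar>X 0 \<omega>\<bar>)) \<partial>lborel)"
  proof (rule nn_integral_cong)
    fix t
    have "(\<integral>\<^sup>+\<omega>. indicator (W n) t * ennreal \<bar>X t \<omega>\<bar> \<partial>M) = indicator (W n) t * (\<integral>\<^sup>+\<omega>. ennreal \<bar>X t \<omega>\<bar> \<partial>M)"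
      by (rule nn_integral_cmult) measurable
    also have "(\<integral>\<^sup>+\<omega>. ennreal \<bar>X t \<omega>\<bar> \<partial>M) = ennreal (expectation (\<lambda>\<omega>. \<bar>X t \<omega>\<bar>))"
      by (rule nn_integral_eq_integral[OF integrable_abs_field]) simp
    also have "expectation (\<lambda>\<omega>. \<bar>X t \<omega>\<bar>) = expectation (\<lambda>\<omega>. \<bar>X 0 \<omega>\<bar>)"
      by (rule stationary_single) simp
    finally show "(\<integral>\<^sup>+\<omega>. indicator (W n) t * ennreal \<bar>X t \<omega>\<bar> \<partial>M) = indicator (W n) t * ennreal (expectation (\<lambda>\<omega>. \<bar>X 0 \<omega>\<bar>))" .
  qed
  also have "\<dots> = emeasure lborel (W n) * ennreal (expectation (\<lambda>\<omega>. \<bar>X 0 \<omega>\<bar>))"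
    by (subst nn_integral_multc) auto
  also have "\<dots> < \<infinity>" using W_finite[of n] by (simp add: ennreal_mult_less_top)
  finally have "(\<integral>\<^sup>+\<omega>. path_norm n \<omega> \<partial>M) \<noteq> \<infinity>" by simp
  then have "AE \<omega> in M. path_norm n \<omega> \<noteq> \<infinity>" by (intro nn_integral_PInf_AE) measurable
  then show ?thesis using AE_space by eventually_elim (simp add: good_iff less_top)
qed

lemma lev_seq_abs_le: "\<bar>lev_seq k x\<bar> \<le> 1" using lev_seq_nonneg[of k x] lev_seq_le_1[of k x] by simp

lemmas S_lev_measurable [measurable] = S_measurable[OF lev_seq_measurable lev_seq_abs_le W_borel W_finite]
lemmas path_lev_integrable = path_integrable[OF lev_seq_measurable lev_seq_abs_le W_borel W_finite]

lemma Yn_measurable [measurable]: "(\<lambda>\<omega>. Yn n \<omega> k) \<in> borel_measurable M"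
  unfolding Yn_def by measurable

lemma S_lev_nonneg: "0 \<le> S (lev_seq k) (W n) \<omega>"
  unfolding S_def set_lebesgue_integral_def by (rule Bochner_Integration.integral_nonneg) (simp add: lev_seq_nonneg)

lemma sum_S_lev_le:
  assumes \<omega>: "\<omega> \<in> space M" and gd: "good n \<omega>"
  shows "(\<Sum>k<K. S (lev_seq k) (W n) \<omega>) \<le> (\<integral>t. indicator (W n) t * (\<bar>X t \<omega>\<bar> + 2) \<partial>lborel)"
proof -
  have iX: "integrable lborel (\<lambda>t. indicator (W n) t * X t \<omega>)"
    using gd by (simp add: good_def set_integrable_def)
  have "integrable lborel (\<lambda>t. \<bar>indicator (W n) t * X t \<omega>\<bar> + indicator (W n) t * 2)"
    using iX W_finite[of n] by (intro Bochner_Integration.integrable_add integrable_abs) auto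
  then have iX2: "integrable lborel (\<lambda>t. indicator (W n) t * (\<bar>X t \<omega>\<bar> + 2))"
    by (rule Bochner_Integration.integrable_cong[OF refl, THEN iffD1, rotated]) (auto simp: indicator_def)
  have "(\<Sum>k<K. S (lev_seq k) (W n) \<omega>) = (\<integral>t. (\<Sum>k<K. indicator (W n) t * lev_seq k (X t \<omega>)) \<partial>lborel)"
    unfolding S_def set_lebesgue_integral_def using path_lev_integrable[OF \<omega>]
    by (subst Bochner_Integration.integral_sum) auto
  also have "\<dots> \<le> (\<integral>t. indicator (W n) t * (\<bar>X t \<omega>\<bar> + 2) \<partial>lborel)"
  proof (rule integral_mono[OF _ iX2])
    show "integrable lborel (\<lambda>t. \<Sum>k<K. indicator (W n) t * lev_seq k (X t \<omega>))"
      by (intro Bochner_Integration.integrable_sum path_lev_integrable[OF \<omega>])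
    show "(\<Sum>k<K. indicator (W n) t * lev_seq k (X t \<omega>)) \<le> indicator (W n) t * (\<bar>X t \<omega>\<bar> + 2)" for t
      unfolding sum_distrib_left[symmetric] by (intro mult_left_mono lev_seq_sum_le) simp
  qed
  finally show ?thesis .
qed

lemma sum_mean_le: "(\<Sum>k<K. mean k) \<le> expectation (\<lambda>\<omega>. \<bar>X 0 \<omega>\<bar> + 2)"
proof -
  have "(\<Sum>k<K. mean k) = expectation (\<lambda>\<omega>. \<Sum>k<K. lev_seq k (X 0 \<omega>))"
    unfolding mean_def by (rule Bochner_Integration.integral_sum[symmetric]) (rule integrable_lev_seq)
  also have "\<dots> \<le> expectation (\<lambda>\<omega>. \<bar>X 0 \<omega>\<bar> + 2)"
  proof (rule integral_mono)
    show "integrable M (\<lambda>\<omega>. \<Sum>k<K. lev_seq k (X 0 \<omega>))" by (intro Bochner_Integration.integrable_sum integrable_lev_seq)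
    show "integrable M (\<lambda>\<omega>. \<bar>X 0 \<omega>\<bar> + 2)" using integrable_abs_field[of 0] by simp
  qed (rule lev_seq_sum_le)
  finally show ?thesis .
qed

text \<open>Pathwise summability, with a bound that depends on the path and on \<open>n\<close>: at
  each point the level functions sum to at most \<open>\<bar>x\<bar> + 2\<close>, which is
  integrable over the window along a good path.\<close>

lemma Yn_in_l1:
  assumes \<omega>: "\<omega> \<in> space M" shows "Yn n \<omega> \<in> l1"
proof (cases "good n \<omega>")
  case True
  define B where "B = ((\<integral>t. indicator (W n) t * (\<bar>X t \<omega>\<bar> + 2) \<partial>lborel) + vW n * expectation (\<lambda>\<omega>. \<bar>X 0 \<omega>\<bar> + 2)) / sqrt (vW n)"
  have "(\<Sum>k<K. \<bar>Yn n \<omega> k\<bar>) \<le> B" for K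
  proof -
    have "(\<Sum>k<K. \<bar>Yn n \<omega> k\<bar>) \<le> (\<Sum>k<K. (S (lev_seq k) (W n) \<omega> + vW n * mean k) / sqrt (vW n))"
    proof (rule sum_mono)
      fix k
      have "\<bar>S (lev_seq k) (W n) \<omega> - vW n * mean k\<bar> \<le> S (lev_seq k) (W n) \<omega> + vW n * mean k"
        using S_lev_nonneg[of k n \<omega>] mean_nonneg[of k] vW_pos[of n] by (intro abs_leI) auto
      then show "\<bar>Yn n \<omega> k\<bar> \<le> (S (lev_seq k) (W n) \<omega> + vW n * mean k) / sqrt (vW n)"
        using True vW_pos[of n] by (simp add: Yn_def abs_divide divide_right_mono)
    qed
    also have "\<dots> = ((\<Sum>k<K. S (lev_seq k) (W n) \<omega>) + vW n * (\<Sum>k<K. mean k)) / sqrt (vW n)"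
      by (simp only: sum_divide_distrib[symmetric] sum.distrib sum_distrib_left[symmetric])
    also have "\<dots> \<le> B"
      unfolding B_def using sum_S_lev_le[OF \<omega> True] sum_mean_le vW_pos[of n]
      by (intro divide_right_mono add_mono mult_left_mono) auto
    finally show ?thesis .
  qed
  then have "summable (\<lambda>k. \<bar>Yn n \<omega> k\<bar>)" by (intro summableI_nonneg_bounded) auto
  then show ?thesis by (simp add: l1_def)
next
  case False
  then show ?thesis by (simp add: l1_def Yn_def)
qed

text \<open>This is the bound that is uniform in \<open>n\<close>: the first moment is at most the
  root of the second, and the second is at most \<open>HH * (wt k)\<^sup>2\<close> once divided by
  the volume.\<close>

lemma Yn_first_moment: "integrable M (\<lambda>\<omega>. Yn n \<omega> k)" "expectation (\<lambda>\<omega>. \<bar>Yn n \<omega> k\<bar>) \<le> sqrt HH * wt k"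
proof -
  define g where "g = (\<lambda>x. lev_seq k x - mean k)"
  interpret G: centered_field M X \<nu> C l g
  proof
    show "g \<in> borel_measurable borel" unfolding g_def by measurable
    show "\<bar>g x\<bar> \<le> 1" for x
      using lev_seq_nonneg[of k x] lev_seq_le_1[of k x] mean_nonneg[of k] mean_le_1[of k] by (simp add: g_def)
    show "expectation (\<lambda>\<omega>. g (X 0 \<omega>)) = 0"
      unfolding g_def using integrable_lev_seq[of k 0] by (simp add: mean_def prob_space)
  qed
  have Wf: "G.fin_set (W n)" using W_finite[of n] by (simp add: G.fin_set_def)
  have v: "G.vol (W n) = vW n" by (simp add: G.vol_def vW_def)
  have Sg: "S g (W n) \<omega> = S (lev_seq k) (W n) \<omega> - vW n * mean k" if "\<omega> \<in> space M" for \<omega>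
  proof -
    have "S g (W n) \<omega> = (\<integral>t. indicator (W n) t * lev_seq k (X t \<omega>) - indicator (W n) t * mean k \<partial>lborel)"
      unfolding S_def set_lebesgue_integral_def g_def by (simp add: right_diff_distrib)
    also have "\<dots> = S (lev_seq k) (W n) \<omega> - vW n * mean k"
      unfolding S_def set_lebesgue_integral_def using path_lev_integrable[OF that] W_finite[of n]
      by (subst Bochner_Integration.integral_diff) (auto simp: vW_def)
    finally show ?thesis .
  qed
  have acov: "G.acov u = cov k k u" for u
  proof -
    have "G.acov u = expectation (\<lambda>\<omega>. lev_seq k (X 0 \<omega>) * lev_seq k (X u \<omega>) - mean k * lev_seq k (X 0 \<omega>) - mean k * lev_seq k (X u \<omega>) + mean k * mean k)"
      unfolding G.acov_def unfolding g_def by (rule Bochner_Integration.integral_cong) (auto simp: algebra_simps)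
    moreover have "integrable M (\<lambda>\<omega>. lev_seq k (X 0 \<omega>) * lev_seq k (X u \<omega>))"
      by (rule integrable_const_bound[of _ 1]) (auto simp: lev_seq_abs_le abs_mult intro!: mult_le_one)
    ultimately show ?thesis
      using integrable_lev_seq[of k] by (simp add: mean_stationary prob_space cov_def)
  qed
  have "\<bar>G.acov u\<bar> \<le> (wt k)\<^sup>2 * h u" for u
    using abs_cov_le[of k k u] by (simp add: acov power2_eq_square mult.commute)
  then have m2: "expectation (\<lambda>\<omega>. (S g (W n) \<omega>)\<^sup>2) \<le> (wt k)\<^sup>2 * HH * vW n"
    using G.second_moment_scaled[OF Wf, of "(wt k)\<^sup>2"] by (simp add: v)
  have bS: "G.bounded_rv (S g (W n))" by (rule G.bounded_rv_S[OF Wf])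
  have iS2: "integrable M (\<lambda>\<omega>. (S g (W n) \<omega>)\<^sup>2)"
    using G.bounded_rv_integrable[OF G.bounded_rv_mult[OF bS bS]] by (simp add: power2_eq_square)
  have iS: "integrable M (S g (W n))" by (rule G.bounded_rv_integrable[OF bS])
  have ae: "AE \<omega> in M. Yn n \<omega> k = S g (W n) \<omega> / sqrt (vW n)"
    using AE_good[of n] AE_space by eventually_elim (simp add: Yn_def Sg)
  have [measurable]: "S g (W n) \<in> borel_measurable M" using iS by simp
  show "integrable M (\<lambda>\<omega>. Yn n \<omega> k)"
    using iS by (subst integrable_cong_AE[OF _ _ ae]) auto
  define m where "m = expectation (\<lambda>\<omega>. \<bar>S g (W n) \<omega>\<bar>)"
  have "0 \<le> expectation (\<lambda>\<omega>. (\<bar>S g (W n) \<omega>\<bar> - m)\<^sup>2)" by (rule Bochner_Integration.integral_nonneg) simp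
  also have "\<dots> = expectation (\<lambda>\<omega>. (S g (W n) \<omega>)\<^sup>2 - 2 * m * \<bar>S g (W n) \<omega>\<bar> + m\<^sup>2)"
    by (rule Bochner_Integration.integral_cong) (auto simp: power2_eq_square algebra_simps)
  also have "\<dots> = expectation (\<lambda>\<omega>. (S g (W n) \<omega>)\<^sup>2) - m\<^sup>2"
    using iS iS2 by (simp add: m_def[symmetric] prob_space) (simp add: power2_eq_square)
  finally have "m\<^sup>2 \<le> (wt k)\<^sup>2 * HH * vW n" using m2 by simp
  also have "\<dots> = (sqrt HH * wt k * sqrt (vW n))\<^sup>2"
    using HH_nonneg vW_pos[of n] by (simp add: power_mult_distrib)
  finally have "m \<le> sqrt HH * wt k * sqrt (vW n)"
    by (rule power2_le_imp_le) (use HH_nonneg vW_pos[of n] wt_nonneg[of k] in auto)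
  then have "m / sqrt (vW n) \<le> sqrt HH * wt k" using vW_pos[of n] by (simp add: pos_divide_le_eq)
  moreover have "expectation (\<lambda>\<omega>. \<bar>Yn n \<omega> k\<bar>) = expectation (\<lambda>\<omega>. \<bar>S g (W n) \<omega> / sqrt (vW n)\<bar>)"
    by (rule integral_cong_AE) (use ae in auto)
  moreover have "\<dots> = m / sqrt (vW n)" unfolding m_def using vW_pos[of n] by (simp add: abs_divide)
  ultimately show "expectation (\<lambda>\<omega>. \<bar>Yn n \<omega> k\<bar>) \<le> sqrt HH * wt k" by simp
qed

text \<open>The Cramer-Wold device: a finite combination of level functions is, after centering, one
  bounded function of the field, so the one-dimensional limit theorem applies to it. Its limit
  variance is the quadratic form of \<open>Gam\<close>, which is therefore nonnegative.\<close>

lemma Gam_form: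
  fixes a :: "nat \<Rightarrow> real" and F :: "nat set"
  assumes F: "finite F"
  shows "0 \<le> (\<Sum>j\<in>F. \<Sum>k\<in>F. a j * a k * Gam j k)"
    "(\<lambda>n. \<integral>\<omega>. iexp (\<Sum>k\<in>F. a k * Yn n \<omega> k) \<partial>M) \<longlonglongrightarrow> complex_of_real (exp (- (\<Sum>j\<in>F. \<Sum>k\<in>F. a j * a k * Gam j k) / 2))"
proof -
  \<comment> \<open>Division by \<open>B\<close> brings the combination below 1 in absolute value,
    and the choice \<open>t = B\<close> in the limit theorem undoes it. The summand 1 keeps
    \<open>B\<close> positive when all coefficients vanish.\<close>
  define B where "B = 1 + (\<Sum>k\<in>F. \<bar>a k\<bar>)"
  have sa: "0 \<le> (\<Sum>k\<in>F. \<bar>a k\<bar>)" by (rule sum_nonneg) simp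
  then have B: "B > 0" unfolding B_def by linarith
  define g where "g = (\<lambda>x. (\<Sum>k\<in>F. a k * (lev_seq k x - mean k)) / B)"
  have L1: "\<bar>lev_seq k x - mean k\<bar> \<le> 1" for k x
    using lev_seq_nonneg[of k x] lev_seq_le_1[of k x] mean_nonneg[of k] mean_le_1[of k] by simp
  interpret G: centered_field M X \<nu> C l g
  proof
    show "g \<in> borel_measurable borel" unfolding g_def by measurable
    show "\<bar>g x\<bar> \<le> 1" for x
    proof -
      have "\<bar>\<Sum>k\<in>F. a k * (lev_seq k x - mean k)\<bar> \<le> (\<Sum>k\<in>F. \<bar>a k * (lev_seq k x - mean k)\<bar>)" by (rule sum_abs)
      also have "\<dots> \<le> (\<Sum>k\<in>F. \<bar>a k\<bar> * 1)" unfolding abs_mult by (intro sum_mono mult_left_mono L1) auto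
      also have "\<dots> \<le> B" by (simp add: B_def)
      finally show ?thesis using B by (simp add: g_def)
    qed
    have "expectation (\<lambda>\<omega>. \<Sum>k\<in>F. a k * (lev_seq k (X 0 \<omega>) - mean k)) = (\<Sum>k\<in>F. a k * (mean k - mean k))"
      using integrable_lev_seq[of _ 0] by (simp add: mean_stationary prob_space)
    then show "expectation (\<lambda>\<omega>. g (X 0 \<omega>)) = 0" unfolding g_def by simp
  qed
  have v: "G.vol (W n) = vW n" for n by (simp add: G.vol_def vW_def)
  have Sg: "B * S g (W n) \<omega> / sqrt (vW n) = (\<Sum>k\<in>F. a k * Yn n \<omega> k)" if \<omega>: "\<omega> \<in> space M" and gd: "good n \<omega>" for n \<omega>
  proof -
    have "S g (W n) \<omega> = (\<integral>t. (\<Sum>k\<in>F. (a k / B) * (indicator (W n) t * lev_seq k (X t \<omega>) - indicator (W n) t * mean k)) \<partial>lborel)"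
      unfolding S_def set_lebesgue_integral_def g_def
      by (rule Bochner_Integration.integral_cong) (auto simp: sum_distrib_left sum_divide_distrib right_diff_distrib diff_divide_distrib mult_ac)
    also have "\<dots> = (\<Sum>k\<in>F. (a k / B) * (S (lev_seq k) (W n) \<omega> - vW n * mean k))"
    proof -
      have i: "integrable lborel (\<lambda>t. indicator (W n) t * lev_seq k (X t \<omega>) - indicator (W n) t * mean k)" for k
        using path_lev_integrable[OF \<omega>] W_finite[of n] by (intro Bochner_Integration.integrable_diff) auto
      have e: "(\<integral>t. indicator (W n) t * lev_seq k (X t \<omega>) - indicator (W n) t * mean k \<partial>lborel) = S (lev_seq k) (W n) \<omega> - vW n * mean k" for k
        unfolding S_def set_lebesgue_integral_def using path_lev_integrable[OF \<omega>] W_finite[of n]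
        by (subst Bochner_Integration.integral_diff) (auto simp: vW_def)
      show ?thesis
        by (subst Bochner_Integration.integral_sum) (auto intro!: integrable_mult_right i simp only: integral_mult_right_zero e)
    qed
    finally have "B * S g (W n) \<omega> = (\<Sum>k\<in>F. a k * (S (lev_seq k) (W n) \<omega> - vW n * mean k))"
      using B by (simp add: sum_distrib_left)
    then show ?thesis using gd by (simp add: Yn_def sum_divide_distrib)
  qed
  have acov: "B\<^sup>2 * G.acov u = (\<Sum>j\<in>F. \<Sum>k\<in>F. a j * a k * cov j k u)" for u
  proof -
    have i: "integrable M (\<lambda>\<omega>. (lev_seq j (X 0 \<omega>) - mean j) * (lev_seq k (X u \<omega>) - mean k))" for j k
      by (rule integrable_const_bound[of _ 1]) (auto simp: abs_mult L1 intro!: mult_le_one)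
    have c: "expectation (\<lambda>\<omega>. (lev_seq j (X 0 \<omega>) - mean j) * (lev_seq k (X u \<omega>) - mean k)) = cov j k u" for j k
    proof -
      have "expectation (\<lambda>\<omega>. (lev_seq j (X 0 \<omega>) - mean j) * (lev_seq k (X u \<omega>) - mean k))
        = expectation (\<lambda>\<omega>. lev_seq j (X 0 \<omega>) * lev_seq k (X u \<omega>) - mean k * lev_seq j (X 0 \<omega>) - mean j * lev_seq k (X u \<omega>) + mean j * mean k)"
        by (rule Bochner_Integration.integral_cong) (auto simp: algebra_simps)
      moreover have "integrable M (\<lambda>\<omega>. lev_seq j (X 0 \<omega>) * lev_seq k (X u \<omega>))"
        by (rule integrable_const_bound[of _ 1]) (auto simp: lev_seq_abs_le abs_mult intro!: mult_le_one)
      ultimately show ?thesis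
        using integrable_lev_seq by (simp add: mean_stationary prob_space cov_def)
    qed
    have "B\<^sup>2 * G.acov u = expectation (\<lambda>\<omega>. B\<^sup>2 * (g (X 0 \<omega>) * g (X u \<omega>)))" by (simp add: G.acov_def)
    also have "\<dots> = expectation (\<lambda>\<omega>. \<Sum>j\<in>F. \<Sum>k\<in>F. (a j * a k) * ((lev_seq j (X 0 \<omega>) - mean j) * (lev_seq k (X u \<omega>) - mean k)))"
    proof (rule Bochner_Integration.integral_cong[OF refl])
      fix \<omega>
      have "B\<^sup>2 * (g (X 0 \<omega>) * g (X u \<omega>)) = (\<Sum>j\<in>F. a j * (lev_seq j (X 0 \<omega>) - mean j)) * (\<Sum>k\<in>F. a k * (lev_seq k (X u \<omega>) - mean k))"
        using B by (simp add: g_def power2_eq_square)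
      also have "\<dots> = (\<Sum>j\<in>F. \<Sum>k\<in>F. (a j * a k) * ((lev_seq j (X 0 \<omega>) - mean j) * (lev_seq k (X u \<omega>) - mean k)))"
        unfolding sum_product by (simp only: mult_ac)
      finally show "B\<^sup>2 * (g (X 0 \<omega>) * g (X u \<omega>)) = (\<Sum>j\<in>F. \<Sum>k\<in>F. (a j * a k) * ((lev_seq j (X 0 \<omega>) - mean j) * (lev_seq k (X u \<omega>) - mean k)))" .
    qed
    also have "\<dots> = (\<Sum>j\<in>F. \<Sum>k\<in>F. a j * a k * cov j k u)"
    proof -
      have "expectation (\<lambda>\<omega>. \<Sum>j\<in>F. \<Sum>k\<in>F. (a j * a k) * ((lev_seq j (X 0 \<omega>) - mean j) * (lev_seq k (X u \<omega>) - mean k)))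
         = (\<Sum>j\<in>F. expectation (\<lambda>\<omega>. \<Sum>k\<in>F. (a j * a k) * ((lev_seq j (X 0 \<omega>) - mean j) * (lev_seq k (X u \<omega>) - mean k))))"
        by (rule Bochner_Integration.integral_sum) (intro Bochner_Integration.integrable_sum integrable_mult_right i)
      also have "\<dots> = (\<Sum>j\<in>F. \<Sum>k\<in>F. expectation (\<lambda>\<omega>. (a j * a k) * ((lev_seq j (X 0 \<omega>) - mean j) * (lev_seq k (X u \<omega>) - mean k))))"
        by (rule sum.cong[OF refl], rule Bochner_Integration.integral_sum) (intro integrable_mult_right i)
      finally show ?thesis by (simp only: integral_mult_right_zero c)
    qed
    finally show ?thesis .
  qed
  have sig: "B\<^sup>2 * G.sigma2 = (\<Sum>j\<in>F. \<Sum>k\<in>F. a j * a k * Gam j k)"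
  proof -
    have "B\<^sup>2 * G.sigma2 = (\<integral>u. B\<^sup>2 * G.acov u \<partial>lborel)" by (simp add: G.sigma2_def)
    also have "\<dots> = (\<integral>u. (\<Sum>j\<in>F. \<Sum>k\<in>F. a j * a k * cov j k u) \<partial>lborel)" by (simp only: acov)
    also have "\<dots> = (\<Sum>j\<in>F. \<integral>u. (\<Sum>k\<in>F. a j * a k * cov j k u) \<partial>lborel)"
      by (rule Bochner_Integration.integral_sum) (intro Bochner_Integration.integrable_sum integrable_mult_right cov_integrable)
    also have "\<dots> = (\<Sum>j\<in>F. \<Sum>k\<in>F. \<integral>u. a j * a k * cov j k u \<partial>lborel)"
      by (rule sum.cong[OF refl], rule Bochner_Integration.integral_sum) (intro integrable_mult_right cov_integrable)
    finally show ?thesis by (simp only: integral_mult_right_zero Gam_def)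
  qed
  show "0 \<le> (\<Sum>j\<in>F. \<Sum>k\<in>F. a j * a k * Gam j k)"
    unfolding sig[symmetric] using G.sigma2_nonneg[OF Wc vh] by simp
  have "(\<integral>\<omega>. iexp (B * S g (W n) \<omega> / sqrt (G.vol (W n))) \<partial>M) = (\<integral>\<omega>. iexp (\<Sum>k\<in>F. a k * Yn n \<omega> k) \<partial>M)" for n
  proof (rule integral_cong_AE)
    have "G.fin_set (W n)" using W_finite[of n] by (simp add: G.fin_set_def)
    from G.bounded_rv_S[OF this] have [measurable]: "S g (W n) \<in> borel_measurable M" by (simp add: G.bounded_rv_def)
    show "(\<lambda>\<omega>. iexp (B * S g (W n) \<omega> / sqrt (G.vol (W n)))) \<in> borel_measurable M" by measurable
    show "(\<lambda>\<omega>. iexp (\<Sum>k\<in>F. a k * Yn n \<omega> k)) \<in> borel_measurable M" by measurable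
    show "AE \<omega> in M. iexp (B * S g (W n) \<omega> / sqrt (G.vol (W n))) = iexp (\<Sum>k\<in>F. a k * Yn n \<omega> k)"
      using AE_good[of n] AE_space by eventually_elim (simp only: v Sg)
  qed
  then show "(\<lambda>n. \<integral>\<omega>. iexp (\<Sum>k\<in>F. a k * Yn n \<omega> k) \<partial>M) \<longlonglongrightarrow> complex_of_real (exp (- (\<Sum>j\<in>F. \<Sum>k\<in>F. a j * a k * Gam j k) / 2))"
    using G.clt[OF Wc vh, of B] unfolding sig by simp
qed

end

section \<open>Summable sequences as functionals on Lipschitz functions\<close>

lemma Lip_lipschitz:
  assumes "f \<in> Vspace" shows "(Lip f)-lipschitz_on UNIV f"
proof -
  obtain L where L: "L-lipschitz_on UNIV f" using assms by (auto simp: Vspace_def)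
  let ?A = "{\<bar>f x - f y\<bar> / \<bar>x - y\<bar> | x y. x \<noteq> y}"
  have le: "\<bar>f x - f y\<bar> / \<bar>x - y\<bar> \<le> L" if "x \<noteq> y" for x y
    using lipschitz_onD[OF L, of x y] that by (simp add: dist_real_def pos_divide_le_eq)
  have bdd: "bdd_above ?A" by (rule bdd_aboveI[of _ L]) (auto simp: le)
  have up: "\<bar>f x - f y\<bar> / \<bar>x - y\<bar> \<le> Lip f" if "x \<noteq> y" for x y
    unfolding Lip_def by (rule cSup_upper[OF _ bdd]) (use that in auto)
  have "0 \<le> \<bar>f 1 - f 0\<bar> / \<bar>1 - 0\<bar>" by simp
  then have L0: "0 \<le> Lip f" using up[of 1 0] by linarith
  show ?thesis
  proof (rule lipschitz_onI[OF _ L0])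
    fix x y
    show "dist (f x) (f y) \<le> Lip f * dist x y"
      using up[of x y] by (cases "x = y") (auto simp: dist_real_def pos_divide_le_eq)
  qed
qed

lemma Vspace_linear:
  assumes "f \<in> Vspace" "g \<in> Vspace" shows "(\<lambda>x. a * f x + b * g x) \<in> Vspace"
proof -
  obtain L K where "L-lipschitz_on UNIV f" "K-lipschitz_on UNIV g" using assms by (auto simp: Vspace_def)
  then have "(\<bar>a\<bar> * L + \<bar>b\<bar> * K)-lipschitz_on UNIV (\<lambda>x. a * f x + b * g x)"
    using lipschitz_on_add[OF lipschitz_on_cmult lipschitz_on_cmult, of L UNIV f K g a b] by simp
  then show ?thesis by (auto simp: Vspace_def)
qed

lemma Vdual_linear:
  assumes "\<phi> \<in> Vdual" "f \<in> Vspace" "g \<in> Vspace"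
  shows "\<phi> (\<lambda>x. a * f x + b * g x) = a * \<phi> f + b * \<phi> g"
  using assms(1)[unfolded Vdual_def mem_Collect_eq, THEN conjunct1, rule_format, OF assms(2,3)] .

lemma Vdual_sum:
  assumes \<phi>: "\<phi> \<in> Vdual" and J: "finite J" "J \<subseteq> Vspace"
  shows "(\<lambda>x. \<Sum>j\<in>J. a j * j x) \<in> Vspace \<and> \<phi> (\<lambda>x. \<Sum>j\<in>J. a j * j x) = (\<Sum>j\<in>J. a j * \<phi> j)"
  using J
proof (induction J rule: finite_induct)
  case empty
  have z: "(\<lambda>x. 0) \<in> Vspace" unfolding Vspace_def using lipschitz_on_constant[of UNIV 0] by auto
  show ?case using z Vdual_linear[OF \<phi> z z, of 0 0] by simp
next
  case (insert i J)
  let ?f = "\<lambda>x. \<Sum>j\<in>J. a j * j x"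
  have IH: "?f \<in> Vspace" "\<phi> ?f = (\<Sum>j\<in>J. a j * \<phi> j)" using insert by auto
  have i: "i \<in> Vspace" using insert by simp
  have "\<phi> (\<lambda>x. a i * i x + 1 * ?f x) = a i * \<phi> i + 1 * \<phi> ?f"
    by (rule Vdual_linear[OF \<phi> i IH(1)])
  then show ?case using Vspace_linear[OF i IH(1), of "a i" 1] IH(2) insert.hyps by simp
qed

definition iota :: "(nat \<Rightarrow> real) \<Rightarrow> (real \<Rightarrow> real) \<Rightarrow> real" where
  "iota y = (\<lambda>f. if f \<in> Vspace then (\<Sum>k. coeff_seq f k * y k) else 0)"

lemma iota_summable:
  assumes "f \<in> Vspace" "y \<in> l1"
  shows "summable (\<lambda>k. \<bar>coeff_seq f k * y k\<bar>)" "summable (\<lambda>k. coeff_seq f k * y k)"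
proof -
  have "summable (\<lambda>k. Lip f * \<bar>y k\<bar>)" using assms(2) by (intro summable_mult) (simp add: l1_def)
  then show 1: "summable (\<lambda>k. \<bar>coeff_seq f k * y k\<bar>)"
  proof (rule summable_comparison_test'[of _ 0])
    fix k
    show "norm \<bar>coeff_seq f k * y k\<bar> \<le> Lip f * \<bar>y k\<bar>"
      using abs_coeff_seq_le[OF Lip_lipschitz[OF assms(1)], of k] by (simp add: abs_mult mult_right_mono)
  qed
  then show "summable (\<lambda>k. coeff_seq f k * y k)" by (rule summable_rabs_cancel)
qed

text \<open>The pairing of a coefficient sequence bounded by \<open>Lip f\<close> with a summable
  one. The estimate is Lipschitz in \<open>y\<close> for each fixed \<open>f\<close>, which is what
  pointwise convergence asks for.\<close>

lemma abs_iota_diff_le: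
  assumes f: "f \<in> Vspace" and y: "y \<in> l1" and z: "z \<in> l1"
  shows "\<bar>iota y f - iota z f\<bar> \<le> Lip f * l1dist y z"
proof -
  have yz: "(\<lambda>k. y k - z k) \<in> l1" using l1_summable_diff[OF y z] by (simp add: l1_def)
  have "iota y f - iota z f = (\<Sum>k. coeff_seq f k * (y k - z k))"
    using f iota_summable(2)[OF f y] iota_summable(2)[OF f z]
    by (simp add: iota_def suminf_diff right_diff_distrib)
  then have "\<bar>iota y f - iota z f\<bar> \<le> (\<Sum>k. \<bar>coeff_seq f k * (y k - z k)\<bar>)"
    using summable_rabs[OF iota_summable(1)[OF f yz]] by simp
  also have "\<dots> \<le> (\<Sum>k. Lip f * \<bar>y k - z k\<bar>)"
  proof (rule suminf_le)
    show "\<bar>coeff_seq f k * (y k - z k)\<bar> \<le> Lip f * \<bar>y k - z k\<bar>" for k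
      using abs_coeff_seq_le[OF Lip_lipschitz[OF f], of k] by (simp add: abs_mult mult_right_mono)
    show "summable (\<lambda>k. \<bar>coeff_seq f k * (y k - z k)\<bar>)" by (rule iota_summable(1)[OF f yz])
    show "summable (\<lambda>k. Lip f * \<bar>y k - z k\<bar>)" by (intro summable_mult l1_summable_diff y z)
  qed
  also have "\<dots> = Lip f * l1dist y z" unfolding l1dist_def by (intro suminf_mult l1_summable_diff y z)
  finally show ?thesis .
qed

lemma iota_in_Vdual:
  assumes y: "y \<in> l1" shows "iota y \<in> Vdual"
proof -
  have lin: "iota y (\<lambda>x. a * f x + b * g x) = a * iota y f + b * iota y g" if "f \<in> Vspace" "g \<in> Vspace" for f g a b
  proof -
    have "(\<Sum>k. coeff_seq (\<lambda>x. a * f x + b * g x) k * y k) = (\<Sum>k. a * (coeff_seq f k * y k) + b * (coeff_seq g k * y k))"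
      by (simp only: coeff_seq_linear distrib_right mult.assoc)
    also have "\<dots> = (\<Sum>k. a * (coeff_seq f k * y k)) + (\<Sum>k. b * (coeff_seq g k * y k))"
      by (intro suminf_add[symmetric] summable_mult iota_summable that y)
    also have "\<dots> = a * (\<Sum>k. coeff_seq f k * y k) + b * (\<Sum>k. coeff_seq g k * y k)"
      by (simp only: suminf_mult[OF iota_summable(2)[OF that(1) y]] suminf_mult[OF iota_summable(2)[OF that(2) y]])
    finally show ?thesis using that Vspace_linear[OF that] by (simp add: iota_def)
  qed
  have z: "(\<lambda>_. 0) \<in> l1" by (simp add: l1_def)
  have "\<bar>iota y f\<bar> \<le> l1dist y (\<lambda>_. 0) * Vnorm f" if f: "f \<in> Vspace" for f
  proof -
    have "iota (\<lambda>_. 0) f = 0" by (simp add: iota_def)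
    then have "\<bar>iota y f\<bar> \<le> Lip f * l1dist y (\<lambda>_. 0)" using abs_iota_diff_le[OF f y z] by simp
    also have "\<dots> \<le> Vnorm f * l1dist y (\<lambda>_. 0)"
      by (intro mult_right_mono l1dist_nonneg y z) (simp add: Vnorm_def)
    finally show ?thesis by (simp add: mult.commute)
  qed
  then have "\<exists>K. \<forall>f\<in>Vspace. \<bar>iota y f\<bar> \<le> K * Vnorm f" by blast
  moreover have "\<forall>f. f \<notin> Vspace \<longrightarrow> iota y f = 0" by (simp add: iota_def)
  ultimately show ?thesis unfolding Vdual_def using lin by blast
qed

lemma tendsto_fun_pointwise:
  fixes F :: "nat \<Rightarrow> 'b \<Rightarrow> real"
  assumes "\<And>i. (\<lambda>j. F j i) \<longlonglongrightarrow> G i"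
  shows "F \<longlonglongrightarrow> G"
proof -
  have "limitin (product_topology (\<lambda>_. euclidean) UNIV) F G sequentially"
    using assms by (simp add: limitin_componentwise)
  then show ?thesis by (simp add: euclidean_product_topology)
qed

text \<open>The distance on \<open>l1\<close> is a metric, so a sequence at distances below
  \<open>1 / real (Suc j)\<close> is enough to test openness, although the product topology on the
  target side is not first countable.\<close>

lemma iota_open:
  assumes U: "open U" and y: "y \<in> l1" "iota y \<in> U"
  shows "\<exists>r>0. \<forall>z\<in>l1. l1dist y z < r \<longrightarrow> iota z \<in> U"
proof (rule ccontr)
  assume "\<not> ?thesis"
  then have "\<forall>j. \<exists>z\<in>l1. l1dist y z < 1 / real (Suc j) \<and> iota z \<notin> U"
    by (metis of_nat_0_less_iff zero_less_Suc zero_less_divide_1_iff)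
  then obtain z where z: "\<And>j. z j \<in> l1" "\<And>j. l1dist y (z j) < 1 / real (Suc j)" "\<And>j. iota (z j) \<notin> U"
    by metis
  have d: "(\<lambda>j. l1dist y (z j)) \<longlonglongrightarrow> 0"
  proof (rule tendsto_sandwich[of "\<lambda>_. 0" _ _ "\<lambda>j. 1 / real (Suc j)"])
    show "(\<lambda>j. 1 / real (Suc j)) \<longlonglongrightarrow> 0" by (rule LIMSEQ_Suc[OF lim_1_over_n])
    show "\<forall>\<^sub>F j in sequentially. 0 \<le> l1dist y (z j)"
      by (rule always_eventually, rule allI, rule l1dist_nonneg[OF y(1) z(1)])
    show "\<forall>\<^sub>F j in sequentially. l1dist y (z j) \<le> 1 / real (Suc j)"
      by (rule always_eventually, rule allI, rule less_imp_le[OF z(2)])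
  qed simp
  have "(\<lambda>j. iota (z j)) \<longlonglongrightarrow> iota y"
  proof (rule tendsto_fun_pointwise)
    fix f
    show "(\<lambda>j. iota (z j) f) \<longlonglongrightarrow> iota y f"
    proof (cases "f \<in> Vspace")
      case True
      have "(\<lambda>j. iota (z j) f - iota y f) \<longlonglongrightarrow> 0"
      proof (rule Lim_null_comparison)
        show "\<forall>\<^sub>F j in sequentially. norm (iota (z j) f - iota y f) \<le> Lip f * l1dist y (z j)"
          using abs_iota_diff_le[OF True z(1) y(1)] by (intro always_eventually allI) (simp add: l1dist_commute)
        show "(\<lambda>j. Lip f * l1dist y (z j)) \<longlonglongrightarrow> 0" using tendsto_mult_left[OF d, of "Lip f"] by simp
      qed
      then show ?thesis by (rule LIM_zero_cancel)
    qed (simp add: iota_def)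
  qed
  then have "\<forall>\<^sub>F j in sequentially. iota (z j) \<in> U" using U y(2) by (rule topological_tendstoD)
  then show False using z(3) by simp
qed

lemma l1_continuous_iota:
  fixes h :: "((real \<Rightarrow> real) \<Rightarrow> real) \<Rightarrow> real"
  assumes h: "continuous_on Vdual h"
  shows "l1_continuous (\<lambda>y. h (iota y))"
  unfolding l1_continuous_def
proof (intro ballI allI impI)
  fix y and e :: real assume y: "y \<in> l1" and e: "e > 0"
  have "iota y \<in> Vdual" by (rule iota_in_Vdual[OF y])
  moreover have "open (ball (h (iota y)) e)" "h (iota y) \<in> ball (h (iota y)) e" using e by auto
  ultimately obtain A where A: "open A" "iota y \<in> A" "\<forall>x\<in>Vdual. x \<in> A \<longrightarrow> h x \<in> ball (h (iota y)) e"
    using h unfolding continuous_on_topological by metis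
  obtain r where "r > 0" "\<forall>z\<in>l1. l1dist y z < r \<longrightarrow> iota z \<in> A" using iota_open[OF A(1) y A(2)] by blast
  then show "\<exists>r>0. \<forall>z\<in>l1. l1dist y z < r \<longrightarrow> \<bar>h (iota y) - h (iota z)\<bar> < e"
    using A(3) iota_in_Vdual by (intro exI[of _ r]) (auto simp: dist_real_def)
qed

text \<open>The Borel sets of an uncountable product are not generated by the coordinates, so open
  sets are treated directly: the indicator of an open set composed with \<open>iota\<close> is lower
  semicontinuous on \<open>l1\<close>.\<close>

lemma measurable_iota:
  assumes Y: "\<And>m. (\<lambda>\<omega>. Y \<omega> m) \<in> borel_measurable N" "\<And>\<omega>. \<omega> \<in> space N \<Longrightarrow> Y \<omega> \<in> l1"
  shows "(\<lambda>\<omega>. iota (Y \<omega>)) \<in> measurable N (restrict_space borel Vdual)"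
proof (rule measurable_restrict_space2)
  show "(\<lambda>\<omega>. iota (Y \<omega>)) \<in> space N \<rightarrow> Vdual" using Y(2) iota_in_Vdual by auto
  show "(\<lambda>\<omega>. iota (Y \<omega>)) \<in> borel_measurable N"
  proof (rule borel_measurableI)
    fix U :: "((real \<Rightarrow> real) \<Rightarrow> real) set" assume U: "open U"
    define H where "H = (\<lambda>y. indicator U (iota y) :: real)"
    have "l1_lsc H" unfolding l1_lsc_def
    proof (intro ballI allI impI)
      fix y and e :: real assume y: "y \<in> l1" and e: "e > 0"
      show "\<exists>r>0. \<forall>z\<in>l1. l1dist y z < r \<longrightarrow> H y - e < H z"
      proof (cases "iota y \<in> U")
        case True
        obtain r where "r > 0" "\<forall>z\<in>l1. l1dist y z < r \<longrightarrow> iota z \<in> U" using iota_open[OF U y True] by blast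
        then show ?thesis using e True by (intro exI[of _ r]) (auto simp: H_def)
      next
        case False
        then show ?thesis using e by (intro exI[of _ 1]) (auto simp: H_def indicator_def)
      qed
    qed
    moreover have "\<bar>H y\<bar> \<le> 1" if "y \<in> l1" for y by (simp add: H_def indicator_def)
    ultimately have m: "(\<lambda>\<omega>. H (Y \<omega>)) \<in> borel_measurable N"
      using measurable_l1_lsc[OF Y, of H 1] by blast
    have "(\<lambda>\<omega>. iota (Y \<omega>)) -` U \<inter> space N = (\<lambda>\<omega>. H (Y \<omega>)) -` {1} \<inter> space N"
      by (auto simp: H_def indicator_def)
    also have "\<dots> \<in> sets N" by (rule measurable_sets[OF m]) simp
    finally show "(\<lambda>\<omega>. iota (Y \<omega>)) -` U \<inter> space N \<in> sets N" .
  qed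
qed

section \<open>The limit covariance of Lipschitz functionals\<close>

lemma Vspace_measurable: "f \<in> Vspace \<Longrightarrow> f \<in> borel_measurable borel"
  by (rule borel_measurable_continuous_onI, rule lipschitz_on_continuous_on, rule Lip_lipschitz)

lemma Lip_nonneg: "f \<in> Vspace \<Longrightarrow> 0 \<le> Lip f"
  using Lip_lipschitz lipschitz_on_nonneg by blast

definition partial :: "(real \<Rightarrow> real) \<Rightarrow> nat \<Rightarrow> real \<Rightarrow> real" where
  "partial f K x = (\<Sum>k<K. coeff_seq f k * lev_seq k x)"

lemma partial_measurable [measurable]: "partial f K \<in> borel_measurable borel"
  unfolding partial_def[abs_def] by measurable

lemma partial_tendsto:
  assumes "f \<in> Vspace" shows "(\<lambda>K. partial f K x) \<longlonglongrightarrow> f x - f 0"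
  using lipschitz_expansion_sums[OF Lip_lipschitz[OF assms], of x] by (simp add: sums_def partial_def)

lemma abs_partial_le:
  assumes "f \<in> Vspace" shows "\<bar>partial f K x\<bar> \<le> Lip f * (\<bar>x\<bar> + 2)"
proof -
  have "\<bar>partial f K x\<bar> \<le> (\<Sum>k<K. \<bar>coeff_seq f k * lev_seq k x\<bar>)" unfolding partial_def by (rule sum_abs)
  also have "\<dots> \<le> (\<Sum>k<K. Lip f * lev_seq k x)"
    using abs_coeff_seq_le[OF Lip_lipschitz[OF assms]]
    by (intro sum_mono) (simp add: abs_mult lev_seq_nonneg mult_right_mono)
  also have "\<dots> = Lip f * (\<Sum>k<K. lev_seq k x)" by (simp add: sum_distrib_left)
  also have "\<dots> \<le> Lip f * (\<bar>x\<bar> + 2)" by (intro mult_left_mono lev_seq_sum_le Lip_nonneg assms)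
  finally show ?thesis .
qed

text \<open>Termwise integration with a weight, for two uses: \<open>w = 1\<close> on the
  probability space, and \<open>w\<close> the indicator of a window along a path. All weighted
  partial sums are dominated by \<open>Lip f * (w t * (\<bar>Y t\<bar> + 2))\<close>.\<close>

lemma lipschitz_expansion_integral:
  assumes f: "f \<in> Vspace" and [measurable]: "w \<in> borel_measurable Q" "Y \<in> borel_measurable Q"
    and w: "\<And>t. 0 \<le> w t" and i: "integrable Q (\<lambda>t. w t * (\<bar>Y t\<bar> + 2))"
    and ik: "\<And>k. integrable Q (\<lambda>t. w t * lev_seq k (Y t))"
  shows "(\<lambda>k. coeff_seq f k * (\<integral>t. w t * lev_seq k (Y t) \<partial>Q)) sums (\<integral>t. w t * (f (Y t) - f 0) \<partial>Q)"
    "integrable Q (\<lambda>t. w t * (f (Y t) - f 0))"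
proof -
  have [measurable]: "f \<in> borel_measurable borel" by (rule Vspace_measurable[OF f])
  have b: "norm (w t * partial f K (Y t)) \<le> Lip f * (w t * (\<bar>Y t\<bar> + 2))" for t K
    using mult_left_mono[OF abs_partial_le[OF f, of K "Y t"] w[of t]] w[of t] by (simp add: abs_mult mult_ac)
  have lim: "(\<lambda>K. w t * partial f K (Y t)) \<longlonglongrightarrow> w t * (f (Y t) - f 0)" for t
    by (intro tendsto_mult_left partial_tendsto f)
  have iL: "integrable Q (\<lambda>t. Lip f * (w t * (\<bar>Y t\<bar> + 2)))" using i by simp
  have m1: "(\<lambda>t. w t * (f (Y t) - f 0)) \<in> borel_measurable Q" by measurable
  have m2: "(\<lambda>t. w t * partial f K (Y t)) \<in> borel_measurable Q" for K by measurable
  show "integrable Q (\<lambda>t. w t * (f (Y t) - f 0))"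
    by (rule integrable_dominated_convergence[OF m1 m2 iL AE_I2[OF lim] AE_I2[OF b]])
  have "(\<lambda>K. \<integral>t. w t * partial f K (Y t) \<partial>Q) \<longlonglongrightarrow> (\<integral>t. w t * (f (Y t) - f 0) \<partial>Q)"
    by (rule integral_dominated_convergence[OF m1 m2 iL AE_I2[OF lim] AE_I2[OF b]])
  moreover have "(\<integral>t. w t * partial f K (Y t) \<partial>Q) = (\<Sum>k<K. coeff_seq f k * (\<integral>t. w t * lev_seq k (Y t) \<partial>Q))" for K
  proof -
    have "(\<integral>t. w t * partial f K (Y t) \<partial>Q) = (\<integral>t. (\<Sum>k<K. coeff_seq f k * (w t * lev_seq k (Y t))) \<partial>Q)"
      unfolding partial_def by (simp only: sum_distrib_left mult_ac)
    also have "\<dots> = (\<Sum>k<K. \<integral>t. coeff_seq f k * (w t * lev_seq k (Y t)) \<partial>Q)"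
      by (rule Bochner_Integration.integral_sum) (intro integrable_mult_right ik)
    finally show ?thesis by (simp only: integral_mult_right_zero)
  qed
  ultimately show "(\<lambda>k. coeff_seq f k * (\<integral>t. w t * lev_seq k (Y t) \<partial>Q)) sums (\<integral>t. w t * (f (Y t) - f 0) \<partial>Q)"
    by (simp only: sums_def)
qed

section \<open>\<open>PhiN\<close> as a functional of the coefficient sequence, and the limit
  covariance\<close>

context lev_window
begin

lemma mean_expansion:
  assumes f: "f \<in> Vspace"
  shows "(\<lambda>k. coeff_seq f k * mean k) sums (expectation (\<lambda>\<omega>. f (X t \<omega>)) - f 0)"
    "integrable M (\<lambda>\<omega>. f (X t \<omega>))"
proof -
  have i: "integrable M (\<lambda>\<omega>. 1 * (\<bar>X t \<omega>\<bar> + 2))" using integrable_abs_field[of t] by simp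
  have ik: "integrable M (\<lambda>\<omega>. 1 * lev_seq k (X t \<omega>))" for k using integrable_lev_seq[of k t] by simp
  have i2: "integrable M (\<lambda>\<omega>. f (X t \<omega>) - f 0)"
    using lipschitz_expansion_integral(2)[OF f _ _ _ i ik] by simp
  then have "integrable M (\<lambda>\<omega>. (f (X t \<omega>) - f 0) + f 0)" by (intro Bochner_Integration.integrable_add) auto
  then show i3: "integrable M (\<lambda>\<omega>. f (X t \<omega>))" by simp
  have "(\<lambda>k. coeff_seq f k * mean k) sums expectation (\<lambda>\<omega>. f (X t \<omega>) - f 0)"
    using lipschitz_expansion_integral(1)[OF f _ _ _ i ik] by (simp add: mean_stationary)
  then show "(\<lambda>k. coeff_seq f k * mean k) sums (expectation (\<lambda>\<omega>. f (X t \<omega>)) - f 0)"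
    using i3 by (simp add: prob_space)
qed

text \<open>Constants cancel in \<open>PhiN\<close>, so \<open>f\<close> may be replaced by
  \<open>f x - f 0\<close>, whose expansion is integrated term by term over the window and in the
  mean. On bad paths both sides are 0.\<close>

lemma PhiN_eq:
  assumes \<omega>: "\<omega> \<in> space M" shows "PhiN M X W n \<omega> = iota (Yn n \<omega>)"
proof (cases "good n \<omega>")
  case False
  then show ?thesis by (simp add: PhiN_def good_def iota_def Yn_def fun_eq_iff)
next
  case True
  have "iota (Yn n \<omega>) f = ((LINT t:W n|lborel. f (X t \<omega>)) - vW n * expectation (\<lambda>\<omega>. f (X 0 \<omega>))) / sqrt (vW n)"
    if f: "f \<in> Vspace" for f
  proof -
    note [measurable] = field_measurable_path[OF \<omega>] Vspace_measurable[OF f]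
    have iX: "integrable lborel (\<lambda>t. indicator (W n) t * X t \<omega>)"
      using True by (simp add: good_def set_integrable_def)
    have "integrable lborel (\<lambda>t. \<bar>indicator (W n) t * X t \<omega>\<bar> + indicator (W n) t * 2)"
      using iX W_finite[of n] by (intro Bochner_Integration.integrable_add integrable_abs) auto
    then have i: "integrable lborel (\<lambda>t. indicator (W n) t * (\<bar>X t \<omega>\<bar> + 2))"
      by (rule Bochner_Integration.integrable_cong[OF refl, THEN iffD1, rotated]) (auto simp: indicator_def)
    have m: "(indicator (W n) :: 'd \<Rightarrow> real) \<in> borel_measurable lborel" "(\<lambda>t. X t \<omega>) \<in> borel_measurable lborel" by simp_all
    note E = lipschitz_expansion_integral[OF f m indicator_pos_le i path_lev_integrable[OF \<omega>]]
    define I where "I = (\<integral>t. indicator (W n) t * (f (X t \<omega>) - f 0) \<partial>lborel)"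
    have "(LINT t:W n|lborel. f (X t \<omega>)) = (\<integral>t. indicator (W n) t * (f (X t \<omega>) - f 0) + indicator (W n) t * f 0 \<partial>lborel)"
      unfolding set_lebesgue_integral_def by (simp add: algebra_simps)
    also have "\<dots> = I + vW n * f 0"
      unfolding I_def using E(2) W_finite[of n] by (subst Bochner_Integration.integral_add) (auto simp: vW_def)
    finally have LI: "(LINT t:W n|lborel. f (X t \<omega>)) = I + vW n * f 0" .
    have s1: "(\<lambda>k. coeff_seq f k * S (lev_seq k) (W n) \<omega>) sums I"
      using E(1) unfolding I_def S_def set_lebesgue_integral_def by simp
    have "(\<lambda>k. (coeff_seq f k * S (lev_seq k) (W n) \<omega> - vW n * (coeff_seq f k * mean k)) / sqrt (vW n)) sums
      ((I - vW n * (expectation (\<lambda>\<omega>. f (X 0 \<omega>)) - f 0)) / sqrt (vW n))"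
      by (intro sums_divide sums_diff s1 sums_mult mean_expansion(1)[OF f])
    moreover have "(coeff_seq f k * S (lev_seq k) (W n) \<omega> - vW n * (coeff_seq f k * mean k)) / sqrt (vW n) = coeff_seq f k * Yn n \<omega> k" for k
      using True by (simp add: Yn_def algebra_simps)
    ultimately have "(\<Sum>k. coeff_seq f k * Yn n \<omega> k) = (I - vW n * (expectation (\<lambda>\<omega>. f (X 0 \<omega>)) - f 0)) / sqrt (vW n)"
      by (simp add: sums_iff)
    then show ?thesis using f by (simp add: iota_def LI algebra_simps)
  qed
  then show ?thesis using True by (auto simp: PhiN_def good_def vW_def fun_eq_iff iota_def)
qed

lemma integrable_sq_field: "integrable M (\<lambda>\<omega>. (\<bar>X t \<omega>\<bar> + 2)\<^sup>2)"
proof -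
  have "integrable M (\<lambda>\<omega>. (\<bar>X 0 \<omega>\<bar> + 2)\<^sup>2)"
  proof (rule Bochner_Integration.integrable_bound[OF moment])
    show "AE \<omega> in M. norm ((\<bar>X 0 \<omega>\<bar> + 2)\<^sup>2) \<le> norm ((2 + \<bar>X 0 \<omega>\<bar>) ^ 4)"
    proof (intro AE_I2)
      fix \<omega>
      have "(2 + \<bar>X 0 \<omega>\<bar>) ^ 2 \<le> (2 + \<bar>X 0 \<omega>\<bar>) ^ 4" by (rule power_increasing) auto
      then show "norm ((\<bar>X 0 \<omega>\<bar> + 2)\<^sup>2) \<le> norm ((2 + \<bar>X 0 \<omega>\<bar>) ^ 4)" by (simp add: add.commute)
    qed
  qed simp
  then have "integrable (distr M borel (X 0)) (\<lambda>x. (\<bar>x\<bar> + 2)\<^sup>2)" by (subst integrable_distr_eq) auto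
  then have "integrable (distr M borel (X t)) (\<lambda>x. (\<bar>x\<bar> + 2)\<^sup>2)" by (subst distr_field)
  then show ?thesis by (subst (asm) integrable_distr_eq) auto
qed

definition CV :: "(real \<Rightarrow> real) \<Rightarrow> (real \<Rightarrow> real) \<Rightarrow> 'd \<Rightarrow> real" where
  "CV f g u = expectation (\<lambda>\<omega>. f (X 0 \<omega>) * g (X u \<omega>)) - expectation (\<lambda>\<omega>. f (X 0 \<omega>)) * expectation (\<lambda>\<omega>. g (X u \<omega>))"

text \<open>Covariances ignore the constants \<open>f 0\<close> and \<open>g 0\<close>, so the
  partial expansions are multiplied out. The products are dominated by squares of
  \<open>\<bar>X t \<omega>\<bar> + 2\<close>, and the sums of means converge separately.\<close>

lemma cov_double_sum_tendsto:
  assumes f: "f \<in> Vspace" and g: "g \<in> Vspace"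
  shows "(\<lambda>K. \<Sum>j<K. \<Sum>k<K. coeff_seq f j * coeff_seq g k * cov j k u) \<longlonglongrightarrow> CV f g u"
proof -
  note [measurable] = Vspace_measurable[OF f] Vspace_measurable[OF g]
  define D where "D = (\<lambda>\<omega>. Lip f * Lip g * ((\<bar>X 0 \<omega>\<bar> + 2)\<^sup>2 + (\<bar>X u \<omega>\<bar> + 2)\<^sup>2))"
  have iD: "integrable M D" unfolding D_def by (intro integrable_mult_right Bochner_Integration.integrable_add integrable_sq_field)
  have b: "norm (partial f K (X 0 \<omega>) * partial g K (X u \<omega>)) \<le> D \<omega>" for K \<omega>
  proof -
    have "\<bar>partial f K (X 0 \<omega>)\<bar> * \<bar>partial g K (X u \<omega>)\<bar> \<le> (Lip f * (\<bar>X 0 \<omega>\<bar> + 2)) * (Lip g * (\<bar>X u \<omega>\<bar> + 2))"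
      using Lip_nonneg[OF f] by (intro mult_mono abs_partial_le f g) auto
    also have "\<dots> = Lip f * Lip g * ((\<bar>X 0 \<omega>\<bar> + 2) * (\<bar>X u \<omega>\<bar> + 2))" by (simp only: mult_ac)
    also have "\<dots> \<le> D \<omega>" unfolding D_def
    proof (rule mult_left_mono)
      have xy: "x * y \<le> x\<^sup>2 + y\<^sup>2" if "0 \<le> x" "0 \<le> y" for x y :: real
        using sum_squares_bound[of x y] mult_nonneg_nonneg[OF that] by linarith
      show "(\<bar>X 0 \<omega>\<bar> + 2) * (\<bar>X u \<omega>\<bar> + 2) \<le> (\<bar>X 0 \<omega>\<bar> + 2)\<^sup>2 + (\<bar>X u \<omega>\<bar> + 2)\<^sup>2" by (rule xy) auto
    qed (use Lip_nonneg[OF f] Lip_nonneg[OF g] in auto)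
    finally show ?thesis by (simp add: abs_mult)
  qed
  have m1: "(\<lambda>\<omega>. (f (X 0 \<omega>) - f 0) * (g (X u \<omega>) - g 0)) \<in> borel_measurable M" by measurable
  have m2: "(\<lambda>\<omega>. partial f K (X 0 \<omega>) * partial g K (X u \<omega>)) \<in> borel_measurable M" for K by measurable
  have lim: "(\<lambda>K. partial f K (X 0 \<omega>) * partial g K (X u \<omega>)) \<longlonglongrightarrow> (f (X 0 \<omega>) - f 0) * (g (X u \<omega>) - g 0)" for \<omega>
    by (intro tendsto_mult partial_tendsto f g)
  have i0: "integrable M (\<lambda>\<omega>. (f (X 0 \<omega>) - f 0) * (g (X u \<omega>) - g 0))"
    by (rule integrable_dominated_convergence[OF m1 m2 iD AE_I2[OF lim] AE_I2[OF b]])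
  have c: "(\<lambda>K. expectation (\<lambda>\<omega>. partial f K (X 0 \<omega>) * partial g K (X u \<omega>))) \<longlonglongrightarrow> expectation (\<lambda>\<omega>. (f (X 0 \<omega>) - f 0) * (g (X u \<omega>) - g 0))"
    by (rule integral_dominated_convergence[OF m1 m2 iD AE_I2[OF lim] AE_I2[OF b]])
  define mf where "mf = expectation (\<lambda>\<omega>. f (X 0 \<omega>))"
  define mg where "mg = expectation (\<lambda>\<omega>. g (X u \<omega>))"
  have "(\<lambda>K. expectation (\<lambda>\<omega>. partial f K (X 0 \<omega>) * partial g K (X u \<omega>)) - (\<Sum>j<K. coeff_seq f j * mean j) * (\<Sum>k<K. coeff_seq g k * mean k))
      \<longlonglongrightarrow> expectation (\<lambda>\<omega>. (f (X 0 \<omega>) - f 0) * (g (X u \<omega>) - g 0)) - (mf - f 0) * (mg - g 0)"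
    using mean_expansion(1)[OF f, of 0] mean_expansion(1)[OF g, of u] unfolding sums_def mf_def mg_def
    by (intro tendsto_diff c tendsto_mult)
  moreover have "expectation (\<lambda>\<omega>. partial f K (X 0 \<omega>) * partial g K (X u \<omega>)) - (\<Sum>j<K. coeff_seq f j * mean j) * (\<Sum>k<K. coeff_seq g k * mean k)
     = (\<Sum>j<K. \<Sum>k<K. coeff_seq f j * coeff_seq g k * cov j k u)" for K
  proof -
    have i: "integrable M (\<lambda>\<omega>. lev_seq j (X 0 \<omega>) * lev_seq k (X u \<omega>))" for j k
      by (rule integrable_const_bound[of _ 1]) (auto simp: lev_seq_abs_le abs_mult intro!: mult_le_one)
    have "expectation (\<lambda>\<omega>. partial f K (X 0 \<omega>) * partial g K (X u \<omega>))
      = expectation (\<lambda>\<omega>. \<Sum>j<K. \<Sum>k<K. (coeff_seq f j * coeff_seq g k) * (lev_seq j (X 0 \<omega>) * lev_seq k (X u \<omega>)))"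
      unfolding partial_def sum_product by (simp only: mult_ac)
    also have "\<dots> = (\<Sum>j<K. expectation (\<lambda>\<omega>. \<Sum>k<K. (coeff_seq f j * coeff_seq g k) * (lev_seq j (X 0 \<omega>) * lev_seq k (X u \<omega>))))"
      by (rule Bochner_Integration.integral_sum) (intro Bochner_Integration.integrable_sum integrable_mult_right i)
    also have "\<dots> = (\<Sum>j<K. \<Sum>k<K. expectation (\<lambda>\<omega>. (coeff_seq f j * coeff_seq g k) * (lev_seq j (X 0 \<omega>) * lev_seq k (X u \<omega>))))"
      by (rule sum.cong[OF refl], rule Bochner_Integration.integral_sum) (intro integrable_mult_right i)
    also have "\<dots> = (\<Sum>j<K. \<Sum>k<K. (coeff_seq f j * coeff_seq g k) * expectation (\<lambda>\<omega>. lev_seq j (X 0 \<omega>) * lev_seq k (X u \<omega>)))"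
      by (simp only: integral_mult_right_zero)
    finally have 1: "expectation (\<lambda>\<omega>. partial f K (X 0 \<omega>) * partial g K (X u \<omega>)) = \<dots>" .
    have 2: "(\<Sum>j<K. coeff_seq f j * mean j) * (\<Sum>k<K. coeff_seq g k * mean k) = (\<Sum>j<K. \<Sum>k<K. (coeff_seq f j * coeff_seq g k) * (mean j * mean k))"
      unfolding sum_product by (simp only: mult_ac)
    show ?thesis unfolding 1 2 cov_def by (simp only: sum_subtractf right_diff_distrib)
  qed
  moreover have "expectation (\<lambda>\<omega>. (f (X 0 \<omega>) - f 0) * (g (X u \<omega>) - g 0)) - (mf - f 0) * (mg - g 0) = CV f g u"
  proof -
    note i1 = mean_expansion(2)[OF f, of 0] and ig = mean_expansion(2)[OF g, of u]
    have "integrable M (\<lambda>\<omega>. (f (X 0 \<omega>) - f 0) * (g (X u \<omega>) - g 0) + g 0 * f (X 0 \<omega>) + f 0 * g (X u \<omega>) - f 0 * g 0)"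
      by (intro Bochner_Integration.integrable_add Bochner_Integration.integrable_diff i0 integrable_mult_right i1 ig) simp
    then have ifg: "integrable M (\<lambda>\<omega>. f (X 0 \<omega>) * g (X u \<omega>))" by (simp add: algebra_simps)
    have "expectation (\<lambda>\<omega>. (f (X 0 \<omega>) - f 0) * (g (X u \<omega>) - g 0)) = expectation (\<lambda>\<omega>. f (X 0 \<omega>) * g (X u \<omega>) - g 0 * f (X 0 \<omega>) - f 0 * g (X u \<omega>) + f 0 * g 0)"
      by (simp add: algebra_simps)
    also have "\<dots> = expectation (\<lambda>\<omega>. f (X 0 \<omega>) * g (X u \<omega>)) - g 0 * mf - f 0 * mg + f 0 * g 0"
      using i1 ig ifg by (simp add: mf_def mg_def prob_space)
    finally show ?thesis by (simp add: CV_def mf_def[symmetric] mg_def[symmetric] algebra_simps)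
  qed
  ultimately show ?thesis by simp
qed

definition QV :: "(real \<Rightarrow> real) \<Rightarrow> (real \<Rightarrow> real) \<Rightarrow> real" where
  "QV f g = (\<integral>u. CV f g u \<partial>lborel)"

text \<open>The second passage to the limit, now under the integral over \<open>u\<close>: the
  double sum of weights is at most the square of their total, so a constant multiple of
  \<open>h\<close> dominates.\<close>

lemma Gam_double_sum_tendsto:
  assumes f: "f \<in> Vspace" and g: "g \<in> Vspace"
  shows "(\<lambda>K. \<Sum>j<K. \<Sum>k<K. coeff_seq f j * coeff_seq g k * Gam j k) \<longlonglongrightarrow> QV f g"
proof -
  define w where "w = (\<lambda>u. Lip f * Lip g * (\<Sum>k. wt k)\<^sup>2 * h u)"
  have iw: "integrable lborel w" unfolding w_def by (intro integrable_mult_right h_integrable)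
  have m: "(\<lambda>u. \<Sum>j<K. \<Sum>k<K. coeff_seq f j * coeff_seq g k * cov j k u) \<in> borel_measurable lborel" for K by measurable
  have mC: "CV f g \<in> borel_measurable lborel"
    by (rule borel_measurable_LIMSEQ_real[OF cov_double_sum_tendsto[OF f g] m])
  have b: "norm (\<Sum>j<K. \<Sum>k<K. coeff_seq f j * coeff_seq g k * cov j k u) \<le> w u" for K u
  proof -
    have c: "\<bar>coeff_seq f j * coeff_seq g k * cov j k u\<bar> \<le> (Lip f * Lip g * h u) * (wt j * wt k)" for j k
    proof -
      have "\<bar>coeff_seq f j\<bar> * \<bar>coeff_seq g k\<bar> * \<bar>cov j k u\<bar> \<le> (Lip f * Lip g) * (h u * (wt j * wt k))"
        using Lip_nonneg[OF f] Lip_nonneg[OF g]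
        by (intro mult_mono abs_cov_le abs_coeff_seq_le Lip_lipschitz f g) auto
      then show ?thesis by (simp only: abs_mult mult_ac)
    qed
    have h0: "0 \<le> Lip f * Lip g * h u" using Lip_nonneg[OF f] Lip_nonneg[OF g] h_pos[of u] by (intro mult_nonneg_nonneg) auto
    have "norm (\<Sum>j<K. \<Sum>k<K. coeff_seq f j * coeff_seq g k * cov j k u) \<le> (\<Sum>j<K. \<Sum>k<K. (Lip f * Lip g * h u) * (wt j * wt k))"
      by (intro order_trans[OF norm_sum] sum_mono) (use c in simp)
    also have "\<dots> = (Lip f * Lip g * h u) * (\<Sum>k<K. wt k)\<^sup>2"
      unfolding power2_eq_square sum_product by (simp only: sum_distrib_left)
    also have "\<dots> \<le> (Lip f * Lip g * h u) * (\<Sum>k. wt k)\<^sup>2"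
      by (intro mult_left_mono[OF _ h0] power_mono sum_le_suminf wt_summable sum_nonneg) (auto simp: wt_nonneg)
    finally show ?thesis by (simp only: w_def mult_ac)
  qed
  have "(\<lambda>K. \<integral>u. (\<Sum>j<K. \<Sum>k<K. coeff_seq f j * coeff_seq g k * cov j k u) \<partial>lborel) \<longlonglongrightarrow> QV f g"
    unfolding QV_def
    by (rule integral_dominated_convergence[OF mC m iw AE_I2[OF cov_double_sum_tendsto[OF f g]] AE_I2[OF b]])
  moreover have "(\<integral>u. (\<Sum>j<K. \<Sum>k<K. coeff_seq f j * coeff_seq g k * cov j k u) \<partial>lborel)
     = (\<Sum>j<K. \<Sum>k<K. coeff_seq f j * coeff_seq g k * Gam j k)" for K
  proof -
    have "(\<integral>u. (\<Sum>j<K. \<Sum>k<K. coeff_seq f j * coeff_seq g k * cov j k u) \<partial>lborel) = (\<Sum>j<K. \<integral>u. (\<Sum>k<K. coeff_seq f j * coeff_seq g k * cov j k u) \<partial>lborel)"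
      by (rule Bochner_Integration.integral_sum) (intro Bochner_Integration.integrable_sum integrable_mult_right cov_integrable)
    also have "\<dots> = (\<Sum>j<K. \<Sum>k<K. \<integral>u. coeff_seq f j * coeff_seq g k * cov j k u \<partial>lborel)"
      by (rule sum.cong[OF refl], rule Bochner_Integration.integral_sum) (intro integrable_mult_right cov_integrable)
    finally show ?thesis by (simp only: integral_mult_right_zero Gam_def)
  qed
  ultimately show ?thesis by simp
qed

lemma QV_nonneg: "f \<in> Vspace \<Longrightarrow> 0 \<le> QV f f"
  by (rule LIMSEQ_le_const[OF Gam_double_sum_tendsto]) (use Gam_form(1)[of "{..<_}"] in auto)

lemma QV_commute:
  assumes f: "f \<in> Vspace" and g: "g \<in> Vspace" shows "QV f g = QV g f"
proof (rule LIMSEQ_unique[OF Gam_double_sum_tendsto[OF f g]])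
  have "(\<Sum>j<K. \<Sum>k<K. coeff_seq f j * coeff_seq g k * Gam j k) = (\<Sum>j<K. \<Sum>k<K. coeff_seq g j * coeff_seq f k * Gam j k)" for K
    by (subst sum.swap) (simp only: Gam_commute mult_ac)
  then show "(\<lambda>K. \<Sum>j<K. \<Sum>k<K. coeff_seq f j * coeff_seq g k * Gam j k) \<longlonglongrightarrow> QV g f"
    using Gam_double_sum_tendsto[OF g f] by simp
qed

text \<open>Prepares polarisation; the factors 1 match the shape in which linearity of elements of
  \<open>Vdual\<close> is stated.\<close>

lemma QV_add:
  assumes f: "f \<in> Vspace" and g: "g \<in> Vspace"
  shows "QV (\<lambda>x. 1 * f x + 1 * g x) (\<lambda>x. 1 * f x + 1 * g x) = QV f f + 2 * QV f g + QV g g"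
proof -
  let ?s = "\<lambda>f g K. \<Sum>j<K. \<Sum>k<K. coeff_seq f j * coeff_seq g k * Gam j k"
  have "?s (\<lambda>x. 1 * f x + 1 * g x) (\<lambda>x. 1 * f x + 1 * g x) K = ?s f f K + ?s f g K + ?s g f K + ?s g g K" for K
    unfolding coeff_seq_linear by (simp add: sum.distrib[symmetric] algebra_simps)
  moreover have "(\<lambda>K. ?s f f K + ?s f g K + ?s g f K + ?s g g K) \<longlonglongrightarrow> QV f f + QV f g + QV g f + QV g g"
    by (intro tendsto_add Gam_double_sum_tendsto f g)
  ultimately have "QV (\<lambda>x. 1 * f x + 1 * g x) (\<lambda>x. 1 * f x + 1 * g x) = QV f f + QV f g + QV g f + QV g g"
    using LIMSEQ_unique[OF Gam_double_sum_tendsto[OF Vspace_linear[OF f g, of 1 1] Vspace_linear[OF f g, of 1 1]]] by simp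
  then show ?thesis by (simp add: QV_commute[OF g f])
qed

end

section \<open>The limit process\<close>

lemma Vdual_coordinate_measurable: "(\<lambda>\<phi>. \<phi> f) \<in> borel_measurable (restrict_space borel Vdual)"
  for f :: "real \<Rightarrow> real"
  by (rule borel_measurable_continuous_on_restrict, rule continuous_on_subset[OF continuous_on_product_coordinates]) simp

context lev_window
begin

text \<open>The Gaussian sequence is summable only almost surely, because its expected norm is at
  most the sum of \<open>sqrt HH * wt k\<close>. Resetting it to 0 on the exceptional null set makes
  \<open>iota\<close> map into \<open>Vdual\<close> everywhere.\<close>

lemma limit_sequence:
  obtains N :: "(nat \<Rightarrow> real) measure" and Z :: "(nat \<Rightarrow> real) \<Rightarrow> nat \<Rightarrow> real" where
    "prob_space N" "\<And>k. integrable N (\<lambda>\<omega>. Z \<omega> k)" "\<And>k. (\<integral>\<omega>. \<bar>Z \<omega> k\<bar> \<partial>N) \<le> sqrt HH * wt k"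
    "\<And>\<omega>. \<omega> \<in> space N \<Longrightarrow> Z \<omega> \<in> l1"
    "\<And>K a. (\<integral>\<omega>. iexp (\<Sum>m<K. a m * Z \<omega> m) \<partial>N) = exp (- (\<Sum>m<K. \<Sum>k<K. a m * a k * Gam m k) / 2)"
proof -
  have psd: "psd_kernel Gam" unfolding psd_kernel_def using Gam_commute Gam_form(1) by blast
  obtain N :: "(nat \<Rightarrow> real) measure" and Z :: "(nat \<Rightarrow> real) \<Rightarrow> nat \<Rightarrow> real" where
    N: "prob_space N" and Zm[measurable]: "\<And>m. (\<lambda>\<omega>. Z \<omega> m) \<in> borel_measurable N"
    and char: "\<And>K a. (\<integral>\<omega>. iexp (\<Sum>m<K. a m * Z \<omega> m) \<partial>N) = exp (- (\<Sum>m<K. \<Sum>k<K. a m * a k * Gam m k) / 2)"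
    by (rule gaussian_sequence[OF psd], rule that)
  interpret N: prob_space N by (rule N)
  have Z2: "integrable N (\<lambda>\<omega>. (Z \<omega> k)\<^sup>2)" "(\<integral>\<omega>. (Z \<omega> k)\<^sup>2 \<partial>N) = Gam k k" "integrable N (\<lambda>\<omega>. Z \<omega> k)" for k
  proof -
    have "0 \<le> Gam k k" by (rule psd_kernel_diag_nonneg[OF psd])
    moreover have "(\<integral>\<omega>. iexp (t * Z \<omega> k) \<partial>N) = complex_of_real (exp (- (t\<^sup>2 * Gam k k) / 2))" for t
    proof -
      \<comment> \<open>Coefficients concentrated at \<open>k\<close> isolate one coordinate in the
        joint characteristic function.\<close>
      have 1: "(\<Sum>m<Suc k. (if m = k then t else 0) * Z \<omega> m) = t * Z \<omega> k" for \<omega> by (simp add: if_distrib[of "\<lambda>x. x * _"] cong: if_cong)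
      have 2: "(\<Sum>m<Suc k. \<Sum>j<Suc k. (if m = k then t else 0) * (if j = k then t else 0) * Gam m j) = t\<^sup>2 * Gam k k"
        by (simp add: power2_eq_square)
      show ?thesis using char[of "\<lambda>m. if m = k then t else 0" "Suc k"] unfolding 1 2 .
    qed
    ultimately show "integrable N (\<lambda>\<omega>. (Z \<omega> k)\<^sup>2)" "(\<integral>\<omega>. (Z \<omega> k)\<^sup>2 \<partial>N) = Gam k k" "integrable N (\<lambda>\<omega>. Z \<omega> k)"
      by (rule gaussian_from_char[OF N Zm])+
  qed
  have le: "(\<integral>\<omega>. \<bar>Z \<omega> k\<bar> \<partial>N) \<le> sqrt HH * wt k" for k
  proof -
    define m where "m = (\<integral>\<omega>. \<bar>Z \<omega> k\<bar> \<partial>N)"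
    have "0 \<le> (\<integral>\<omega>. (\<bar>Z \<omega> k\<bar> - m)\<^sup>2 \<partial>N)" by (rule Bochner_Integration.integral_nonneg) simp
    also have "\<dots> = (\<integral>\<omega>. (Z \<omega> k)\<^sup>2 - 2 * m * \<bar>Z \<omega> k\<bar> + m\<^sup>2 \<partial>N)"
      by (rule Bochner_Integration.integral_cong) (auto simp: power2_eq_square algebra_simps)
    also have "\<dots> = Gam k k - m\<^sup>2"
      using Z2(1,3)[of k] by (simp add: m_def[symmetric] N.prob_space Z2(2)) (simp add: power2_eq_square)
    finally have "m\<^sup>2 \<le> HH * (wt k)\<^sup>2" using Gam_diag_le[of k] by simp
    also have "\<dots> = (sqrt HH * wt k)\<^sup>2" using HH_nonneg by (simp add: power_mult_distrib)
    finally show ?thesis unfolding m_def[symmetric]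
      by (rule power2_le_imp_le) (use HH_nonneg wt_nonneg[of k] in auto)
  qed
  define s where "s = (\<lambda>\<omega>. \<Sum>k. ennreal \<bar>Z \<omega> k\<bar>)"
  have [measurable]: "s \<in> borel_measurable N" unfolding s_def by measurable
  have "(\<integral>\<^sup>+\<omega>. s \<omega> \<partial>N) = (\<Sum>k. \<integral>\<^sup>+\<omega>. ennreal \<bar>Z \<omega> k\<bar> \<partial>N)"
    unfolding s_def by (rule nn_integral_suminf) measurable
  also have "\<dots> \<le> (\<Sum>k. ennreal (sqrt HH * wt k))"
  proof (rule suminf_le)
    show "(\<integral>\<^sup>+\<omega>. ennreal \<bar>Z \<omega> k\<bar> \<partial>N) \<le> ennreal (sqrt HH * wt k)" for k
      using nn_integral_eq_integral[OF integrable_abs[OF Z2(3)[of k]]] le[of k] by (simp add: ennreal_leI)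
  qed auto
  also have "\<dots> = ennreal (\<Sum>k. sqrt HH * wt k)"
    using HH_nonneg wt_nonneg by (intro suminf_ennreal2 summable_mult wt_summable) auto
  also have "\<dots> < \<infinity>" by simp
  finally have "(\<integral>\<^sup>+\<omega>. s \<omega> \<partial>N) \<noteq> \<infinity>" by simp
  then have ae: "AE \<omega> in N. s \<omega> \<noteq> \<infinity>" by (intro nn_integral_PInf_AE) measurable
  define Z' where "Z' = (\<lambda>\<omega> k. if s \<omega> \<noteq> \<infinity> then Z \<omega> k else 0)"
  have Z'm[measurable]: "(\<lambda>\<omega>. Z' \<omega> k) \<in> borel_measurable N" for k unfolding Z'_def by measurable
  have ae': "AE \<omega> in N. \<forall>k. Z' \<omega> k = Z \<omega> k" using ae by eventually_elim (simp add: Z'_def)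
  show ?thesis
  proof (rule that[of N Z'])
    show "prob_space N" by (rule N)
    have aek: "AE \<omega> in N. Z' \<omega> k = Z \<omega> k" for k using ae' by eventually_elim simp
    show "integrable N (\<lambda>\<omega>. Z' \<omega> k)" for k
      by (subst integrable_cong_AE[OF _ _ aek]) (use Z2(3) in auto)
    have "(\<integral>\<omega>. \<bar>Z' \<omega> k\<bar> \<partial>N) = (\<integral>\<omega>. \<bar>Z \<omega> k\<bar> \<partial>N)" for k
      by (rule integral_cong_AE) (use aek[of k] in auto)
    then show "(\<integral>\<omega>. \<bar>Z' \<omega> k\<bar> \<partial>N) \<le> sqrt HH * wt k" for k using le[of k] by simp
    show "Z' \<omega> \<in> l1" for \<omega>
    proof (cases "s \<omega> \<noteq> \<infinity>")
      case True
      then have "summable (\<lambda>k. \<bar>Z \<omega> k\<bar>)" unfolding s_def by (intro summable_suminf_not_top) auto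
      then show ?thesis using True by (simp add: l1_def Z'_def)
    qed (simp add: l1_def Z'_def)
    show "(\<integral>\<omega>. iexp (\<Sum>m<K. a m * Z' \<omega> m) \<partial>N) = exp (- (\<Sum>m<K. \<Sum>k<K. a m * a k * Gam m k) / 2)" for K a
    proof -
      have "(\<integral>\<omega>. iexp (\<Sum>m<K. a m * Z' \<omega> m) \<partial>N) = (\<integral>\<omega>. iexp (\<Sum>m<K. a m * Z \<omega> m) \<partial>N)"
      proof (rule integral_cong_AE)
        show "AE \<omega> in N. iexp (\<Sum>m<K. a m * Z' \<omega> m) = iexp (\<Sum>m<K. a m * Z \<omega> m)"
          using ae' by eventually_elim simp
      qed measurable
      then show ?thesis by (simp only: char)
    qed
  qed
qed

theorem weak_limit:
  "\<exists>P. prob_space P \<and> sets P = sets (restrict_space borel Vdual)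
     \<and> centered_gaussian_on_V P
     \<and> (\<forall>f\<in>Vspace. \<forall>g\<in>Vspace. (\<integral>\<phi>. \<phi> f * \<phi> g \<partial>P) - (\<integral>\<phi>. \<phi> f \<partial>P) * (\<integral>\<phi>. \<phi> g \<partial>P) = QV f g)
     \<and> (\<forall>h :: ((real \<Rightarrow> real) \<Rightarrow> real) \<Rightarrow> real. continuous_on Vdual h \<and> bounded (h ` Vdual) \<longrightarrow>
          (\<lambda>n. \<integral>\<omega>. h (PhiN M X W n \<omega>) \<partial>M) \<longlonglongrightarrow> (\<integral>\<phi>. h \<phi> \<partial>P))"
proof -
  obtain N :: "(nat \<Rightarrow> real) measure" and Z :: "(nat \<Rightarrow> real) \<Rightarrow> nat \<Rightarrow> real" where
    N: "prob_space N" and iZ: "\<And>k. integrable N (\<lambda>\<omega>. Z \<omega> k)"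
    and leZ: "\<And>k. (\<integral>\<omega>. \<bar>Z \<omega> k\<bar> \<partial>N) \<le> sqrt HH * wt k"
    and Zl: "\<And>\<omega>. \<omega> \<in> space N \<Longrightarrow> Z \<omega> \<in> l1"
    and char: "\<And>K a. (\<integral>\<omega>. iexp (\<Sum>m<K. a m * Z \<omega> m) \<partial>N) = exp (- (\<Sum>m<K. \<Sum>k<K. a m * a k * Gam m k) / 2)"
    by (rule limit_sequence, rule that)
  interpret N: prob_space N by (rule N)
  have Zm[measurable]: "(\<lambda>\<omega>. Z \<omega> k) \<in> borel_measurable N" for k using iZ[of k] by simp
  let ?V = "restrict_space borel Vdual :: ((real \<Rightarrow> real) \<Rightarrow> real) measure"
  have im: "(\<lambda>\<omega>. iota (Z \<omega>)) \<in> measurable N ?V" by (rule measurable_iota[OF Zm Zl])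
  have fm: "(\<lambda>\<omega>. iota (Z \<omega>) f) \<in> borel_measurable N" for f
    by (rule measurable_compose[OF im Vdual_coordinate_measurable])
  define P where "P = distr N ?V (\<lambda>\<omega>. iota (Z \<omega>))"
  have iP: "(\<integral>\<phi>. F \<phi> \<partial>P) = (\<integral>\<omega>. F (iota (Z \<omega>)) \<partial>N)" if "F \<in> borel_measurable ?V" for F :: "_ \<Rightarrow> real"
    unfolding P_def by (rule integral_distr[OF im that])
  \<comment> \<open>The finite sums have characteristic functions given by \<open>Gam\<close>. They
    converge to \<open>iota (Z \<omega>) f\<close> at every \<open>\<omega>\<close>, and the
    quadratic forms converge to \<open>QV f f\<close>.\<close>
  have charf: "(\<integral>\<omega>. iexp (t * iota (Z \<omega>) f) \<partial>N) = complex_of_real (exp (- (t\<^sup>2 * QV f f) / 2))" if f: "f \<in> Vspace" for t f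
  proof -
    have lim: "(\<lambda>K. \<Sum>k<K. coeff_seq f k * Z \<omega> k) \<longlonglongrightarrow> iota (Z \<omega>) f" if "\<omega> \<in> space N" for \<omega>
      using summable_LIMSEQ[OF iota_summable(2)[OF f Zl[OF that]]] f by (simp add: iota_def)
    have "(\<lambda>K. \<integral>\<omega>. iexp (t * (\<Sum>k<K. coeff_seq f k * Z \<omega> k)) \<partial>N) \<longlonglongrightarrow> (\<integral>\<omega>. iexp (t * iota (Z \<omega>) f) \<partial>N)"
    proof (rule integral_dominated_convergence[where w = "\<lambda>_. 1"])
      note [measurable] = fm
      show "(\<lambda>\<omega>. iexp (t * iota (Z \<omega>) f)) \<in> borel_measurable N" by measurable
      show "AE \<omega> in N. (\<lambda>K. iexp (t * (\<Sum>k<K. coeff_seq f k * Z \<omega> k))) \<longlonglongrightarrow> iexp (t * iota (Z \<omega>) f)"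
        by (intro AE_I2 tendsto_exp tendsto_mult_left tendsto_of_real lim)
    qed auto
    moreover have "(\<integral>\<omega>. iexp (t * (\<Sum>k<K. coeff_seq f k * Z \<omega> k)) \<partial>N)
        = complex_of_real (exp (- (t\<^sup>2 * (\<Sum>j<K. \<Sum>k<K. coeff_seq f j * coeff_seq f k * Gam j k)) / 2))" for K
    proof -
      have 1: "t * (\<Sum>k<K. coeff_seq f k * Z \<omega> k) = (\<Sum>k<K. (t * coeff_seq f k) * Z \<omega> k)" for \<omega>
        by (simp only: sum_distrib_left mult_ac)
      have 2: "t\<^sup>2 * (\<Sum>j<K. \<Sum>k<K. coeff_seq f j * coeff_seq f k * Gam j k) = (\<Sum>j<K. \<Sum>k<K. (t * coeff_seq f j) * (t * coeff_seq f k) * Gam j k)"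
        by (simp only: sum_distrib_left power2_eq_square mult_ac)
      show ?thesis unfolding 1 2 by (rule char)
    qed
    moreover have "(\<lambda>K. complex_of_real (exp (- (t\<^sup>2 * (\<Sum>j<K. \<Sum>k<K. coeff_seq f j * coeff_seq f k * Gam j k)) / 2)))
       \<longlonglongrightarrow> complex_of_real (exp (- (t\<^sup>2 * QV f f) / 2))"
      by (intro tendsto_of_real tendsto_exp tendsto_divide tendsto_minus tendsto_mult_left Gam_double_sum_tendsto f tendsto_const) simp
    ultimately show ?thesis by (simp only: LIMSEQ_unique)
  qed
  note gauss = gaussian_from_char[OF N fm QV_nonneg charf]
  have sP: "sets P = sets ?V" by (simp add: P_def)
  have "prob_space P" unfolding P_def by (rule N.prob_space_distr[OF im])
  moreover have "centered_gaussian_on_V P"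
    unfolding centered_gaussian_on_V_def
  proof (intro allI impI)
    fix J :: "(real \<Rightarrow> real) set" and a :: "(real \<Rightarrow> real) \<Rightarrow> real" assume J: "finite J \<and> J \<subseteq> Vspace"
    \<comment> \<open>Linearity of the paths turns a finite combination of values into the value at
      a single Lipschitz function, whose law is already known.\<close>
    define g where "g = (\<lambda>x. \<Sum>j\<in>J. a j * j x)"
    have eq: "(\<Sum>j\<in>J. a j * iota (Z \<omega>) j) = iota (Z \<omega>) g" if "\<omega> \<in> space N" for \<omega>
      using Vdual_sum[OF iota_in_Vdual[OF Zl[OF that]], of J a] J by (simp add: g_def)
    \<comment> \<open>\<open>Vdual_sum\<close> yields membership in \<open>Vspace\<close> together
      with its formula for a functional, so some element of \<open>Vdual\<close> has to be supplied;
      the zero sequence provides one.\<close>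
    have "\<exists>\<phi>. \<phi> \<in> Vdual" using iota_in_Vdual[of "\<lambda>_. 0"] by (auto simp: l1_def)
    then have g: "g \<in> Vspace" using Vdual_sum[of _ J a] J by (auto simp: g_def)
    have m: "(\<lambda>\<phi>. \<Sum>j\<in>J. a j * \<phi> j) \<in> borel_measurable ?V"
      by (intro borel_measurable_sum borel_measurable_times borel_measurable_const Vdual_coordinate_measurable)
    have "distr P lborel (\<lambda>\<phi>. \<Sum>j\<in>J. a j * \<phi> j) = distr N lborel ((\<lambda>\<phi>. \<Sum>j\<in>J. a j * \<phi> j) \<circ> (\<lambda>\<omega>. iota (Z \<omega>)))"
      unfolding P_def using m by (intro distr_distr im) simp
    also have "\<dots> = distr N lborel (\<lambda>\<omega>. iota (Z \<omega>) g)" by (rule distr_cong) (auto simp: eq)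
    finally have d: "distr P lborel (\<lambda>\<phi>. \<Sum>j\<in>J. a j * \<phi> j) = distr N lborel (\<lambda>\<omega>. iota (Z \<omega>) g)" .
    have "(\<lambda>\<phi>. \<Sum>j\<in>J. a j * \<phi> j) \<in> borel_measurable P"
      using m by (simp add: measurable_cong_sets[OF sP refl])
    then show "centered_normal P (\<lambda>\<phi>. \<Sum>j\<in>J. a j * \<phi> j)"
      using gauss(1)[OF g g] unfolding centered_normal_def d by simp
  qed
  moreover have "(\<integral>\<phi>. \<phi> f * \<phi> g \<partial>P) - (\<integral>\<phi>. \<phi> f \<partial>P) * (\<integral>\<phi>. \<phi> g \<partial>P) = QV f g"
    if f: "f \<in> Vspace" and g: "g \<in> Vspace" for f g
  proof -
    let ?s = "\<lambda>x. 1 * f x + 1 * g x"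
    have s: "?s \<in> Vspace" by (rule Vspace_linear[OF f g])
    have lin: "iota (Z \<omega>) ?s = 1 * iota (Z \<omega>) f + 1 * iota (Z \<omega>) g" if "\<omega> \<in> space N" for \<omega>
      by (rule Vdual_linear[OF iota_in_Vdual[OF Zl[OF that]] f g])
    have "(\<integral>\<phi>. \<phi> f * \<phi> g \<partial>P) = (\<integral>\<omega>. iota (Z \<omega>) f * iota (Z \<omega>) g \<partial>N)"
      by (intro iP borel_measurable_times Vdual_coordinate_measurable)
    \<comment> \<open>Polarisation: the known laws are those of single values, so the product is
      written through three squares.\<close>
    also have "\<dots> = (\<integral>\<omega>. ((iota (Z \<omega>) ?s)\<^sup>2 - (iota (Z \<omega>) f)\<^sup>2 - (iota (Z \<omega>) g)\<^sup>2) / 2 \<partial>N)"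
      by (rule Bochner_Integration.integral_cong[OF refl]) (simp only: lin, simp add: power2_eq_square algebra_simps)
    also have "\<dots> = (QV ?s ?s - QV f f - QV g g) / 2"
      using gauss(2,3)[OF s s] gauss(2,3)[OF f f] gauss(2,3)[OF g g] by simp
    also have "\<dots> = QV f g" unfolding QV_add[OF f g] by simp
    finally have 1: "(\<integral>\<phi>. \<phi> f * \<phi> g \<partial>P) = QV f g" .
    have "(\<integral>\<phi>. \<phi> f \<partial>P) = 0" using iP[OF Vdual_coordinate_measurable[of f]] gauss(5)[OF f f] by simp
    with 1 show ?thesis by simp
  qed
  moreover have "(\<lambda>n. \<integral>\<omega>. h (PhiN M X W n \<omega>) \<partial>M) \<longlonglongrightarrow> (\<integral>\<phi>. h \<phi> \<partial>P)"
    if h: "continuous_on Vdual h" "bounded (h ` Vdual)" for h :: "((real \<Rightarrow> real) \<Rightarrow> real) \<Rightarrow> real"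
  proof -
    obtain B where B: "\<And>\<phi>. \<phi> \<in> Vdual \<Longrightarrow> \<bar>h \<phi>\<bar> \<le> B" using h(2) by (auto simp: bounded_iff)
    have Hb: "\<bar>h (iota y)\<bar> \<le> B" if "y \<in> l1" for y by (rule B[OF iota_in_Vdual[OF that]])
    have cf: "(\<lambda>n. \<integral>\<omega>. iexp (\<Sum>m<K. a m * Yn n \<omega> m) \<partial>M) \<longlonglongrightarrow> (\<integral>\<omega>. iexp (\<Sum>m<K. a m * Z \<omega> m) \<partial>N)" for K a
      unfolding char using Gam_form(2)[of "{..<K}" a] by simp
    \<comment> \<open>This bound, common to \<open>Yn\<close> and \<open>Z\<close>, is the
      \<open>\<tau>\<close> of the convergence theorem for sequences.\<close>
    have st: "summable (\<lambda>k. sqrt HH * wt k)" by (intro summable_mult wt_summable)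
    have "(\<lambda>n. \<integral>\<omega>. h (iota (Yn n \<omega>)) \<partial>M) \<longlonglongrightarrow> (\<integral>\<omega>. h (iota (Z \<omega>)) \<partial>N)"
      by (rule l1_continuous_expectation_tendsto[OF prob_space_axioms N Yn_first_moment iZ leZ st Yn_in_l1 Zl cf l1_continuous_iota[OF h(1)] Hb])
    moreover have "(\<integral>\<omega>. h (PhiN M X W n \<omega>) \<partial>M) = (\<integral>\<omega>. h (iota (Yn n \<omega>)) \<partial>M)" for n
      by (rule Bochner_Integration.integral_cong[OF refl]) (simp only: PhiN_eq)
    moreover have "(\<integral>\<phi>. h \<phi> \<partial>P) = (\<integral>\<omega>. h (iota (Z \<omega>)) \<partial>N)"
      by (rule iP[OF borel_measurable_continuous_on_restrict[OF h(1)]])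
    ultimately show ?thesis by simp
  qed
  ultimately show ?thesis using sP by (intro exI[of _ P]) auto
qed

end

text \<open>Split at \<open>\<bar>x\<bar> = 2\<close>: below it the base is at most 4, giving 256;
  above it \<open>2 + \<bar>x\<bar> \<le> 2 * \<bar>x\<bar>\<close> gives the factor 16.\<close>

lemma fourth_power_le_powr:
  fixes x \<delta> :: real
  assumes "\<delta> > 4" shows "(2 + \<bar>x\<bar>) ^ 4 \<le> 256 + 16 * \<bar>x\<bar> powr \<delta>"
proof (cases "\<bar>x\<bar> \<le> 2")
  case True
  then have "(2 + \<bar>x\<bar>) ^ 4 \<le> (4::real) ^ 4" by (intro power_mono) auto
  also have "\<dots> \<le> 256 + 16 * \<bar>x\<bar> powr \<delta>" using powr_ge_zero[of "\<bar>x\<bar>" \<delta>] by simp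
  finally show ?thesis .
next
  case False
  then have "(2 + \<bar>x\<bar>) ^ 4 \<le> (2 * \<bar>x\<bar>) ^ 4" by (intro power_mono) auto
  also have "\<dots> = 16 * \<bar>x\<bar> powr real 4" using False by (subst powr_realpow) (auto simp: power_mult_distrib)
  also have "\<dots> \<le> 16 * \<bar>x\<bar> powr \<delta>" using False assms by (intro mult_left_mono powr_mono) auto
  finally show ?thesis by simp
qed

theorem mainTheorem10:
  fixes M :: "'a measure" and X :: "'d::euclidean_space \<Rightarrow> 'a \<Rightarrow> real"
    and W :: "nat \<Rightarrow> 'd set" and \<nu> :: nat and \<delta> C l :: real
  assumes "prob_space M"
    and "measurable_field M X"
    and "strictly_stationary M X"
    and "\<delta> > 4" and "C > 0" and "l > 0"
    and "real \<nu> / real DIM('d) > max (l + \<delta> / (\<delta> - 2)) (max (\<delta> / (\<delta> - 4)) 3)"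
    and "\<And>\<gamma> r. \<gamma> \<ge> 2 * kappa TYPE('d) \<Longrightarrow> r > 0 \<Longrightarrow>
           alpha_mix M X \<gamma> r \<le> ereal (C * r powr (- real \<nu>) * \<gamma> powr l)"
    and "integrable M (\<lambda>\<omega>. \<bar>X 0 \<omega>\<bar> powr \<delta>)"
    and "\<And>n. compact (W n)"
    and "van_hove W"
  shows "\<exists>P. prob_space P \<and> sets P = sets (restrict_space borel Vdual)
           \<and> centered_gaussian_on_V P
           \<and> (\<forall>f\<in>Vspace. \<forall>g\<in>Vspace.
                (\<integral>\<phi>. \<phi> f * \<phi> g \<partial>P) - (\<integral>\<phi>. \<phi> f \<partial>P) * (\<integral>\<phi>. \<phi> g \<partial>P)
                = (\<integral>t. ((\<integral>\<omega>. f (X 0 \<omega>) * g (X t \<omega>) \<partial>M)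
                          - (\<integral>\<omega>. f (X 0 \<omega>) \<partial>M) * (\<integral>\<omega>. g (X t \<omega>) \<partial>M)) \<partial>lborel))
           \<and> (\<forall>h :: ((real \<Rightarrow> real) \<Rightarrow> real) \<Rightarrow> real.
                continuous_on Vdual h \<and> bounded (h ` Vdual) \<longrightarrow>
                (\<lambda>n. \<integral>\<omega>. h (PhiN M X W n \<omega>) \<partial>M) \<longlonglongrightarrow> (\<integral>\<phi>. h \<phi> \<partial>P))"
  proof -
  interpret prob_space M by fact
  define D where "D = real DIM('d)"
  have D: "D > 0" by (simp add: D_def)
  \<comment> \<open>As this ratio exceeds 1, the lower bound on \<open>\<nu>\<close> over the
    dimension exceeds both \<open>l + 1\<close> and 3, which are the two inequalities that
    \<open>mixing_field\<close> asks for.\<close>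
  have r: "1 < \<delta> / (\<delta> - 2)" using \<open>\<delta> > 4\<close> by simp
  then have "l + 1 < real \<nu> / D" "3 < real \<nu> / D"
    using \<open>max (l + \<delta> / (\<delta> - 2)) (max (\<delta> / (\<delta> - 4)) 3) < real \<nu> / real DIM('d)\<close> unfolding D_def by linarith+
  then have nu: "(l + 1) * D < real \<nu>" "3 * D < real \<nu>" using D by (simp_all add: pos_less_divide_eq)
  have X0: "X 0 \<in> borel_measurable M"
    using measurable_compose[OF measurable_Pair1'[of "0::'d" borel M] \<open>measurable_field M X\<close>[unfolded measurable_field_def]] by simp
  interpret lev_window M X \<nu> C l W
  proof
    show "real \<nu> > 3 * real DIM('d)" "real \<nu> > (l + 1) * real DIM('d)" using nu by (simp_all add: D_def)
    show "integrable M (\<lambda>\<omega>. (2 + \<bar>X 0 \<omega>\<bar>) ^ 4)"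
    proof (rule Bochner_Integration.integrable_bound)
      show "integrable M (\<lambda>\<omega>. 256 + 16 * \<bar>X 0 \<omega>\<bar> powr \<delta>)"
        using \<open>integrable M (\<lambda>\<omega>. \<bar>X 0 \<omega>\<bar> powr \<delta>)\<close> by simp
      show "(\<lambda>\<omega>. (2 + \<bar>X 0 \<omega>\<bar>) ^ 4) \<in> borel_measurable M" using X0 by measurable
      show "AE \<omega> in M. norm ((2 + \<bar>X 0 \<omega>\<bar>) ^ 4) \<le> norm (256 + 16 * \<bar>X 0 \<omega>\<bar> powr \<delta>)"
        using fourth_power_le_powr[OF \<open>\<delta> > 4\<close>] by (intro AE_I2) simp
    qed
  qed fact+
  show ?thesis using weak_limit unfolding QV_def CV_def .
qed

end
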